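(* Let $k,\ell\in\mathbb{Z}_{\ge1}$. Let $\lambda_1, \ldots, \lambda_k \in \mathbb{C}^\times$ be distinct, $n_1, \ldots, n_k \in \mathbb{Z}_{\ge 1}$, and $f_i= t-\lambda_i$. For each $1 \leq i \leq k$, let $\mu_i: \mathrm{Vir}^{f_i^{n_i}} \rightarrow \mathbb{C}$ be a Lie algebra homomorphism. Similarly, let $\gamma_1, \ldots, \gamma_\ell \in \mathbb{C}^\times$ be distinct, $m_1, \ldots, m_\ell \in \mathbb{Z}_{\ge 1}$, and $g_i= t-\gamma_i$. For each $1 \leq i \leq \ell$, let $\theta_i: \mathrm{Vir}^{g_i^{m_i}} \rightarrow \mathbb{C}$ be a Lie algebra homomorphism. Finally, let $V, W$ be simple $\mathrm{Vir}^+$-locally annihilated $\mathrm{Vir}$-modules. Then $$\bigotimes_{i=1}^k V_{\mu_i}^{f_i^{n_i}} \otimes V \cong \bigotimes_{i=1}^\ell V_{\theta_i}^{g_i^{m_i}} \otimes W$$ as $\mathrm{Vir}$-modules if and only if $V \cong W$, $k=\ell$, and, after possibly renumbering, $\lambda_i = \gamma_i$, $n_i = m_i$, and $\mu_i = \theta_i$ for all $i$.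
   Context: The Virasoro algebra $\mathrm{Vir}$ is the complex Lie algebra with basis $\{z\}\cup\{e_j \mid j\in\mathbb{Z}\}$ and bracket $[e_j,e_k]=(k-j)e_{j+k}+\delta_{k,-j}\frac{j^3-j}{12}z$, $[z,e_j]=0$. For a Laurent polynomial $g=\sum_j c_jt^j\in\mathbb{C}[t^{\pm}]$ put $e(g)=\sum_j c_je_j$. For $f\in\mathbb{C}[t]$ with nonzero constant term, $\mathrm{Vir}^f=\mathrm{span}_{\mathbb{C}}\{z,\ e(t^jf)\mid j\in\mathbb{Z}\}$, a Lie subalgebra of $\mathrm{Vir}$. For a Lie algebra homomorphism $\mu:\mathrm{Vir}^f\to\mathbb{C}$ ($\mathbb{C}$ abelian), $\mathbb{C}_\mu$ is the corresponding one-dimensional $\mathrm{Vir}^f$-module and $V^f_\mu=U(\mathrm{Vir})\otimes_{U(\mathrm{Vir}^f)}\mathbb{C}_\mu$. A $\mathrm{Vir}$-module $V$ is $\mathrm{Vir}^+$-locally annihilated if for each $v\in V$ there is $L\in\mathbb{Z}_{\ge0}$ such that $e_jv=0$ for all $j\ge L$. *)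

theory Defs
  imports
    "HOL-Algebra.Module"
    "HOL-Algebra.QuotRing"
    "HOL-Library.Poly_Mapping"
    "HOL-Library.Set_Algebras"
    "HOL-Computational_Algebra.Polynomial"
begin

section \<open>Free complex vector spaces\<close>

text \<open>
  The type \<open>'x \<Rightarrow>\<^sub>0 complex\<close> is the complex vector space with basis \<open>'x\<close>; the basis vector
  of \<open>g\<close> is \<open>Poly_Mapping.single g 1\<close>.
\<close>

definition cscale :: "complex \<Rightarrow> ('x \<Rightarrow>\<^sub>0 complex) \<Rightarrow> ('x \<Rightarrow>\<^sub>0 complex)" where
  "cscale c p = Poly_Mapping.map ((*) c) p"

lemma lookup_cscale: "Poly_Mapping.lookup (cscale c p) g = c * Poly_Mapping.lookup p g"
  by (simp add: cscale_def Poly_Mapping.map.rep_eq when_def)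

global_interpretation cspace: vector_space "cscale :: complex \<Rightarrow> ('x \<Rightarrow>\<^sub>0 complex) \<Rightarrow> _"
  by unfold_locales
    (simp_all add: poly_mapping_eq_iff fun_eq_iff lookup_cscale lookup_add algebra_simps)

abbreviation basis_vec :: "'x \<Rightarrow> ('x \<Rightarrow>\<^sub>0 complex)" where
  "basis_vec g \<equiv> Poly_Mapping.single g 1"

definition lin_ext :: "('x \<Rightarrow> ('y \<Rightarrow>\<^sub>0 complex)) \<Rightarrow> ('x \<Rightarrow>\<^sub>0 complex) \<Rightarrow> ('y \<Rightarrow>\<^sub>0 complex)" where
  "lin_ext a p = (\<Sum>g\<in>Poly_Mapping.keys p. cscale (Poly_Mapping.lookup p g) (a g))"


section \<open>The Virasoro algebra\<close>

datatype vir_basis = Z | E int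

type_synonym vir = "vir_basis \<Rightarrow>\<^sub>0 complex"

abbreviation vz :: vir where "vz \<equiv> basis_vec Z"
abbreviation ve :: "int \<Rightarrow> vir" where "ve j \<equiv> basis_vec (E j)"

fun vir_basis_bracket :: "vir_basis \<Rightarrow> vir_basis \<Rightarrow> vir" where
  "vir_basis_bracket (E j) (E k) =
     cscale (of_int (k - j)) (ve (j + k)) +
     (if k = - j then cscale (of_int (j ^ 3 - j) / 12) vz else 0)"
| "vir_basis_bracket Z _ = 0"
| "vir_basis_bracket _ Z = 0"

definition vir_bracket :: "vir \<Rightarrow> vir \<Rightarrow> vir" where
  "vir_bracket x y = lin_ext (\<lambda>a. lin_ext (\<lambda>b. vir_basis_bracket a b) y) x"

text \<open>
  The ring of Laurent polynomials in \<open>t\<close> is \<open>int \<Rightarrow>\<^sub>0 complex\<close> with the convolution product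
  of the library; \<open>t\<^sup>j\<close> is \<open>basis_vec j\<close>.
\<close>

definition laurent_of_poly :: "complex poly \<Rightarrow> (int \<Rightarrow>\<^sub>0 complex)" where
  "laurent_of_poly f = (\<Sum>i\<le>Polynomial.degree f. Poly_Mapping.single (int i) (Polynomial.coeff f i))"

definition e_of :: "(int \<Rightarrow>\<^sub>0 complex) \<Rightarrow> vir" where
  "e_of g = lin_ext ve g"

definition Virf :: "complex poly \<Rightarrow> vir set" where
  "Virf f = cspace.span (insert vz {e_of (basis_vec j * laurent_of_poly f) | j. True})"

text \<open>
  Lie algebra homomorphisms from the subalgebra \<open>L\<close> to the abelian Lie algebra of complex numbers.
  Only the values on \<open>L\<close> matter.
\<close>

definition lie_character :: "vir set \<Rightarrow> (vir \<Rightarrow> complex) \<Rightarrow> bool" where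
  "lie_character L \<mu> \<longleftrightarrow>
     (\<forall>x\<in>L. \<forall>y\<in>L. \<mu> (x + y) = \<mu> x + \<mu> y) \<and>
     (\<forall>c. \<forall>x\<in>L. \<mu> (cscale c x) = c * \<mu> x) \<and>
     (\<forall>x\<in>L. \<forall>y\<in>L. \<mu> (vir_bracket x y) = 0)"


section \<open>Modules\<close>

text \<open>
  A module over a Lie subalgebra of the Virasoro algebra is a complex vector space with an action.
  The fields \<open>mult\<close> and \<open>one\<close> that the library's module records inherit from rings play no role.
\<close>

record 'v vmod = "(complex, 'v) module" +
  act :: "vir \<Rightarrow> 'v \<Rightarrow> 'v"

definition complex_ring :: "complex ring" where
  "complex_ring = \<lparr> carrier = UNIV, monoid.mult = (*), one = 1, ring.zero = 0, add = (+) \<rparr>"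

definition vir_module :: "'v vmod \<Rightarrow> bool" where
  "vir_module M \<longleftrightarrow>
     Module.module complex_ring M \<and>
     (\<forall>x. \<forall>v\<in>carrier M. act M x v \<in> carrier M) \<and>
     (\<forall>x. \<forall>v\<in>carrier M. \<forall>w\<in>carrier M. act M x (v \<oplus>\<^bsub>M\<^esub> w) = act M x v \<oplus>\<^bsub>M\<^esub> act M x w) \<and>
     (\<forall>x c. \<forall>v\<in>carrier M. act M x (c \<odot>\<^bsub>M\<^esub> v) = c \<odot>\<^bsub>M\<^esub> act M x v) \<and>
     (\<forall>x y. \<forall>v\<in>carrier M. act M (x + y) v = act M x v \<oplus>\<^bsub>M\<^esub> act M y v) \<and>
     (\<forall>x c. \<forall>v\<in>carrier M. act M (cscale c x) v = c \<odot>\<^bsub>M\<^esub> act M x v) \<and>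
     (\<forall>x y. \<forall>v\<in>carrier M.
        act M (vir_bracket x y) v = act M x (act M y v) \<ominus>\<^bsub>M\<^esub> act M y (act M x v))"

definition vir_submodule :: "'v set \<Rightarrow> 'v vmod \<Rightarrow> bool" where
  "vir_submodule N M \<longleftrightarrow> submodule N complex_ring M \<and> (\<forall>x. \<forall>v\<in>N. act M x v \<in> N)"

definition simple_vir_module :: "'v vmod \<Rightarrow> bool" where
  "simple_vir_module M \<longleftrightarrow>
     vir_module M \<and> carrier M \<noteq> {\<zero>\<^bsub>M\<^esub>} \<and>
     (\<forall>N. vir_submodule N M \<longrightarrow> N = {\<zero>\<^bsub>M\<^esub>} \<or> N = carrier M)"

definition vir_locally_annihilated :: "'v vmod \<Rightarrow> bool" where
  "vir_locally_annihilated M \<longleftrightarrow>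
     (\<forall>v\<in>carrier M. \<exists>l::nat. \<forall>j\<ge>int l. act M (ve j) v = \<zero>\<^bsub>M\<^esub>)"

definition vir_iso :: "'v vmod \<Rightarrow> 'w vmod \<Rightarrow> bool" (infix \<open>\<cong>\<^sub>V\<close> 50) where
  "M \<cong>\<^sub>V N \<longleftrightarrow>
     (\<exists>\<phi>. bij_betw \<phi> (carrier M) (carrier N) \<and>
        (\<forall>v\<in>carrier M. \<forall>w\<in>carrier M. \<phi> (v \<oplus>\<^bsub>M\<^esub> w) = \<phi> v \<oplus>\<^bsub>N\<^esub> \<phi> w) \<and>
        (\<forall>c. \<forall>v\<in>carrier M. \<phi> (c \<odot>\<^bsub>M\<^esub> v) = c \<odot>\<^bsub>N\<^esub> \<phi> v) \<and>
        (\<forall>x. \<forall>v\<in>carrier M. \<phi> (act M x v) = act N x (\<phi> v)))"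

text \<open>
  \<open>presented G R a\<close> is the quotient of the free vector space on the set \<open>G\<close> by the span of the
  relations \<open>R\<close>, where \<open>x\<close> acts on the class of a generator \<open>g\<close> as the class of \<open>a x g\<close>.
  It is applied only where \<open>R\<close> is supported on \<open>G\<close> and the linear extension of each \<open>a x\<close>
  preserves the span of \<open>R\<close>, so that each union below is a single coset.
\<close>

definition presented ::
  "'x set \<Rightarrow> ('x \<Rightarrow>\<^sub>0 complex) set \<Rightarrow> (vir \<Rightarrow> 'x \<Rightarrow> ('x \<Rightarrow>\<^sub>0 complex)) \<Rightarrow> ('x \<Rightarrow>\<^sub>0 complex) set vmod" where
  "presented G R a =
     \<lparr> carrier = {p +o cspace.span R | p. Poly_Mapping.keys p \<subseteq> G},
       monoid.mult = undefined, one = undefined,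
       ring.zero = cspace.span R,
       add = (\<lambda>P Q. P + Q),
       module.smult = (\<lambda>c P. \<Union>p\<in>P. cscale c p +o cspace.span R),
       act = (\<lambda>x P. \<Union>p\<in>P. lin_ext (a x) p +o cspace.span R) \<rparr>"


section \<open>Tensor products\<close>

definition bilinear_relations ::
  "(complex, 'a, 'c) module_scheme \<Rightarrow> (complex, 'b, 'd) module_scheme \<Rightarrow> ('a \<times> 'b \<Rightarrow>\<^sub>0 complex) set" where
  "bilinear_relations A B =
     {basis_vec (u \<oplus>\<^bsub>A\<^esub> u', v) - basis_vec (u, v) - basis_vec (u', v) | u u' v.
        u \<in> carrier A \<and> u' \<in> carrier A \<and> v \<in> carrier B} \<union>
     {basis_vec (u, v \<oplus>\<^bsub>B\<^esub> v') - basis_vec (u, v) - basis_vec (u, v') | u v v'.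
        u \<in> carrier A \<and> v \<in> carrier B \<and> v' \<in> carrier B} \<union>
     {basis_vec (c \<odot>\<^bsub>A\<^esub> u, v) - cscale c (basis_vec (u, v)) | c u v.
        u \<in> carrier A \<and> v \<in> carrier B} \<union>
     {basis_vec (u, c \<odot>\<^bsub>B\<^esub> v) - cscale c (basis_vec (u, v)) | c u v.
        u \<in> carrier A \<and> v \<in> carrier B}"

definition tensor :: "'a vmod \<Rightarrow> 'b vmod \<Rightarrow> ('a \<times> 'b \<Rightarrow>\<^sub>0 complex) set vmod" (infixl \<open>\<otimes>\<^sub>V\<close> 70) where
  "A \<otimes>\<^sub>V B = presented (carrier A \<times> carrier B) (bilinear_relations A B)
     (\<lambda>x (u, v). basis_vec (act A x u, v) + basis_vec (u, act B x v))"

text \<open>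
  The tensor product of a family indexed by a finite set \<open>I\<close>. A pure tensor is indexed by an
  element of \<open>\<Pi>\<^sub>E i\<in>I. carrier (M i)\<close>.
\<close>

definition multilinear_relations ::
  "'i set \<Rightarrow> ('i \<Rightarrow> 'a vmod) \<Rightarrow> (('i \<Rightarrow> 'a) \<Rightarrow>\<^sub>0 complex) set" where
  "multilinear_relations I M =
     {basis_vec (m(i := u \<oplus>\<^bsub>M i\<^esub> v)) - basis_vec (m(i := u)) - basis_vec (m(i := v)) | m i u v.
        m \<in> (\<Pi>\<^sub>E i\<in>I. carrier (M i)) \<and> i \<in> I \<and> u \<in> carrier (M i) \<and> v \<in> carrier (M i)} \<union>
     {basis_vec (m(i := c \<odot>\<^bsub>M i\<^esub> u)) - cscale c (basis_vec (m(i := u))) | m i c u.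
        m \<in> (\<Pi>\<^sub>E i\<in>I. carrier (M i)) \<and> i \<in> I \<and> u \<in> carrier (M i)}"

definition tensor_family ::
  "'i set \<Rightarrow> ('i \<Rightarrow> 'a vmod) \<Rightarrow> (('i \<Rightarrow> 'a) \<Rightarrow>\<^sub>0 complex) set vmod" where
  "tensor_family I M =
     presented (\<Pi>\<^sub>E i\<in>I. carrier (M i)) (multilinear_relations I M)
       (\<lambda>x m. \<Sum>i\<in>I. basis_vec (m(i := act (M i) x (m i))))"


section \<open>Universal enveloping algebras\<close>

text \<open>Words with concatenation, so that \<open>'a fword \<Rightarrow>\<^sub>0 complex\<close> is the free algebra on \<open>'a\<close>.\<close>

datatype 'a fword = FWord (letters: "'a list")

instantiation fword :: (type) monoid_add
begin

definition zero_fword :: "'a fword" where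
  "zero_fword = FWord []"

definition plus_fword :: "'a fword \<Rightarrow> 'a fword \<Rightarrow> 'a fword" where
  "plus_fword v w = FWord (letters v @ letters w)"

instance
  by standard (simp_all add: zero_fword_def plus_fword_def)

end

type_synonym falg = "vir fword \<Rightarrow>\<^sub>0 complex"

definition free_alg :: "vir set \<Rightarrow> falg ring" where
  "free_alg L =
     \<lparr> carrier = {p. \<forall>w\<in>Poly_Mapping.keys p. set (letters w) \<subseteq> L},
       monoid.mult = (*), one = 1, ring.zero = 0, add = (+) \<rparr>"

abbreviation fgen :: "vir \<Rightarrow> falg" where
  "fgen x \<equiv> basis_vec (FWord [x])"

text \<open>
  The enveloping algebra of the Lie subalgebra \<open>L\<close>, with the tensor algebra of \<open>L\<close> presented as
  the free algebra on the set \<open>L\<close> modulo linearity of the generators.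
\<close>

definition uea_ideal :: "vir set \<Rightarrow> falg set" where
  "uea_ideal L = genideal (free_alg L)
     ({fgen (x + y) - fgen x - fgen y | x y. x \<in> L \<and> y \<in> L} \<union>
      {fgen (cscale c x) - cscale c (fgen x) | c x. x \<in> L} \<union>
      {fgen x * fgen y - fgen y * fgen x - fgen (vir_bracket x y) | x y. x \<in> L \<and> y \<in> L})"

definition uea_class :: "vir set \<Rightarrow> falg \<Rightarrow> falg set" where
  "uea_class L p = uea_ideal L +>\<^bsub>free_alg L\<^esub> p"

definition uea :: "vir set \<Rightarrow> (complex, falg set) module" where
  "uea L = ring.extend (free_alg L Quot uea_ideal L)
     (module.fields (\<lambda>c P. \<Union>p\<in>P. uea_class L (cscale c p)))"

text \<open>The map of enveloping algebras induced by the inclusion of \<open>L\<close> into the Virasoro algebra.\<close>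

definition uea_incl :: "falg set \<Rightarrow> falg set" where
  "uea_incl r = the_elem (uea_class UNIV ` r)"

definition free_alg_act :: "'v vmod \<Rightarrow> falg \<Rightarrow> 'v \<Rightarrow> 'v" where
  "free_alg_act M p v =
     (\<Oplus>\<^bsub>M\<^esub>w\<in>Poly_Mapping.keys p. Poly_Mapping.lookup p w \<odot>\<^bsub>M\<^esub> foldr (act M) (letters w) v)"

definition uea_act :: "'v vmod \<Rightarrow> falg set \<Rightarrow> 'v \<Rightarrow> 'v" where
  "uea_act M r v = the_elem ((\<lambda>p. free_alg_act M p v) ` r)"

text \<open>
  The module \<open>U(Vir) \<otimes> N\<close> induced from a module \<open>N\<close> over the Lie subalgebra \<open>L\<close>, the tensor
  product being taken over \<open>U(L)\<close>.
\<close>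

definition induced :: "vir set \<Rightarrow> 'v vmod \<Rightarrow> (falg set \<times> 'v \<Rightarrow>\<^sub>0 complex) set vmod" where
  "induced L N =
     presented (carrier (uea UNIV) \<times> carrier N)
       (bilinear_relations (uea UNIV) N \<union>
        {basis_vec (u \<otimes>\<^bsub>uea UNIV\<^esub> uea_incl r, v) - basis_vec (u, uea_act N r v) | u r v.
           u \<in> carrier (uea UNIV) \<and> r \<in> carrier (uea L) \<and> v \<in> carrier N})
       (\<lambda>x (u, v). basis_vec (uea_class UNIV (fgen x) \<otimes>\<^bsub>uea UNIV\<^esub> u, v))"

definition one_dim :: "(vir \<Rightarrow> complex) \<Rightarrow> complex vmod" where
  "one_dim \<mu> =
     \<lparr> carrier = UNIV, monoid.mult = undefined, one = undefined, ring.zero = 0, add = (+), module.smult = (*),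
       act = (\<lambda>x c. \<mu> x * c) \<rparr>"

definition Vfmu ::
  "complex poly \<Rightarrow> (vir \<Rightarrow> complex) \<Rightarrow> (falg set \<times> complex \<Rightarrow>\<^sub>0 complex) set vmod" where
  "Vfmu f \<mu> = induced (Virf f) (one_dim \<mu>)"

end

(*
Write V_mu for the module induced from mu, at the point lam with exponent n.
Every vector of V_mu is killed by e(g) once g vanishes to high order at lam, and every
vector of V is killed by e(g) once g is divisible by a high power of t. By the Chinese
remainder theorem the action of any e(h) on one chosen factor of a given vector of the tensor
product is therefore the action of some e(g) on the whole vector, and an isomorphism
intertwines these factor actions.
Contracting all other factors against coordinate functions carries the generator of V_mu to
an eigenvector of Vir^f, with character mu, in the factor V_theta of the other side at the
same point. There such an eigenvector exists only if n >= m and the character is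
theta + r * weight with a natural number r; by symmetry n = m and mu = theta.
The same contraction onto the last factor gives a nonzero homomorphism V -> W, which is
an isomorphism by Schur's argument.

The eigenvectors of V_theta are found without the PBW theorem: the elements vanishing to
order s at lam form a chain of subalgebras, each of codimension one in the previous one,
so V_theta is an iterated induction in which every step turns a module N into the space
of polynomials N[y].
*)
theory Submission
  imports Defs "HOL-Library.Nat_Bijection"
begin

section \<open>Linear maps out of free spaces\<close>

text \<open>Two obstacles shape the proof. The image of a generator under an isomorphism is an
  unknown sum of pure tensors; contraction isolates one factor, but commutes only with elements that
  vanish to high order at all other points, which is why bases of arbitrary carriers and the notion
  \<open>locally_killed\<close> appear. And the centre escapes every such approximation. It lies in
  the derived algebra of Vir^f, so \<open>mu vz = 0\<close>, each induced factor is killed by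
  \<open>vz\<close>, and the centre acts through the last factor alone. The shift in the eigenvector
  statement arises by passing to leading coefficients: adjoining \<open>y\<close> corrects an
  eigenvalue by the degree times the component along \<open>y\<close> of the bracket with
  \<open>y\<close>. This component vanishes except when \<open>y\<close> is nonzero at the point,
  the last element adjoined. The relations \<open>mu = theta + r * weight\<close> and
  \<open>theta = mu + r' * weight\<close> together force \<open>(r + r') * weight = 0\<close>. The
  induced module is compared with the iterated polynomial space by its universal property;
  injectivity of the resulting map climbs the chain one step at a time.\<close>

abbreviation clin :: "(('x \<Rightarrow>\<^sub>0 complex) \<Rightarrow> ('y \<Rightarrow>\<^sub>0 complex)) \<Rightarrow> bool" where
  "clin \<equiv> module_hom cscale cscale"

lemmas clin_add = module_hom.add[of cscale cscale]
  and clin_scale = module_hom.scale[of cscale cscale]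
  and clin_zero = module_hom.zero[of cscale cscale]
  and clin_diff = module_hom.diff[of cscale cscale]
  and clin_sum = module_hom.sum[of cscale cscale]

lemma clinI:
  assumes "\<And>p q. f (p + q) = f p + f q" and "\<And>c p. f (cscale c p) = cscale c (f p)"
  shows "clin f"
  using assms by (intro module_hom.intro module_hom_axioms.intro cspace.module_axioms)

lemma clin_id: "clin (\<lambda>p. p)"
  by (rule clinI) auto

lemma clin_cscale: "clin (cscale c)"
  by (rule clinI) (simp_all add: cspace.scale_right_distrib mult.commute)

lemma clin_comp: "clin f \<Longrightarrow> clin g \<Longrightarrow> clin (\<lambda>p. f (g p))"
  by (rule clinI) (simp_all add: clin_add clin_scale)

lemma clin_plus: "clin f \<Longrightarrow> clin g \<Longrightarrow> clin (\<lambda>p. f p + g p)"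
  by (rule clinI) (simp_all add: clin_add clin_scale cspace.scale_right_distrib)

lemma clin_minus: "clin f \<Longrightarrow> clin g \<Longrightarrow> clin (\<lambda>p. f p - g p)"
  by (rule clinI) (simp_all add: clin_add clin_scale cspace.scale_right_diff_distrib)

lemma clin_cscale_comp: "clin f \<Longrightarrow> clin (\<lambda>p. cscale c (f p))"
  using clin_comp[OF clin_cscale] .

lemma clin_0: "clin (\<lambda>p. 0)"
  by (rule clinI) auto

lemma cscale_single [simp]: "cscale c (Poly_Mapping.single g d) = Poly_Mapping.single g (c * d)"
  by (rule poly_mapping_eqI) (simp add: lookup_cscale lookup_single when_def)

lemma keys_cscale: "Poly_Mapping.keys (cscale c p) \<subseteq> Poly_Mapping.keys p"
  by (auto simp: in_keys_iff lookup_cscale)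

lemma keys_add_subset: "Poly_Mapping.keys p \<subseteq> G \<Longrightarrow> Poly_Mapping.keys q \<subseteq> G \<Longrightarrow> Poly_Mapping.keys (p + q) \<subseteq> G"
  using keys_add[of p q] by blast

lemma keys_sum_subset: "(\<And>i. i \<in> I \<Longrightarrow> Poly_Mapping.keys (f i) \<subseteq> G) \<Longrightarrow> Poly_Mapping.keys (sum f I) \<subseteq> G"
  using keys_sum[of f I] by blast

lemma keys_diff_subset:
  fixes p q :: "'x \<Rightarrow>\<^sub>0 'b::ab_group_add"
  shows "Poly_Mapping.keys p \<subseteq> G \<Longrightarrow> Poly_Mapping.keys q \<subseteq> G \<Longrightarrow> Poly_Mapping.keys (p - q) \<subseteq> G"
  using keys_diff[of p q] by blast

lemma subspace_supported: "cspace.subspace {p. Poly_Mapping.keys p \<subseteq> G}"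
  unfolding cspace.subspace_def by (auto dest!: keys_cscale[THEN subsetD] keys_add[THEN subsetD])

lemma pm_expand: "p = (\<Sum>g\<in>Poly_Mapping.keys p. cscale (Poly_Mapping.lookup p g) (basis_vec g))"
proof (rule poly_mapping_eqI)
  fix x
  have "Poly_Mapping.lookup (\<Sum>g\<in>Poly_Mapping.keys p. cscale (Poly_Mapping.lookup p g) (basis_vec g)) x
      = (\<Sum>g\<in>Poly_Mapping.keys p. if g = x then Poly_Mapping.lookup p x else 0)"
    by (auto simp: lookup_sum lookup_single when_def intro: sum.cong)
  also have "\<dots> = Poly_Mapping.lookup p x" by (simp add: sum.delta in_keys_iff)
  finally show "Poly_Mapping.lookup p x =
      Poly_Mapping.lookup (\<Sum>g\<in>Poly_Mapping.keys p. cscale (Poly_Mapping.lookup p g) (basis_vec g)) x" ..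
qed

lemma supported_induct [consumes 1, case_names zero basis add scale]:
  assumes "Poly_Mapping.keys p \<subseteq> G" and "P 0" and "\<And>g. g \<in> G \<Longrightarrow> P (basis_vec g)"
    and "\<And>p q. Poly_Mapping.keys p \<subseteq> G \<Longrightarrow> Poly_Mapping.keys q \<subseteq> G \<Longrightarrow> P p \<Longrightarrow> P q \<Longrightarrow> P (p + q)"
    and "\<And>c p. Poly_Mapping.keys p \<subseteq> G \<Longrightarrow> P p \<Longrightarrow> P (cscale c p)"
  shows "P p"
proof -
  \<comment> \<open>The support of the partial sums is carried along, because the premises for sums
    and multiples ask for it.\<close>
  have "P (\<Sum>g\<in>S. cscale (Poly_Mapping.lookup p g) (basis_vec g)) \<and>
      Poly_Mapping.keys (\<Sum>g\<in>S. cscale (Poly_Mapping.lookup p g) (basis_vec g)) \<subseteq> G"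
    if "finite S" "S \<subseteq> G" for S
    using that
  proof (induction S rule: finite_induct)
    case empty
    then show ?case using assms(2) by simp
  next
    case (insert x F)
    have k: "Poly_Mapping.keys (basis_vec x) \<subseteq> G" using insert.prems by simp
    have "P (cscale (Poly_Mapping.lookup p x) (basis_vec x))"
      using assms(3,5) insert.prems k by blast
    moreover have "Poly_Mapping.keys (cscale (Poly_Mapping.lookup p x) (basis_vec x)) \<subseteq> G"
      using keys_cscale k by fast
    ultimately show ?case
      using insert assms(4) keys_add_subset by (metis (no_types, lifting) insert_subset sum.insert)
  qed
  from this[of "Poly_Mapping.keys p"] show ?thesis using pm_expand[of p] assms(1) by simp
qed

lemma pm_induct [case_names basis add scale]:
  assumes "\<And>g. P (basis_vec g)" and "\<And>p q. P p \<Longrightarrow> P q \<Longrightarrow> P (p + q)"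
    and "\<And>c p. P p \<Longrightarrow> P (cscale c p)"
  shows "P (p :: 'x \<Rightarrow>\<^sub>0 complex)"
proof -
  \<comment> \<open>Zero has no case of its own; it is the zero multiple of a basis vector.\<close>
  have "P (cscale 0 p)" for p using assms(3)[of "basis_vec undefined" 0] assms(1) by simp
  then have "P 0" by simp
  then show ?thesis using supported_induct[of p UNIV P] assms by blast
qed

text \<open>The set of keys changes under addition and scaling; a common finite superset makes the
  sums comparable term by term.\<close>

lemma lin_ext_superset:
  assumes "finite S" and "Poly_Mapping.keys p \<subseteq> S"
  shows "lin_ext a p = (\<Sum>g\<in>S. cscale (Poly_Mapping.lookup p g) (a g))"
  unfolding lin_ext_def by (rule sum.mono_neutral_left) (use assms in \<open>auto simp: in_keys_iff\<close>)

lemma lin_ext_basis [simp]: "lin_ext a (basis_vec g) = a g"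
  by (simp add: lin_ext_def)

lemma clin_lin_ext: "clin (lin_ext a)"
proof (rule clinI)
  fix p q :: "'a \<Rightarrow>\<^sub>0 complex" and c
  let ?S = "Poly_Mapping.keys p \<union> Poly_Mapping.keys q"
  have "lin_ext a (p + q) = (\<Sum>g\<in>?S. cscale (Poly_Mapping.lookup (p + q) g) (a g))"
    using keys_add[of p q] by (intro lin_ext_superset) auto
  also have "\<dots> = (\<Sum>g\<in>?S. cscale (Poly_Mapping.lookup p g) (a g)) + (\<Sum>g\<in>?S. cscale (Poly_Mapping.lookup q g) (a g))"
    by (simp add: lookup_add cspace.scale_left_distrib sum.distrib)
  also have "\<dots> = lin_ext a p + lin_ext a q"
    by (simp add: lin_ext_superset[of ?S])
  finally show "lin_ext a (p + q) = lin_ext a p + lin_ext a q" .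
  have "lin_ext a (cscale c p) = (\<Sum>g\<in>Poly_Mapping.keys p. cscale (c * Poly_Mapping.lookup p g) (a g))"
    by (subst lin_ext_superset[of "Poly_Mapping.keys p"]) (auto simp: lookup_cscale intro: keys_cscale[THEN subsetD])
  then show "lin_ext a (cscale c p) = cscale c (lin_ext a p)"
    by (simp add: lin_ext_def cspace.scale_sum_right)
qed

lemmas lin_ext_add = clin_add[OF clin_lin_ext]
  and lin_ext_cscale = clin_scale[OF clin_lin_ext]
  and lin_ext_zero = clin_zero[OF clin_lin_ext]
  and lin_ext_diff = clin_diff[OF clin_lin_ext]

lemma clin_eq_on_basis:
  assumes "clin f" and "clin g" and "\<And>x. f (basis_vec x) = g (basis_vec x)"
  shows "f p = g p"
  by (induction p rule: pm_induct) (simp_all add: assms clin_add clin_scale)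

lemma keys_lin_ext: "(\<And>g. g \<in> Poly_Mapping.keys p \<Longrightarrow> Poly_Mapping.keys (a g) \<subseteq> G) \<Longrightarrow> Poly_Mapping.keys (lin_ext a p) \<subseteq> G"
  unfolding lin_ext_def by (rule keys_sum_subset) (auto dest!: keys_cscale[THEN subsetD])

lemma lin_ext_cong: "(\<And>g. g \<in> Poly_Mapping.keys p \<Longrightarrow> a g = b g) \<Longrightarrow> lin_ext a p = lin_ext b p"
  unfolding lin_ext_def by (rule sum.cong) auto

section \<open>Complex vector spaces as module records\<close>

lemma complex_ring_simps [simp]:
  "carrier complex_ring = UNIV" "a \<oplus>\<^bsub>complex_ring\<^esub> b = a + b" "a \<otimes>\<^bsub>complex_ring\<^esub> b = a * b"
  "\<one>\<^bsub>complex_ring\<^esub> = 1" "\<zero>\<^bsub>complex_ring\<^esub> = 0"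
  by (simp_all add: complex_ring_def)

lemma cring_complex_ring: "cring complex_ring"
proof (rule cringI)
  show "abelian_group complex_ring"
  proof (rule abelian_groupI)
    fix x :: complex assume "x \<in> carrier complex_ring"
    show "\<exists>y\<in>carrier complex_ring. y \<oplus>\<^bsub>complex_ring\<^esub> x = \<zero>\<^bsub>complex_ring\<^esub>"
      by (auto intro: exI[of _ "- x"])
  qed (auto simp: algebra_simps)
  show "comm_monoid complex_ring"
    by (rule comm_monoidI) (auto simp: algebra_simps)
qed (auto simp: algebra_simps)

text \<open>The library's modules with the scalars fixed to the complex numbers, so that the carrier
  conditions on scalars disappear.\<close>

locale cmod = Module.module complex_ring M for M :: "(complex, 'v, 'm) module_scheme" (structure)
begin

lemma cmod: "cmod M" by (rule cmod_axioms)

lemma sm_closed [simp, intro]: "v \<in> carrier M \<Longrightarrow> c \<odot> v \<in> carrier M"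
  using smult_closed by simp

lemma sm_add_left: "v \<in> carrier M \<Longrightarrow> (a + b) \<odot> v = a \<odot> v \<oplus> b \<odot> v"
  using smult_l_distr[of a b v] by simp

lemma sm_add_right: "u \<in> carrier M \<Longrightarrow> v \<in> carrier M \<Longrightarrow> a \<odot> (u \<oplus> v) = a \<odot> u \<oplus> a \<odot> v"
  using smult_r_distr[of a u v] by simp

lemma sm_sm: "v \<in> carrier M \<Longrightarrow> a \<odot> (b \<odot> v) = (a * b) \<odot> v"
  using smult_assoc1[of a b v] by simp

lemma sm_one [simp]: "v \<in> carrier M \<Longrightarrow> 1 \<odot> v = v"
  using smult_one by simp

lemma sm_zero_left [simp]: "v \<in> carrier M \<Longrightarrow> 0 \<odot> v = \<zero>"
  using smult_l_null by simp

lemma sm_zero_right [simp]: "c \<odot> \<zero> = \<zero>"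
  using smult_r_null by simp

lemma neg_eq_sm: "v \<in> carrier M \<Longrightarrow> \<ominus> v = (-1) \<odot> v"
proof -
  assume v: "v \<in> carrier M"
  have "(-1) \<odot> v \<oplus> v = (-1 + 1) \<odot> v" using sm_add_left[of v "-1" 1] v by simp
  then have "(-1) \<odot> v \<oplus> v = \<zero>" using v by simp
  then show ?thesis using v by (metis minus_equality sm_closed)
qed

lemma minus_eq_sm: "u \<in> carrier M \<Longrightarrow> v \<in> carrier M \<Longrightarrow> u \<ominus> v = u \<oplus> (-1) \<odot> v"
  by (simp add: minus_eq neg_eq_sm)

end

lemma cmodI: "Module.module complex_ring M \<Longrightarrow> cmod M"
  by (simp add: cmod_def)

text \<open>The counterpart of \<open>lin_ext\<close> for a carrier-based target: the linear map out
  of a free space that sends \<open>basis_vec g\<close> to \<open>f g\<close>.\<close>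

definition lcomb :: "(complex, 'v, 'm) module_scheme \<Rightarrow> ('x \<Rightarrow> 'v) \<Rightarrow> ('x \<Rightarrow>\<^sub>0 complex) \<Rightarrow> 'v" where
  "lcomb M f p = (\<Oplus>\<^bsub>M\<^esub>g\<in>Poly_Mapping.keys p. Poly_Mapping.lookup p g \<odot>\<^bsub>M\<^esub> f g)"

context cmod
begin

lemma lcomb_superset:
  assumes "finite S" and "Poly_Mapping.keys p \<subseteq> S" and "f \<in> S \<rightarrow> carrier M"
  shows "lcomb M f p = (\<Oplus>g\<in>S. Poly_Mapping.lookup p g \<odot> f g)"
  unfolding lcomb_def
  by (rule add.finprod_mono_neutral_cong_left) (use assms in \<open>auto simp: in_keys_iff Pi_iff\<close>)

lemma lcomb_closed [simp]: "f \<in> G \<rightarrow> carrier M \<Longrightarrow> Poly_Mapping.keys p \<subseteq> G \<Longrightarrow> lcomb M f p \<in> carrier M"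
  unfolding lcomb_def by (rule finsum_closed) auto

lemma lcomb_zero [simp]: "lcomb M f 0 = \<zero>"
  by (simp add: lcomb_def)

lemma lcomb_basis [simp]: "f g \<in> carrier M \<Longrightarrow> lcomb M f (basis_vec g) = f g"
  by (simp add: lcomb_def)

lemma lcomb_add:
  assumes f: "f \<in> G \<rightarrow> carrier M" and p: "Poly_Mapping.keys p \<subseteq> G" and q: "Poly_Mapping.keys q \<subseteq> G"
  shows "lcomb M f (p + q) = lcomb M f p \<oplus> lcomb M f q"
proof -
  let ?S = "Poly_Mapping.keys p \<union> Poly_Mapping.keys q"
  have fS: "f \<in> ?S \<rightarrow> carrier M" using f p q by auto
  have "lcomb M f (p + q) = (\<Oplus>g\<in>?S. Poly_Mapping.lookup (p + q) g \<odot> f g)"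
    using keys_add[of p q] fS by (intro lcomb_superset) auto
  also have "\<dots> = (\<Oplus>g\<in>?S. Poly_Mapping.lookup p g \<odot> f g \<oplus> Poly_Mapping.lookup q g \<odot> f g)"
    by (rule add.finprod_cong') (use fS in \<open>auto simp: lookup_add sm_add_left Pi_iff\<close>)
  also have "\<dots> = (\<Oplus>g\<in>?S. Poly_Mapping.lookup p g \<odot> f g) \<oplus> (\<Oplus>g\<in>?S. Poly_Mapping.lookup q g \<odot> f g)"
    by (rule finsum_addf) (use fS in \<open>auto simp: Pi_iff\<close>)
  also have "\<dots> = lcomb M f p \<oplus> lcomb M f q"
    using fS by (simp add: lcomb_superset[of ?S])
  finally show ?thesis .
qed

lemma lcomb_scale:
  assumes f: "f \<in> G \<rightarrow> carrier M" and p: "Poly_Mapping.keys p \<subseteq> G"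
  shows "lcomb M f (cscale c p) = c \<odot> lcomb M f p"
proof -
  let ?S = "Poly_Mapping.keys p"
  have fS: "f \<in> ?S \<rightarrow> carrier M" using f p by auto
  have "lcomb M f (cscale c p) = (\<Oplus>g\<in>?S. Poly_Mapping.lookup (cscale c p) g \<odot> f g)"
    using keys_cscale[of c p] fS by (intro lcomb_superset) auto
  also have "\<dots> = (\<Oplus>g\<in>?S. c \<odot> (Poly_Mapping.lookup p g \<odot> f g))"
    by (rule add.finprod_cong') (use fS in \<open>auto simp: lookup_cscale sm_sm Pi_iff\<close>)
  also have "\<dots> = c \<odot> lcomb M f p"
    unfolding lcomb_def by (rule finsum_smult_ldistr[symmetric]) (use fS in \<open>auto simp: Pi_iff\<close>)
  finally show ?thesis .
qed

end

definition cmod_hom ::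
  "(complex, 'v, 'm) module_scheme \<Rightarrow> (complex, 'w, 'n) module_scheme \<Rightarrow> ('v \<Rightarrow> 'w) \<Rightarrow> bool" where
  "cmod_hom M N \<phi> \<longleftrightarrow> \<phi> \<in> carrier M \<rightarrow> carrier N \<and>
     (\<forall>v\<in>carrier M. \<forall>w\<in>carrier M. \<phi> (v \<oplus>\<^bsub>M\<^esub> w) = \<phi> v \<oplus>\<^bsub>N\<^esub> \<phi> w) \<and>
     (\<forall>c. \<forall>v\<in>carrier M. \<phi> (c \<odot>\<^bsub>M\<^esub> v) = c \<odot>\<^bsub>N\<^esub> \<phi> v)"

lemma cmod_hom_closed: "cmod_hom M N \<phi> \<Longrightarrow> v \<in> carrier M \<Longrightarrow> \<phi> v \<in> carrier N"
  by (auto simp: cmod_hom_def)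

lemma cmod_hom_add: "cmod_hom M N \<phi> \<Longrightarrow> v \<in> carrier M \<Longrightarrow> w \<in> carrier M \<Longrightarrow> \<phi> (v \<oplus>\<^bsub>M\<^esub> w) = \<phi> v \<oplus>\<^bsub>N\<^esub> \<phi> w"
  by (auto simp: cmod_hom_def)

lemma cmod_hom_scale: "cmod_hom M N \<phi> \<Longrightarrow> v \<in> carrier M \<Longrightarrow> \<phi> (c \<odot>\<^bsub>M\<^esub> v) = c \<odot>\<^bsub>N\<^esub> \<phi> v"
  by (auto simp: cmod_hom_def)

lemma cmod_hom_zero:
  assumes "cmod M" "cmod N" "cmod_hom M N \<phi>"
  shows "\<phi> \<zero>\<^bsub>M\<^esub> = \<zero>\<^bsub>N\<^esub>"
proof -
  interpret M: cmod M by fact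
  interpret N: cmod N by fact
  show ?thesis
    using cmod_hom_scale[OF assms(3) M.zero_closed, of 0] cmod_hom_closed[OF assms(3) M.zero_closed] by simp
qed

section \<open>Presented spaces\<close>

text \<open>Since the relations are supported on \<open>G\<close>, any representative of the class
  of a supported vector is again supported. \<open>lift_cls\<close> relies on this, as it evaluates
  at an arbitrarily chosen representative.\<close>

locale presentation =
  fixes G :: "'x set" and R :: "('x \<Rightarrow>\<^sub>0 complex) set"
  assumes rel_supported: "r \<in> R \<Longrightarrow> Poly_Mapping.keys r \<subseteq> G"
begin

abbreviation "K \<equiv> cspace.span R"

definition cls :: "('x \<Rightarrow>\<^sub>0 complex) \<Rightarrow> ('x \<Rightarrow>\<^sub>0 complex) set" where
  "cls p = p +o K"

lemma K_supported: "k \<in> K \<Longrightarrow> Poly_Mapping.keys k \<subseteq> G"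
  using cspace.span_minimal[of R "{p. Poly_Mapping.keys p \<subseteq> G}"] subspace_supported rel_supported by blast

lemma in_cls: "q \<in> cls p \<longleftrightarrow> q - p \<in> K"
proof
  assume "q - p \<in> K"
  then show "q \<in> cls p" unfolding cls_def elt_set_plus_def by (intro CollectI bexI[of _ "q - p"]) auto
qed (auto simp: cls_def elt_set_plus_def)

lemma cls_eq_iff: "cls p = cls q \<longleftrightarrow> p - q \<in> K"
proof
  assume "cls p = cls q"
  moreover have "p \<in> cls p" by (simp add: in_cls cspace.span_zero)
  ultimately have "p \<in> cls q" by simp
  then show "p - q \<in> K" by (simp add: in_cls)
next
  assume *: "p - q \<in> K"
  have "r - p \<in> K \<longleftrightarrow> r - q \<in> K" for r
    using cspace.span_add[OF _ *, of "r - p"] cspace.span_diff[OF _ *, of "r - q"] by auto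
  then show "cls p = cls q" by (auto simp: in_cls)
qed

lemma self_in_cls: "p \<in> cls p"
  by (simp add: in_cls cspace.span_zero)

text \<open>Scalar multiplication and action in \<open>presented\<close> are unions over all
  representatives. A linear map that preserves the relation space sends representatives of one class
  to a single coset, and the union collapses to it.\<close>

lemma UN_cls:
  assumes "clin f" and "\<And>k. k \<in> K \<Longrightarrow> f k \<in> K"
  shows "(\<Union>q\<in>cls p. f q +o K) = cls (f p)"
proof -
  have "f q +o K = cls (f p)" if "q \<in> cls p" for q
  proof -
    have "f (q - p) \<in> K" using assms(2) that by (simp add: in_cls)
    then have "cls (f q) = cls (f p)" by (simp add: cls_eq_iff clin_diff[OF assms(1)])
    then show ?thesis by (simp add: cls_def)
  qed
  then show ?thesis using self_in_cls[of p] by blast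
qed

lemma cls_plus: "cls p + cls q = cls (p + q)"
proof -
  have "cls p + cls q = (p + q) +o (K + K)"
    unfolding cls_def by (simp add: set_plus_rearrange)
  moreover have "K + K = K"
    using cspace.span_add[of _ R] cspace.span_zero[of R] by (force simp: set_plus_def)
  ultimately show ?thesis by (simp add: cls_def)
qed

lemma span_preserved:
  assumes "clin f" and "\<And>r. r \<in> R \<Longrightarrow> f r \<in> K" and "k \<in> K"
  shows "f k \<in> K"
proof -
  have "cspace.subspace {k. f k \<in> K}"
    unfolding cspace.subspace_def
    by (simp add: clin_zero[OF assms(1)] clin_add[OF assms(1)] clin_scale[OF assms(1)]
        cspace.span_zero cspace.span_add cspace.span_scale)
  then show ?thesis using cspace.span_minimal[of R "{k. f k \<in> K}"] assms(2,3) by blast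
qed

lemma presented_sel:
  "carrier (presented G R a) = cls ` {p. Poly_Mapping.keys p \<subseteq> G}"
  "\<zero>\<^bsub>presented G R a\<^esub> = cls 0"
  "cls p \<oplus>\<^bsub>presented G R a\<^esub> cls q = cls (p + q)"
  "c \<odot>\<^bsub>presented G R a\<^esub> cls p = cls (cscale c p)"
proof -
  show "carrier (presented G R a) = cls ` {p. Poly_Mapping.keys p \<subseteq> G}"
    by (auto simp: presented_def cls_def)
  show "\<zero>\<^bsub>presented G R a\<^esub> = cls 0" by (simp add: presented_def cls_def)
  show "cls p \<oplus>\<^bsub>presented G R a\<^esub> cls q = cls (p + q)" by (simp add: presented_def cls_plus)
  show "c \<odot>\<^bsub>presented G R a\<^esub> cls p = cls (cscale c p)"
    using UN_cls[OF clin_cscale, of c p] by (simp add: presented_def cspace.span_scale)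
qed

lemma act_cls:
  assumes "\<And>r. r \<in> R \<Longrightarrow> lin_ext (a x) r \<in> K"
  shows "act (presented G R a) x (cls p) = cls (lin_ext (a x) p)"
  using UN_cls[OF clin_lin_ext[of "a x"], of p] span_preserved[OF clin_lin_ext assms]
  by (simp add: presented_def)

lemma cls_in_carrier [simp, intro]: "Poly_Mapping.keys p \<subseteq> G \<Longrightarrow> cls p \<in> carrier (presented G R a)"
  by (auto simp: presented_sel)

lemma presented_cmod: "cmod (presented G R a)"
proof (rule cmodI, rule moduleI)
  let ?P = "presented G R a"
  show "cring complex_ring" by (rule cring_complex_ring)
  show "abelian_group ?P"
  proof (rule abelian_groupI)
    fix x assume "x \<in> carrier ?P"
    then obtain p where p: "x = cls p" "Poly_Mapping.keys p \<subseteq> G" by (auto simp: presented_sel)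
    then have "cls (- p) \<in> carrier ?P" "cls (- p) \<oplus>\<^bsub>?P\<^esub> x = \<zero>\<^bsub>?P\<^esub>"
      by (auto simp: presented_sel)
    then show "\<exists>y\<in>carrier ?P. y \<oplus>\<^bsub>?P\<^esub> x = \<zero>\<^bsub>?P\<^esub>" by blast
  next
    fix x y assume "x \<in> carrier ?P" "y \<in> carrier ?P"
    then obtain p q where pq: "x = cls p" "Poly_Mapping.keys p \<subseteq> G" "y = cls q" "Poly_Mapping.keys q \<subseteq> G"
      by (auto simp: presented_sel)
    show "x \<oplus>\<^bsub>?P\<^esub> y \<in> carrier ?P"
      using keys_add_subset[OF pq(2) pq(4)] by (auto simp: pq presented_sel)
    show "x \<oplus>\<^bsub>?P\<^esub> y = y \<oplus>\<^bsub>?P\<^esub> x" by (simp add: pq presented_sel add.commute)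
    fix z assume "z \<in> carrier ?P"
    then show "(x \<oplus>\<^bsub>?P\<^esub> y) \<oplus>\<^bsub>?P\<^esub> z = x \<oplus>\<^bsub>?P\<^esub> (y \<oplus>\<^bsub>?P\<^esub> z)"
      by (auto simp: pq presented_sel add.assoc)
  qed (auto simp: presented_sel)
next
  fix a' b :: complex and x y assume "x \<in> carrier (presented G R a)" "y \<in> carrier (presented G R a)"
  then obtain p q where pq: "x = cls p" "Poly_Mapping.keys p \<subseteq> G" "y = cls q" "Poly_Mapping.keys q \<subseteq> G"
    by (auto simp: presented_sel)
  show "a' \<odot>\<^bsub>presented G R a\<^esub> (x \<oplus>\<^bsub>presented G R a\<^esub> y) =
      a' \<odot>\<^bsub>presented G R a\<^esub> x \<oplus>\<^bsub>presented G R a\<^esub> a' \<odot>\<^bsub>presented G R a\<^esub> y"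
    by (simp add: pq presented_sel cspace.scale_right_distrib)
next
  fix a' b :: complex and x assume "x \<in> carrier (presented G R a)"
  then obtain p where p: "x = cls p" "Poly_Mapping.keys p \<subseteq> G" by (auto simp: presented_sel)
  show "a' \<odot>\<^bsub>presented G R a\<^esub> x \<in> carrier (presented G R a)"
    using p keys_cscale[of a' p] by (auto simp: presented_sel)
  show "(a' \<oplus>\<^bsub>complex_ring\<^esub> b) \<odot>\<^bsub>presented G R a\<^esub> x =
      a' \<odot>\<^bsub>presented G R a\<^esub> x \<oplus>\<^bsub>presented G R a\<^esub> b \<odot>\<^bsub>presented G R a\<^esub> x"
    by (simp add: p presented_sel cspace.scale_left_distrib)
  show "(a' \<otimes>\<^bsub>complex_ring\<^esub> b) \<odot>\<^bsub>presented G R a\<^esub> x = a' \<odot>\<^bsub>presented G R a\<^esub> (b \<odot>\<^bsub>presented G R a\<^esub> x)"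
    by (simp add: p presented_sel)
  show "\<one>\<^bsub>complex_ring\<^esub> \<odot>\<^bsub>presented G R a\<^esub> x = x"
    by (simp add: p presented_sel)
qed

lemma presented_induct [consumes 1, case_names gen add scale]:
  assumes "P \<in> carrier (presented G R a)" and "\<And>g. g \<in> G \<Longrightarrow> Q (cls (basis_vec g))"
    and "\<And>x y. x \<in> carrier (presented G R a) \<Longrightarrow> y \<in> carrier (presented G R a) \<Longrightarrow> Q x \<Longrightarrow> Q y \<Longrightarrow>
      Q (x \<oplus>\<^bsub>presented G R a\<^esub> y)"
    and "\<And>c x. x \<in> carrier (presented G R a) \<Longrightarrow> Q x \<Longrightarrow> Q (c \<odot>\<^bsub>presented G R a\<^esub> x)"
    and "G \<noteq> {}"
  shows "Q P"
proof -
  obtain p where p: "P = cls p" "Poly_Mapping.keys p \<subseteq> G" using assms(1) by (auto simp: presented_sel)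
  from p(2) have "Q (cls p)"
  proof (induction rule: supported_induct)
    case zero
    \<comment> \<open>Zero is the zero multiple of a generator, so some generator has to
      exist.\<close>
    obtain g where g: "g \<in> G" using assms(5) by blast
    then have "Q (0 \<odot>\<^bsub>presented G R a\<^esub> cls (basis_vec g))" using assms(2,4) by simp
    then show ?case by (simp add: presented_sel)
  next
    case (add p q)
    then show ?case using assms(3)[of "cls p" "cls q"] by (simp add: presented_sel(3))
  next
    case (scale c p)
    then show ?case using assms(4)[of "cls p" c] by (simp add: presented_sel(4))
  qed (use assms(2) in auto)
  then show ?thesis using p by simp
qed

text \<open>The choice of representative is harmless once the relations are sent to zero; see
  \<open>lift_cls\<close>.\<close>

definition lift :: "(complex, 'v, 'm) module_scheme \<Rightarrow> ('x \<Rightarrow> 'v) \<Rightarrow> ('x \<Rightarrow>\<^sub>0 complex) set \<Rightarrow> 'v" where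
  "lift N f P = lcomb N f (SOME p. p \<in> P)"

lemma lift_cls:
  assumes "cmod N" and f: "f \<in> G \<rightarrow> carrier N" and rel: "\<And>r. r \<in> R \<Longrightarrow> lcomb N f r = \<zero>\<^bsub>N\<^esub>"
    and p: "Poly_Mapping.keys p \<subseteq> G"
  shows "lift N f (cls p) = lcomb N f p"
proof -
  interpret N: cmod N by fact
  have "cspace.subspace {k. Poly_Mapping.keys k \<subseteq> G \<and> lcomb N f k = \<zero>\<^bsub>N\<^esub>}"
    unfolding cspace.subspace_def
    by (auto simp: N.lcomb_add[OF f] N.lcomb_scale[OF f]
        dest!: keys_cscale[THEN subsetD] keys_add[THEN subsetD])
  then have K: "lcomb N f k = \<zero>\<^bsub>N\<^esub>" if "k \<in> K" for k
    using cspace.span_minimal[of R "{k. Poly_Mapping.keys k \<subseteq> G \<and> lcomb N f k = \<zero>\<^bsub>N\<^esub>}"]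
      rel rel_supported that by blast
  define q where "q = (SOME q. q \<in> cls p)"
  have "q \<in> cls p" unfolding q_def using self_in_cls by (rule someI)
  then have qp: "q - p \<in> K" by (simp add: in_cls)
  have "lcomb N f (p + (q - p)) = lcomb N f p \<oplus>\<^bsub>N\<^esub> lcomb N f (q - p)"
    using qp p K_supported by (intro N.lcomb_add[OF f]) auto
  then show ?thesis using K[OF qp] N.lcomb_closed[OF f p] by (simp add: lift_def q_def)
qed

lemma lift_hom:
  assumes "cmod N" and f: "f \<in> G \<rightarrow> carrier N" and rel: "\<And>r. r \<in> R \<Longrightarrow> lcomb N f r = \<zero>\<^bsub>N\<^esub>"
  shows "cmod_hom (presented G R a) N (lift N f)"
proof -
  interpret N: cmod N by fact
  note l = lift_cls[OF assms]
  show ?thesis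
    unfolding cmod_hom_def
  proof (intro conjI ballI allI funcsetI)
    fix x assume "x \<in> carrier (presented G R a)"
    then obtain p where p: "x = cls p" "Poly_Mapping.keys p \<subseteq> G" by (auto simp: presented_sel)
    show "lift N f x \<in> carrier N" using p N.lcomb_closed[OF f] l by simp
    show "lift N f (c \<odot>\<^bsub>presented G R a\<^esub> x) = c \<odot>\<^bsub>N\<^esub> lift N f x" for c
      using p l N.lcomb_scale[OF f] keys_cscale[of c p] by (simp add: presented_sel)
    fix y assume "y \<in> carrier (presented G R a)"
    then obtain q where q: "y = cls q" "Poly_Mapping.keys q \<subseteq> G" by (auto simp: presented_sel)
    show "lift N f (x \<oplus>\<^bsub>presented G R a\<^esub> y) = lift N f x \<oplus>\<^bsub>N\<^esub> lift N f y"
      using p q l N.lcomb_add[OF f p(2) q(2)] keys_add_subset[OF p(2) q(2)] by (simp add: presented_sel)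
  qed
qed

end

section \<open>Coordinates\<close>

context cmod
begin

lemma lcomb_uminus_one:
  assumes f: "f \<in> G \<rightarrow> carrier M" and p: "Poly_Mapping.keys p \<subseteq> G" and q: "Poly_Mapping.keys q \<subseteq> G"
  shows "lcomb M f (p - q) = lcomb M f p \<ominus> lcomb M f q"
proof -
  have eq: "p - q = p + cscale (-1) q" by (rule poly_mapping_eqI) (simp add: lookup_minus lookup_add lookup_cscale)
  have k: "Poly_Mapping.keys (cscale (-1) q) \<subseteq> G" using keys_cscale[of "-1" q] q by blast
  show ?thesis
    unfolding eq lcomb_add[OF f p k] lcomb_scale[OF f q]
    by (rule minus_eq_sm[OF lcomb_closed[OF f p] lcomb_closed[OF f q], symmetric])
qed

lemma diff_eq_zero_iff:
  assumes "u \<in> carrier M" "v \<in> carrier M"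
  shows "u \<ominus> v = \<zero> \<longleftrightarrow> u = v"
proof
  assume uv: "u \<ominus> v = \<zero>"
  have "u = (u \<ominus> v) \<oplus> v" unfolding minus_eq using assms by (simp add: a_assoc l_neg)
  also have "\<dots> = v" using uv assms by simp
  finally show "u = v" .
qed (use assms in \<open>simp add: r_neg minus_eq\<close>)

text \<open>All relations imposed below have this shape or that of \<open>lcomb_rel_scale\<close>,
  so checking them on a candidate map amounts to one equation for \<open>f\<close>.\<close>

lemma lcomb_rel_add:
  assumes f: "f \<in> G \<rightarrow> carrier M" and "a \<in> G" "b \<in> G" "c \<in> G" and "f a = f b \<oplus> f c"
  shows "lcomb M f (basis_vec a - basis_vec b - basis_vec c) = \<zero>"
proof -
  have k: "Poly_Mapping.keys (basis_vec a) \<subseteq> G" "Poly_Mapping.keys (basis_vec b) \<subseteq> G"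
    "Poly_Mapping.keys (basis_vec c) \<subseteq> G" using assms by auto
  have cl: "f a \<in> carrier M" "f b \<in> carrier M" "f c \<in> carrier M" using f assms(2-4) by blast+
  show ?thesis
    using lcomb_uminus_one[OF f k(1) keys_add_subset[OF k(2,3)]] lcomb_add[OF f k(2,3)] cl assms(5)
    by (simp add: diff_diff_eq diff_eq_zero_iff)
qed

lemma lcomb_rel_scale:
  assumes f: "f \<in> G \<rightarrow> carrier M" and "a \<in> G" "b \<in> G" and "f a = c \<odot> f b"
  shows "lcomb M f (basis_vec a - cscale c (basis_vec b)) = \<zero>"
proof -
  have k: "Poly_Mapping.keys (basis_vec a) \<subseteq> G" "Poly_Mapping.keys (basis_vec b) \<subseteq> G"
    using assms by auto
  have cl: "f a \<in> carrier M" "f b \<in> carrier M" using f assms(2-3) by blast+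
  show ?thesis
    using lcomb_uminus_one[OF f k(1) order_trans[OF keys_cscale k(2)]] lcomb_scale[OF f k(2)] cl assms(4)
    by (simp add: diff_eq_zero_iff del: cscale_single)
qed

end

lemma rel_add_supp: "a \<in> G \<Longrightarrow> b \<in> G \<Longrightarrow> c \<in> G \<Longrightarrow>
    Poly_Mapping.keys (basis_vec a - basis_vec b - basis_vec c :: _ \<Rightarrow>\<^sub>0 complex) \<subseteq> G"
  by (intro keys_diff_subset) auto

lemma rel_scale_supp: "a \<in> G \<Longrightarrow> b \<in> G \<Longrightarrow> Poly_Mapping.keys (basis_vec a - cscale c (basis_vec b)) \<subseteq> G"
  by (intro keys_diff_subset order_trans[OF keys_cscale]) auto

section \<open>Bases with dual coordinate functions\<close>

text \<open>Here \<open>\<beta>\<close> is a basis indexed by \<open>X\<close> and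
  \<open>\<kappa>\<close> the family dual to it; biorthogonality encodes linear independence. The
  dual family is part of the notion because products of coordinate functions are what separates
  tensors.\<close>

definition coords ::
  "(complex, 'a, 'm) module_scheme \<Rightarrow> 'x set \<Rightarrow> ('x \<Rightarrow> 'a) \<Rightarrow> ('a \<Rightarrow> 'x \<Rightarrow> complex) \<Rightarrow> bool" where
  "coords A X \<beta> \<kappa> \<longleftrightarrow> \<beta> \<in> X \<rightarrow> carrier A \<and>
     (\<forall>u\<in>carrier A. \<forall>v\<in>carrier A. \<forall>x\<in>X. \<kappa> (u \<oplus>\<^bsub>A\<^esub> v) x = \<kappa> u x + \<kappa> v x) \<and>
     (\<forall>c. \<forall>v\<in>carrier A. \<forall>x\<in>X. \<kappa> (c \<odot>\<^bsub>A\<^esub> v) x = c * \<kappa> v x) \<and>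
     (\<forall>x\<in>X. \<forall>y\<in>X. \<kappa> (\<beta> x) y = (if x = y then 1 else 0)) \<and>
     (\<forall>v\<in>carrier A. \<exists>p. Poly_Mapping.keys p \<subseteq> X \<and> v = lcomb A \<beta> p)"

lemma coords_closed: "coords A X \<beta> \<kappa> \<Longrightarrow> x \<in> X \<Longrightarrow> \<beta> x \<in> carrier A"
  by (auto simp: coords_def)

lemma coords_add: "coords A X \<beta> \<kappa> \<Longrightarrow> u \<in> carrier A \<Longrightarrow> v \<in> carrier A \<Longrightarrow> x \<in> X \<Longrightarrow> \<kappa> (u \<oplus>\<^bsub>A\<^esub> v) x = \<kappa> u x + \<kappa> v x"
  by (auto simp: coords_def)

lemma coords_scale: "coords A X \<beta> \<kappa> \<Longrightarrow> v \<in> carrier A \<Longrightarrow> x \<in> X \<Longrightarrow> \<kappa> (c \<odot>\<^bsub>A\<^esub> v) x = c * \<kappa> v x"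
  by (auto simp: coords_def)

lemma coords_basis: "coords A X \<beta> \<kappa> \<Longrightarrow> x \<in> X \<Longrightarrow> y \<in> X \<Longrightarrow> \<kappa> (\<beta> x) y = (if x = y then 1 else 0)"
  by (auto simp: coords_def)

lemma coords_span:
  assumes "coords A X \<beta> \<kappa>" "v \<in> carrier A"
  obtains p where "Poly_Mapping.keys p \<subseteq> X" "v = lcomb A \<beta> p"
  using assms by (auto simp: coords_def)

lemma coords_lcomb:
  assumes "cmod A" "coords A X \<beta> \<kappa>" "Poly_Mapping.keys p \<subseteq> X" "y \<in> X"
  shows "\<kappa> (lcomb A \<beta> p) y = Poly_Mapping.lookup p y"
proof -
  interpret A: cmod A by fact
  have \<beta>: "\<beta> \<in> X \<rightarrow> carrier A" using assms(2) by (simp add: coords_def)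
  from assms(3) show ?thesis
  proof (induction rule: supported_induct)
    case zero
    have "\<kappa> (0 \<odot>\<^bsub>A\<^esub> \<zero>\<^bsub>A\<^esub>) y = 0 * \<kappa> \<zero>\<^bsub>A\<^esub> y" by (rule coords_scale[OF assms(2) _ assms(4)]) simp
    then show ?case by simp
  next
    case (basis g)
    then show ?case using \<beta> assms(4) by (simp add: coords_basis[OF assms(2)] lookup_single when_def Pi_iff)
  next
    case (add p q)
    then show ?case using \<beta>
      by (simp add: A.lcomb_add[OF \<beta>] coords_add[OF assms(2)] assms(4) lookup_add)
  next
    case (scale c p)
    then show ?case using \<beta>
      by (simp add: A.lcomb_scale[OF \<beta>] coords_scale[OF assms(2)] assms(4) lookup_cscale)
  qed
qed

lemma coords_eq_zero:
  assumes "cmod A" "coords A X \<beta> \<kappa>" "v \<in> carrier A" "\<And>x. x \<in> X \<Longrightarrow> \<kappa> v x = 0"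
  shows "v = \<zero>\<^bsub>A\<^esub>"
proof -
  interpret A: cmod A by fact
  obtain p where p: "Poly_Mapping.keys p \<subseteq> X" "v = lcomb A \<beta> p"
    using coords_span[OF assms(2,3)] .
  have "p = 0"
  proof (rule poly_mapping_eqI)
    fix x
    show "Poly_Mapping.lookup p x = Poly_Mapping.lookup 0 x"
      using coords_lcomb[OF assms(1,2) p(1), of x] assms(4) p by (cases "x \<in> X") (auto simp: in_keys_iff)
  qed
  then show ?thesis using p by simp
qed

lemma coords_nonzero:
  assumes "cmod A" "coords A X \<beta> \<kappa>" "v \<in> carrier A" "v \<noteq> \<zero>\<^bsub>A\<^esub>"
  obtains x where "x \<in> X" "\<kappa> v x \<noteq> 0"
  using coords_eq_zero[OF assms(1-3)] assms(4) by blast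

text \<open>
  A basis of an arbitrary carrier-based space is obtained in the free space on the carrier,
  by completing a basis of the kernel of the evaluation map with basis vectors.
\<close>

lemma coords_exist:
  assumes "cmod (A :: (complex, 'a, 'm) module_scheme)"
  obtains X \<kappa> where "coords A X (\<lambda>x. x) \<kappa>"
proof -
  interpret A: cmod A by fact
  have id: "(\<lambda>x. x) \<in> carrier A \<rightarrow> carrier A" by simp
  let ?ev = "lcomb A (\<lambda>x. x)"
  define N where "N = {p. Poly_Mapping.keys p \<subseteq> carrier A \<and> ?ev p = \<zero>\<^bsub>A\<^esub>}"
  obtain B where B: "B \<subseteq> N" "cspace.independent B" "N \<subseteq> cspace.span B"
    using cspace.maximal_independent_subset by blast
  let ?E = "basis_vec ` carrier A :: ('a \<Rightarrow>\<^sub>0 complex) set"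
  obtain C where C: "B \<subseteq> C" "C \<subseteq> B \<union> ?E" "cspace.independent C" "B \<union> ?E \<subseteq> cspace.span C"
    using cspace.maximal_independent_subset_extend[of B "B \<union> ?E"] B(2) by auto
  define X where "X = {a \<in> carrier A. basis_vec a \<in> C - B}"
  \<comment> \<open>\<open>C\<close> extends a basis \<open>B\<close> of the kernel of evaluation by
    basis vectors, and \<open>X\<close> collects the latter. The coefficient at an element outside
    \<open>B\<close> vanishes on the kernel (\<open>repN\<close>), which makes it a linear function
    of the vector \<open>v\<close> rather than of \<open>basis_vec v\<close>.\<close>
  define \<kappa> where "\<kappa> v x = cspace.representation C (basis_vec v) (basis_vec x)" for v x :: 'a
  have spC: "basis_vec v \<in> cspace.span C" if "v \<in> carrier A" for v using C(4) that by auto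
  have repN: "cspace.representation C p (basis_vec x) = 0" if "p \<in> N" "x \<in> X" for p x
  proof -
    have "cspace.representation C p = cspace.representation B p"
      using cspace.representation_extend[OF C(3) _ C(1)] B(3) that(1) by blast
    then show ?thesis using cspace.representation_ne_zero[of B p "basis_vec x"] that(2) by (auto simp: X_def)
  qed
  have spN: "p \<in> cspace.span C" if "p \<in> N" for p
    using that B(3) cspace.span_mono[OF C(1)] by blast
  have ev_b: "?ev (basis_vec v) = v" if "v \<in> carrier A" for v using that by simp
  have "coords A X (\<lambda>x. x) \<kappa>"
    unfolding coords_def
  proof (intro conjI ballI allI)
    show "(\<lambda>x. x) \<in> X \<rightarrow> carrier A" by (auto simp: X_def)
    fix c u v x assume uvx: "u \<in> carrier A" "v \<in> carrier A" "x \<in> X"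
    let ?b = "\<lambda>v. basis_vec v :: 'a \<Rightarrow>\<^sub>0 complex"
    have k: "Poly_Mapping.keys (?b u) \<subseteq> carrier A" "Poly_Mapping.keys (?b v) \<subseteq> carrier A"
      "Poly_Mapping.keys (?b (u \<oplus>\<^bsub>A\<^esub> v)) \<subseteq> carrier A"
      using uvx by auto
    have "?ev (?b (u \<oplus>\<^bsub>A\<^esub> v) - (?b u + ?b v)) = ?ev (?b (u \<oplus>\<^bsub>A\<^esub> v)) \<ominus>\<^bsub>A\<^esub> ?ev (?b u + ?b v)"
      by (rule A.lcomb_uminus_one[OF id k(3) keys_add_subset[OF k(1,2)]])
    also have "?ev (?b u + ?b v) = u \<oplus>\<^bsub>A\<^esub> v"
      using A.lcomb_add[OF id k(1,2)] uvx by simp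
    finally have "?ev (?b (u \<oplus>\<^bsub>A\<^esub> v) - (?b u + ?b v)) = \<zero>\<^bsub>A\<^esub>"
      using uvx by (simp add: A.diff_eq_zero_iff)
    then have d: "?b (u \<oplus>\<^bsub>A\<^esub> v) - (?b u + ?b v) \<in> N"
      unfolding N_def using keys_diff_subset[OF k(3) keys_add_subset[OF k(1,2)]] by blast
    have "cspace.representation C (?b (u \<oplus>\<^bsub>A\<^esub> v) - (?b u + ?b v)) (?b x) = \<kappa> (u \<oplus>\<^bsub>A\<^esub> v) x - (\<kappa> u x + \<kappa> v x)"
      using uvx spC by (simp add: \<kappa>_def cspace.representation_diff[OF C(3)] cspace.representation_add[OF C(3)] cspace.span_add)
    then show "\<kappa> (u \<oplus>\<^bsub>A\<^esub> v) x = \<kappa> u x + \<kappa> v x" using repN[OF d uvx(3)] by simp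
  next
    fix c v x assume vx: "v \<in> carrier A" "x \<in> X"
    let ?b = "\<lambda>v. basis_vec v :: 'a \<Rightarrow>\<^sub>0 complex"
    have k: "Poly_Mapping.keys (?b v) \<subseteq> carrier A"  "Poly_Mapping.keys (?b (c \<odot>\<^bsub>A\<^esub> v)) \<subseteq> carrier A"
      using vx by auto
    have k': "Poly_Mapping.keys (cscale c (?b v)) \<subseteq> carrier A" by (rule order_trans[OF keys_cscale k(1)])
    have "?ev (?b (c \<odot>\<^bsub>A\<^esub> v) - cscale c (?b v)) = ?ev (?b (c \<odot>\<^bsub>A\<^esub> v)) \<ominus>\<^bsub>A\<^esub> ?ev (cscale c (?b v))"
      by (rule A.lcomb_uminus_one[OF id k(2) k'])
    also have "?ev (cscale c (?b v)) = c \<odot>\<^bsub>A\<^esub> v"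
      using A.lcomb_scale[OF id k(1)] vx by simp
    finally have "?ev (?b (c \<odot>\<^bsub>A\<^esub> v) - cscale c (?b v)) = \<zero>\<^bsub>A\<^esub>"
      using vx by (simp add: A.diff_eq_zero_iff)
    then have d: "?b (c \<odot>\<^bsub>A\<^esub> v) - cscale c (?b v) \<in> N"
      unfolding N_def using keys_diff_subset[OF k(2) k'] by blast
    have "cspace.representation C (?b (c \<odot>\<^bsub>A\<^esub> v) - cscale c (?b v)) (?b x) = \<kappa> (c \<odot>\<^bsub>A\<^esub> v) x - c * \<kappa> v x"
      using vx spC cspace.span_scale[OF spC[OF vx(1)]]
      by (simp add: \<kappa>_def cspace.representation_diff[OF C(3)] cspace.representation_scale[OF C(3)] del: cscale_single)
    then show "\<kappa> (c \<odot>\<^bsub>A\<^esub> v) x = c * \<kappa> v x" using repN[OF d vx(2)] by simp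
  next
    fix x y assume xy: "x \<in> X" "y \<in> X"
    then have "basis_vec x \<in> C" by (simp add: X_def)
    moreover have "(basis_vec y :: 'a \<Rightarrow>\<^sub>0 complex) = basis_vec x \<longleftrightarrow> x = y"
      by (metis keys_single singleton_inject zero_neq_one)
    ultimately show "\<kappa> x y = (if x = y then 1 else 0)"
      by (simp add: \<kappa>_def cspace.representation_basis[OF C(3)])
  next
    fix v assume v: "v \<in> carrier A"
    define S where "S = {w. \<exists>p. Poly_Mapping.keys p \<subseteq> X \<and> w = ?ev p}"
    have idX: "(\<lambda>x. x) \<in> X \<rightarrow> carrier A" by (auto simp: X_def)
    have S_add: "u \<oplus>\<^bsub>A\<^esub> w \<in> S" if uS: "u \<in> S" "w \<in> S" for u w
    proof -
      obtain p q where "Poly_Mapping.keys p \<subseteq> X" "u = ?ev p" "Poly_Mapping.keys q \<subseteq> X" "w = ?ev q"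
        using uS by (auto simp: S_def)
      then show ?thesis unfolding S_def
        by (intro CollectI exI[of _ "p + q"]) (simp add: A.lcomb_add[OF idX] keys_add_subset)
    qed
    have S_scale: "c \<odot>\<^bsub>A\<^esub> u \<in> S" if uS: "u \<in> S" for c u
    proof -
      obtain p where "Poly_Mapping.keys p \<subseteq> X" "u = ?ev p" using uS by (auto simp: S_def)
      then show ?thesis unfolding S_def
        by (intro CollectI exI[of _ "cscale c p"]) (simp add: A.lcomb_scale[OF idX] order_trans[OF keys_cscale])
    qed
    have S0: "\<zero>\<^bsub>A\<^esub> \<in> S" unfolding S_def by (auto intro: exI[of _ 0])
    \<comment> \<open>Elements of \<open>B\<close> evaluate to zero and the remaining elements of
      \<open>C\<close> to members of \<open>X\<close>; hence evaluation of anything in the span of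
      \<open>C\<close> is a combination of \<open>X\<close>.\<close>
    have "cspace.subspace {p. Poly_Mapping.keys p \<subseteq> carrier A \<and> ?ev p \<in> S}"
      unfolding cspace.subspace_def using S0 S_add S_scale
      by (auto simp: A.lcomb_add[OF id] A.lcomb_scale[OF id]
          dest!: keys_cscale[THEN subsetD] keys_add[THEN subsetD])
    moreover have "C \<subseteq> {p. Poly_Mapping.keys p \<subseteq> carrier A \<and> ?ev p \<in> S}"
    proof
      fix b assume b: "b \<in> C"
      show "b \<in> {p. Poly_Mapping.keys p \<subseteq> carrier A \<and> ?ev p \<in> S}"
      proof (cases "b \<in> B")
        case True
        then show ?thesis using B(1) S0 by (auto simp: N_def)
      next
        case False
        then obtain a where a: "a \<in> carrier A" "b = basis_vec a" using b C(2) by auto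
        then have "a \<in> X" using b False by (simp add: X_def)
        then have "Poly_Mapping.keys (basis_vec a) \<subseteq> X" by simp
        then have "?ev (basis_vec a) \<in> S" unfolding S_def by blast
        then show ?thesis using a by simp
      qed
    qed
    ultimately have "cspace.span C \<subseteq> {p. Poly_Mapping.keys p \<subseteq> carrier A \<and> ?ev p \<in> S}"
      by (rule cspace.span_minimal[rotated])
    then have "?ev (basis_vec v) \<in> S" using spC[OF v] by blast
    then show "\<exists>p. Poly_Mapping.keys p \<subseteq> X \<and> v = ?ev p" using v by (simp add: S_def)
  qed
  then show ?thesis by (rule that)
qed

section \<open>Tensor products\<close>

text \<open>The part of the module axioms on which tensor products and contractions rest;
  \<open>vir_mod\<close> adds linearity in the Lie algebra element and the bracket relation.\<close>

definition lin_act :: "'v vmod \<Rightarrow> bool" where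
  "lin_act M \<longleftrightarrow> cmod M \<and> (\<forall>x. cmod_hom M M (act M x))"

lemma vir_module_lin_act: "vir_module M \<Longrightarrow> lin_act M"
  by (auto simp: lin_act_def vir_module_def cmod_def cmod_hom_def)

lemma cmod_one_dim: "cmod (one_dim \<mu>)"
proof (rule cmodI, rule moduleI)
  show "abelian_group (one_dim \<mu>)"
  proof (rule abelian_groupI)
    fix x :: complex
    show "\<exists>y\<in>carrier (one_dim \<mu>). y \<oplus>\<^bsub>one_dim \<mu>\<^esub> x = \<zero>\<^bsub>one_dim \<mu>\<^esub>"
      by (auto simp: one_dim_def intro: exI[of _ "- x"])
  qed (auto simp: one_dim_def algebra_simps)
qed (auto simp: one_dim_def cring_complex_ring algebra_simps)

lemma one_dim_simps [simp]:
  "carrier (one_dim \<mu>) = UNIV" "a \<oplus>\<^bsub>one_dim \<mu>\<^esub> b = a + b" "a \<odot>\<^bsub>one_dim \<mu>\<^esub> b = a * b"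
  "\<zero>\<^bsub>one_dim \<mu>\<^esub> = 0" "act (one_dim \<mu>) x a = \<mu> x * a"
  by (simp_all add: one_dim_def)

lemma (in presentation) presented_lin_act:
  assumes "\<And>x r. r \<in> R \<Longrightarrow> lin_ext (a x) r \<in> K" and "\<And>x g. g \<in> G \<Longrightarrow> Poly_Mapping.keys (a x g) \<subseteq> G"
  shows "lin_act (presented G R a)"
  unfolding lin_act_def cmod_hom_def
proof (intro conjI presented_cmod allI ballI funcsetI)
  fix x P assume "P \<in> carrier (presented G R a)"
  then obtain p where p: "P = cls p" "Poly_Mapping.keys p \<subseteq> G" by (auto simp: presented_sel)
  note ac = act_cls[where a = a and x = x, OF assms(1)]
  show "act (presented G R a) x P \<in> carrier (presented G R a)"
  proof -
    have "Poly_Mapping.keys (lin_ext (a x) p) \<subseteq> G"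
      by (rule keys_lin_ext) (use p(2) assms(2) in blast)
    then show ?thesis by (simp add: p ac)
  qed
  show "act (presented G R a) x (c \<odot>\<^bsub>presented G R a\<^esub> P) = c \<odot>\<^bsub>presented G R a\<^esub> act (presented G R a) x P" for c
    by (simp add: p ac presented_sel lin_ext_cscale)
  fix Q assume "Q \<in> carrier (presented G R a)"
  then obtain q where q: "Q = cls q" "Poly_Mapping.keys q \<subseteq> G" by (auto simp: presented_sel)
  show "act (presented G R a) x (P \<oplus>\<^bsub>presented G R a\<^esub> Q) =
      act (presented G R a) x P \<oplus>\<^bsub>presented G R a\<^esub> act (presented G R a) x Q"
    by (simp add: p q ac presented_sel lin_ext_add)
qed

locale lin_act_mod = cmod M for M :: "'v vmod" (structure) +
  assumes act_hom: "cmod_hom M M (act M x)"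
begin

lemma act_closed [simp, intro]: "v \<in> carrier M \<Longrightarrow> act M x v \<in> carrier M"
  using cmod_hom_closed[OF act_hom] .

lemma act_add: "u \<in> carrier M \<Longrightarrow> v \<in> carrier M \<Longrightarrow> act M x (u \<oplus> v) = act M x u \<oplus> act M x v"
  using cmod_hom_add[OF act_hom] .

lemma act_scale: "v \<in> carrier M \<Longrightarrow> act M x (c \<odot> v) = c \<odot> act M x v"
  using cmod_hom_scale[OF act_hom] .

lemma act_zero [simp]: "act M x \<zero> = \<zero>"
  using cmod_hom_zero[OF cmod cmod act_hom] .

end

lemma lin_act_mod: "lin_act M \<Longrightarrow> lin_act_mod M"
  by (simp add: lin_act_mod_def lin_act_mod_axioms_def lin_act_def)

section \<open>Bilinear relations\<close>

locale bilin = A: cmod A + B: cmod B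
  for A :: "(complex, 'a, 'm) module_scheme" and B :: "(complex, 'b, 'n) module_scheme"
begin

lemma rel_cases:
  assumes "r \<in> bilinear_relations A B"
    and "\<And>u u' v. u \<in> carrier A \<Longrightarrow> u' \<in> carrier A \<Longrightarrow> v \<in> carrier B \<Longrightarrow>
      Q (basis_vec (u \<oplus>\<^bsub>A\<^esub> u', v) - basis_vec (u, v) - basis_vec (u', v))"
    and "\<And>u v v'. u \<in> carrier A \<Longrightarrow> v \<in> carrier B \<Longrightarrow> v' \<in> carrier B \<Longrightarrow>
      Q (basis_vec (u, v \<oplus>\<^bsub>B\<^esub> v') - basis_vec (u, v) - basis_vec (u, v'))"
    and "\<And>c u v. u \<in> carrier A \<Longrightarrow> v \<in> carrier B \<Longrightarrow> Q (basis_vec (c \<odot>\<^bsub>A\<^esub> u, v) - cscale c (basis_vec (u, v)))"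
    and "\<And>c u v. u \<in> carrier A \<Longrightarrow> v \<in> carrier B \<Longrightarrow> Q (basis_vec (u, c \<odot>\<^bsub>B\<^esub> v) - cscale c (basis_vec (u, v)))"
  shows "Q r"
  using assms(1) unfolding bilinear_relations_def by safe (rule assms(2-5); assumption)+

lemma rel_supp: "r \<in> bilinear_relations A B \<Longrightarrow> Poly_Mapping.keys r \<subseteq> carrier A \<times> carrier B"
  by (erule rel_cases[where Q = "\<lambda>r. Poly_Mapping.keys r \<subseteq> carrier A \<times> carrier B"])
    (rule rel_add_supp rel_scale_supp; simp)+

lemma rel_lcomb:
  assumes "cmod N" and "\<And>u v. u \<in> carrier A \<Longrightarrow> v \<in> carrier B \<Longrightarrow> f (u, v) \<in> carrier N"
    and "\<And>u u' v. u \<in> carrier A \<Longrightarrow> u' \<in> carrier A \<Longrightarrow> v \<in> carrier B \<Longrightarrow> f (u \<oplus>\<^bsub>A\<^esub> u', v) = f (u, v) \<oplus>\<^bsub>N\<^esub> f (u', v)"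
    and "\<And>u v v'. u \<in> carrier A \<Longrightarrow> v \<in> carrier B \<Longrightarrow> v' \<in> carrier B \<Longrightarrow> f (u, v \<oplus>\<^bsub>B\<^esub> v') = f (u, v) \<oplus>\<^bsub>N\<^esub> f (u, v')"
    and "\<And>c u v. u \<in> carrier A \<Longrightarrow> v \<in> carrier B \<Longrightarrow> f (c \<odot>\<^bsub>A\<^esub> u, v) = c \<odot>\<^bsub>N\<^esub> f (u, v)"
    and "\<And>c u v. u \<in> carrier A \<Longrightarrow> v \<in> carrier B \<Longrightarrow> f (u, c \<odot>\<^bsub>B\<^esub> v) = c \<odot>\<^bsub>N\<^esub> f (u, v)"
    and "r \<in> bilinear_relations A B"
  shows "lcomb N f r = \<zero>\<^bsub>N\<^esub>"
proof -
  interpret N: cmod N by fact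
  let ?G = "carrier A \<times> carrier B"
  have f: "f \<in> ?G \<rightarrow> carrier N" using assms(2) by auto
  from assms(7) show ?thesis
    by (rule rel_cases[where Q = "\<lambda>r. lcomb N f r = \<zero>\<^bsub>N\<^esub>"]) (rule N.lcomb_rel_add[OF f] N.lcomb_rel_scale[OF f]; simp add: assms(3-6))+
qed

end

definition lin_closed :: "(complex, 'v, 'm) module_scheme \<Rightarrow> 'v set \<Rightarrow> bool" where
  "lin_closed N S \<longleftrightarrow> \<zero>\<^bsub>N\<^esub> \<in> S \<and> (\<forall>u\<in>S. \<forall>v\<in>S. u \<oplus>\<^bsub>N\<^esub> v \<in> S) \<and> (\<forall>c. \<forall>u\<in>S. c \<odot>\<^bsub>N\<^esub> u \<in> S)"

lemma (in cmod) lin_closed_lcombs: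
  assumes \<beta>: "\<beta> \<in> X \<rightarrow> carrier M"
  shows "lin_closed M {lcomb M \<beta> p | p. Poly_Mapping.keys p \<subseteq> X}"
  unfolding lin_closed_def
proof (intro conjI ballI allI)
  show "\<zero> \<in> {lcomb M \<beta> p |p. Poly_Mapping.keys p \<subseteq> X}"
    by (intro CollectI exI[of _ 0]) simp
  fix u c assume "u \<in> {lcomb M \<beta> p |p. Poly_Mapping.keys p \<subseteq> X}"
  then obtain p where p: "u = lcomb M \<beta> p" "Poly_Mapping.keys p \<subseteq> X" by auto
  show "c \<odot> u \<in> {lcomb M \<beta> p |p. Poly_Mapping.keys p \<subseteq> X}"
    using p by (intro CollectI exI[of _ "cscale c p"]) (simp add: lcomb_scale[OF \<beta>] order_trans[OF keys_cscale])
  fix v assume "v \<in> {lcomb M \<beta> p |p. Poly_Mapping.keys p \<subseteq> X}"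
  then obtain q where q: "v = lcomb M \<beta> q" "Poly_Mapping.keys q \<subseteq> X" by auto
  show "u \<oplus> v \<in> {lcomb M \<beta> p |p. Poly_Mapping.keys p \<subseteq> X}"
    using p q by (intro CollectI exI[of _ "p + q"]) (simp add: lcomb_add[OF \<beta>] keys_add_subset)
qed

text \<open>Applied to one tensor factor at a time, to show that products of basis vectors span a
  tensor product.\<close>

lemma coords_hom_in:
  assumes "cmod A" "cmod N" "coords A X \<beta> \<kappa>" "cmod_hom A N f" "lin_closed N S"
    and "\<And>x. x \<in> X \<Longrightarrow> f (\<beta> x) \<in> S" and "v \<in> carrier A"
  shows "f v \<in> S"
proof -
  interpret A: cmod A by fact
  obtain p where p: "Poly_Mapping.keys p \<subseteq> X" "v = lcomb A \<beta> p" using coords_span[OF assms(3,7)] .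
  have \<beta>: "\<beta> \<in> X \<rightarrow> carrier A" using assms(3) by (simp add: coords_def)
  from p(1) have "f (lcomb A \<beta> p) \<in> S"
  proof (induction rule: supported_induct)
    case zero
    then show ?case using cmod_hom_zero[OF assms(1,2,4)] assms(5) by (simp add: lin_closed_def)
  next
    case (basis g)
    then show ?case using assms(6) \<beta> by (simp add: Pi_iff)
  next
    case (add p q)
    then show ?case using assms(5) \<beta>
      by (simp add: A.lcomb_add[OF \<beta>] cmod_hom_add[OF assms(4)] lin_closed_def)
  next
    case (scale c p)
    then show ?case using assms(5) \<beta>
      by (simp add: A.lcomb_scale[OF \<beta>] cmod_hom_scale[OF assms(4)] lin_closed_def)
  qed
  then show ?thesis using p by simp
qed

section \<open>Local annihilation along a decreasing family\<close>

text \<open>In the applications \<open>J N\<close> consists of the elements of order at least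
  \<open>N\<close> at a point, or at several points at once. A single vector of the module does not
  notice elements of sufficiently high order there.\<close>

definition locally_killed :: "(nat \<Rightarrow> vir set) \<Rightarrow> 'v vmod \<Rightarrow> bool" where
  "locally_killed J A \<longleftrightarrow> (\<forall>v\<in>carrier A. \<exists>N. \<forall>x\<in>J N. act A x v = \<zero>\<^bsub>A\<^esub>)"

text \<open>Contractions intertwine the actions only from some stage on, and the stage depends on
  the vector. For a sum the larger of the two stages works because \<open>J\<close>
  decreases.\<close>

lemma intertwine_add:
  assumes "lin_act_mod T" "lin_act_mod A" "cmod_hom T A \<Phi>" "decseq J"
    and "y \<in> carrier T" "z \<in> carrier T"
    and "\<exists>N. \<forall>x\<in>J N. \<Phi> (act T x y) = act A x (\<Phi> y)" "\<exists>N. \<forall>x\<in>J N. \<Phi> (act T x z) = act A x (\<Phi> z)"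
  shows "\<exists>N. \<forall>x\<in>J N. \<Phi> (act T x (y \<oplus>\<^bsub>T\<^esub> z)) = act A x (\<Phi> (y \<oplus>\<^bsub>T\<^esub> z))"
proof -
  interpret T: lin_act_mod T by fact
  interpret A: lin_act_mod A by fact
  obtain N N' where N: "\<forall>x\<in>J N. \<Phi> (act T x y) = act A x (\<Phi> y)" "\<forall>x\<in>J N'. \<Phi> (act T x z) = act A x (\<Phi> z)"
    using assms(7,8) by blast
  have m: "x \<in> J N" "x \<in> J N'" if "x \<in> J (max N N')" for x
    using that decseqD[OF assms(4), of N "max N N'"] decseqD[OF assms(4), of N' "max N N'"] by auto
  show ?thesis
    by (rule exI[of _ "max N N'"])
      (use N assms(5,6) m in \<open>simp add: T.act_add cmod_hom_add[OF assms(3)] A.act_add cmod_hom_closed[OF assms(3)]\<close>)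
qed

lemma intertwine_scale:
  assumes "lin_act_mod T" "lin_act_mod A" "cmod_hom T A \<Phi>"
    and "z \<in> carrier T" "\<exists>N. \<forall>x\<in>J N. \<Phi> (act T x z) = act A x (\<Phi> z)"
  shows "\<exists>N. \<forall>x\<in>J N. \<Phi> (act T x (c \<odot>\<^bsub>T\<^esub> z)) = act A x (\<Phi> (c \<odot>\<^bsub>T\<^esub> z))"
proof -
  interpret T: lin_act_mod T by fact
  interpret A: lin_act_mod A by fact
  obtain N where N: "\<forall>x\<in>J N. \<Phi> (act T x z) = act A x (\<Phi> z)"
    using assms(5) by blast
  show ?thesis
    by (rule exI[of _ N])
      (use N assms(4) in \<open>simp add: T.act_scale cmod_hom_scale[OF assms(3)] A.act_scale cmod_hom_closed[OF assms(3)]\<close>)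
qed

section \<open>The tensor product of two modules\<close>

locale tensor_pair = A: lin_act_mod A + B: lin_act_mod B
  for A :: "'a vmod" and B :: "'b vmod"
begin

sublocale bilin A B ..

sublocale presentation "carrier A \<times> carrier B" "bilinear_relations A B"
  by unfold_locales (rule rel_supp)

definition tens :: "'a \<Rightarrow> 'b \<Rightarrow> ('a \<times> 'b \<Rightarrow>\<^sub>0 complex) set" where
  "tens u v = cls (basis_vec (u, v))"

lemma K_add_left: "u \<in> carrier A \<Longrightarrow> u' \<in> carrier A \<Longrightarrow> v \<in> carrier B \<Longrightarrow>
    basis_vec (u \<oplus>\<^bsub>A\<^esub> u', v) - basis_vec (u, v) - basis_vec (u', v) \<in> K"
  by (rule cspace.span_base) (auto simp: bilinear_relations_def)

lemma K_add_right: "u \<in> carrier A \<Longrightarrow> v \<in> carrier B \<Longrightarrow> v' \<in> carrier B \<Longrightarrow>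
    basis_vec (u, v \<oplus>\<^bsub>B\<^esub> v') - basis_vec (u, v) - basis_vec (u, v') \<in> K"
  by (rule cspace.span_base) (auto simp: bilinear_relations_def)

lemma K_scale_left: "u \<in> carrier A \<Longrightarrow> v \<in> carrier B \<Longrightarrow>
    basis_vec (c \<odot>\<^bsub>A\<^esub> u, v) - cscale c (basis_vec (u, v)) \<in> K"
  by (rule cspace.span_base) (auto simp: bilinear_relations_def)

lemma K_scale_right: "u \<in> carrier A \<Longrightarrow> v \<in> carrier B \<Longrightarrow>
    basis_vec (u, c \<odot>\<^bsub>B\<^esub> v) - cscale c (basis_vec (u, v)) \<in> K"
  by (rule cspace.span_base) (auto simp: bilinear_relations_def)

abbreviation "act_gen \<equiv> \<lambda>x (u, v). basis_vec (act A x u, v) + basis_vec (u, act B x v) :: ('a \<times> 'b) \<Rightarrow>\<^sub>0 complex"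

text \<open>By the Leibniz rule the image of a relation is the sum of two relations of the same
  kind, one for each factor on which \<open>x\<close> acts.\<close>

lemma act_rel:
  assumes "r \<in> bilinear_relations A B"
  shows "lin_ext (act_gen x) r \<in> K"
  using assms
proof (rule rel_cases[where Q = "\<lambda>r. lin_ext (act_gen x) r \<in> K"])
  fix u u' v assume *: "u \<in> carrier A" "u' \<in> carrier A" "v \<in> carrier B"
  show "lin_ext (act_gen x) (basis_vec (u \<oplus>\<^bsub>A\<^esub> u', v) - basis_vec (u, v) - basis_vec (u', v)) \<in> K"
    using cspace.span_add[OF K_add_left[of "act A x u" "act A x u'" v] K_add_left[of u u' "act B x v"]] *
    by (simp add: lin_ext_diff lin_ext_add A.act_add algebra_simps)
next
  fix u v v' assume *: "u \<in> carrier A" "v \<in> carrier B" "v' \<in> carrier B"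
  show "lin_ext (act_gen x) (basis_vec (u, v \<oplus>\<^bsub>B\<^esub> v') - basis_vec (u, v) - basis_vec (u, v')) \<in> K"
    using cspace.span_add[OF K_add_right[of "act A x u" v v'] K_add_right[of u "act B x v" "act B x v'"]] *
    by (simp add: lin_ext_diff lin_ext_add B.act_add algebra_simps)
next
  fix c u v assume *: "u \<in> carrier A" "v \<in> carrier B"
  show "lin_ext (act_gen x) (basis_vec (c \<odot>\<^bsub>A\<^esub> u, v) - cscale c (basis_vec (u, v))) \<in> K"
    using cspace.span_add[OF K_scale_left[of "act A x u" v c] K_scale_left[of u "act B x v" c]] *
    by (simp add: lin_ext_diff lin_ext_cscale A.act_scale algebra_simps cspace.scale_right_distrib del: cscale_single)
  show "lin_ext (act_gen x) (basis_vec (u, c \<odot>\<^bsub>B\<^esub> v) - cscale c (basis_vec (u, v))) \<in> K"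
    using cspace.span_add[OF K_scale_right[of "act A x u" v c] K_scale_right[of u "act B x v" c]] *
    by (simp add: lin_ext_diff lin_ext_cscale B.act_scale algebra_simps cspace.scale_right_distrib del: cscale_single)
qed

lemma tensor_eq: "A \<otimes>\<^sub>V B = presented (carrier A \<times> carrier B) (bilinear_relations A B) act_gen"
  by (simp add: tensor_def)

lemma tensor_lin_act: "lin_act (A \<otimes>\<^sub>V B)"
  unfolding tensor_eq
proof (rule presented_lin_act)
  show "r \<in> bilinear_relations A B \<Longrightarrow> lin_ext (act_gen x) r \<in> K" for x r by (rule act_rel)
  show "g \<in> carrier A \<times> carrier B \<Longrightarrow> Poly_Mapping.keys (act_gen x g) \<subseteq> carrier A \<times> carrier B" for x g
    by (auto dest!: keys_add[THEN subsetD])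
qed

sublocale T: lin_act_mod "A \<otimes>\<^sub>V B"
  by (rule lin_act_mod[OF tensor_lin_act])

lemma tens_closed [simp, intro]: "u \<in> carrier A \<Longrightarrow> v \<in> carrier B \<Longrightarrow> tens u v \<in> carrier (A \<otimes>\<^sub>V B)"
  unfolding tensor_eq tens_def by auto

lemma tens_add_left: "u \<in> carrier A \<Longrightarrow> u' \<in> carrier A \<Longrightarrow> v \<in> carrier B \<Longrightarrow>
    tens (u \<oplus>\<^bsub>A\<^esub> u') v = tens u v \<oplus>\<^bsub>A \<otimes>\<^sub>V B\<^esub> tens u' v"
  using K_add_left by (simp add: tens_def tensor_eq presented_sel cls_eq_iff diff_diff_eq)

lemma tens_add_right: "u \<in> carrier A \<Longrightarrow> v \<in> carrier B \<Longrightarrow> v' \<in> carrier B \<Longrightarrow>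
    tens u (v \<oplus>\<^bsub>B\<^esub> v') = tens u v \<oplus>\<^bsub>A \<otimes>\<^sub>V B\<^esub> tens u v'"
  using K_add_right by (simp add: tens_def tensor_eq presented_sel cls_eq_iff diff_diff_eq)

lemma tens_scale_left: "u \<in> carrier A \<Longrightarrow> v \<in> carrier B \<Longrightarrow>
    tens (c \<odot>\<^bsub>A\<^esub> u) v = c \<odot>\<^bsub>A \<otimes>\<^sub>V B\<^esub> tens u v"
  using K_scale_left by (simp add: tens_def tensor_eq presented_sel cls_eq_iff del: cscale_single)

lemma tens_scale_right: "u \<in> carrier A \<Longrightarrow> v \<in> carrier B \<Longrightarrow>
    tens u (c \<odot>\<^bsub>B\<^esub> v) = c \<odot>\<^bsub>A \<otimes>\<^sub>V B\<^esub> tens u v"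
  using K_scale_right by (simp add: tens_def tensor_eq presented_sel cls_eq_iff del: cscale_single)

lemma tens_hom_left: "v \<in> carrier B \<Longrightarrow> cmod_hom A (A \<otimes>\<^sub>V B) (\<lambda>u. tens u v)"
  by (auto simp: cmod_hom_def tens_add_left tens_scale_left)

lemma tens_hom_right: "u \<in> carrier A \<Longrightarrow> cmod_hom B (A \<otimes>\<^sub>V B) (tens u)"
  by (auto simp: cmod_hom_def tens_add_right tens_scale_right)

lemma tens_zero_left [simp]: "v \<in> carrier B \<Longrightarrow> tens \<zero>\<^bsub>A\<^esub> v = \<zero>\<^bsub>A \<otimes>\<^sub>V B\<^esub>"
  using cmod_hom_zero[OF A.cmod T.cmod tens_hom_left] .

lemma tens_zero_right [simp]: "u \<in> carrier A \<Longrightarrow> tens u \<zero>\<^bsub>B\<^esub> = \<zero>\<^bsub>A \<otimes>\<^sub>V B\<^esub>"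
  using cmod_hom_zero[OF B.cmod T.cmod tens_hom_right] .

lemma act_tens: "act (A \<otimes>\<^sub>V B) x (tens u v) = tens (act A x u) v \<oplus>\<^bsub>A \<otimes>\<^sub>V B\<^esub> tens u (act B x v)"
  unfolding tensor_eq tens_def by (simp add: act_cls[OF act_rel] presented_sel)

lemma tens_induct [consumes 1, case_names tens add scale]:
  assumes "y \<in> carrier (A \<otimes>\<^sub>V B)" and "\<And>u v. u \<in> carrier A \<Longrightarrow> v \<in> carrier B \<Longrightarrow> Q (tens u v)"
    and "\<And>x y. x \<in> carrier (A \<otimes>\<^sub>V B) \<Longrightarrow> y \<in> carrier (A \<otimes>\<^sub>V B) \<Longrightarrow> Q x \<Longrightarrow> Q y \<Longrightarrow> Q (x \<oplus>\<^bsub>A \<otimes>\<^sub>V B\<^esub> y)"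
    and "\<And>c x. x \<in> carrier (A \<otimes>\<^sub>V B) \<Longrightarrow> Q x \<Longrightarrow> Q (c \<odot>\<^bsub>A \<otimes>\<^sub>V B\<^esub> x)"
  shows "Q y"
  using assms(1) unfolding tensor_eq
proof (induction rule: presented_induct)
  case (gen g)
  then show ?case using assms(2) by (auto simp: tens_def)
next
  case (add x y) then show ?case using assms(3) unfolding tensor_eq by blast
next
  case (scale c x) then show ?case using assms(4) unfolding tensor_eq by blast
next
  show "carrier A \<times> carrier B \<noteq> {}" using A.zero_closed B.zero_closed by blast
qed

lemma tens_lift:
  assumes "cmod N" and "\<And>u v. u \<in> carrier A \<Longrightarrow> v \<in> carrier B \<Longrightarrow> f u v \<in> carrier N"
    and "\<And>u u' v. u \<in> carrier A \<Longrightarrow> u' \<in> carrier A \<Longrightarrow> v \<in> carrier B \<Longrightarrow> f (u \<oplus>\<^bsub>A\<^esub> u') v = f u v \<oplus>\<^bsub>N\<^esub> f u' v"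
    and "\<And>u v v'. u \<in> carrier A \<Longrightarrow> v \<in> carrier B \<Longrightarrow> v' \<in> carrier B \<Longrightarrow> f u (v \<oplus>\<^bsub>B\<^esub> v') = f u v \<oplus>\<^bsub>N\<^esub> f u v'"
    and "\<And>c u v. u \<in> carrier A \<Longrightarrow> v \<in> carrier B \<Longrightarrow> f (c \<odot>\<^bsub>A\<^esub> u) v = c \<odot>\<^bsub>N\<^esub> f u v"
    and "\<And>c u v. u \<in> carrier A \<Longrightarrow> v \<in> carrier B \<Longrightarrow> f u (c \<odot>\<^bsub>B\<^esub> v) = c \<odot>\<^bsub>N\<^esub> f u v"
  obtains \<Phi> where "cmod_hom (A \<otimes>\<^sub>V B) N \<Phi>"
    and "\<And>u v. u \<in> carrier A \<Longrightarrow> v \<in> carrier B \<Longrightarrow> \<Phi> (tens u v) = f u v"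
proof -
  interpret N: cmod N by fact
  let ?f = "case_prod f"
  have rel: "lcomb N ?f r = \<zero>\<^bsub>N\<^esub>" if "r \<in> bilinear_relations A B" for r
    by (rule rel_lcomb[OF assms(1) _ _ _ _ _ that]) (use assms in auto)
  have f: "?f \<in> carrier A \<times> carrier B \<rightarrow> carrier N" using assms(2) by auto
  have "lift N ?f (tens u v) = f u v" if "u \<in> carrier A" "v \<in> carrier B" for u v
    using lift_cls[OF assms(1) f rel, of "basis_vec (u, v)"] assms(2)[OF that] that
    by (simp add: tens_def)
  moreover have "cmod_hom (A \<otimes>\<^sub>V B) N (lift N ?f)"
    unfolding tensor_eq by (rule lift_hom[OF assms(1) f rel])
  ultimately show ?thesis using that by blast
qed

text \<open>A product of two coordinate functions is bilinear, so it descends to the tensor product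
  and yields the dual family. Spanning is obtained by replacing first one factor and then the other
  by arbitrary vectors.\<close>

lemma tens_coords:
  assumes X: "coords A X \<beta> \<kappa>" and Y: "coords B Y \<beta>' \<kappa>'"
  obtains \<chi> where "coords (A \<otimes>\<^sub>V B) (X \<times> Y) (\<lambda>(x, y). tens (\<beta> x) (\<beta>' y)) \<chi>"
    and "\<And>u v x y. u \<in> carrier A \<Longrightarrow> v \<in> carrier B \<Longrightarrow> x \<in> X \<Longrightarrow> y \<in> Y \<Longrightarrow> \<chi> (tens u v) (x, y) = \<kappa> u x * \<kappa>' v y"
proof -
  \<comment> \<open>The one-dimensional module of the zero character plays the scalars, so that
    functionals are maps into a \<open>cmod\<close>.\<close>
  let ?C = "one_dim (\<lambda>_. 0)"
  have ex: "\<exists>\<Phi>. cmod_hom (A \<otimes>\<^sub>V B) ?C \<Phi> \<and> (\<forall>u\<in>carrier A. \<forall>v\<in>carrier B. \<Phi> (tens u v) = \<kappa> u x * \<kappa>' v y)"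
    if "x \<in> X" "y \<in> Y" for x y
  proof (rule tens_lift[of ?C "\<lambda>u v. \<kappa> u x * \<kappa>' v y"])
    show "cmod ?C" by (rule cmod_one_dim)
  qed (use that in \<open>auto simp: coords_add[OF X] coords_add[OF Y] coords_scale[OF X] coords_scale[OF Y] algebra_simps\<close>)
  define \<chi> where "\<chi> P xy = (SOME \<Phi>. cmod_hom (A \<otimes>\<^sub>V B) ?C \<Phi> \<and>
      (\<forall>u\<in>carrier A. \<forall>v\<in>carrier B. \<Phi> (tens u v) = \<kappa> u (fst xy) * \<kappa>' v (snd xy))) P" for P xy
  have \<chi>: "cmod_hom (A \<otimes>\<^sub>V B) ?C (\<lambda>P. \<chi> P (x, y))"
    "\<forall>u\<in>carrier A. \<forall>v\<in>carrier B. \<chi> (tens u v) (x, y) = \<kappa> u x * \<kappa>' v y"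
    if "x \<in> X" "y \<in> Y" for x y
    using someI_ex[OF ex[OF that]] unfolding \<chi>_def by simp_all
  let ?\<beta> = "\<lambda>(x, y). tens (\<beta> x) (\<beta>' y)"
  have \<beta>: "?\<beta> \<in> X \<times> Y \<rightarrow> carrier (A \<otimes>\<^sub>V B)"
    by (auto simp: coords_closed[OF X] coords_closed[OF Y])
  let ?S = "{lcomb (A \<otimes>\<^sub>V B) ?\<beta> p | p. Poly_Mapping.keys p \<subseteq> X \<times> Y}"
  have S: "lin_closed (A \<otimes>\<^sub>V B) ?S" by (rule T.lin_closed_lcombs[OF \<beta>])
  have b: "tens (\<beta> x) (\<beta>' y) \<in> ?S" if "x \<in> X" "y \<in> Y" for x y
    by (intro CollectI exI[of _ "basis_vec (x, y)"])
      (use that in \<open>simp add: coords_closed[OF X] coords_closed[OF Y]\<close>)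
  have b2: "tens (\<beta> x) v \<in> ?S" if "x \<in> X" "v \<in> carrier B" for x v
    using coords_hom_in[OF B.cmod T.cmod Y tens_hom_right S b that(2)] that(1) coords_closed[OF X] by blast
  have b3: "tens u v \<in> ?S" if "u \<in> carrier A" "v \<in> carrier B" for u v
    using coords_hom_in[OF A.cmod T.cmod X tens_hom_left S b2 that(1)] that(2) by blast
  have sp: "P \<in> ?S" if "P \<in> carrier (A \<otimes>\<^sub>V B)" for P
    using that by (induction rule: tens_induct) (use b3 S in \<open>auto simp: lin_closed_def\<close>)
  have "coords (A \<otimes>\<^sub>V B) (X \<times> Y) ?\<beta> \<chi>"
    unfolding coords_def
  proof (intro conjI \<beta> allI ballI)
    fix xy assume xy: "xy \<in> X \<times> Y"
    fix u assume u: "u \<in> carrier (A \<otimes>\<^sub>V B)"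
    show "\<chi> (c \<odot>\<^bsub>A \<otimes>\<^sub>V B\<^esub> u) xy = c * \<chi> u xy" for c
      using cmod_hom_scale[OF \<chi>(1) u] xy by auto
    fix v assume v: "v \<in> carrier (A \<otimes>\<^sub>V B)"
    show "\<chi> (u \<oplus>\<^bsub>A \<otimes>\<^sub>V B\<^esub> v) xy = \<chi> u xy + \<chi> v xy"
      using cmod_hom_add[OF \<chi>(1) u v] xy by auto
  next
    fix a b assume "a \<in> X \<times> Y" "b \<in> X \<times> Y"
    then show "\<chi> (?\<beta> a) b = (if a = b then 1 else 0)"
      using \<chi>(2) by (auto simp: coords_closed[OF X] coords_closed[OF Y] coords_basis[OF X] coords_basis[OF Y]
          split: if_splits)
  next
    fix v assume "v \<in> carrier (A \<otimes>\<^sub>V B)"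
    then show "\<exists>p. Poly_Mapping.keys p \<subseteq> X \<times> Y \<and> v = lcomb (A \<otimes>\<^sub>V B) ?\<beta> p" using sp by auto
  qed
  then show ?thesis by (rule that) (use \<chi>(2) in auto)
qed

text \<open>Coordinates of a pure tensor are products of coordinates of its factors, and a nonzero
  one can be chosen in each factor.\<close>

lemma tens_nonzero:
  assumes "u \<in> carrier A" "u \<noteq> \<zero>\<^bsub>A\<^esub>" "v \<in> carrier B" "v \<noteq> \<zero>\<^bsub>B\<^esub>"
  shows "tens u v \<noteq> \<zero>\<^bsub>A \<otimes>\<^sub>V B\<^esub>"
proof
  assume 0: "tens u v = \<zero>\<^bsub>A \<otimes>\<^sub>V B\<^esub>"
  obtain X \<kappa> where X: "coords A X (\<lambda>x. x) \<kappa>" using coords_exist[OF A.cmod] .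
  obtain Y \<kappa>' where Y: "coords B Y (\<lambda>x. x) \<kappa>'" using coords_exist[OF B.cmod] .
  obtain x where x: "x \<in> X" "\<kappa> u x \<noteq> 0" using coords_nonzero[OF A.cmod X assms(1,2)] .
  obtain y where y: "y \<in> Y" "\<kappa>' v y \<noteq> 0" using coords_nonzero[OF B.cmod Y assms(3,4)] .
  obtain \<chi> where \<chi>: "coords (A \<otimes>\<^sub>V B) (X \<times> Y) (\<lambda>(x, y). tens x y) \<chi>"
    "\<And>u v x y. u \<in> carrier A \<Longrightarrow> v \<in> carrier B \<Longrightarrow> x \<in> X \<Longrightarrow> y \<in> Y \<Longrightarrow> \<chi> (tens u v) (x, y) = \<kappa> u x * \<kappa>' v y"
    using tens_coords[OF X Y] by blast
  have "\<chi> (0 \<odot>\<^bsub>A \<otimes>\<^sub>V B\<^esub> tens u v) (x, y) = 0"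
    using coords_scale[OF \<chi>(1), of "tens u v" "(x, y)" 0] assms x y by auto
  then have "\<chi> (tens u v) (x, y) = 0" using 0 by simp
  then show False using \<chi>(2) assms x y by simp
qed

text \<open>Pairing \<open>B\<close> with a coordinate function is not a homomorphism. But if
  \<open>x\<close> kills all components in \<open>B\<close> that occur in \<open>z\<close>, only the
  summand of the Leibniz rule acting on \<open>A\<close> survives, and this summand passes through
  the pairing.\<close>

lemma contract_right:
  assumes y: "y \<in> carrier (A \<otimes>\<^sub>V B)" "y \<noteq> \<zero>\<^bsub>A \<otimes>\<^sub>V B\<^esub>"
    and J: "locally_killed J B" "decseq J"
  shows "\<exists>\<Phi>. cmod_hom (A \<otimes>\<^sub>V B) A \<Phi> \<and> \<Phi> y \<noteq> \<zero>\<^bsub>A\<^esub> \<and>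
    (\<forall>z\<in>carrier (A \<otimes>\<^sub>V B). \<exists>N. \<forall>x\<in>J N. \<Phi> (act (A \<otimes>\<^sub>V B) x z) = act A x (\<Phi> z))"
proof -
  obtain X \<kappa> where X: "coords A X (\<lambda>x. x) \<kappa>" using coords_exist[OF A.cmod] .
  obtain Y \<kappa>' where Y: "coords B Y (\<lambda>x. x) \<kappa>'" using coords_exist[OF B.cmod] .
  obtain \<chi> where \<chi>: "coords (A \<otimes>\<^sub>V B) (X \<times> Y) (\<lambda>(x, y). tens x y) \<chi>"
    "\<And>u v x y. u \<in> carrier A \<Longrightarrow> v \<in> carrier B \<Longrightarrow> x \<in> X \<Longrightarrow> y \<in> Y \<Longrightarrow> \<chi> (tens u v) (x, y) = \<kappa> u x * \<kappa>' v y"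
    using tens_coords[OF X Y] by blast
  obtain ab where "ab \<in> X \<times> Y" "\<chi> y ab \<noteq> 0"
    using coords_nonzero[OF T.cmod \<chi>(1) y] .
  then obtain a b where ab: "a \<in> X" "b \<in> Y" "\<chi> y (a, b) \<noteq> 0" by auto
  obtain \<Phi> where \<Phi>: "cmod_hom (A \<otimes>\<^sub>V B) A \<Phi>"
    "\<And>u v. u \<in> carrier A \<Longrightarrow> v \<in> carrier B \<Longrightarrow> \<Phi> (tens u v) = \<kappa>' v b \<odot>\<^bsub>A\<^esub> u"
  proof (rule tens_lift[of A "\<lambda>u v. \<kappa>' v b \<odot>\<^bsub>A\<^esub> u"])
  qed (use ab in \<open>auto simp: A.cmod A.sm_add_left A.sm_add_right A.sm_sm coords_add[OF Y] coords_scale[OF Y] mult.commute\<close>)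
  \<comment> \<open>The coordinate at \<open>(a, b)\<close> factors through the contraction; as it
    is nonzero on \<open>y\<close>, so is the contraction of \<open>y\<close>.\<close>
  have "\<kappa> (\<Phi> z) a = \<chi> z (a, b)" if "z \<in> carrier (A \<otimes>\<^sub>V B)" for z
    using that
    by (induction rule: tens_induct)
      (use ab in \<open>simp_all add: \<Phi>(2) \<chi>(2) coords_scale[OF X] coords_add[OF X] coords_scale[OF \<chi>(1)] coords_add[OF \<chi>(1)]
        cmod_hom_closed[OF \<Phi>(1)] cmod_hom_add[OF \<Phi>(1)] cmod_hom_scale[OF \<Phi>(1)]\<close>)
  from this[OF y(1)] have nz: "\<Phi> y \<noteq> \<zero>\<^bsub>A\<^esub>"
    using ab coords_scale[OF X A.zero_closed ab(1), of 0] by auto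
  have "\<exists>N. \<forall>x\<in>J N. \<Phi> (act (A \<otimes>\<^sub>V B) x z) = act A x (\<Phi> z)" if "z \<in> carrier (A \<otimes>\<^sub>V B)" for z
    using that
  proof (induction rule: tens_induct)
    case (tens u v)
    obtain N where N: "\<forall>x\<in>J N. act B x v = \<zero>\<^bsub>B\<^esub>" using J(1) tens by (auto simp: locally_killed_def)
    show ?case
      by (rule exI[of _ N]) (use N tens in \<open>simp add: act_tens cmod_hom_add[OF \<Phi>(1)] \<Phi>(2) A.act_scale\<close>)
  next
    case (add y z)
    then show ?case by (intro intertwine_add[OF T.lin_act_mod_axioms A.lin_act_mod_axioms \<Phi>(1) J(2)])
  next
    case (scale c z)
    then show ?case by (intro intertwine_scale[OF T.lin_act_mod_axioms A.lin_act_mod_axioms \<Phi>(1)])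
  qed
  with \<Phi>(1) nz show ?thesis by (intro exI[of _ \<Phi>] conjI ballI)
qed

text \<open>Mirror image of \<open>contract_right\<close>, with an exact clause for elements that
  act as zero on all of \<open>A\<close>. That clause is for the central element, which lies in no
  \<open>order_filt\<close>.\<close>

lemma contract_left:
  assumes y: "y \<in> carrier (A \<otimes>\<^sub>V B)" "y \<noteq> \<zero>\<^bsub>A \<otimes>\<^sub>V B\<^esub>"
    and J: "locally_killed J A" "decseq J"
  shows "\<exists>\<Phi>. cmod_hom (A \<otimes>\<^sub>V B) B \<Phi> \<and> \<Phi> y \<noteq> \<zero>\<^bsub>B\<^esub> \<and>
    (\<forall>z\<in>carrier (A \<otimes>\<^sub>V B). \<exists>N. \<forall>x\<in>J N. \<Phi> (act (A \<otimes>\<^sub>V B) x z) = act B x (\<Phi> z)) \<and>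
    (\<forall>x. (\<forall>u\<in>carrier A. act A x u = \<zero>\<^bsub>A\<^esub>) \<longrightarrow>
      (\<forall>z\<in>carrier (A \<otimes>\<^sub>V B). \<Phi> (act (A \<otimes>\<^sub>V B) x z) = act B x (\<Phi> z)))"
proof -
  obtain X \<kappa> where X: "coords A X (\<lambda>x. x) \<kappa>" using coords_exist[OF A.cmod] .
  obtain Y \<kappa>' where Y: "coords B Y (\<lambda>x. x) \<kappa>'" using coords_exist[OF B.cmod] .
  obtain \<chi> where \<chi>: "coords (A \<otimes>\<^sub>V B) (X \<times> Y) (\<lambda>(x, y). tens x y) \<chi>"
    "\<And>u v x y. u \<in> carrier A \<Longrightarrow> v \<in> carrier B \<Longrightarrow> x \<in> X \<Longrightarrow> y \<in> Y \<Longrightarrow> \<chi> (tens u v) (x, y) = \<kappa> u x * \<kappa>' v y"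
    using tens_coords[OF X Y] by blast
  obtain ab where "ab \<in> X \<times> Y" "\<chi> y ab \<noteq> 0"
    using coords_nonzero[OF T.cmod \<chi>(1) y] .
  then obtain a b where ab: "a \<in> X" "b \<in> Y" "\<chi> y (a, b) \<noteq> 0" by auto
  obtain \<Phi> where \<Phi>: "cmod_hom (A \<otimes>\<^sub>V B) B \<Phi>"
    "\<And>u v. u \<in> carrier A \<Longrightarrow> v \<in> carrier B \<Longrightarrow> \<Phi> (tens u v) = \<kappa> u a \<odot>\<^bsub>B\<^esub> v"
  proof (rule tens_lift[of B "\<lambda>u v. \<kappa> u a \<odot>\<^bsub>B\<^esub> v"])
  qed (use ab in \<open>auto simp: B.cmod B.sm_add_left B.sm_add_right B.sm_sm coords_add[OF X] coords_scale[OF X] mult.commute\<close>)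
  have "\<kappa>' (\<Phi> z) b = \<chi> z (a, b)" if "z \<in> carrier (A \<otimes>\<^sub>V B)" for z
    using that
    by (induction rule: tens_induct)
      (use ab in \<open>simp_all add: \<Phi>(2) \<chi>(2) coords_scale[OF Y] coords_add[OF Y] coords_scale[OF \<chi>(1)] coords_add[OF \<chi>(1)]
        cmod_hom_closed[OF \<Phi>(1)] cmod_hom_add[OF \<Phi>(1)] cmod_hom_scale[OF \<Phi>(1)]\<close>)
  from this[OF y(1)] have nz: "\<Phi> y \<noteq> \<zero>\<^bsub>B\<^esub>"
    using ab coords_scale[OF Y B.zero_closed ab(2), of 0] by auto
  have 1: "\<exists>N. \<forall>x\<in>J N. \<Phi> (act (A \<otimes>\<^sub>V B) x z) = act B x (\<Phi> z)" if "z \<in> carrier (A \<otimes>\<^sub>V B)" for z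
    using that
  proof (induction rule: tens_induct)
    case (tens u v)
    obtain N where N: "\<forall>x\<in>J N. act A x u = \<zero>\<^bsub>A\<^esub>" using J(1) tens by (auto simp: locally_killed_def)
    show ?case
      by (rule exI[of _ N]) (use N tens in \<open>simp add: act_tens cmod_hom_add[OF \<Phi>(1)] \<Phi>(2) B.act_scale\<close>)
  next
    case (add y z)
    then show ?case by (intro intertwine_add[OF T.lin_act_mod_axioms B.lin_act_mod_axioms \<Phi>(1) J(2)])
  next
    case (scale c z)
    then show ?case by (intro intertwine_scale[OF T.lin_act_mod_axioms B.lin_act_mod_axioms \<Phi>(1)])
  qed
  have 2: "\<forall>z\<in>carrier (A \<otimes>\<^sub>V B). \<Phi> (act (A \<otimes>\<^sub>V B) x z) = act B x (\<Phi> z)"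
    if x: "\<forall>u\<in>carrier A. act A x u = \<zero>\<^bsub>A\<^esub>" for x
  proof
    fix z assume "z \<in> carrier (A \<otimes>\<^sub>V B)"
    then show "\<Phi> (act (A \<otimes>\<^sub>V B) x z) = act B x (\<Phi> z)"
    proof (induction rule: tens_induct)
      case (tens u v)
      then show ?case by (simp add: x act_tens cmod_hom_add[OF \<Phi>(1)] \<Phi>(2) B.act_scale)
    next
      case (add x y)
      then show ?case by (simp add: T.act_add cmod_hom_add[OF \<Phi>(1)] B.act_add cmod_hom_closed[OF \<Phi>(1)])
    next
      case (scale c x)
      then show ?case by (simp add: T.act_scale cmod_hom_scale[OF \<Phi>(1)] B.act_scale cmod_hom_closed[OF \<Phi>(1)])
    qed
  qed
  show ?thesis by (intro exI[of _ \<Phi>] conjI allI impI \<Phi>(1) nz ballI[OF 1] 2)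
qed

end

section \<open>Tensor products of finite families\<close>

lemma decseq_INT:
  fixes J :: "'i \<Rightarrow> nat \<Rightarrow> 'x set"
  assumes "\<And>i. i \<in> I \<Longrightarrow> decseq (J i)"
  shows "decseq (\<lambda>N. \<Inter>i\<in>I. J i N)"
  unfolding decseq_def
proof (intro allI impI INT_greatest subsetI)
  fix N N' :: nat and x i assume "N \<le> N'" "x \<in> (\<Inter>i\<in>I. J i N')" "i \<in> I"
  then show "x \<in> J i N" using decseqD[OF assms[of i], of N N'] by auto
qed

locale tensor_fam =
  fixes I :: "'i set" and M :: "'i \<Rightarrow> 'a vmod"
  assumes fin: "finite I" and lin_acts: "i \<in> I \<Longrightarrow> lin_act_mod (M i)"
begin

abbreviation "P \<equiv> \<Pi>\<^sub>E i\<in>I. carrier (M i)"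

lemma cm: "i \<in> I \<Longrightarrow> cmod (M i)"
  using lin_acts lin_act_mod.axioms(1) by blast

lemma in_P: "m \<in> P \<Longrightarrow> i \<in> I \<Longrightarrow> m i \<in> carrier (M i)"
  by auto

lemma upd_P: "m \<in> P \<Longrightarrow> i \<in> I \<Longrightarrow> u \<in> carrier (M i) \<Longrightarrow> m(i := u) \<in> P"
  by (auto simp: PiE_def extensional_def)

lemma zero_P: "(\<lambda>i\<in>I. \<zero>\<^bsub>M i\<^esub>) \<in> P"
proof -
  have "\<zero>\<^bsub>M i\<^esub> \<in> carrier (M i)" if "i \<in> I" for i
  proof -
    interpret Mi: cmod "M i" by (rule cm[OF that])
    show ?thesis by simp
  qed
  then show ?thesis by simp
qed

lemma add_c: "i \<in> I \<Longrightarrow> u \<in> carrier (M i) \<Longrightarrow> v \<in> carrier (M i) \<Longrightarrow> u \<oplus>\<^bsub>M i\<^esub> v \<in> carrier (M i)"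
proof -
  assume i: "i \<in> I" and uv: "u \<in> carrier (M i)" "v \<in> carrier (M i)"
  interpret Mi: cmod "M i" by (rule cm[OF i])
  show ?thesis using uv by simp
qed

lemma scale_c: "i \<in> I \<Longrightarrow> u \<in> carrier (M i) \<Longrightarrow> c \<odot>\<^bsub>M i\<^esub> u \<in> carrier (M i)"
proof -
  assume i: "i \<in> I" and uv: "u \<in> carrier (M i)"
  interpret Mi: cmod "M i" by (rule cm[OF i])
  show ?thesis using uv by simp
qed

lemma rel_cases:
  assumes "r \<in> multilinear_relations I M"
    and "\<And>m i u v. m \<in> P \<Longrightarrow> i \<in> I \<Longrightarrow> u \<in> carrier (M i) \<Longrightarrow> v \<in> carrier (M i) \<Longrightarrow>
      Q (basis_vec (m(i := u \<oplus>\<^bsub>M i\<^esub> v)) - basis_vec (m(i := u)) - basis_vec (m(i := v)))"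
    and "\<And>m i c u. m \<in> P \<Longrightarrow> i \<in> I \<Longrightarrow> u \<in> carrier (M i) \<Longrightarrow>
      Q (basis_vec (m(i := c \<odot>\<^bsub>M i\<^esub> u)) - cscale c (basis_vec (m(i := u))))"
  shows "Q r"
  using assms(1) unfolding multilinear_relations_def
  by (elim UnE; elim CollectE exE conjE; hypsubst) (rule assms(2,3); assumption)+

sublocale presentation P "multilinear_relations I M"
proof
  fix r assume "r \<in> multilinear_relations I M"
  then show "Poly_Mapping.keys r \<subseteq> P"
    by (rule rel_cases[where Q = "\<lambda>r. Poly_Mapping.keys r \<subseteq> P"])
      (rule rel_add_supp rel_scale_supp; simp only: upd_P add_c scale_c)+
qed

lemma K_add: "m \<in> P \<Longrightarrow> i \<in> I \<Longrightarrow> u \<in> carrier (M i) \<Longrightarrow> v \<in> carrier (M i) \<Longrightarrow>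
    basis_vec (m(i := u \<oplus>\<^bsub>M i\<^esub> v)) - basis_vec (m(i := u)) - basis_vec (m(i := v)) \<in> K"
  by (rule cspace.span_base) (unfold multilinear_relations_def, blast)

lemma K_scale: "m \<in> P \<Longrightarrow> i \<in> I \<Longrightarrow> u \<in> carrier (M i) \<Longrightarrow>
    basis_vec (m(i := c \<odot>\<^bsub>M i\<^esub> u)) - cscale c (basis_vec (m(i := u))) \<in> K"
  by (rule cspace.span_base) (unfold multilinear_relations_def, blast)

abbreviation "act_gen \<equiv> \<lambda>x m. \<Sum>i\<in>I. (basis_vec (m(i := act (M i) x (m i))) :: ('i \<Rightarrow> 'a) \<Rightarrow>\<^sub>0 complex)"

text \<open>In the Leibniz sum, the term for the slot of the relation is the same kind of relation
  between images under \<open>x\<close>; each other term is the given relation over a family altered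
  in a different slot.\<close>

lemma act_rel:
  assumes "r \<in> multilinear_relations I M"
  shows "lin_ext (act_gen x) r \<in> K"
  using assms
proof (rule rel_cases[where Q = "\<lambda>r. lin_ext (act_gen x) r \<in> K"])
  fix m i u v assume *: "m \<in> P" "i \<in> I" "u \<in> carrier (M i)" "v \<in> carrier (M i)"
  interpret Mi: lin_act_mod "M i" by (rule lin_acts[OF *(2)])
  have "(\<Sum>j\<in>I. basis_vec ((m(i := u \<oplus>\<^bsub>M i\<^esub> v))(j := act (M j) x ((m(i := u \<oplus>\<^bsub>M i\<^esub> v)) j)))
      - basis_vec ((m(i := u))(j := act (M j) x ((m(i := u)) j)))
      - basis_vec ((m(i := v))(j := act (M j) x ((m(i := v)) j)))) \<in> K"
  proof (rule cspace.span_sum)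
    fix j assume j: "j \<in> I"
    show "basis_vec ((m(i := u \<oplus>\<^bsub>M i\<^esub> v))(j := act (M j) x ((m(i := u \<oplus>\<^bsub>M i\<^esub> v)) j)))
      - basis_vec ((m(i := u))(j := act (M j) x ((m(i := u)) j)))
      - basis_vec ((m(i := v))(j := act (M j) x ((m(i := v)) j))) \<in> K"
    proof (cases "j = i")
      case True
      then show ?thesis using K_add[OF *(1,2), of "act (M i) x u" "act (M i) x v"] * by (simp add: Mi.act_add)
    next
      case False
      interpret Mj: lin_act_mod "M j" by (rule lin_acts[OF j])
      have "m(j := act (M j) x (m j)) \<in> P" using * j in_P[OF *(1) j] by (intro upd_P) auto
      from K_add[OF this *(2-4)] show ?thesis using False by (simp add: fun_upd_twist)
    qed
  qed
  then show "lin_ext (act_gen x) (basis_vec (m(i := u \<oplus>\<^bsub>M i\<^esub> v)) - basis_vec (m(i := u)) - basis_vec (m(i := v))) \<in> K"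
    by (simp add: lin_ext_diff sum_subtractf del: fun_upd_apply)
next
  fix m i c u assume *: "m \<in> P" "i \<in> I" "u \<in> carrier (M i)"
  interpret Mi: lin_act_mod "M i" by (rule lin_acts[OF *(2)])
  have "(\<Sum>j\<in>I. basis_vec ((m(i := c \<odot>\<^bsub>M i\<^esub> u))(j := act (M j) x ((m(i := c \<odot>\<^bsub>M i\<^esub> u)) j)))
      - cscale c (basis_vec ((m(i := u))(j := act (M j) x ((m(i := u)) j))))) \<in> K"
  proof (rule cspace.span_sum)
    fix j assume j: "j \<in> I"
    show "basis_vec ((m(i := c \<odot>\<^bsub>M i\<^esub> u))(j := act (M j) x ((m(i := c \<odot>\<^bsub>M i\<^esub> u)) j)))
      - cscale c (basis_vec ((m(i := u))(j := act (M j) x ((m(i := u)) j)))) \<in> K"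
    proof (cases "j = i")
      case True
      then show ?thesis using K_scale[OF *(1,2), of "act (M i) x u" c] * by (simp add: Mi.act_scale)
    next
      case False
      interpret Mj: lin_act_mod "M j" by (rule lin_acts[OF j])
      have "m(j := act (M j) x (m j)) \<in> P" using * j in_P[OF *(1) j] by (intro upd_P) auto
      from K_scale[OF this *(2-3)] show ?thesis using False by (simp add: fun_upd_twist)
    qed
  qed
  then show "lin_ext (act_gen x) (basis_vec (m(i := c \<odot>\<^bsub>M i\<^esub> u)) - cscale c (basis_vec (m(i := u)))) \<in> K"
    by (simp add: lin_ext_diff lin_ext_cscale sum_subtractf cspace.scale_sum_right del: fun_upd_apply cscale_single)
qed

abbreviation "T \<equiv> tensor_family I M"

lemma fam_eq: "T = presented P (multilinear_relations I M) act_gen"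
  by (simp add: tensor_family_def)

lemma fam_lin_act: "lin_act T"
  unfolding fam_eq
proof (rule presented_lin_act)
  show "r \<in> multilinear_relations I M \<Longrightarrow> lin_ext (act_gen x) r \<in> K" for x r by (rule act_rel)
  show "Poly_Mapping.keys (act_gen x g) \<subseteq> P" if g: "g \<in> P" for x g
  proof (rule keys_sum_subset)
    fix i assume i: "i \<in> I"
    interpret Mi: lin_act_mod "M i" by (rule lin_acts[OF i])
    show "Poly_Mapping.keys (basis_vec (g(i := act (M i) x (g i))) :: ('i \<Rightarrow> 'a) \<Rightarrow>\<^sub>0 complex) \<subseteq> P"
      using upd_P[OF g i, of "act (M i) x (g i)"] in_P[OF g i] by simp
  qed
qed

sublocale T: lin_act_mod T
  by (rule lin_act_mod[OF fam_lin_act])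

definition pure :: "('i \<Rightarrow> 'a) \<Rightarrow> (('i \<Rightarrow> 'a) \<Rightarrow>\<^sub>0 complex) set" where
  "pure m = cls (basis_vec m)"

lemma pure_closed [simp, intro]: "m \<in> P \<Longrightarrow> pure m \<in> carrier T"
  unfolding fam_eq pure_def by (rule cls_in_carrier) simp

lemma pure_add: "m \<in> P \<Longrightarrow> i \<in> I \<Longrightarrow> u \<in> carrier (M i) \<Longrightarrow> v \<in> carrier (M i) \<Longrightarrow>
    pure (m(i := u \<oplus>\<^bsub>M i\<^esub> v)) = pure (m(i := u)) \<oplus>\<^bsub>T\<^esub> pure (m(i := v))"
  using K_add by (simp add: pure_def fam_eq presented_sel cls_eq_iff diff_diff_eq)

lemma pure_scale: "m \<in> P \<Longrightarrow> i \<in> I \<Longrightarrow> u \<in> carrier (M i) \<Longrightarrow>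
    pure (m(i := c \<odot>\<^bsub>M i\<^esub> u)) = c \<odot>\<^bsub>T\<^esub> pure (m(i := u))"
  using K_scale by (simp add: pure_def fam_eq presented_sel cls_eq_iff del: cscale_single)

lemma pure_hom: "m \<in> P \<Longrightarrow> i \<in> I \<Longrightarrow> cmod_hom (M i) T (\<lambda>u. pure (m(i := u)))"
  using upd_P by (auto simp: cmod_hom_def pure_add pure_scale)

lemma pure_zero: "m \<in> P \<Longrightarrow> i \<in> I \<Longrightarrow> pure (m(i := \<zero>\<^bsub>M i\<^esub>)) = \<zero>\<^bsub>T\<^esub>"
  using cmod_hom_zero[OF cm T.cmod pure_hom] .

lemma act_pure_sum: "act T x (pure m) = cls (\<Sum>i\<in>I. basis_vec (m(i := act (M i) x (m i))))"
  unfolding fam_eq pure_def by (simp add: act_cls[OF act_rel] del: fun_upd_apply)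

text \<open>A killed entry turns the summand of the Leibniz rule into a pure tensor with a zero
  entry.\<close>

lemma K_of_killed:
  assumes "m \<in> P" "j \<in> I" "act (M j) x (m j) = \<zero>\<^bsub>M j\<^esub>"
  shows "basis_vec (m(j := act (M j) x (m j))) \<in> K"
  using pure_zero[OF assms(1,2)] cls_eq_iff[of _ 0] by (simp add: assms(3) pure_def fam_eq presented_sel)

lemma act_pure_single:
  assumes m: "m \<in> P" and i: "i \<in> I" and k: "\<And>j. j \<in> I \<Longrightarrow> j \<noteq> i \<Longrightarrow> act (M j) x (m j) = \<zero>\<^bsub>M j\<^esub>"
  shows "act T x (pure m) = pure (m(i := act (M i) x (m i)))"
proof -
  have "(\<Sum>j\<in>I. basis_vec (m(j := act (M j) x (m j)))) - basis_vec (m(i := act (M i) x (m i)))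
      = (\<Sum>j\<in>I - {i}. basis_vec (m(j := act (M j) x (m j))) :: ('i \<Rightarrow> 'a) \<Rightarrow>\<^sub>0 complex)"
    using fin i by (simp add: sum.remove)
  also have "\<dots> \<in> K"
    by (rule cspace.span_sum) (use K_of_killed[OF m] k in auto)
  finally show ?thesis unfolding act_pure_sum unfolding pure_def cls_eq_iff .
qed

lemma act_pure_zero:
  assumes m: "m \<in> P" and k: "\<And>j. j \<in> I \<Longrightarrow> act (M j) x (m j) = \<zero>\<^bsub>M j\<^esub>"
  shows "act T x (pure m) = \<zero>\<^bsub>T\<^esub>"
proof -
  have "(\<Sum>j\<in>I. basis_vec (m(j := act (M j) x (m j)))) - 0 \<in> K"
    unfolding diff_zero by (rule cspace.span_sum) (use K_of_killed[OF m] k in auto)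
  then have "cls (\<Sum>j\<in>I. basis_vec (m(j := act (M j) x (m j)))) = cls 0"
    by (simp add: cls_eq_iff)
  then show ?thesis unfolding act_pure_sum by (simp add: fam_eq presented_sel)
qed

lemma pure_induct [consumes 1, case_names pure add scale]:
  assumes "y \<in> carrier T" and "\<And>m. m \<in> P \<Longrightarrow> Q (pure m)"
    and "\<And>x y. x \<in> carrier T \<Longrightarrow> y \<in> carrier T \<Longrightarrow> Q x \<Longrightarrow> Q y \<Longrightarrow> Q (x \<oplus>\<^bsub>T\<^esub> y)"
    and "\<And>c x. x \<in> carrier T \<Longrightarrow> Q x \<Longrightarrow> Q (c \<odot>\<^bsub>T\<^esub> x)"
  shows "Q y"
  using assms(1) unfolding fam_eq
proof (induction rule: presented_induct)
  case (gen g)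
  then show ?case using assms(2) unfolding pure_def by blast
next
  case (add x y) then show ?case using assms(3) unfolding fam_eq by blast
next
  case (scale c x) then show ?case using assms(4) unfolding fam_eq by blast
next
  show "P \<noteq> {}" using zero_P by blast
qed

lemma pure_lift:
  assumes "cmod N" and "\<And>m. m \<in> P \<Longrightarrow> f m \<in> carrier N"
    and "\<And>m i u v. m \<in> P \<Longrightarrow> i \<in> I \<Longrightarrow> u \<in> carrier (M i) \<Longrightarrow> v \<in> carrier (M i) \<Longrightarrow>
      f (m(i := u \<oplus>\<^bsub>M i\<^esub> v)) = f (m(i := u)) \<oplus>\<^bsub>N\<^esub> f (m(i := v))"
    and "\<And>m i c u. m \<in> P \<Longrightarrow> i \<in> I \<Longrightarrow> u \<in> carrier (M i) \<Longrightarrow> f (m(i := c \<odot>\<^bsub>M i\<^esub> u)) = c \<odot>\<^bsub>N\<^esub> f (m(i := u))"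
  obtains \<Phi> where "cmod_hom T N \<Phi>" and "\<And>m. m \<in> P \<Longrightarrow> \<Phi> (pure m) = f m"
proof -
  interpret N: cmod N by fact
  have f: "f \<in> P \<rightarrow> carrier N" using assms(2) by blast
  have rel: "lcomb N f r = \<zero>\<^bsub>N\<^esub>" if "r \<in> multilinear_relations I M" for r
    using that by (rule rel_cases[where Q = "\<lambda>r. lcomb N f r = \<zero>\<^bsub>N\<^esub>"])
      (rule N.lcomb_rel_add[OF f] N.lcomb_rel_scale[OF f]; simp only: assms(3,4) upd_P add_c scale_c)+
  have "lift N f (pure m) = f m" if "m \<in> P" for m
    using lift_cls[OF assms(1) f rel, of "basis_vec m"] assms(2)[OF that] that by (simp add: pure_def)
  moreover have "cmod_hom T N (lift N f)"
    unfolding fam_eq by (rule lift_hom[OF assms(1) f rel])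
  ultimately show ?thesis using that by blast
qed

lemma prod_upd: "i \<in> I \<Longrightarrow> (\<Prod>j\<in>I. \<kappa> j ((m(i := u)) j) (t j)) = (\<Prod>j\<in>I - {i}. \<kappa> j (m j) (t j)) * (\<kappa> i u (t i) :: complex)"
  using fin by (simp add: prod.remove[of I i] mult.commute)

lemma pure_coords:
  assumes X: "\<And>i. i \<in> I \<Longrightarrow> coords (M i) (X i) (\<lambda>x. x) (\<kappa> i)"
  obtains \<chi> where "coords T (\<Pi>\<^sub>E i\<in>I. X i) pure \<chi>"
    and "\<And>m t. m \<in> P \<Longrightarrow> t \<in> (\<Pi>\<^sub>E i\<in>I. X i) \<Longrightarrow> \<chi> (pure m) t = (\<Prod>i\<in>I. \<kappa> i (m i) (t i))"
proof -
  let ?C = "one_dim (\<lambda>_. 0)"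
  let ?X = "\<Pi>\<^sub>E i\<in>I. X i"
  have XP: "?X \<subseteq> P" using coords_closed[OF X] by (intro PiE_mono) auto
  have ex: "\<exists>\<Phi>. cmod_hom T ?C \<Phi> \<and> (\<forall>m\<in>P. \<Phi> (pure m) = (\<Prod>i\<in>I. \<kappa> i (m i) (t i)))"
    if t: "t \<in> ?X" for t
  proof (rule pure_lift[of ?C "\<lambda>m. \<Prod>i\<in>I. \<kappa> i (m i) (t i)"])
    show "cmod ?C" by (rule cmod_one_dim)
    fix m i u assume *: "m \<in> P" "i \<in> I" "u \<in> carrier (M i)"
    have ti: "t i \<in> X i" using t *(2) by auto
    show "(\<Prod>j\<in>I. \<kappa> j ((m(i := c \<odot>\<^bsub>M i\<^esub> u)) j) (t j)) = c \<odot>\<^bsub>?C\<^esub> (\<Prod>j\<in>I. \<kappa> j ((m(i := u)) j) (t j))" for c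
      unfolding prod_upd[OF *(2)] by (simp add: coords_scale[OF X[OF *(2)] *(3) ti])
    fix v assume v: "v \<in> carrier (M i)"
    show "(\<Prod>j\<in>I. \<kappa> j ((m(i := u \<oplus>\<^bsub>M i\<^esub> v)) j) (t j)) =
        (\<Prod>j\<in>I. \<kappa> j ((m(i := u)) j) (t j)) \<oplus>\<^bsub>?C\<^esub> (\<Prod>j\<in>I. \<kappa> j ((m(i := v)) j) (t j))"
      unfolding prod_upd[OF *(2)] by (simp add: coords_add[OF X[OF *(2)] *(3) v ti] algebra_simps)
  qed auto
  define \<chi> where "\<chi> y t = (SOME \<Phi>. cmod_hom T ?C \<Phi> \<and> (\<forall>m\<in>P. \<Phi> (pure m) = (\<Prod>i\<in>I. \<kappa> i (m i) (t i)))) y" for y t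
  have \<chi>: "cmod_hom T ?C (\<lambda>y. \<chi> y t)" "\<forall>m\<in>P. \<chi> (pure m) t = (\<Prod>i\<in>I. \<kappa> i (m i) (t i))" if "t \<in> ?X" for t
    using someI_ex[OF ex[OF that]] unfolding \<chi>_def by simp_all
  have \<beta>: "pure \<in> ?X \<rightarrow> carrier T" using XP by blast
  let ?S = "{lcomb T pure p | p. Poly_Mapping.keys p \<subseteq> ?X}"
  have S: "lin_closed T ?S" by (rule T.lin_closed_lcombs[OF \<beta>])
  \<comment> \<open>Induction on the set \<open>J\<close> of slots with arbitrary entries; in the
    other slots the entries are basis vectors.\<close>
  have sp0: "\<forall>m\<in>P. (\<forall>i\<in>I - J. m i \<in> X i) \<longrightarrow> pure m \<in> ?S" if "finite J" "J \<subseteq> I" for J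
    using that
  proof (induction J rule: finite_induct)
    case empty
    show ?case
    proof (intro ballI impI)
      fix m assume m: "m \<in> P" "\<forall>i\<in>I - {}. m i \<in> X i"
      then have "m \<in> ?X" by (auto simp: PiE_iff)
      with m show "pure m \<in> ?S" by (intro CollectI exI[of _ "basis_vec m"]) simp
    qed
  next
    case (insert j J)
    show ?case
    proof (intro ballI impI)
      fix m assume m: "m \<in> P" "\<forall>i\<in>I - insert j J. m i \<in> X i"
      have j: "j \<in> I" using insert by simp
      have "(\<lambda>u. pure (m(j := u))) (m j) \<in> ?S"
      proof (rule coords_hom_in[OF cm[OF j] T.cmod X[OF j] pure_hom[OF m(1) j] S _ in_P[OF m(1) j]])
        fix x assume x: "x \<in> X j"
        show "pure (m(j := x)) \<in> ?S"
          using insert.IH insert.prems m(2) x upd_P[OF m(1) j coords_closed[OF X[OF j] x]] by auto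
      qed
      then show "pure m \<in> ?S" by simp
    qed
  qed
  have sp: "y \<in> ?S" if "y \<in> carrier T" for y
    using that
  proof (induction rule: pure_induct)
    case (pure m)
    show ?case using sp0[OF fin] pure by simp
  qed (use S in \<open>auto simp: lin_closed_def\<close>)
  have "coords T ?X pure \<chi>"
    unfolding coords_def
  proof (intro conjI \<beta> allI ballI)
    fix t assume t: "t \<in> ?X"
    fix u assume u: "u \<in> carrier T"
    show "\<chi> (c \<odot>\<^bsub>T\<^esub> u) t = c * \<chi> u t" for c
      using cmod_hom_scale[OF \<chi>(1)[OF t] u] by simp
    fix v assume v: "v \<in> carrier T"
    show "\<chi> (u \<oplus>\<^bsub>T\<^esub> v) t = \<chi> u t + \<chi> v t"
      using cmod_hom_add[OF \<chi>(1)[OF t] u v] by simp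
  next
    fix s t assume st: "s \<in> ?X" "t \<in> ?X"
    have "\<chi> (pure s) t = (\<Prod>i\<in>I. if s i = t i then 1 else 0)"
    proof -
      have "\<chi> (pure s) t = (\<Prod>i\<in>I. \<kappa> i (s i) (t i))" using \<chi>(2)[OF st(2)] st(1) XP by blast
      also have "\<dots> = (\<Prod>i\<in>I. if s i = t i then 1 else 0)"
        by (rule prod.cong) (use st coords_basis[OF X] in \<open>auto simp: PiE_iff\<close>)
      finally show ?thesis .
    qed
    also have "\<dots> = (if s = t then 1 else 0)"
    proof (cases "s = t")
      case False
      then obtain i where "i \<in> I" "s i \<noteq> t i" using PiE_ext[OF st] by blast
      then show ?thesis using False fin by (auto intro: prod_zero)
    qed simp
    finally show "\<chi> (pure s) t = (if s = t then 1 else 0)" .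
  next
    fix v assume "v \<in> carrier T"
    then show "\<exists>p. Poly_Mapping.keys p \<subseteq> ?X \<and> v = lcomb T pure p" using sp by auto
  qed
  then show ?thesis by (rule that) (use \<chi>(2) in auto)
qed

lemma pure_nonzero:
  assumes m: "m \<in> P" "\<And>i. i \<in> I \<Longrightarrow> m i \<noteq> \<zero>\<^bsub>M i\<^esub>"
  shows "pure m \<noteq> \<zero>\<^bsub>T\<^esub>"
proof
  assume 0: "pure m = \<zero>\<^bsub>T\<^esub>"
  have "\<forall>i\<in>I. \<exists>X \<kappa>. coords (M i) X (\<lambda>x. x) \<kappa>" using coords_exist[OF cm] by metis
  then obtain X \<kappa> where X: "\<And>i. i \<in> I \<Longrightarrow> coords (M i) (X i) (\<lambda>x. x) (\<kappa> i)" by metis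
  have "\<forall>i\<in>I. \<exists>x. x \<in> X i \<and> \<kappa> i (m i) x \<noteq> 0"
    using coords_nonzero[OF cm X in_P[OF m(1)] m(2)] by blast
  then obtain t where t: "\<And>i. i \<in> I \<Longrightarrow> t i \<in> X i" "\<And>i. i \<in> I \<Longrightarrow> \<kappa> i (m i) (t i) \<noteq> 0" by metis
  let ?t = "\<lambda>i\<in>I. t i"
  have t': "?t \<in> (\<Pi>\<^sub>E i\<in>I. X i)" using t by auto
  obtain \<chi> where \<chi>: "coords T (\<Pi>\<^sub>E i\<in>I. X i) pure \<chi>"
    "\<And>m t. m \<in> P \<Longrightarrow> t \<in> (\<Pi>\<^sub>E i\<in>I. X i) \<Longrightarrow> \<chi> (pure m) t = (\<Prod>i\<in>I. \<kappa> i (m i) (t i))"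
    using pure_coords[OF X] by blast
  have "\<chi> (0 \<odot>\<^bsub>T\<^esub> pure m) ?t = 0"
    using coords_scale[OF \<chi>(1) pure_closed[OF m(1)] t', of 0] by simp
  then have "\<chi> (pure m) ?t = 0" using 0 by simp
  moreover have "\<chi> (pure m) ?t = (\<Prod>i\<in>I. \<kappa> i (m i) (t i))" using \<chi>(2)[OF m(1) t'] by simp
  ultimately show False using t(2) fin by simp
qed

text \<open>Finiteness of the family allows the maximum of the stages of its entries.\<close>

lemma common_bound:
  assumes "I' \<subseteq> I" "\<And>i. i \<in> I' \<Longrightarrow> locally_killed (J i) (M i)" "\<And>i. i \<in> I' \<Longrightarrow> decseq (J i)" "m \<in> P"
  shows "\<exists>N. \<forall>i\<in>I'. \<forall>x\<in>J i N. act (M i) x (m i) = \<zero>\<^bsub>M i\<^esub>"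
proof -
  have "\<forall>i\<in>I'. \<exists>N. \<forall>x\<in>J i N. act (M i) x (m i) = \<zero>\<^bsub>M i\<^esub>"
    using assms(1,2) in_P[OF assms(4)] by (auto simp: locally_killed_def)
  then obtain n where n: "\<And>i x. i \<in> I' \<Longrightarrow> x \<in> J i (n i) \<Longrightarrow> act (M i) x (m i) = \<zero>\<^bsub>M i\<^esub>" by metis
  have f: "finite I'" using assms(1) fin finite_subset by blast
  have "act (M i) x (m i) = \<zero>\<^bsub>M i\<^esub>" if "i \<in> I'" "x \<in> J i (Max (n ` I'))" for i x
    using decseqD[OF assms(3)[OF that(1)], of "n i" "Max (n ` I')"] that f n by auto
  then show ?thesis by blast
qed

lemma fam_locally_killed:
  assumes "\<And>i. i \<in> I \<Longrightarrow> locally_killed (J i) (M i)" "\<And>i. i \<in> I \<Longrightarrow> decseq (J i)"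
  shows "locally_killed (\<lambda>N. \<Inter>i\<in>I. J i N) T"
  unfolding locally_killed_def
proof
  have dec: "decseq (\<lambda>N. \<Inter>i\<in>I. J i N)" by (rule decseq_INT) (rule assms(2))
  fix v assume "v \<in> carrier T"
  then show "\<exists>N. \<forall>x\<in>\<Inter>i\<in>I. J i N. act T x v = \<zero>\<^bsub>T\<^esub>"
  proof (induction rule: pure_induct)
    case (pure m)
    obtain N where N: "\<forall>i\<in>I. \<forall>x\<in>J i N. act (M i) x (m i) = \<zero>\<^bsub>M i\<^esub>"
      using common_bound[OF order_refl assms pure] ..
    show ?case by (intro exI[of _ N] ballI act_pure_zero[OF pure]) (use N in auto)
  next
    case (add y z)
    then obtain N N' where N: "\<forall>x\<in>\<Inter>i\<in>I. J i N. act T x y = \<zero>\<^bsub>T\<^esub>" "\<forall>x\<in>\<Inter>i\<in>I. J i N'. act T x z = \<zero>\<^bsub>T\<^esub>"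
      by blast
    have "x \<in> (\<Inter>i\<in>I. J i N)" "x \<in> (\<Inter>i\<in>I. J i N')" if "x \<in> (\<Inter>i\<in>I. J i (max N N'))" for x
      using that decseqD[OF dec, of N "max N N'"] decseqD[OF dec, of N' "max N N'"] by (simp_all add: subset_iff)
    then show ?case using N add(1,2) by (intro exI[of _ "max N N'"]) (simp add: T.act_add)
  next
    case (scale c z)
    then obtain N where "\<forall>x\<in>\<Inter>i\<in>I. J i N. act T x z = \<zero>\<^bsub>T\<^esub>" by blast
    then show ?case using scale(1) by (intro exI[of _ N]) (simp add: T.act_scale)
  qed
qed

lemma contract:
  assumes y: "y \<in> carrier T" "y \<noteq> \<zero>\<^bsub>T\<^esub>" and i: "i \<in> I"
    and J: "\<And>j. j \<in> I \<Longrightarrow> j \<noteq> i \<Longrightarrow> locally_killed (J j) (M j)" "\<And>j. j \<in> I \<Longrightarrow> j \<noteq> i \<Longrightarrow> decseq (J j)"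
  shows "\<exists>\<Phi>. cmod_hom T (M i) \<Phi> \<and> \<Phi> y \<noteq> \<zero>\<^bsub>M i\<^esub> \<and>
    (\<forall>z\<in>carrier T. \<exists>N. \<forall>x\<in>\<Inter>j\<in>I - {i}. J j N. \<Phi> (act T x z) = act (M i) x (\<Phi> z))"
proof -
  interpret Mi: lin_act_mod "M i" by (rule lin_acts[OF i])
  have "\<forall>i\<in>I. \<exists>X \<kappa>. coords (M i) X (\<lambda>x. x) \<kappa>" using coords_exist[OF cm] by metis
  then obtain X \<kappa> where X: "\<And>i. i \<in> I \<Longrightarrow> coords (M i) (X i) (\<lambda>x. x) (\<kappa> i)" by metis
  obtain \<chi> where \<chi>: "coords T (\<Pi>\<^sub>E i\<in>I. X i) pure \<chi>"
    "\<And>m t. m \<in> P \<Longrightarrow> t \<in> (\<Pi>\<^sub>E i\<in>I. X i) \<Longrightarrow> \<chi> (pure m) t = (\<Prod>i\<in>I. \<kappa> i (m i) (t i))"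
    using pure_coords[OF X] by blast
  obtain t where t: "t \<in> (\<Pi>\<^sub>E i\<in>I. X i)" "\<chi> y t \<noteq> 0"
    using coords_nonzero[OF T.cmod \<chi>(1) y] .
  have tj: "t j \<in> X j" if "j \<in> I" for j using t(1) that by auto
  \<comment> \<open>The product of the coordinates in all slots except \<open>i\<close>. It ignores
    slot \<open>i\<close> by \<open>c_i\<close> and is linear in every other slot by
    \<open>c_j\<close>, so multiplying the entry at \<open>i\<close> by it is multilinear.\<close>
  let ?c = "\<lambda>m. \<Prod>j\<in>I - {i}. \<kappa> j (m j) (t j)"
  have c_i: "?c (m(i := u)) = ?c m" for m u by (rule prod.cong) auto
  have c_j: "?c (m(j := u)) = (\<Prod>l\<in>I - {i} - {j}. \<kappa> l (m l) (t l)) * \<kappa> j u (t j)" if "j \<in> I" "j \<noteq> i" for m j u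
    using fin that by (simp add: prod.remove[of "I - {i}" j] mult.commute)
  obtain \<Phi> where \<Phi>: "cmod_hom T (M i) \<Phi>" "\<And>m. m \<in> P \<Longrightarrow> \<Phi> (pure m) = ?c m \<odot>\<^bsub>M i\<^esub> m i"
  proof (rule pure_lift[of "M i" "\<lambda>m. ?c m \<odot>\<^bsub>M i\<^esub> m i"])
    show "cmod (M i)" by (rule Mi.cmod)
    show "?c m \<odot>\<^bsub>M i\<^esub> m i \<in> carrier (M i)" if "m \<in> P" for m using in_P[OF that i] by simp
    fix m j u assume *: "m \<in> P" "j \<in> I" "u \<in> carrier (M j)"
    have mi: "m i \<in> carrier (M i)" using in_P[OF *(1) i] .
    show "?c (m(j := d \<odot>\<^bsub>M j\<^esub> u)) \<odot>\<^bsub>M i\<^esub> (m(j := d \<odot>\<^bsub>M j\<^esub> u)) i =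
        d \<odot>\<^bsub>M i\<^esub> (?c (m(j := u)) \<odot>\<^bsub>M i\<^esub> (m(j := u)) i)" for d
    proof (cases "j = i")
      case True
      have "u \<in> carrier (M i)" using * True by simp
      then show ?thesis unfolding True c_i by (simp add: Mi.sm_sm mult.commute)
    next
      case False
      then show ?thesis unfolding c_j[OF *(2) False]
        using mi by (simp add: Mi.sm_sm coords_scale[OF X[OF *(2)] *(3) tj[OF *(2)]] mult.left_commute)
    qed
    fix v assume v: "v \<in> carrier (M j)"
    show "?c (m(j := u \<oplus>\<^bsub>M j\<^esub> v)) \<odot>\<^bsub>M i\<^esub> (m(j := u \<oplus>\<^bsub>M j\<^esub> v)) i =
        ?c (m(j := u)) \<odot>\<^bsub>M i\<^esub> (m(j := u)) i \<oplus>\<^bsub>M i\<^esub> ?c (m(j := v)) \<odot>\<^bsub>M i\<^esub> (m(j := v)) i"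
    proof (cases "j = i")
      case True
      have "u \<in> carrier (M i)" "v \<in> carrier (M i)" using * v True by simp_all
      then show ?thesis unfolding True c_i by (simp add: Mi.sm_add_right)
    next
      case False
      then show ?thesis unfolding c_j[OF *(2) False] coords_add[OF X[OF *(2)] *(3) v tj[OF *(2)]]
        using mi by (simp add: Mi.sm_add_left ring_distribs)
    qed
  qed auto
  have "\<kappa> i (\<Phi> z) (t i) = \<chi> z t" if "z \<in> carrier T" for z
    using that
  proof (induction rule: pure_induct)
    case (pure m)
    then show ?case
      using fin i in_P[OF pure i]
      by (simp add: \<Phi>(2) \<chi>(2)[OF _ t(1)] coords_scale[OF X[OF i] _ tj[OF i]] prod.remove[of I i] mult.commute)
  next
    case (add x y)
    then show ?case
      by (simp add: coords_add[OF X[OF i] _ _ tj[OF i]] coords_add[OF \<chi>(1) _ _ t(1)]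
          cmod_hom_closed[OF \<Phi>(1)] cmod_hom_add[OF \<Phi>(1)])
  next
    case (scale c x)
    then show ?case
      by (simp add: coords_scale[OF X[OF i] _ tj[OF i]] coords_scale[OF \<chi>(1) _ t(1)]
          cmod_hom_closed[OF \<Phi>(1)] cmod_hom_scale[OF \<Phi>(1)])
  qed
  from this[OF y(1)] have nz: "\<Phi> y \<noteq> \<zero>\<^bsub>M i\<^esub>"
    using t(2) coords_scale[OF X[OF i] Mi.zero_closed tj[OF i], of 0] by auto
  have d: "decseq (\<lambda>N. \<Inter>j\<in>I - {i}. J j N)"
    by (rule decseq_INT) (use J(2) in auto)
  have "\<exists>N. \<forall>x\<in>\<Inter>j\<in>I - {i}. J j N. \<Phi> (act T x z) = act (M i) x (\<Phi> z)" if "z \<in> carrier T" for z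
    using that
  proof (induction rule: pure_induct)
    case (pure m)
    have "\<exists>N. \<forall>j\<in>I - {i}. \<forall>x\<in>J j N. act (M j) x (m j) = \<zero>\<^bsub>M j\<^esub>"
      by (rule common_bound[OF Diff_subset _ _ pure]) (use J in auto)
    then obtain N where N: "\<forall>j\<in>I - {i}. \<forall>x\<in>J j N. act (M j) x (m j) = \<zero>\<^bsub>M j\<^esub>" ..
    have "\<Phi> (act T x (pure m)) = act (M i) x (\<Phi> (pure m))" if x: "x \<in> (\<Inter>j\<in>I - {i}. J j N)" for x
    proof -
      have "act T x (pure m) = pure (m(i := act (M i) x (m i)))"
        by (rule act_pure_single[OF pure i]) (use N x in auto)
      moreover have "m(i := act (M i) x (m i)) \<in> P" using upd_P[OF pure i] in_P[OF pure i] by simp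
      ultimately show ?thesis
        using in_P[OF pure i] by (simp add: \<Phi>(2) pure Mi.act_scale c_i del: fun_upd_apply) (simp)
    qed
    then show ?case by blast
  next
    case (add y z)
    then show ?case by (intro intertwine_add[OF T.lin_act_mod_axioms Mi.lin_act_mod_axioms \<Phi>(1) d])
  next
    case (scale c z)
    then show ?case by (intro intertwine_scale[OF T.lin_act_mod_axioms Mi.lin_act_mod_axioms \<Phi>(1)])
  qed
  with \<Phi>(1) nz show ?thesis by (intro exI[of _ \<Phi>] conjI ballI)
qed

end

section \<open>Laurent polynomials and the Virasoro bracket\<close>

type_synonym laurent = "int \<Rightarrow>\<^sub>0 complex"

text \<open>The quotient by the centre, identified with the Laurent polynomials. By
  \<open>lau_bracket\<close> the bracket there is the one of the vector fields
  \<open>g D\<close>.\<close>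

definition lau :: "vir \<Rightarrow> laurent" where
  "lau = lin_ext (\<lambda>b. case b of E j \<Rightarrow> basis_vec j | Z \<Rightarrow> 0)"

text \<open>The Euler derivation \<open>t d/dt\<close>.\<close>

definition D :: "laurent \<Rightarrow> laurent" where
  "D = lin_ext (\<lambda>j. cscale (of_int j) (basis_vec j))"

lemma clin_lau: "clin lau" and clin_D: "clin D" and clin_e_of: "clin e_of"
  unfolding lau_def D_def e_of_def[abs_def] by (rule clin_lin_ext)+

lemmas lau_add = clin_add[OF clin_lau] and lau_scale = clin_scale[OF clin_lau] and lau_zero = clin_zero[OF clin_lau]
  and lau_diff = clin_diff[OF clin_lau]
  and D_zero = clin_zero[OF clin_D] and D_add = clin_add[OF clin_D] and D_scale = clin_scale[OF clin_D] and D_diff = clin_diff[OF clin_D]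
  and e_of_add = clin_add[OF clin_e_of] and e_of_scale = clin_scale[OF clin_e_of] and e_of_zero = clin_zero[OF clin_e_of]
  and e_of_diff = clin_diff[OF clin_e_of]

lemma lau_basis [simp]: "lau (ve j) = basis_vec j" "lau vz = 0"
  by (simp_all add: lau_def)

lemma lau_single [simp]: "lau (Poly_Mapping.single (E j) c) = Poly_Mapping.single j c" "lau (Poly_Mapping.single Z c) = 0"
  using lau_scale[of c "ve j"] lau_scale[of c vz] by simp_all

lemma D_basis [simp]: "D (basis_vec j) = Poly_Mapping.single j (of_int j)"
  by (simp add: D_def)

lemma e_of_basis [simp]: "e_of (basis_vec j) = ve j"
  by (simp add: e_of_def)

lemma lau_e_of [simp]: "lau (e_of g) = g"
  by (rule clin_eq_on_basis) (auto intro: clin_comp[OF clin_lau clin_e_of] clin_id)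

lemma lookup_lau: "Poly_Mapping.lookup (lau x) j = Poly_Mapping.lookup x (E j)"
proof (induction x rule: pm_induct)
  case (basis g)
  then show ?case by (cases g) (auto simp: lookup_single when_def)
qed (simp_all add: lau_add lau_scale lookup_add lookup_cscale)

lemma vir_eqI: "lau x = lau y \<Longrightarrow> Poly_Mapping.lookup x Z = Poly_Mapping.lookup y Z \<Longrightarrow> x = y"
  by (rule poly_mapping_eqI) (metis lookup_lau vir_basis.exhaust)

lemma lookup_e_of_Z [simp]: "Poly_Mapping.lookup (e_of g) Z = 0"
  by (induction g rule: pm_induct) (simp_all add: e_of_add e_of_scale lookup_add lookup_cscale lookup_single)

lemma vir_decomp: "x = cscale (Poly_Mapping.lookup x Z) vz + e_of (lau x)"
  by (rule vir_eqI) (simp_all add: lau_add lau_scale lookup_add lookup_cscale lookup_single del: cscale_single)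

text \<open>With the scalar absorbed into the basis vector, the rule serves statements about
  products at a point where \<open>cscale\<close> is not yet known to commute with them.\<close>

lemma pm_single_induct [case_names single add]:
  fixes p :: "'x \<Rightarrow>\<^sub>0 complex"
  assumes "\<And>g c. P (Poly_Mapping.single g c)" "\<And>p q. P p \<Longrightarrow> P q \<Longrightarrow> P (p + q)"
  shows "P p"
proof -
  have "P (\<Sum>g\<in>S. cscale (Poly_Mapping.lookup p g) (basis_vec g))" if "finite S" for S
    using that by induction (use assms(1)[of undefined 0] assms in auto)
  from this[of "Poly_Mapping.keys p"] show ?thesis by (simp del: cscale_single flip: pm_expand)
qed

lemma cscale_mult: "cscale c g * h = cscale c (g * h)" and mult_cscale: "g * cscale c h = cscale c (g * h)"
  for g h :: laurent
proof -
  have *: "cscale c g = Poly_Mapping.single 0 c * g" for g :: laurent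
    by (induction g rule: pm_single_induct) (simp_all add: mult_single cspace.scale_right_distrib distrib_left)
  show "cscale c g * h = cscale c (g * h)" "g * cscale c h = cscale c (g * h)"
    by (simp_all add: * mult_ac)
qed

lemma D_mult: "D (g * h) = D g * h + g * D h"
proof (induction g rule: pm_induct)
  case (basis j)
  show ?case
  proof (induction h rule: pm_induct)
    case (basis k)
    then show ?case by (simp add: mult_single flip: single_add)
  qed (simp_all add: D_add D_scale mult_cscale distrib_left cspace.scale_right_distrib)
qed (simp_all add: D_add D_scale distrib_left distrib_right cscale_mult cspace.scale_right_distrib)

lemma clin_lin_ext_fun: "(\<And>a. clin (F a)) \<Longrightarrow> clin (\<lambda>y. lin_ext (\<lambda>a. F a y) x)"
  by (rule clinI)
    (simp_all add: lin_ext_def clin_add clin_scale cspace.scale_right_distrib sum.distrib cspace.scale_sum_right mult.commute)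

lemma clin_bracket_left: "clin (\<lambda>x. vir_bracket x y)" and clin_bracket_right: "clin (\<lambda>y. vir_bracket x y)"
  unfolding vir_bracket_def by (rule clin_lin_ext, rule clin_lin_ext_fun, rule clin_lin_ext)

lemmas bracket_add_left = clin_add[OF clin_bracket_left] and bracket_scale_left = clin_scale[OF clin_bracket_left]
  and bracket_add_right = clin_add[OF clin_bracket_right] and bracket_scale_right = clin_scale[OF clin_bracket_right]

lemma bracket_basis [simp]: "vir_bracket (basis_vec a) (basis_vec b) = vir_basis_bracket a b"
  by (simp add: vir_bracket_def)

lemma bracket_Z_left [simp]: "vir_bracket vz x = 0"
proof (induction x rule: pm_induct)
  case (basis g)
  show ?case by (cases g) simp_all
qed (simp_all add: bracket_add_right bracket_scale_right)

lemma bracket_Z_right [simp]: "vir_bracket x vz = 0"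
proof (induction x rule: pm_induct)
  case (basis g)
  show ?case by (cases g) simp_all
qed (simp_all add: bracket_add_left bracket_scale_left)

lemma lau_bracket: "lau (vir_bracket x y) = lau x * D (lau y) - lau y * D (lau x)"
proof (induction x rule: pm_induct)
  case (basis a)
  show ?case
  proof (induction y rule: pm_induct)
    case (basis b)
    show ?case
    proof (cases a; cases b)
      fix j k assume "a = E j" "b = E k"
      then show ?thesis
        by (simp add: lau_add lau_zero mult_single add.commute flip: single_diff)
    qed (simp_all add: lau_zero D_zero)
  next
    case (add p q)
    then show ?case by (simp add: bracket_add_right lau_add D_add distrib_left distrib_right)
  next
    case (scale c p)
    then show ?case
      by (simp add: bracket_scale_right lau_scale D_scale cscale_mult mult_cscale cspace.scale_right_diff_distrib)
  qed
next
  case (add p q)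
  then show ?case by (simp add: bracket_add_left lau_add D_add distrib_left distrib_right)
next
  case (scale c p)
  then show ?case
    by (simp add: bracket_scale_left lau_scale D_scale cscale_mult mult_cscale cspace.scale_right_diff_distrib)
qed

text \<open>The cocycle of the central extension. The superset \<open>S\<close> leaves room for a
  caller to insert the index at which the sum is concentrated.\<close>

lemma lookup_bracket_Z:
  assumes "finite S" "Poly_Mapping.keys (lau x) \<subseteq> S"
  shows "Poly_Mapping.lookup (vir_bracket x y) Z =
    (\<Sum>j\<in>S. Poly_Mapping.lookup (lau x) j * Poly_Mapping.lookup (lau y) (- j) * of_int (j ^ 3 - j) / 12)"
proof -
  \<comment> \<open>Values in the free space on one point turn a linear functional into an instance
    of \<open>lin_ext\<close>.\<close>
  define \<omega> where "\<omega> y = (\<lambda>j. Poly_Mapping.single () (Poly_Mapping.lookup (lau y) (- j) * of_int (j ^ 3 - j) / 12))" for y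
  have "Poly_Mapping.lookup (vir_bracket x y) Z = Poly_Mapping.lookup (lin_ext (\<omega> y) (lau x)) ()"
  proof (induction x rule: pm_induct)
    case (basis a)
    show ?case
    proof (induction y rule: pm_induct)
      case (basis b)
      show ?case
        by (cases a; cases b)
          (auto simp: \<omega>_def lin_ext_zero lookup_add lookup_cscale lookup_single when_def)
    next
      case (add p q)
      then show ?case
        by (cases a) (simp_all add: bracket_add_right lookup_add lau_add \<omega>_def lin_ext_zero algebra_simps add_divide_distrib)
    next
      case (scale c p)
      then show ?case
        by (cases a) (simp_all add: bracket_scale_right lookup_cscale lau_scale \<omega>_def lin_ext_zero)
    qed
  qed (simp_all add: bracket_add_left bracket_scale_left lau_add lau_scale lin_ext_add lin_ext_cscale lookup_add lookup_cscale)
  also have "\<dots> = (\<Sum>j\<in>S. Poly_Mapping.lookup (lau x) j * Poly_Mapping.lookup (lau y) (- j) * of_int (j ^ 3 - j) / 12)"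
    by (simp add: lin_ext_superset[OF assms] \<omega>_def lookup_sum mult.assoc)
  finally show ?thesis .
qed

section \<open>The subalgebras attached to a point\<close>

definition linfac :: "complex \<Rightarrow> laurent" where
  "linfac lam = basis_vec 1 - Poly_Mapping.single 0 lam"

text \<open>The central element belongs to every member of the family because \<open>lau\<close>
  kills it. The member for \<open>s = 0\<close> is the whole algebra, and the member for
  \<open>s = n\<close> is Vir^f by \<open>Virf_eq\<close>.\<close>

definition vanish :: "complex \<Rightarrow> nat \<Rightarrow> vir set" where
  "vanish lam s = {x. linfac lam ^ s dvd lau x}"

lemma lookup_shift: "Poly_Mapping.lookup (basis_vec j * g) k = Poly_Mapping.lookup g (k - j)" for g :: laurent
  by (induction g rule: pm_induct)
    (auto simp: mult_single lookup_single when_def distrib_left mult_cscale lookup_add lookup_cscale)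

lemma single0_mult: "Poly_Mapping.single 0 c * g = cscale c g" for g :: laurent
  using cscale_mult[of c 1 g] by (simp flip: single_one)

lemma lookup_laurent_of_poly:
  "Poly_Mapping.lookup (laurent_of_poly p) k = (if k \<ge> 0 then Polynomial.coeff p (nat k) else 0)"
proof -
  have "Poly_Mapping.lookup (laurent_of_poly p) k = (\<Sum>i\<le>Polynomial.degree p. if int i = k then Polynomial.coeff p i else 0)"
    unfolding laurent_of_poly_def lookup_sum lookup_single when_def ..
  also have "\<dots> = (if k \<ge> 0 then Polynomial.coeff p (nat k) else 0)"
  proof (cases "k \<ge> 0")
    case True
    then have "(\<Sum>i\<le>Polynomial.degree p. if int i = k then Polynomial.coeff p i else 0)
        = (\<Sum>i\<le>Polynomial.degree p. if i = nat k then Polynomial.coeff p (nat k) else 0)"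
      by (intro sum.cong) auto
    then show ?thesis using True by (auto simp: coeff_eq_0)
  qed (auto intro!: sum.neutral)
  finally show ?thesis .
qed

lemma laurent_add: "laurent_of_poly (p + q) = laurent_of_poly p + laurent_of_poly q"
  by (rule poly_mapping_eqI) (simp add: lookup_laurent_of_poly lookup_add)

lemma laurent_smult: "laurent_of_poly (Polynomial.smult c p) = cscale c (laurent_of_poly p)"
  by (rule poly_mapping_eqI) (simp add: lookup_laurent_of_poly lookup_cscale)

lemma laurent_0 [simp]: "laurent_of_poly 0 = 0"
  by (rule poly_mapping_eqI) (simp add: lookup_laurent_of_poly)

lemma laurent_pCons: "laurent_of_poly (pCons a p) = Poly_Mapping.single 0 a + basis_vec 1 * laurent_of_poly p"
proof (rule poly_mapping_eqI)
  fix k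
  show "Poly_Mapping.lookup (laurent_of_poly (pCons a p)) k =
      Poly_Mapping.lookup (Poly_Mapping.single 0 a + basis_vec 1 * laurent_of_poly p) k"
    by (auto simp: lookup_laurent_of_poly lookup_add lookup_shift lookup_single when_def coeff_pCons nat_diff_distrib'
        split: nat.splits)
qed

lemma laurent_mult: "laurent_of_poly (p * q) = laurent_of_poly p * laurent_of_poly q"
  by (induction p)
    (simp_all add: laurent_add laurent_smult laurent_pCons distrib_right single0_mult mult.assoc)

lemma laurent_1 [simp]: "laurent_of_poly 1 = 1"
  unfolding one_pCons laurent_pCons by simp

lemma laurent_power: "laurent_of_poly (p ^ n) = laurent_of_poly p ^ n"
  by (induction n) (simp_all add: laurent_mult)

lemma laurent_lin: "laurent_of_poly [:- lam, 1:] = linfac lam"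
  by (simp add: laurent_pCons linfac_def single_uminus)

lemma subspace_vanish: "cspace.subspace (vanish lam s)"
proof -
  have "linfac lam ^ s dvd cscale c g" if "linfac lam ^ s dvd g" for c g
    using dvd_mult[OF that, of "Poly_Mapping.single 0 c"] by (simp add: single0_mult)
  then show ?thesis unfolding cspace.subspace_def vanish_def by (simp add: lau_zero lau_add lau_scale)
qed

text \<open>A span of generators becomes a divisibility condition, in which brackets and successive
  quotients can be computed.\<close>

lemma Virf_eq: "Virf ([:- lam, 1:] ^ n) = vanish lam n"
proof -
  let ?S = "insert vz {e_of (basis_vec j * laurent_of_poly ([:- lam, 1:] ^ n)) |j. True}"
  have l: "laurent_of_poly ([:- lam, 1:] ^ n) = linfac lam ^ n" by (simp add: laurent_power laurent_lin)
  have "Virf ([:- lam, 1:] ^ n) \<subseteq> vanish lam n"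
    unfolding Virf_def by (rule cspace.span_minimal[OF _ subspace_vanish]) (auto simp: l vanish_def)
  moreover have "x \<in> Virf ([:- lam, 1:] ^ n)" if xn: "x \<in> vanish lam n" for x
  proof -
    obtain q where q: "lau x = linfac lam ^ n * q" using xn by (auto simp: vanish_def)
    have "e_of (q * linfac lam ^ n) \<in> cspace.span ?S" for q
    proof (induction q rule: pm_induct)
      case (basis j)
      then show ?case by (rule cspace.span_base) (auto simp: l)
    qed (simp_all add: distrib_right cscale_mult e_of_add e_of_scale cspace.span_add cspace.span_scale)
    moreover have "cscale (Poly_Mapping.lookup x Z) vz \<in> cspace.span ?S"
      by (rule cspace.span_scale) (rule cspace.span_base, simp)
    ultimately show ?thesis
      unfolding Virf_def by (subst vir_decomp[of x]) (simp add: cspace.span_add q mult.commute del: cscale_single)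
  qed
  ultimately show ?thesis by blast
qed

text \<open>Leibniz rule: differentiating a product of \<open>a + 1\<close> equal factors leaves
  \<open>a\<close> of them in each term.\<close>

lemma dvd_D: "linfac lam ^ Suc a dvd g \<Longrightarrow> linfac lam ^ a dvd D g"
proof -
  assume "linfac lam ^ Suc a dvd g"
  then obtain q where "g = linfac lam ^ Suc a * q" by auto
  moreover have "linfac lam ^ a dvd D (linfac lam ^ Suc a * q)" for q
  proof (induction a arbitrary: q)
    case (Suc a)
    have "linfac lam ^ Suc (Suc a) * q = linfac lam * (linfac lam ^ Suc a * q)" by (simp add: mult.assoc)
    then have "D (linfac lam ^ Suc (Suc a) * q) = D (linfac lam) * (linfac lam ^ Suc a * q) + linfac lam * D (linfac lam ^ Suc a * q)"
      by (simp only: D_mult)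
    moreover have "linfac lam ^ Suc a dvd D (linfac lam) * (linfac lam ^ Suc a * q)" by simp
    moreover have "linfac lam ^ Suc a dvd linfac lam * D (linfac lam ^ Suc a * q)"
      using mult_dvd_mono[OF dvd_refl[of "linfac lam"] Suc.IH[of q]] by simp
    ultimately show ?case by (metis dvd_add)
  qed simp
  ultimately show ?thesis by simp
qed

lemma dvd_D': "linfac lam ^ a dvd g \<Longrightarrow> linfac lam ^ (a - 1) dvd D g"
  by (cases a) (simp_all add: dvd_D del: power_Suc)

text \<open>The derivative in \<open>g * D h\<close> costs one order. For equal orders this makes
  the filtration consist of subalgebras; for an element of order \<open>n\<close> and one of smaller
  order it controls the shift of a character.\<close>

lemma bracket_vanish:
  assumes "x \<in> vanish lam a" "y \<in> vanish lam b" "c \<le> a + b - 1"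
  shows "vir_bracket x y \<in> vanish lam c"
proof -
  have gen: "linfac lam ^ c dvd g * D h" if "linfac lam ^ a dvd g" "linfac lam ^ b dvd h" "c \<le> a + b - 1" for g h a b
  proof -
    have "linfac lam ^ (a + (b - 1)) dvd g * D h"
      unfolding power_add using that(1) dvd_D'[OF that(2)] by (rule mult_dvd_mono)
    moreover have "c \<le> a + (b - 1)" using that(3) by simp
    ultimately show ?thesis using le_imp_power_dvd dvd_trans by blast
  qed
  show ?thesis
    using gen[of a "lau x" b "lau y"] gen[of b "lau y" a "lau x"] assms
    by (simp add: vanish_def lau_bracket add.commute)
qed

lemma vanish_mono: "a \<le> b \<Longrightarrow> vanish lam b \<subseteq> vanish lam a"
  unfolding vanish_def using le_imp_power_dvd dvd_trans by blast

subsection \<open>Evaluation\<close>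

text \<open>Evaluation at \<open>lam\<close>, with integer powers for the negative exponents. The
  detour through the free space on one point makes it an instance of \<open>lin_ext\<close>.\<close>

definition ev :: "complex \<Rightarrow> laurent \<Rightarrow> complex" where
  "ev lam g = Poly_Mapping.lookup (lin_ext (\<lambda>j. Poly_Mapping.single () (lam powi j)) g) ()"

lemma ev_add: "ev lam (g + h) = ev lam g + ev lam h" and ev_diff: "ev lam (g - h) = ev lam g - ev lam h"
  and ev_scale: "ev lam (cscale c g) = c * ev lam g" and ev_basis [simp]: "ev lam (basis_vec j) = lam powi j"
  and ev_zero [simp]: "ev lam 0 = 0"
  by (simp_all add: ev_def lin_ext_add lin_ext_diff lin_ext_cscale lin_ext_zero lookup_add lookup_minus lookup_cscale)

lemma ev_single: "ev lam (Poly_Mapping.single j c) = c * lam powi j"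
  using ev_scale[of lam c "basis_vec j"] by simp

lemma ev_one [simp]: "ev lam 1 = 1"
  using ev_basis[of lam 0] by simp

lemma ev_mult: "lam \<noteq> 0 \<Longrightarrow> ev lam (g * h) = ev lam g * ev lam h"
proof (induction g rule: pm_induct)
  case (basis j)
  show ?case
    by (induction h rule: pm_induct)
      (simp_all add: mult_single power_int_add basis distrib_left mult_cscale ev_add ev_scale)
qed (simp_all add: distrib_right cscale_mult ev_add ev_scale)

lemma ev_lin [simp]: "lam \<noteq> 0 \<Longrightarrow> ev lam (linfac lam) = 0"
  by (simp add: linfac_def ev_diff ev_single)

text \<open>The remainder theorem. The powers of \<open>t\<close> are reached from \<open>1\<close>
  in both directions; each step multiplies the difference by a unit and adds a multiple of
  \<open>linfac lam\<close>.\<close>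

lemma lin_dvd_diff_ev:
  assumes "lam \<noteq> 0"
  shows "linfac lam dvd g - Poly_Mapping.single 0 (ev lam g)"
proof (induction g rule: pm_induct)
  case (basis j)
  show ?case
  proof (induction j rule: int_induct[where k = 0])
    case base
    then show ?case by simp
  next
    case (step1 i)
    have "basis_vec (i + 1) - Poly_Mapping.single 0 (ev lam (basis_vec (i + 1))) =
        basis_vec 1 * (basis_vec i - Poly_Mapping.single 0 (ev lam (basis_vec i)))
        + Poly_Mapping.single 0 (lam powi i) * linfac lam"
      using assms by (simp add: linfac_def right_diff_distrib mult_single power_int_add mult.commute add.commute)
    then show ?case using step1 by simp
  next
    case (step2 i)
    have "basis_vec (i - 1) - Poly_Mapping.single 0 (ev lam (basis_vec (i - 1))) =
        basis_vec (- 1) * (basis_vec i - Poly_Mapping.single 0 (ev lam (basis_vec i)))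
        - Poly_Mapping.single (- 1) (lam powi (i - 1)) * linfac lam"
      using assms by (simp add: linfac_def right_diff_distrib mult_single power_int_diff field_simps flip: single_diff)
    then show ?case using step2 by simp
  qed
next
  case (add p q)
  have "p + q - Poly_Mapping.single 0 (ev lam (p + q)) =
      (p - Poly_Mapping.single 0 (ev lam p)) + (q - Poly_Mapping.single 0 (ev lam q))"
    by (simp add: ev_add single_add)
  then show ?case using dvd_add[OF add.IH] by (simp only:)
next
  case (scale c p)
  have "cscale c p - Poly_Mapping.single 0 (ev lam (cscale c p)) = Poly_Mapping.single 0 c * (p - Poly_Mapping.single 0 (ev lam p))"
    by (simp add: ev_scale single0_mult cspace.scale_right_diff_distrib)
  then show ?case using scale by simp
qed

lemma lin_nonzero [simp]: "linfac lam \<noteq> 0"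
proof
  assume "linfac lam = 0"
  then have "Poly_Mapping.lookup (linfac lam) 1 = 0" by simp
  then show False by (simp add: linfac_def lookup_minus lookup_single)
qed

lemma lin_dvd_iff: "lam \<noteq> 0 \<Longrightarrow> linfac lam dvd g \<longleftrightarrow> ev lam g = 0"
  using lin_dvd_diff_ev[of lam g] by (auto simp: ev_mult)

text \<open>The description operator makes this meaningful only on \<open>vanish lam s\<close>.\<close>

definition taylor :: "complex \<Rightarrow> nat \<Rightarrow> vir \<Rightarrow> complex" where
  "taylor lam s x = ev lam (THE q. lau x = linfac lam ^ s * q)"

lemma taylor_eq: "lau x = linfac lam ^ s * q \<Longrightarrow> taylor lam s x = ev lam q"
  unfolding taylor_def by (subst the_equality[of _ q]) auto

lemma taylor_add: "x \<in> vanish lam s \<Longrightarrow> y \<in> vanish lam s \<Longrightarrow> taylor lam s (x + y) = taylor lam s x + taylor lam s y"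
  unfolding vanish_def dvd_def
  by (auto simp: taylor_eq lau_add ev_add simp flip: distrib_left)

lemma taylor_scale: "x \<in> vanish lam s \<Longrightarrow> taylor lam s (cscale c x) = c * taylor lam s x"
  unfolding vanish_def dvd_def
  by (auto simp: taylor_eq lau_scale ev_scale simp flip: mult_cscale)

lemma taylor_lin: "taylor lam s (e_of (linfac lam ^ s)) = 1"
  using taylor_eq[of "e_of (linfac lam ^ s)" lam s 1] by simp

text \<open>Each member of the chain is the kernel of a functional on the previous one, nonzero by
  \<open>taylor_lin\<close>. This is the codimension-one situation of
  \<open>ind_step\<close>.\<close>

lemma vanish_Suc_iff:
  assumes "lam \<noteq> 0" "x \<in> vanish lam s"
  shows "x \<in> vanish lam (Suc s) \<longleftrightarrow> taylor lam s x = 0"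
proof -
  obtain q where q: "lau x = linfac lam ^ s * q" using assms(2) by (auto simp: vanish_def)
  have "linfac lam ^ Suc s dvd linfac lam ^ s * q \<longleftrightarrow> linfac lam dvd q"
    unfolding power_Suc2 by (subst dvd_mult_cancel_left) simp
  then show ?thesis by (simp add: vanish_def taylor_eq[OF q] q lin_dvd_iff[OF assms(1)] del: power_Suc)
qed

section \<open>Approximation at finitely many points\<close>

text \<open>
  Orders of vanishing at a point of the line. The point \<open>0\<close> stands for the
  locally annihilated factor: there the order is the order of the Laurent polynomial in \<open>t\<close>.
\<close>

definition germs :: "complex \<Rightarrow> nat \<Rightarrow> laurent set" where
  "germs \<nu> N = (if \<nu> = 0 then {g. Poly_Mapping.keys g \<subseteq> {int N..}} else {g. linfac \<nu> ^ N dvd g})"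

text \<open>The elements carry no central part: the centre may act nontrivially on the locally
  annihilated factor, so it must not count as an element of high order at \<open>0\<close>.\<close>

definition order_filt :: "complex \<Rightarrow> nat \<Rightarrow> vir set" where
  "order_filt \<nu> N = e_of ` germs \<nu> N"

lemma germs_antimono: "N \<le> N' \<Longrightarrow> germs \<nu> N' \<subseteq> germs \<nu> N"
  unfolding germs_def by (auto intro: dvd_trans[OF le_imp_power_dvd])

lemma decseq_order_filt: "decseq (order_filt \<nu>)"
  unfolding decseq_def order_filt_def using germs_antimono by blast

text \<open>The Bezout form of coprimality passes to products simply by multiplying two
  identities.\<close>

definition comax :: "complex poly \<Rightarrow> complex poly \<Rightarrow> bool" where
  "comax a b \<longleftrightarrow> (\<exists>u v. u * a + v * b = 1)"

lemma comax_sym: "comax a b \<Longrightarrow> comax b a"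
  unfolding comax_def by (metis add.commute)

lemma comax_mult: "comax a b \<Longrightarrow> comax a c \<Longrightarrow> comax a (b * c)"
proof -
  assume "comax a b" "comax a c"
  then obtain u v u' v' where 1: "u * a + v * b = 1" "u' * a + v' * c = 1" by (auto simp: comax_def)
  \<comment> \<open>The product of the two identities, expanded: every term except the one with
    \<open>b * c\<close> contains the factor \<open>a\<close>.\<close>
  have "(u * u' * a + u * v' * c + v * b * u') * a + (v * v') * (b * c) = (u * a + v * b) * (u' * a + v' * c)"
    by (simp add: algebra_simps)
  also have "\<dots> = 1" by (simp only: 1 mult_1)
  finally show ?thesis unfolding comax_def by blast
qed

lemma comax_one: "comax a 1"
  unfolding comax_def by (rule exI[of _ 0], rule exI[of _ 1]) simp

lemma comax_power: "comax a b \<Longrightarrow> comax a (b ^ n)"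
  by (induction n) (auto intro: comax_mult comax_one)

lemma comax_prod: "finite S \<Longrightarrow> (\<And>s. s \<in> S \<Longrightarrow> comax a (f s)) \<Longrightarrow> comax a (prod f S)"
  by (induction S rule: finite_induct) (auto intro: comax_mult comax_one)

lemma comax_linear:
  assumes "x \<noteq> y"
  shows "comax [:- x, 1:] [:- y, 1:]"
proof -
  obtain c where "c * (y - x) = 1" using assms by (metis eq_iff_diff_eq_0 left_inverse)
  then show ?thesis
    unfolding comax_def by (intro exI[of _ "[:c:]"] exI[of _ "[:- c:]"]) (simp add: one_pCons algebra_simps)
qed

text \<open>At \<open>0\<close> the Laurent polynomial \<open>h\<close> may have a pole, which the
  exponent \<open>M\<close> has to outweigh; at the other points \<open>h\<close> cannot lower the
  order.\<close>

lemma mult_in_germs: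
  assumes "[:- \<nu>, 1:] ^ M dvd p" and "\<And>k. k \<in> Poly_Mapping.keys h \<Longrightarrow> int N \<le> k + int M" and "N \<le> M"
  shows "h * laurent_of_poly p \<in> germs \<nu> N"
proof (cases "\<nu> = 0")
  case True
  obtain q where q: "p = [:0, 1:] ^ M * q" using assms(1) True by auto
  have "laurent_of_poly ([:0, 1:] ^ M) = basis_vec (int M)"
  proof (induction M)
    case (Suc M)
    then show ?case by (simp add: laurent_mult laurent_pCons mult_single)
  qed simp
  then have p: "laurent_of_poly p = basis_vec (int M) * laurent_of_poly q" by (simp add: q laurent_mult)
  have "Poly_Mapping.keys (laurent_of_poly p) \<subseteq> {int M..}"
    by (auto simp: p in_keys_iff lookup_shift lookup_laurent_of_poly split: if_splits)
  then have "Poly_Mapping.keys (h * laurent_of_poly p) \<subseteq> {int N..}"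
    using keys_mult[of h "laurent_of_poly p"] assms(2) by fastforce
  then show ?thesis by (simp add: germs_def True)
next
  case False
  have "linfac \<nu> ^ M dvd laurent_of_poly p"
    using assms(1) by (auto simp: dvd_def laurent_mult laurent_power laurent_lin)
  moreover have "linfac \<nu> ^ N dvd linfac \<nu> ^ M" using assms(3) by (rule le_imp_power_dvd)
  ultimately show ?thesis using False by (auto simp: germs_def intro: dvd_mult dvd_trans)
qed

text \<open>In a Bezout identity \<open>u * a + v * b = 1\<close>, with \<open>a\<close> a power of
  the linear factor at \<open>x\<close> and \<open>b\<close> the product of the powers at the other
  points, \<open>h * v * b\<close> agrees with \<open>h\<close> modulo \<open>a\<close> and is
  divisible by \<open>b\<close>. The point \<open>0\<close> takes part like any other.\<close>

lemma approximation:
  assumes "finite \<Lambda>"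
  obtains g where "g - h \<in> germs x N" and "\<And>\<nu>. \<nu> \<in> \<Lambda> \<Longrightarrow> \<nu> \<noteq> x \<Longrightarrow> g \<in> germs \<nu> N"
proof -
  obtain m where m: "\<And>k. k \<in> Poly_Mapping.keys h \<Longrightarrow> - int m \<le> k"
  proof -
    have "\<exists>m::nat. \<forall>k\<in>S. - int m \<le> k" if "finite S" for S
      using that
    proof induction
      case (insert k S)
      then obtain m where "\<forall>k\<in>S. - int m \<le> k" by blast
      then show ?case by (intro exI[of _ "max m (nat (- k))"]) fastforce
    qed simp
    from this[OF finite_keys[of h]] show thesis using that by blast
  qed
  \<comment> \<open>The summand \<open>m\<close> pays for the pole of \<open>h\<close> at
    \<open>0\<close>.\<close>
  define M where "M = N + m"
  let ?a = "[:- x, 1:] ^ M" and ?b = "\<Prod>\<nu>\<in>\<Lambda> - {x}. [:- \<nu>, 1:] ^ M"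
  have "comax ?a ?b"
    using assms by (intro comax_prod comax_power comax_sym[OF comax_power] comax_linear) auto
  then obtain u v where uv: "u * ?a + v * ?b = 1" by (auto simp: comax_def)
  define g where "g = h * laurent_of_poly (v * ?b)"
  have "h * laurent_of_poly (u * ?a + v * ?b) = h" by (simp add: uv)
  then have "h = h * laurent_of_poly (u * ?a) + g" by (simp add: laurent_add distrib_left g_def)
  then have gh: "g - h = - h * laurent_of_poly (u * ?a)" by (simp add: algebra_simps)
  have hm: "int N \<le> k + int M" if "k \<in> Poly_Mapping.keys h" for k using m[OF that] by (simp add: M_def)
  have "g - h \<in> germs x N"
    unfolding gh by (rule mult_in_germs[of _ M]) (use hm in \<open>simp_all add: M_def\<close>)
  moreover have "g \<in> germs \<nu> N" if "\<nu> \<in> \<Lambda>" "\<nu> \<noteq> x" for \<nu>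
    unfolding g_def
  proof (rule mult_in_germs[of _ M])
    have "[:- \<nu>, 1:] ^ M dvd ?b" using assms that by (intro dvd_prodI) auto
    then show "[:- \<nu>, 1:] ^ M dvd v * ?b" by (rule dvd_mult)
  qed (use hm in \<open>simp_all add: M_def\<close>)
  ultimately show ?thesis by (rule that)
qed

section \<open>Characters\<close>

locale character =
  fixes lam :: complex and n :: nat and mu :: "vir \<Rightarrow> complex"
  assumes lam: "lam \<noteq> 0" and n: "n \<ge> 1"
    and char: "lie_character (Virf ([:- lam, 1:] ^ n)) mu"
begin

lemma mu_add: "x \<in> vanish lam n \<Longrightarrow> y \<in> vanish lam n \<Longrightarrow> mu (x + y) = mu x + mu y"
  and mu_scale: "x \<in> vanish lam n \<Longrightarrow> mu (cscale c x) = c * mu x"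
  and mu_bracket: "x \<in> vanish lam n \<Longrightarrow> y \<in> vanish lam n \<Longrightarrow> mu (vir_bracket x y) = 0"
  using char by (auto simp: lie_character_def Virf_eq)

lemma vz_vanish: "vz \<in> vanish lam k"
  by (simp add: vanish_def)

lemma vanish_scale: "x \<in> vanish lam k \<Longrightarrow> cscale c x \<in> vanish lam k"
  using subspace_vanish cspace.subspace_scale by blast

lemma vanish_diff: "x \<in> vanish lam k \<Longrightarrow> y \<in> vanish lam k \<Longrightarrow> x - y \<in> vanish lam k"
  using subspace_vanish cspace.subspace_diff by blast

lemma mu_diff: "x \<in> vanish lam n \<Longrightarrow> y \<in> vanish lam n \<Longrightarrow> mu (x - y) = mu x - mu y"
  using mu_add[of "x - y" y] vanish_diff[of x n y] by simp

abbreviation "gen a \<equiv> e_of (basis_vec a * linfac lam ^ n)"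

lemma gen_vanish: "gen a \<in> vanish lam n"
  by (simp add: vanish_def)

text \<open>The two terms that contain the derivative of the power of \<open>linfac lam\<close>
  cancel, and only the exponents \<open>a\<close> and \<open>b\<close> are differentiated.\<close>

lemma lau_gen_bracket:
  "lau (vir_bracket (gen a) (gen b)) = cscale (of_int (b - a)) (basis_vec (a + b) * linfac lam ^ (2 * n))"
proof -
  have D: "D (basis_vec a * p) = cscale (of_int a) (basis_vec a * p) + basis_vec a * D p" for a p
    using cscale_mult[of "of_int a" "basis_vec a" p] by (simp add: D_mult)
  have b: "basis_vec (a + b) = basis_vec a * (basis_vec b :: laurent)" by (simp add: mult_single)
  have p2: "linfac lam ^ (2 * n) = linfac lam ^ n * linfac lam ^ n" by (simp add: mult_2 power_add)
  show ?thesis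
    unfolding p2 by (simp add: lau_bracket D b mult_cscale cscale_mult algebra_simps cspace.scale_left_diff_distrib)
qed

lemma linfac_power_coeffs:
  "Poly_Mapping.lookup (linfac lam ^ n) (int n) = 1"
  "k < 0 \<or> k > int n \<Longrightarrow> Poly_Mapping.lookup (linfac lam ^ n) k = 0"
proof -
  have l: "linfac lam ^ n = laurent_of_poly ([:- lam, 1:] ^ n)" by (simp add: laurent_power laurent_lin)
  have d: "Polynomial.degree ([:- lam, 1:] ^ n) = n" by (simp add: degree_power_eq)
  have "Polynomial.coeff ([:- lam, 1:] ^ n) n = 1" using lead_coeff_power[of "[:- lam, 1:]" n] d by simp
  then show "Poly_Mapping.lookup (linfac lam ^ n) (int n) = 1" by (simp add: l lookup_laurent_of_poly)
  show "k < 0 \<or> k > int n \<Longrightarrow> Poly_Mapping.lookup (linfac lam ^ n) k = 0"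
    by (auto simp: l lookup_laurent_of_poly d coeff_eq_0)
qed

text \<open>The exponents of the first factor lie between \<open>c - n\<close> and \<open>c\<close>,
  the negated exponents of the second between \<open>c\<close> and \<open>c + n\<close>. They meet
  only at \<open>c\<close>, where both coefficients are leading coefficients, hence
  \<open>1\<close>.\<close>

lemma central_gen_bracket:
  "Poly_Mapping.lookup (vir_bracket (gen (c - int n)) (gen (- int n - c))) Z = of_int (c ^ 3 - c) / 12"
proof -
  let ?p = "linfac lam ^ n"
  let ?S = "insert c (Poly_Mapping.keys (lau (gen (c - int n))))"
  have "Poly_Mapping.lookup (vir_bracket (gen (c - int n)) (gen (- int n - c))) Z =
      (\<Sum>j\<in>?S. Poly_Mapping.lookup (lau (gen (c - int n))) j * Poly_Mapping.lookup (lau (gen (- int n - c))) (- j)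
        * of_int (j ^ 3 - j) / 12)"
    by (rule lookup_bracket_Z) auto
  also have "\<dots> = (\<Sum>j\<in>?S. if j = c then of_int (c ^ 3 - c) / 12 else 0)"
  proof (rule sum.cong[OF refl])
    fix j
    show "Poly_Mapping.lookup (lau (gen (c - int n))) j * Poly_Mapping.lookup (lau (gen (- int n - c))) (- j)
        * of_int (j ^ 3 - j) / 12 = (if j = c then of_int (c ^ 3 - c) / 12 else 0)"
      using linfac_power_coeffs(2)[of "j - (c - int n)"] linfac_power_coeffs(2)[of "- j - (- int n - c)"]
      by (cases "j = c"; cases "j < c") (auto simp: lookup_shift linfac_power_coeffs(1))
  qed
  also have "\<dots> = of_int (c ^ 3 - c) / 12" by simp
  finally show ?thesis .
qed

text \<open>
  The central element is a combination of the brackets of \<open>gen (c - n)\<close> with \<open>gen (- n - c)\<close>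
  for \<open>c = 1, 2\<close>, as only the top coefficients of \<open>f\<close> enter their central terms.
\<close>

lemma mu_vz: "mu vz = 0"
proof -
  let ?x = "\<lambda>c. vir_bracket (gen (c - int n)) (gen (- int n - c))"
  \<comment> \<open>The Laurent part of \<open>?x c\<close> is \<open>- 2 * c\<close> times a fixed
    element, its central part is \<open>(c^3 - c) / 12\<close>. So in \<open>?x 2\<close> minus
    twice \<open>?x 1\<close> the Laurent parts cancel and the central part is
    \<open>1/2\<close>.\<close>
  have eq: "vz = cscale 2 (?x 2 - cscale 2 (?x 1))"
    by (rule vir_eqI)
      (simp_all add: lau_scale lau_diff lau_gen_bracket lookup_cscale lookup_minus central_gen_bracket lookup_single)
  have v: "?x c \<in> vanish lam n" for c
    by (rule bracket_vanish[OF gen_vanish gen_vanish]) (use n in simp)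
  have "mu (cscale 2 (?x 2 - cscale 2 (?x 1))) = 0"
    by (simp add: mu_scale mu_diff v vanish_diff vanish_scale mu_bracket gen_vanish)
  with eq show ?thesis by simp
qed

text \<open>Up to a central part, on which \<open>mu\<close> is zero, the element
  \<open>e(t^s f^2)\<close> is a nonzero multiple of the bracket of two generators of Vir^f.\<close>

lemma mu_vanish:
  assumes "x \<in> vanish lam (2 * n)"
  shows "mu x = 0"
proof -
  let ?e = "\<lambda>q. e_of (q * linfac lam ^ (2 * n))"
  have e: "?e q \<in> vanish lam n" for q
    by (simp add: vanish_def mult_2 power_add)
  have z: "mu (?e q) = 0" for q
  proof (induction q rule: pm_induct)
    case (basis s)
    \<comment> \<open>Two different exponents with sum \<open>s\<close>, so that the structure
      constant \<open>b - a\<close> can be divided out.\<close>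
    obtain a b where ab: "a + b = s" "b - a \<noteq> 0"
    proof (cases "s = 0")
      case True
      then show ?thesis using that[of 1 "-1"] by simp
    next
      case False
      then show ?thesis using that[of s 0] by simp
    qed
    let ?x = "vir_bracket (gen a) (gen b)"
    have v: "?x \<in> vanish lam n" by (rule bracket_vanish[OF gen_vanish gen_vanish]) (use n in simp)
    have "?e (basis_vec s) = cscale (1 / of_int (b - a)) (?x - cscale (Poly_Mapping.lookup ?x Z) vz)"
      by (rule vir_eqI)
        (use ab in \<open>simp_all add: lau_scale lau_diff lau_gen_bracket lookup_cscale lookup_minus lookup_single\<close>)
    also have "mu \<dots> = 0"
      using v vz_vanish by (simp add: mu_scale mu_diff vanish_diff vanish_scale mu_bracket gen_vanish mu_vz del: cscale_single)
    finally show ?case .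
  next
    case (add p q)
    then show ?case by (simp add: distrib_right e_of_add mu_add e)
  next
    case (scale c p)
    then show ?case by (simp add: cscale_mult e_of_scale mu_scale e)
  qed
  obtain q where q: "lau x = linfac lam ^ (2 * n) * q" using assms by (auto simp: vanish_def)
  have "x = cscale (Poly_Mapping.lookup x Z) vz + ?e q"
    using vir_decomp[of x] by (simp add: q mult.commute del: cscale_single)
  then have "mu x = mu (cscale (Poly_Mapping.lookup x Z) vz + ?e q)" by simp
  also have "\<dots> = 0"
    by (simp add: mu_add mu_scale vz_vanish vanish_scale e mu_vz z del: cscale_single)
  finally show ?thesis .
qed

end

section \<open>Induction from a subalgebra of codimension one\<close>

lemma bracket_self [simp]: "vir_bracket x x = 0"
proof -
  have anti: "vir_bracket x y = - vir_bracket y x" for x y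
  proof (induction x rule: pm_induct)
    case (basis a)
    show ?case
    proof (induction y rule: pm_induct)
      case (basis b)
      show ?case
      proof (cases a; cases b)
        fix j k assume "a = E j" "b = E k"
        then show ?thesis
          by (auto simp: add.commute power3_eq_cube simp flip: single_uminus intro!: poly_mapping_eqI)
            (auto simp: lookup_add lookup_single when_def field_simps)
      qed simp_all
    qed (simp_all add: bracket_add_left bracket_add_right bracket_scale_left bracket_scale_right cspace.scale_minus_right)
  qed (simp_all add: bracket_add_left bracket_add_right bracket_scale_left bracket_scale_right cspace.scale_minus_right)
  have "vir_bracket x x + vir_bracket x x = 0" using anti[of x x] by (metis add.right_inverse)
  then have "2 * Poly_Mapping.lookup (vir_bracket x x) k = 0" for k
    by (metis lookup_add lookup_zero mult_2)
  then show ?thesis by (intro poly_mapping_eqI) simp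
qed

text \<open>The central term of the inner bracket dies in the outer one.\<close>

lemma bracket_ve_ve_ve:
  "vir_bracket (vir_bracket (ve i) (ve j)) (ve k) = cscale (of_int (j - i)) (vir_bracket (ve (i + j)) (ve k))"
  "vir_bracket (ve k) (vir_bracket (ve i) (ve j)) = cscale (of_int (j - i)) (vir_bracket (ve k) (ve (i + j)))"
proof -
  have "vir_bracket (if b then cscale c vz else 0) x = 0" "vir_bracket x (if b then cscale c vz else 0) = 0" for b c x
    by (auto simp: bracket_scale_left bracket_scale_right clin_zero[OF clin_bracket_left] clin_zero[OF clin_bracket_right]
        simp del: cscale_single)
  then show "vir_bracket (vir_bracket (ve i) (ve j)) (ve k) = cscale (of_int (j - i)) (vir_bracket (ve (i + j)) (ve k))"
    "vir_bracket (ve k) (vir_bracket (ve i) (ve j)) = cscale (of_int (j - i)) (vir_bracket (ve k) (ve (i + j)))"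
    unfolding bracket_basis[of "E i" "E j"] vir_basis_bracket.simps
    by (simp_all only: bracket_add_left bracket_add_right bracket_scale_left bracket_scale_right add_0_right)
qed

lemma lookup_bracket_ve: "Poly_Mapping.lookup (vir_bracket (ve i) (ve j)) Z = (if j = - i then of_int (i ^ 3 - i) / 12 else 0)"
  by (auto simp: lookup_add lookup_single)

text \<open>Stated as the derivation property of bracketing with \<open>c\<close>, the form in which
  \<open>defect_raise\<close> uses it. The central parts amount to the 2-cocycle identity, which on
  basis vectors is nontrivial only for indices with sum zero.\<close>

lemma jacobi: "vir_bracket (vir_bracket a b) c = vir_bracket (vir_bracket a c) b + vir_bracket a (vir_bracket b c)"
proof (rule vir_eqI)
  show "lau (vir_bracket (vir_bracket a b) c) = lau (vir_bracket (vir_bracket a c) b + vir_bracket a (vir_bracket b c))"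
    by (simp add: lau_bracket lau_add D_diff D_mult algebra_simps)
  note bl = bracket_add_left bracket_add_right bracket_scale_left bracket_scale_right lookup_add lookup_cscale
    clin_zero[OF clin_bracket_left] clin_zero[OF clin_bracket_right]
  show "Poly_Mapping.lookup (vir_bracket (vir_bracket a b) c) Z =
      Poly_Mapping.lookup (vir_bracket (vir_bracket a c) b + vir_bracket a (vir_bracket b c)) Z"
  proof (induction a rule: pm_induct)
    case (basis a)
    show ?case
    proof (induction b rule: pm_induct)
      case (basis b)
      show ?case
      proof (induction c rule: pm_induct)
        case (basis c)
        show ?case
        proof (cases "a = Z \<or> b = Z \<or> c = Z")
          case True
          then show ?thesis by (auto simp: bl simp del: bracket_basis)
        next
          case False
          then obtain i j k where ijk: "a = E i" "b = E j" "c = E k" by (metis vir_basis.exhaust)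
          show ?thesis
          proof (cases "k = - i - j")
            case True
            show ?thesis
              unfolding ijk True lookup_add bracket_ve_ve_ve lookup_cscale lookup_bracket_ve
              by (simp add: field_simps power3_eq_cube)
          next
            case False
            then show ?thesis
              unfolding ijk lookup_add bracket_ve_ve_ve lookup_cscale lookup_bracket_ve by auto
          qed
        qed
      qed (simp_all add: bl algebra_simps)
    qed (simp_all add: bl algebra_simps)
  qed (simp_all add: bl algebra_simps)
qed

text \<open>
  The polynomials over a space indexed by \<open>nat\<close> are again encoded as a space indexed by \<open>nat\<close>,
  so that all stages of the iterated induction have the same type.
\<close>

type_synonym uspace = "nat \<Rightarrow>\<^sub>0 complex"

text \<open>\<open>level r u\<close> stands for the monomial \<open>u y^r\<close>;
  \<open>raise\<close> is multiplication by \<open>y\<close>, and \<open>coeff_at r\<close> extracts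
  the coefficient of \<open>y^r\<close>.\<close>

definition level :: "nat \<Rightarrow> uspace \<Rightarrow> uspace" where
  "level r = lin_ext (\<lambda>i. basis_vec (prod_encode (r, i)))"

definition raise :: "uspace \<Rightarrow> uspace" where
  "raise = lin_ext (\<lambda>k. basis_vec (prod_encode (Suc (fst (prod_decode k)), snd (prod_decode k))))"

definition coeff_at :: "nat \<Rightarrow> uspace \<Rightarrow> uspace" where
  "coeff_at r = lin_ext (\<lambda>k. if fst (prod_decode k) = r then basis_vec (snd (prod_decode k)) else 0)"

lemma clin_level: "clin (level r)" and clin_raise: "clin raise" and clin_coeff_at: "clin (coeff_at r)"
  unfolding level_def raise_def coeff_at_def by (rule clin_lin_ext)+

lemma level_basis: "basis_vec k = level (fst (prod_decode k)) (basis_vec (snd (prod_decode k)))"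
  by (simp add: level_def)

lemma clin_eq_on_levels:
  assumes "clin f" "clin g" "\<And>r u. f (level r u) = g (level r u)"
  shows "f v = g v"
  by (rule clin_eq_on_basis[OF assms(1,2)]) (metis assms(3) level_basis)

lemma raise_level: "raise (level r u) = level (Suc r) u"
  by (rule clin_eq_on_basis[of _ _ u, OF clin_comp[OF clin_raise clin_level] clin_level])
    (simp add: level_def raise_def)

lemma coeff_at_level: "coeff_at q (level r u) = (if q = r then u else 0)"
proof -
  have "clin (\<lambda>u. if q = r then u else 0)" by (cases "q = r") (simp_all add: clin_id clin_0)
  then show ?thesis
    by (intro clin_eq_on_basis[of _ _ u, OF clin_comp[OF clin_coeff_at clin_level]])
      (auto simp: level_def coeff_at_def)
qed

lemma coeff_at_raise: "coeff_at (Suc q) (raise v) = coeff_at q v" "coeff_at 0 (raise v) = 0"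
proof -
  show "coeff_at (Suc q) (raise v) = coeff_at q v"
    by (rule clin_eq_on_levels[OF clin_comp[OF clin_coeff_at clin_raise] clin_coeff_at]) (simp add: raise_level coeff_at_level)
  show "coeff_at 0 (raise v) = 0"
    by (rule clin_eq_on_levels[OF clin_comp[OF clin_coeff_at clin_raise] clin_0]) (simp add: raise_level coeff_at_level)
qed

lemma lookup_coeff_at: "Poly_Mapping.lookup (coeff_at r v) i = Poly_Mapping.lookup v (prod_encode (r, i))"
proof (induction v rule: pm_induct)
  case (basis k)
  show ?case
    using prod_decode_inverse[of k]
    by (cases "prod_decode k") (auto simp: coeff_at_def lookup_single when_def)
qed (simp_all add: clin_add[OF clin_coeff_at] clin_scale[OF clin_coeff_at] lookup_add lookup_cscale)

lemma coeff_at_eqI: "(\<And>r. coeff_at r v = coeff_at r w) \<Longrightarrow> v = w"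
  by (rule poly_mapping_eqI) (metis lookup_coeff_at prod_decode_inverse surj_pair)

lemma coeff_at_bounded: "\<exists>R. \<forall>r>R. coeff_at r v = 0"
proof (induction v rule: pm_induct)
  case (basis k)
  have "coeff_at r (basis_vec k) = 0" if "r > fst (prod_decode k)" for r using that by (simp add: coeff_at_def)
  then show ?case by blast
next
  case (add p q)
  then obtain R S where "\<forall>r>R. coeff_at r p = 0" "\<forall>r>S. coeff_at r q = 0" by blast
  then show ?case by (intro exI[of _ "max R S"]) (simp add: clin_add[OF clin_coeff_at])
next
  case (scale c p)
  then show ?case by (auto simp: clin_scale[OF clin_coeff_at])
qed

lemma top_component:
  assumes "v \<noteq> 0"
  obtains r where "coeff_at r v \<noteq> 0" "\<And>q. q > r \<Longrightarrow> coeff_at q v = 0"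
proof -
  obtain R where R: "\<forall>r>R. coeff_at r v = 0" using coeff_at_bounded by blast
  obtain r0 where r0: "coeff_at r0 v \<noteq> 0"
    using assms coeff_at_eqI[of v 0] by (auto simp: clin_zero[OF clin_coeff_at])
  let ?A = "{r. coeff_at r v \<noteq> 0}"
  have f: "finite ?A" by (rule finite_subset[of _ "{..R}"]) (use R not_less in auto)
  have "coeff_at (Max ?A) v \<noteq> 0" using Max_in[OF f] r0 by auto
  moreover have "coeff_at q v = 0" if "q > Max ?A" for q
    using Max_ge[OF f, of q] that by (auto simp: not_le)
  ultimately show ?thesis by (rule that)
qed

lemma level_expand:
  assumes "\<And>q. q > r \<Longrightarrow> coeff_at q v = 0"
  shows "v = (\<Sum>q\<le>r. level q (coeff_at q v))"
proof (rule coeff_at_eqI)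
  fix p
  have "coeff_at p (\<Sum>q\<le>r. level q (coeff_at q v)) = (\<Sum>q\<le>r. if p = q then coeff_at q v else 0)"
    by (simp add: clin_sum[OF clin_coeff_at] coeff_at_level)
  also have "\<dots> = coeff_at p v" using assms by (auto simp: not_le)
  finally show "coeff_at p v = coeff_at p (\<Sum>q\<le>r. level q (coeff_at q v))" ..
qed

section \<open>Extending a representation along one new Lie algebra element\<close>

definition vir_rep :: "vir set \<Rightarrow> (vir \<Rightarrow> uspace \<Rightarrow> uspace) \<Rightarrow> bool" where
  "vir_rep H \<rho> \<longleftrightarrow> (\<forall>x\<in>H. clin (\<rho> x)) \<and>
     (\<forall>x\<in>H. \<forall>y\<in>H. \<forall>u. \<rho> (x + y) u = \<rho> x u + \<rho> y u) \<and>
     (\<forall>x\<in>H. \<forall>c u. \<rho> (cscale c x) u = cscale c (\<rho> x u)) \<and>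
     (\<forall>x\<in>H. \<forall>y\<in>H. \<forall>u. \<rho> (vir_bracket x y) u = \<rho> x (\<rho> y u) - \<rho> y (\<rho> x u))"

text \<open>The functional \<open>\<alpha>\<close> has kernel \<open>H'\<close> in \<open>H\<close>
  and is normalised at \<open>y\<close>, so \<open>H\<close> is \<open>H'\<close> plus the line of
  \<open>y\<close>. Since \<open>H'\<close> is a subalgebra but in general no ideal, a bracket with
  \<open>y\<close> may have a component along \<open>y\<close>.\<close>

locale ind_step =
  fixes H H' :: "vir set" and y :: vir and \<alpha> :: "vir \<Rightarrow> complex" and \<rho> :: "vir \<Rightarrow> uspace \<Rightarrow> uspace"
  assumes H_sub: "cspace.subspace H" and H_br: "a \<in> H \<Longrightarrow> b \<in> H \<Longrightarrow> vir_bracket a b \<in> H"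
    and H'_def: "a \<in> H' \<longleftrightarrow> a \<in> H \<and> \<alpha> a = 0"
    and H'_br: "a \<in> H' \<Longrightarrow> b \<in> H' \<Longrightarrow> vir_bracket a b \<in> H'"
    and y: "y \<in> H" "\<alpha> y = 1"
    and \<alpha>_add: "a \<in> H \<Longrightarrow> b \<in> H \<Longrightarrow> \<alpha> (a + b) = \<alpha> a + \<alpha> b"
    and \<alpha>_scale: "a \<in> H \<Longrightarrow> \<alpha> (cscale c a) = c * \<alpha> a"
    and rep: "vir_rep H' \<rho>"
begin

lemma H_add: "a \<in> H \<Longrightarrow> b \<in> H \<Longrightarrow> a + b \<in> H" and H_scale: "a \<in> H \<Longrightarrow> cscale c a \<in> H" and H_0: "0 \<in> H"
  using H_sub cspace.subspace_add cspace.subspace_scale cspace.subspace_0 by blast+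

lemma \<rho>_lin: "a \<in> H' \<Longrightarrow> clin (\<rho> a)" and \<rho>_add: "a \<in> H' \<Longrightarrow> b \<in> H' \<Longrightarrow> \<rho> (a + b) u = \<rho> a u + \<rho> b u"
  and \<rho>_scale: "a \<in> H' \<Longrightarrow> \<rho> (cscale c a) u = cscale c (\<rho> a u)"
  and \<rho>_br: "a \<in> H' \<Longrightarrow> b \<in> H' \<Longrightarrow> \<rho> (vir_bracket a b) u = \<rho> a (\<rho> b u) - \<rho> b (\<rho> a u)"
  using rep by (auto simp: vir_rep_def)

definition proj :: "vir \<Rightarrow> vir" where
  "proj a = a + cscale (- \<alpha> a) y"

lemma proj_H': "a \<in> H \<Longrightarrow> proj a \<in> H'"
  unfolding proj_def H'_def using y by (auto simp: \<alpha>_add \<alpha>_scale H_scale H_add simp del: cspace.scale_minus_left)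

lemma proj_add: "a \<in> H \<Longrightarrow> b \<in> H \<Longrightarrow> proj (a + b) = proj a + proj b"
  by (simp add: proj_def \<alpha>_add cspace.scale_left_distrib algebra_simps)

lemma proj_scale: "a \<in> H \<Longrightarrow> proj (cscale c a) = cscale c (proj a)"
  by (simp add: proj_def \<alpha>_scale cspace.scale_right_diff_distrib)

lemma proj_id: "a \<in> H' \<Longrightarrow> proj a = a"
  by (simp add: proj_def H'_def)

text \<open>The action of \<open>a\<close> on \<open>u y^r\<close> that is forced by
  \<open>a y = y a + [a, y]\<close>, moving \<open>a\<close> past one \<open>y\<close> at a time. In
  degree zero, \<open>a\<close> is split into its multiple of \<open>y\<close> and its projection to
  \<open>H'\<close>, which acts through \<open>\<rho>\<close>.\<close>

primrec R :: "nat \<Rightarrow> vir \<Rightarrow> uspace \<Rightarrow> uspace" where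
  "R 0 a u = cscale (\<alpha> a) (level 1 u) + level 0 (\<rho> (proj a) u)"
| "R (Suc r) a u = raise (R r a u) + R r (vir_bracket a y) u"

lemma R_clin: "a \<in> H \<Longrightarrow> clin (R r a)"
proof (induction r arbitrary: a)
  case 0
  have "clin (\<lambda>u. cscale (\<alpha> a) (level 1 u) + level 0 (\<rho> (proj a) u))"
    by (intro clin_plus clin_cscale_comp clin_comp[OF clin_level] clin_level \<rho>_lin proj_H' 0)
  then show ?case by simp
next
  case (Suc r)
  have "clin (\<lambda>u. raise (R r a u) + R r (vir_bracket a y) u)"
    by (intro clin_plus clin_comp[OF clin_raise] Suc.IH Suc.prems H_br y)
  then show ?case by simp
qed

lemma R_add: "a \<in> H \<Longrightarrow> b \<in> H \<Longrightarrow> R r (a + b) u = R r a u + R r b u"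
  by (induction r arbitrary: a b)
    (simp_all add: \<alpha>_add proj_add \<rho>_add proj_H' cspace.scale_left_distrib clin_add[OF clin_level] clin_add[OF clin_raise]
      bracket_add_left H_br y)

lemma R_scale: "a \<in> H \<Longrightarrow> R r (cscale c a) u = cscale c (R r a u)"
  by (induction r arbitrary: a)
    (simp_all add: \<alpha>_scale proj_scale \<rho>_scale proj_H' cspace.scale_right_distrib clin_scale[OF clin_level] clin_scale[OF clin_raise]
      bracket_scale_left H_br y)

definition ind :: "vir \<Rightarrow> uspace \<Rightarrow> uspace" where
  "ind a = lin_ext (\<lambda>k. R (fst (prod_decode k)) a (basis_vec (snd (prod_decode k))))"

lemma ind_clin: "clin (ind a)"
  unfolding ind_def by (rule clin_lin_ext)

lemma ind_level: "a \<in> H \<Longrightarrow> ind a (level r u) = R r a u"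
  by (rule clin_eq_on_basis[of _ _ u, OF clin_comp[OF ind_clin clin_level] R_clin]) (simp_all add: level_def ind_def)

lemma ind_add: "a \<in> H \<Longrightarrow> b \<in> H \<Longrightarrow> ind (a + b) v = ind a v + ind b v"
  by (rule clin_eq_on_levels[OF ind_clin clin_plus[OF ind_clin ind_clin]]) (simp add: ind_level H_add R_add)

lemma ind_scale: "a \<in> H \<Longrightarrow> ind (cscale c a) v = cscale c (ind a v)"
  by (rule clin_eq_on_levels[OF ind_clin clin_cscale_comp[OF ind_clin]]) (simp add: ind_level H_scale R_scale)

lemma ind_zero: "ind 0 v = 0"
  using ind_scale[OF H_0, of 0] by simp

lemma ind_raise: "a \<in> H \<Longrightarrow> ind a (raise v) = raise (ind a v) + ind (vir_bracket a y) v"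
  by (rule clin_eq_on_levels[OF clin_comp[OF ind_clin clin_raise]
        clin_plus[OF clin_comp[OF clin_raise ind_clin] ind_clin]])
    (simp add: raise_level ind_level H_br y)

lemma ind_y: "ind y v = raise v"
proof (rule clin_eq_on_levels[OF ind_clin clin_raise])
  fix r u
  have p0: "proj y = cscale 0 y" by (simp add: proj_def y)
  have "0 \<in> H'" using proj_H'[OF y(1)] p0 by simp
  then have "\<rho> 0 u = 0" for u using \<rho>_scale[of 0 0 u] by simp
  then have "R r y u = level (Suc r) u"
  proof (induction r)
    case 0
    then show ?case using y p0 by (simp add: clin_zero[OF clin_level])
  next
    case (Suc r)
    then show ?case using R_scale[OF H_0, of r 0 u] by (simp add: raise_level)
  qed
  then show "ind y (level r u) = raise (level r u)" by (simp add: ind_level y raise_level)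
qed

lemma ind_level0: "a \<in> H' \<Longrightarrow> ind a (level 0 u) = level 0 (\<rho> a u)"
  using ind_level[of a 0 u] proj_id[of a] by (simp add: H'_def)

abbreviation "defect a b v \<equiv> ind a (ind b v) - ind b (ind a v) - ind (vir_bracket a b) v"

text \<open>By the Jacobi identity the failure of the bracket relation on \<open>raise v\<close> is
  a combination of such failures on \<open>v\<close>, which sets up an induction on the
  degree.\<close>

lemma defect_raise:
  assumes "a \<in> H" "b \<in> H"
  shows "defect a b (raise v) = raise (defect a b v) + defect (vir_bracket a y) b v + defect a (vir_bracket b y) v"
  using assms y
  by (simp add: ind_raise H_br clin_add[OF ind_clin] clin_diff[OF clin_raise] jacobi[of a b y] ind_add)

lemma bracket_anti: "vir_bracket a b = cscale (- 1) (vir_bracket b a)"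
proof -
  have "vir_bracket (a + b) (a + b) = vir_bracket a b + vir_bracket b a"
    by (simp add: bracket_add_left bracket_add_right del: bracket_self) simp
  then have "vir_bracket a b + vir_bracket b a = 0" by simp
  then show ?thesis by (simp add: eq_neg_iff_add_eq_0)
qed

lemma defect_y: "a \<in> H \<Longrightarrow> defect a y v = 0" "a \<in> H \<Longrightarrow> defect y a v = 0"
proof -
  assume a: "a \<in> H"
  show "defect a y v = 0" by (simp add: ind_y ind_raise a)
  show "defect y a v = 0"
    by (subst bracket_anti) (simp only: ind_scale[OF H_br[OF a y(1)]], simp add: ind_y ind_raise a)
qed

text \<open>The defect is bilinear in \<open>a\<close> and \<open>b\<close>. Splitting both along
  \<open>H'\<close> and \<open>y\<close> leaves a pair in \<open>H'\<close>, settled by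
  \<open>\<rho>\<close> being a representation, and pairs containing \<open>y\<close>, settled in
  every degree by \<open>defect_y\<close>.\<close>

lemma defect_level0:
  assumes "a \<in> H" "b \<in> H"
  shows "defect a b (level 0 u) = 0"
proof -
  have dec: "a = proj a + cscale (\<alpha> a) y" "b = proj b + cscale (\<alpha> b) y" by (simp_all add: proj_def)
  have pH: "proj a \<in> H" "proj b \<in> H" "proj a \<in> H'" "proj b \<in> H'"
    using proj_H' assms by (auto simp: H'_def)
  have 0: "defect (proj a) (proj b) (level 0 u) = 0"
    using pH by (simp add: ind_level0 \<rho>_br H'_br clin_diff[OF clin_level])
  have bil: "defect (p + cscale c y) (q + cscale d y) v = defect p q v + cscale c (defect y q v)
      + cscale d (defect p y v) + cscale (c * d) (defect y y v)" if "p \<in> H" "q \<in> H" for p q c d v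
  proof -
    have "vir_bracket (p + cscale c y) (q + cscale d y) =
        vir_bracket p q + cscale c (vir_bracket y q) + cscale d (vir_bracket p y) + cscale (c * d) (vir_bracket y y)"
      by (simp add: bracket_add_left bracket_add_right bracket_scale_left bracket_scale_right cspace.scale_right_distrib
          add_ac del: bracket_self)
    then show ?thesis
      using that y
      by (simp add: ind_add ind_scale H_add H_scale H_br clin_add[OF ind_clin] clin_scale[OF ind_clin]
          cspace.scale_right_distrib cspace.scale_right_diff_distrib algebra_simps del: bracket_self)
  qed
  show ?thesis
    by (subst (1 2 3) dec(1), subst (1 2 3) dec(2)) (simp only: bil[OF pH(1,2)], simp add: 0 defect_y pH y ind_zero)
qed

lemma ind_bracket:
  assumes "a \<in> H" "b \<in> H"
  shows "ind (vir_bracket a b) v = ind a (ind b v) - ind b (ind a v)"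
proof (rule clin_eq_on_levels[OF ind_clin clin_minus[OF clin_comp[OF ind_clin ind_clin] clin_comp[OF ind_clin ind_clin]]])
  fix r u
  have "defect a b (level r u) = 0"
    using assms
  proof (induction r arbitrary: a b)
    case 0
    then show ?case by (rule defect_level0)
  next
    case (Suc r)
    have *: "defect a b (level r u) = 0" "defect (vir_bracket a y) b (level r u) = 0" "defect a (vir_bracket b y) (level r u) = 0"
      using Suc.IH Suc.prems H_br y by blast+
    show ?case
      unfolding raise_level[symmetric] defect_raise[OF Suc.prems] * by (simp add: clin_zero[OF clin_raise])
  qed
  then show "ind (vir_bracket a b) (level r u) = ind a (ind b (level r u)) - ind b (ind a (level r u))" by simp
qed

lemma ind_rep: "vir_rep H ind"
  unfolding vir_rep_def using ind_clin ind_add ind_scale ind_bracket by blast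

lemma coeff_at_R_high: "a \<in> H \<Longrightarrow> q > Suc r \<Longrightarrow> coeff_at q (R r a u) = 0"
proof (induction r arbitrary: a q)
  case 0
  then show ?case by (simp add: clin_add[OF clin_coeff_at] clin_scale[OF clin_coeff_at] coeff_at_level)
next
  case (Suc r)
  then obtain p where "q = Suc p" "p > Suc r" by (cases q) auto
  with Suc show ?case by (simp add: clin_add[OF clin_coeff_at] coeff_at_raise H_br y)
qed

lemma coeff_at_R_top: "a \<in> H \<Longrightarrow> coeff_at (Suc r) (R r a u) = cscale (\<alpha> a) u"
proof (induction r arbitrary: a)
  case 0
  then show ?case by (simp add: clin_add[OF clin_coeff_at] clin_scale[OF clin_coeff_at] coeff_at_level)
next
  case (Suc r)
  then show ?case by (simp add: clin_add[OF clin_coeff_at] coeff_at_raise coeff_at_R_high H_br y)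
qed

text \<open>Moving \<open>a\<close> past each of the \<open>r\<close> factors \<open>y\<close>
  leaves a bracket \<open>[a, y]\<close>, whose component along \<open>y\<close> restores the lost
  degree. The \<open>r\<close> contributions add up to the shift.\<close>

lemma coeff_at_R_same:
  assumes "a \<in> H'"
  shows "coeff_at r (R r a u) = \<rho> a u + cscale (of_nat r * \<alpha> (vir_bracket a y)) u"
proof (induction r)
  case 0
  then show ?case using assms by (simp add: clin_add[OF clin_coeff_at] clin_scale[OF clin_coeff_at] coeff_at_level proj_id)
next
  case (Suc r)
  have "a \<in> H" using assms by (simp add: H'_def)
  then show ?case
    using Suc by (simp add: clin_add[OF clin_coeff_at] coeff_at_raise coeff_at_R_top H_br y algebra_simps cspace.scale_left_distrib)
qed

lemma coeff_at_ind_top: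
  assumes "a \<in> H" "\<And>q. q > r \<Longrightarrow> coeff_at q v = 0"
  shows "coeff_at (Suc r) (ind a v) = cscale (\<alpha> a) (coeff_at r v)"
proof -
  have "coeff_at (Suc r) (ind a (\<Sum>q\<le>r. level q (coeff_at q v))) = (\<Sum>q\<le>r. coeff_at (Suc r) (R q a (coeff_at q v)))"
    by (simp add: clin_sum[OF clin_coeff_at] clin_sum[OF ind_clin] ind_level assms(1))
  also have "\<dots> = (\<Sum>q\<le>r. if q = r then cscale (\<alpha> a) (coeff_at r v) else 0)"
    by (rule sum.cong) (auto simp: coeff_at_R_top coeff_at_R_high assms(1))
  finally show ?thesis using level_expand[OF assms(2)] by simp
qed

lemma coeff_at_ind_same:
  assumes "a \<in> H'" "\<And>q. q > r \<Longrightarrow> coeff_at q v = 0"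
  shows "coeff_at r (ind a v) = \<rho> a (coeff_at r v) + cscale (of_nat r * \<alpha> (vir_bracket a y)) (coeff_at r v)"
proof -
  have aH: "a \<in> H" "\<alpha> a = 0" using assms(1) by (auto simp: H'_def)
  have low: "coeff_at r (R q a u) = 0" if "q < r" for q u
    using coeff_at_R_high[OF aH(1), of q r u] coeff_at_R_top[OF aH(1), of q u] aH(2) that by (cases "r = Suc q") auto
  have "coeff_at r (ind a (\<Sum>q\<le>r. level q (coeff_at q v))) = (\<Sum>q\<le>r. coeff_at r (R q a (coeff_at q v)))"
    by (simp add: clin_sum[OF clin_coeff_at] clin_sum[OF ind_clin] ind_level aH)
  also have "\<dots> = (\<Sum>q\<le>r. if q = r then \<rho> a (coeff_at r v) + cscale (of_nat r * \<alpha> (vir_bracket a y)) (coeff_at r v) else 0)"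
    by (rule sum.cong) (auto simp: coeff_at_R_same[OF assms(1)] low)
  finally show ?thesis using level_expand[OF assms(2)] by simp
qed

text \<open>Compare leading coefficients. If \<open>\<alpha> a\<close> is nonzero, \<open>a\<close>
  raises the degree and no eigenvector is possible; otherwise the leading coefficient is an
  eigenvector of \<open>\<rho> a\<close> for a shifted eigenvalue, which is why \<open>inj\<close>
  speaks of all \<open>d\<close>.\<close>

lemma ind_shifted_injective:
  assumes a: "a \<in> H" and eig: "ind a v = cscale c v"
    and inj: "a \<in> H' \<Longrightarrow> (\<And>d u. \<rho> a u = cscale d u \<Longrightarrow> u = 0)"
  shows "v = 0"
proof (rule ccontr)
  assume "v \<noteq> 0"
  then obtain r where r: "coeff_at r v \<noteq> 0" "\<And>q. q > r \<Longrightarrow> coeff_at q v = 0" using top_component by blast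
  show False
  proof (cases "\<alpha> a = 0")
    case False
    have "cscale (\<alpha> a) (coeff_at r v) = 0"
      using coeff_at_ind_top[OF a, of r v, OF r(2)] r(2)[of "Suc r"] by (simp add: eig clin_scale[OF clin_coeff_at])
    then show False using False r(1) by simp
  next
    case True
    then have aH: "a \<in> H'" using a by (simp add: H'_def)
    let ?d = "c - of_nat r * \<alpha> (vir_bracket a y)"
    have "\<rho> a (coeff_at r v) = cscale ?d (coeff_at r v)"
      using coeff_at_ind_same[OF aH, of r v, OF r(2)] by (simp add: eig clin_scale[OF clin_coeff_at] cspace.scale_left_diff_distrib)
    then show False using inj[OF aH] r(1) by blast
  qed
qed

text \<open>The vector \<open>u\<close> is the leading coefficient of \<open>v\<close> and
  \<open>r\<close> its degree.\<close>

lemma ind_eigenvector: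
  assumes "K \<subseteq> H'" "v \<noteq> 0" "\<And>a. a \<in> K \<Longrightarrow> ind a v = cscale (\<nu> a) v"
  obtains r u where "u \<noteq> 0" "\<And>a. a \<in> K \<Longrightarrow> \<rho> a u = cscale (\<nu> a - of_nat r * \<alpha> (vir_bracket a y)) u"
proof -
  obtain r where r: "coeff_at r v \<noteq> 0" "\<And>q. q > r \<Longrightarrow> coeff_at q v = 0" using top_component[OF assms(2)] by blast
  have "\<rho> a (coeff_at r v) = cscale (\<nu> a - of_nat r * \<alpha> (vir_bracket a y)) (coeff_at r v)" if "a \<in> K" for a
    using coeff_at_ind_same[of a r v] r(2) assms(1,3) that
    by (auto simp: clin_scale[OF clin_coeff_at] cspace.scale_left_diff_distrib)
  with r(1) show ?thesis by (rule that)
qed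

end

section \<open>Cyclic submodules and the injectivity of maps out of them\<close>

inductive_set cyc :: "'v vmod \<Rightarrow> vir set \<Rightarrow> 'v \<Rightarrow> 'v set" for M H w where
  cyc_gen: "w \<in> cyc M H w"
| cyc_add: "u \<in> cyc M H w \<Longrightarrow> v \<in> cyc M H w \<Longrightarrow> u \<oplus>\<^bsub>M\<^esub> v \<in> cyc M H w"
| cyc_scale: "u \<in> cyc M H w \<Longrightarrow> c \<odot>\<^bsub>M\<^esub> u \<in> cyc M H w"
| cyc_act: "x \<in> H \<Longrightarrow> u \<in> cyc M H w \<Longrightarrow> act M x u \<in> cyc M H w"

text \<open>The domain is \<open>U(H) w\<close> instead of the carrier of \<open>M\<close>, so that
  one module provides a domain for every subalgebra of the chain.\<close>

definition cyc_hom :: "'v vmod \<Rightarrow> vir set \<Rightarrow> 'v \<Rightarrow> (vir \<Rightarrow> uspace \<Rightarrow> uspace) \<Rightarrow> ('v \<Rightarrow> uspace) \<Rightarrow> bool" where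
  "cyc_hom M H w \<rho> \<Phi> \<longleftrightarrow>
     (\<forall>u\<in>cyc M H w. \<forall>v\<in>cyc M H w. \<Phi> (u \<oplus>\<^bsub>M\<^esub> v) = \<Phi> u + \<Phi> v) \<and>
     (\<forall>c. \<forall>u\<in>cyc M H w. \<Phi> (c \<odot>\<^bsub>M\<^esub> u) = cscale c (\<Phi> u)) \<and>
     (\<forall>x\<in>H. \<forall>u\<in>cyc M H w. \<Phi> (act M x u) = \<rho> x (\<Phi> u))"

locale vir_mod = lin_act_mod M for M :: "'v vmod" (structure) +
  assumes act_plus: "v \<in> carrier M \<Longrightarrow> act M (x + y) v = act M x v \<oplus> act M y v"
    and act_cscale: "v \<in> carrier M \<Longrightarrow> act M (cscale c x) v = c \<odot> act M x v"
    and act_bracket: "v \<in> carrier M \<Longrightarrow> act M (vir_bracket x y) v = act M x (act M y v) \<ominus> act M y (act M x v)"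
begin

lemma cyc_carrier:
  assumes "w \<in> carrier M" "u \<in> cyc M H w"
  shows "u \<in> carrier M"
  using assms(2) by induction (use assms(1) in auto)

lemma act_zero_left [simp]: "v \<in> carrier M \<Longrightarrow> act M 0 v = \<zero>"
  using act_cscale[of v 0 0] by simp

lemma act_act: "v \<in> carrier M \<Longrightarrow> act M x (act M y v) = act M y (act M x v) \<oplus> act M (vir_bracket x y) v"
proof -
  assume v: "v \<in> carrier M"
  have "act M y (act M x v) \<oplus> act M (vir_bracket x y) v = act M x (act M y v) \<ominus> act M y (act M x v) \<oplus> act M y (act M x v)"
    using v by (simp add: act_bracket a_comm)
  also have "\<dots> = act M x (act M y v)" using v by (simp add: minus_eq a_assoc l_neg)
  finally show ?thesis ..
qed

lemma cyc_mono:
  assumes "H \<subseteq> H'" "u \<in> cyc M H w"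
  shows "u \<in> cyc M H' w"
  using assms(2) by induction (use assms(1) in \<open>auto intro: cyc.intros\<close>)

end

lemma vir_module_vir_mod: "vir_module M \<Longrightarrow> vir_mod M"
  unfolding vir_mod_def vir_mod_axioms_def
  using lin_act_mod[OF vir_module_lin_act] by (auto simp: vir_module_def)

context ind_step
begin

text \<open>Every vector of \<open>U(H) w\<close> is a polynomial in \<open>y\<close> with
  coefficients in \<open>U(H') w\<close>, and \<open>\<Phi>\<close> sends it to the polynomial whose
  coefficients are the images. Hence injectivity one step down suffices, for the restriction of
  \<open>\<Phi>\<close> to \<open>U(H') w\<close>.\<close>

lemma cyc_hom_injective:
  assumes "vir_mod M" "w \<in> carrier M" "cyc_hom M H w ind \<Phi>" "\<Phi> w = level 0 \<omega>"
    and inj: "\<And>\<Psi>. cyc_hom M H' w \<rho> \<Psi> \<Longrightarrow> \<Psi> w = \<omega> \<Longrightarrow> \<forall>v\<in>cyc M H' w. \<Psi> v = 0 \<longrightarrow> v = \<zero>\<^bsub>M\<^esub>"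
    and v: "v \<in> cyc M H w" "\<Phi> v = 0"
  shows "v = \<zero>\<^bsub>M\<^esub>"
proof -
  interpret M: vir_mod M by fact
  have HH: "H' \<subseteq> H" by (auto simp: H'_def)
  have c': "u \<in> carrier M" if "u \<in> cyc M H' w" for u using M.cyc_carrier[OF assms(2) that] .
  have mono: "u \<in> cyc M H w" if "u \<in> cyc M H' w" for u using M.cyc_mono[OF HH that] .
  have \<Phi>: "\<And>u v. u \<in> cyc M H w \<Longrightarrow> v \<in> cyc M H w \<Longrightarrow> \<Phi> (u \<oplus>\<^bsub>M\<^esub> v) = \<Phi> u + \<Phi> v"
    "\<And>c u. u \<in> cyc M H w \<Longrightarrow> \<Phi> (c \<odot>\<^bsub>M\<^esub> u) = cscale c (\<Phi> u)"
    "\<And>x u. x \<in> H \<Longrightarrow> u \<in> cyc M H w \<Longrightarrow> \<Phi> (act M x u) = ind x (\<Phi> u)"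
    using assms(3) by (auto simp: cyc_hom_def)
  \<comment> \<open>On \<open>U(H') w\<close> the values of \<open>\<Phi>\<close> are constant
    polynomials, so taking the constant coefficient gives a map one step down without loss.\<close>
  have lev: "\<Phi> u = level 0 (coeff_at 0 (\<Phi> u))" if "u \<in> cyc M H' w" for u
    using that
  proof induction
    case cyc_gen
    then show ?case by (simp add: assms(4) coeff_at_level)
  next
    case (cyc_add u v)
    then show ?case
      by (simp add: \<Phi>(1) mono clin_add[OF clin_coeff_at] clin_add[OF clin_level])
  next
    case (cyc_scale u c)
    then show ?case by (simp add: \<Phi>(2) mono clin_scale[OF clin_coeff_at] clin_scale[OF clin_level])
  next
    case (cyc_act x u)
    have "\<Phi> (act M x u) = ind x (\<Phi> u)" by (rule \<Phi>(3)) (use cyc_act HH mono in auto)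
    also have "\<dots> = ind x (level 0 (coeff_at 0 (\<Phi> u)))" using cyc_act.IH by (rule arg_cong)
    also have "\<dots> = level 0 (\<rho> x (coeff_at 0 (\<Phi> u)))" by (rule ind_level0[OF cyc_act.hyps(1)])
    finally show ?case by (simp add: coeff_at_level)
  qed
  have "cyc_hom M H' w \<rho> (\<lambda>u. coeff_at 0 (\<Phi> u))"
    unfolding cyc_hom_def
  proof (intro conjI ballI allI)
    fix u v assume "u \<in> cyc M H' w" "v \<in> cyc M H' w"
    then show "coeff_at 0 (\<Phi> (u \<oplus>\<^bsub>M\<^esub> v)) = coeff_at 0 (\<Phi> u) + coeff_at 0 (\<Phi> v)"
      by (simp add: \<Phi>(1) mono clin_add[OF clin_coeff_at])
  next
    fix c u assume "u \<in> cyc M H' w"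
    then show "coeff_at 0 (\<Phi> (c \<odot>\<^bsub>M\<^esub> u)) = cscale c (coeff_at 0 (\<Phi> u))"
      by (simp add: \<Phi>(2) mono clin_scale[OF clin_coeff_at])
  next
    fix x u assume *: "x \<in> H'" "u \<in> cyc M H' w"
    have "\<Phi> (act M x u) = ind x (\<Phi> u)" by (rule \<Phi>(3)) (use * HH mono in auto)
    also have "\<dots> = ind x (level 0 (coeff_at 0 (\<Phi> u)))" using lev[OF *(2)] by (rule arg_cong)
    finally show "coeff_at 0 (\<Phi> (act M x u)) = \<rho> x (coeff_at 0 (\<Phi> u))" by (simp add: ind_level0 * coeff_at_level)
  qed
  then have inj': "\<forall>u\<in>cyc M H' w. coeff_at 0 (\<Phi> u) = 0 \<longrightarrow> u = \<zero>\<^bsub>M\<^esub>"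
    by (rule inj) (simp add: assms(4) coeff_at_level)
  \<comment> \<open>The vectors in Horner form \<open>u\<^sub>0 + y (u\<^sub>1 + y (u\<^sub>2 + \<dots>))\<close> exhaust the cyclic submodule.\<close>
  define B where "B = rec_nat (cyc M H' w) (\<lambda>_ S. {u \<oplus>\<^bsub>M\<^esub> act M y v | u v. u \<in> cyc M H' w \<and> v \<in> S})"
  have B0: "B 0 = cyc M H' w" and BS: "B (Suc k) = {u \<oplus>\<^bsub>M\<^esub> act M y v | u v. u \<in> cyc M H' w \<and> v \<in> B k}" for k
    by (simp_all add: B_def)
  have z: "\<zero>\<^bsub>M\<^esub> \<in> cyc M H' w"
    using cyc_scale[OF cyc_gen[of w M H'], of 0] assms(2) by simp
  have Bcyc: "u \<in> cyc M H w" if "u \<in> B k" for k u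
    using that by (induction k arbitrary: u) (auto simp: B0 BS mono intro!: cyc_add cyc_act[OF y(1)])
  have Bcar: "u \<in> carrier M" if "u \<in> B k" for k u
    using M.cyc_carrier[OF assms(2) Bcyc[OF that]] .
  have B_up: "u \<in> B (Suc k)" if "u \<in> B k" for k u
    using that
  proof (induction k arbitrary: u)
    case 0
    then have "u = u \<oplus>\<^bsub>M\<^esub> act M y \<zero>\<^bsub>M\<^esub>" using c' by (simp add: B0)
    then show ?case using 0 z unfolding BS B0 by blast
  next
    case (Suc k)
    obtain a b where "u = a \<oplus>\<^bsub>M\<^esub> act M y b" "a \<in> cyc M H' w" "b \<in> B k" using Suc.prems by (auto simp: BS)
    then show ?case using Suc.IH[of b] by (subst BS) blast
  qed
  have B_mono: "u \<in> B l" if "u \<in> B k" "k \<le> l" for u k l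
    using that(2,1) by (induction rule: dec_induct) (auto intro: B_up)
  have B_add: "u \<oplus>\<^bsub>M\<^esub> v \<in> B k" if "u \<in> B k" "v \<in> B k" for u v k
    using that
  proof (induction k arbitrary: u v)
    case 0
    then show ?case by (simp add: B0 cyc_add)
  next
    case (Suc k)
    obtain a b where u: "u = a \<oplus>\<^bsub>M\<^esub> act M y b" "a \<in> cyc M H' w" "b \<in> B k" using Suc.prems(1) by (auto simp: BS)
    obtain c d where v: "v = c \<oplus>\<^bsub>M\<^esub> act M y d" "c \<in> cyc M H' w" "d \<in> B k" using Suc.prems(2) by (auto simp: BS)
    have "u \<oplus>\<^bsub>M\<^esub> v = (a \<oplus>\<^bsub>M\<^esub> c) \<oplus>\<^bsub>M\<^esub> act M y (b \<oplus>\<^bsub>M\<^esub> d)"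
      using u v Bcar c' by (simp add: M.act_add M.a_ac)
    moreover have "a \<oplus>\<^bsub>M\<^esub> c \<in> cyc M H' w" "b \<oplus>\<^bsub>M\<^esub> d \<in> B k" using u v Suc.IH by (auto intro: cyc_add)
    ultimately show ?case unfolding BS by blast
  qed
  have B_scale: "c \<odot>\<^bsub>M\<^esub> u \<in> B k" if "u \<in> B k" for c u k
    using that
  proof (induction k arbitrary: u)
    case 0
    then show ?case by (simp add: B0 cyc_scale)
  next
    case (Suc k)
    obtain a b where u: "u = a \<oplus>\<^bsub>M\<^esub> act M y b" "a \<in> cyc M H' w" "b \<in> B k" using Suc.prems(1) by (auto simp: BS)
    have "c \<odot>\<^bsub>M\<^esub> u = c \<odot>\<^bsub>M\<^esub> a \<oplus>\<^bsub>M\<^esub> act M y (c \<odot>\<^bsub>M\<^esub> b)"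
      using u Bcar c' by (simp add: M.act_scale M.sm_add_right)
    moreover have "c \<odot>\<^bsub>M\<^esub> a \<in> cyc M H' w" "c \<odot>\<^bsub>M\<^esub> b \<in> B k" using u Suc.IH by (auto intro: cyc_scale)
    ultimately show ?case unfolding BS by blast
  qed
  have B_y: "act M y u \<in> B (Suc k)" if "u \<in> B k" for u k
  proof -
    have "act M y u = \<zero>\<^bsub>M\<^esub> \<oplus>\<^bsub>M\<^esub> act M y u" using Bcar[OF that] by simp
    then show ?thesis using that z unfolding BS by blast
  qed
  have split: "act M x u = act M (proj x) u \<oplus>\<^bsub>M\<^esub> \<alpha> x \<odot>\<^bsub>M\<^esub> act M y u" if "u \<in> carrier M" for x u
  proof -
    have "x = proj x + cscale (\<alpha> x) y" by (simp add: proj_def)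
    then have "act M x u = act M (proj x + cscale (\<alpha> x) y) u" by simp
    then show ?thesis using that by (simp add: M.act_plus M.act_cscale)
  qed
  \<comment> \<open>An element of \<open>H\<close> lengthens a Horner form by at most one: it is
    moved past \<open>y\<close>, and the bracket that appears acts on a shorter form.\<close>
  have B_act: "act M x u \<in> B (Suc k)" if "x \<in> H" "u \<in> B k" for x u k
    using that
  proof (induction k arbitrary: u x)
    case 0
    then have u: "u \<in> cyc M H' w" by (simp add: B0)
    have p0: "act M (proj x) u \<in> B 0" unfolding B0 by (rule cyc_act[OF proj_H'[OF 0(1)] u])
    show ?case
      by (subst split[OF c'[OF u]]) (rule B_add[OF B_up[OF p0] B_scale[OF B_y[OF 0(2)]]])
  next
    case (Suc k)
    obtain a b where u: "u = a \<oplus>\<^bsub>M\<^esub> act M y b" "a \<in> cyc M H' w" "b \<in> B k" using Suc.prems(2) by (auto simp: BS)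
    have cab: "a \<in> carrier M" "b \<in> carrier M" using c' Bcar u by auto
    have p0: "act M (proj x) a \<in> B 0" unfolding B0 by (rule cyc_act[OF proj_H'[OF Suc.prems(1)] u(2)])
    have p1: "act M y a \<in> B (Suc 0)" by (rule B_y) (simp add: B0 u(2))
    have 1: "act M x a \<in> B (Suc (Suc k))"
      by (subst split[OF cab(1)], rule B_add[OF B_mono[OF p0] B_scale[OF B_mono[OF p1]]]) auto
    have 2: "act M y (act M x b) \<in> B (Suc (Suc k))" by (rule B_y[OF Suc.IH[OF Suc.prems(1) u(3)]])
    have 3: "act M (vir_bracket x y) b \<in> B (Suc (Suc k))"
      by (rule B_up[OF Suc.IH[OF H_br[OF Suc.prems(1) y(1)] u(3)]])
    have "act M x u = act M x a \<oplus>\<^bsub>M\<^esub> (act M y (act M x b) \<oplus>\<^bsub>M\<^esub> act M (vir_bracket x y) b)"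
      using cab by (simp add: u(1) M.act_add M.act_act[of b x y])
    then show ?case using B_add[OF 1 B_add[OF 2 3]] by simp
  qed
  have ex: "\<exists>k. u \<in> B k" if "u \<in> cyc M H w" for u
    using that
  proof induction
    case cyc_gen
    show ?case by (rule exI[of _ 0]) (simp add: B0 cyc.cyc_gen)
  next
    case (cyc_add u v)
    then obtain k l where "u \<in> B k" "v \<in> B l" by blast
    then have "u \<in> B (max k l)" "v \<in> B (max k l)" by (auto elim: B_mono)
    then show ?case by (blast intro: B_add)
  next
    case (cyc_scale u c)
    then show ?case by (blast intro: B_scale)
  next
    case (cyc_act x u)
    then show ?case by (blast intro: B_act)
  qed
  have "u = \<zero>\<^bsub>M\<^esub>" if "u \<in> B k" "\<Phi> u = 0" for u k
    using that
  proof (induction k arbitrary: u)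
    case 0
    then show ?case using inj' by (simp add: B0 clin_zero[OF clin_coeff_at])
  next
    case (Suc k)
    obtain a b where u: "u = a \<oplus>\<^bsub>M\<^esub> act M y b" "a \<in> cyc M H' w" "b \<in> B k" using Suc.prems(1) by (auto simp: BS)
    have b: "b \<in> cyc M H w" "a \<in> cyc M H w" "act M y b \<in> cyc M H w"
      by (rule Bcyc[OF u(3)] mono[OF u(2)] cyc_act[OF y(1) Bcyc[OF u(3)]])+
    \<comment> \<open>A constant plus a multiple of \<open>y\<close> is zero only if both are; the
      constant part is treated by \<open>inj'\<close> and the rest by the induction
      hypothesis.\<close>
    have sum: "level 0 (coeff_at 0 (\<Phi> a)) + raise (\<Phi> b) = 0"
      using Suc.prems(2) b by (simp add: u(1) \<Phi> y(1) ind_y flip: lev[OF u(2)])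
    have a0: "coeff_at 0 (\<Phi> a) = 0"
      using arg_cong[OF sum, of "coeff_at 0"]
      by (simp add: clin_add[OF clin_coeff_at] coeff_at_level coeff_at_raise clin_zero[OF clin_coeff_at])
    then have "a = \<zero>\<^bsub>M\<^esub>" using inj' u(2) by blast
    moreover have "\<Phi> b = 0"
    proof (rule coeff_at_eqI)
      fix r
      have "raise (\<Phi> b) = 0" using sum a0 by (simp add: clin_zero[OF clin_level])
      then show "coeff_at r (\<Phi> b) = coeff_at r 0"
        using coeff_at_raise(1)[of r "\<Phi> b"] by (simp add: clin_zero[OF clin_coeff_at])
    qed
    then have "b = \<zero>\<^bsub>M\<^esub>" using Suc.IH u(3) by blast
    ultimately show ?case using u(1) by simp
  qed
  then show ?thesis using ex[OF v(1)] v(2) by blast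
qed

end

section \<open>The iterated induction from a character\<close>

context character
begin

text \<open>
  The shift of the character of \<open>vanish lam n\<close> caused by one application of an element that does
  not vanish at \<open>lam\<close>. Elements of positive order cause no shift.
\<close>

definition weight :: "vir \<Rightarrow> complex" where
  "weight x = taylor lam 0 (vir_bracket x (e_of (linfac lam ^ 0)))"

text \<open>The invariant of the downward induction on \<open>s\<close>. Injectivity is demanded for
  every equivariant map that sends \<open>w\<close> to \<open>\<omega>\<close>, because a map at one
  stage restricts to some map of this kind at the stage before, not to a prescribed one.\<close>

definition tower :: "'v vmod \<Rightarrow> 'v \<Rightarrow> nat \<Rightarrow> (vir \<Rightarrow> uspace \<Rightarrow> uspace) \<Rightarrow> uspace \<Rightarrow> bool" where
  "tower M w s \<rho> \<omega> \<longleftrightarrow>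
     vir_rep (vanish lam s) \<rho> \<and> \<omega> \<noteq> 0 \<and> (\<forall>x\<in>vanish lam n. \<rho> x \<omega> = cscale (mu x) \<omega>) \<and>
     (\<forall>x\<in>vanish lam s - vanish lam n. \<forall>c v. \<rho> x v = cscale c v \<longrightarrow> v = 0) \<and>
     (\<forall>\<nu> v. v \<noteq> 0 \<longrightarrow> (\<forall>x\<in>vanish lam n. \<rho> x v = cscale (\<nu> x) v) \<longrightarrow>
        (\<exists>r::nat. \<forall>x\<in>vanish lam n. \<nu> x = mu x + of_nat r * weight x)) \<and>
     (\<forall>\<Phi>. cyc_hom M (vanish lam s) w \<rho> \<Phi> \<longrightarrow> \<Phi> w = \<omega> \<longrightarrow> (\<forall>v\<in>cyc M (vanish lam s) w. \<Phi> v = 0 \<longrightarrow> v = \<zero>\<^bsub>M\<^esub>))"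

text \<open>At the start all of \<open>uspace\<close> is acted on by scalars. Every nonzero vector
  has character \<open>mu\<close>, so the eigenvector clause holds with \<open>r = 0\<close>, while
  the cyclic module of \<open>w\<close> is a line and maps to the line of
  \<open>basis_vec 0\<close>.\<close>

lemma tower_base:
  assumes "vir_mod M" "w \<in> carrier M" "\<And>x. x \<in> vanish lam n \<Longrightarrow> act M x w = mu x \<odot>\<^bsub>M\<^esub> w"
  shows "tower M w n (\<lambda>x. cscale (mu x)) (basis_vec 0)"
  unfolding tower_def
proof (intro conjI allI impI ballI)
  interpret M: vir_mod M by fact
  show "vir_rep (vanish lam n) (\<lambda>x. cscale (mu x))"
    unfolding vir_rep_def
    by (auto simp: clin_cscale mu_add mu_scale mu_bracket cspace.scale_left_distrib mult.commute)
  show "(basis_vec 0 :: uspace) \<noteq> 0" by (metis keys_single keys_zero insert_not_empty zero_neq_one)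
  show "cscale (mu x) (basis_vec 0) = cscale (mu x) (basis_vec 0)" for x ..
  show "v = 0" if "x \<in> vanish lam n - vanish lam n" for x and v :: uspace using that by simp
  show "\<exists>r::nat. \<forall>x\<in>vanish lam n. \<nu> x = mu x + of_nat r * weight x"
    if "v \<noteq> 0" "\<forall>x\<in>vanish lam n. cscale (mu x) v = cscale (\<nu> x) v" for \<nu> and v :: uspace
    using that by (intro exI[of _ 0]) auto
  fix \<Phi> v
  assume \<Phi>: "cyc_hom M (vanish lam n) w (\<lambda>x. cscale (mu x)) \<Phi>" "\<Phi> w = basis_vec 0"
    and v: "v \<in> cyc M (vanish lam n) w" "\<Phi> v = 0"
  have "\<exists>c. v = c \<odot>\<^bsub>M\<^esub> w"
    using v(1)
  proof induction
    case cyc_gen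
    then show ?case using assms(2) by (intro exI[of _ 1]) simp
  next
    case (cyc_add u v)
    then obtain a b where "u = a \<odot>\<^bsub>M\<^esub> w" "v = b \<odot>\<^bsub>M\<^esub> w" by blast
    then show ?case using assms(2) by (intro exI[of _ "a + b"]) (simp add: M.sm_add_left)
  next
    case (cyc_scale u c)
    then obtain a where "u = a \<odot>\<^bsub>M\<^esub> w" by blast
    then show ?case using assms(2) by (intro exI[of _ "c * a"]) (simp add: M.sm_sm)
  next
    case (cyc_act x u)
    then obtain a where "u = a \<odot>\<^bsub>M\<^esub> w" by blast
    then show ?case using assms(2) cyc_act(1) by (intro exI[of _ "a * mu x"]) (simp add: M.act_scale assms(3) M.sm_sm)
  qed
  then obtain c where c: "v = c \<odot>\<^bsub>M\<^esub> w" ..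
  have "\<Phi> v = cscale c (basis_vec 0)" using \<Phi> cyc_gen[of w M] by (auto simp: c cyc_hom_def)
  then have "Poly_Mapping.lookup (Poly_Mapping.single 0 c) 0 = Poly_Mapping.lookup (0 :: uspace) 0" using v(2) by simp
  then have "c = 0" by simp
  then show "v = \<zero>\<^bsub>M\<^esub>" using c assms(2) by simp
qed

lemma tower_step:
  assumes "vir_mod M" "w \<in> carrier M" "s < n" "tower M w (Suc s) \<rho> \<omega>"
  shows "\<exists>\<rho>' \<omega>'. tower M w s \<rho>' \<omega>'"
proof -
  let ?y = "e_of (linfac lam ^ s)"
  note T = assms(4)[unfolded tower_def]
  note T2 = T[THEN conjunct2]
  note T3 = T2[THEN conjunct2]
  note T4 = T3[THEN conjunct2]
  note T5 = T4[THEN conjunct2]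
  note t = T[THEN conjunct1] T2[THEN conjunct1] T3[THEN conjunct1] T4[THEN conjunct1] T5[THEN conjunct1] T5[THEN conjunct2]
  interpret ind_step "vanish lam s" "vanish lam (Suc s)" ?y "taylor lam s" \<rho>
  proof
    show "cspace.subspace (vanish lam s)" by (rule subspace_vanish)
    show "vir_bracket a b \<in> vanish lam s" if "a \<in> vanish lam s" "b \<in> vanish lam s" for a b
      using bracket_vanish[OF that, of s] by (cases s) (simp_all add: vanish_def)
    show "vir_bracket a b \<in> vanish lam (Suc s)" if "a \<in> vanish lam (Suc s)" "b \<in> vanish lam (Suc s)" for a b
      using bracket_vanish[OF that, of "Suc s"] by simp
    show "a \<in> vanish lam (Suc s) \<longleftrightarrow> a \<in> vanish lam s \<and> taylor lam s a = 0" for a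
      using vanish_Suc_iff[OF lam, of a s] vanish_mono[of s "Suc s" lam] by auto
    show "?y \<in> vanish lam s" by (simp add: vanish_def)
  qed (use t(1) in \<open>simp_all add: taylor_lin taylor_add taylor_scale\<close>)
  have Kn: "vanish lam n \<subseteq> vanish lam (Suc s)" using assms(3) by (intro vanish_mono) simp
  \<comment> \<open>For \<open>s > 0\<close> the bracket has order at least
    \<open>n + s - 1\<close>, which exceeds \<open>s\<close> since \<open>n > s\<close>. It has no
    component along \<open>?y\<close>, so degrees contribute to the shift only at
    \<open>s = 0\<close>.\<close>
  have w: "taylor lam s (vir_bracket x ?y) = (if s = 0 then weight x else 0)" if "x \<in> vanish lam n" for x
  proof (cases "s = 0")
    case False
    have "vir_bracket x ?y \<in> vanish lam (Suc s)"
      by (rule bracket_vanish[OF that, of _ s]) (use assms(3) False in \<open>auto simp: vanish_def\<close>)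
    then show ?thesis using False H'_def by simp
  qed (simp add: weight_def)
  have "tower M w s ind (level 0 \<omega>)"
    unfolding tower_def
  proof (intro conjI allI impI ballI)
    show "vir_rep (vanish lam s) ind" by (rule ind_rep)
    show "level 0 \<omega> \<noteq> 0" using t(2) coeff_at_level[of 0 0 \<omega>] by (auto simp: clin_zero[OF clin_coeff_at])
    show "ind x (level 0 \<omega>) = cscale (mu x) (level 0 \<omega>)" if "x \<in> vanish lam n" for x
      using that Kn t(3) by (auto simp: ind_level0 clin_scale[OF clin_level])
    show "v = 0" if "x \<in> vanish lam s - vanish lam n" "ind x v = cscale c v" for x c v
      using ind_shifted_injective[of x v c] that t(4) by blast
  next
    fix \<nu> v assume "v \<noteq> 0" "\<forall>x\<in>vanish lam n. ind x v = cscale (\<nu> x) v"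
    then obtain r u where u: "u \<noteq> 0"
      "\<And>x. x \<in> vanish lam n \<Longrightarrow> \<rho> x u = cscale (\<nu> x - of_nat r * taylor lam s (vir_bracket x ?y)) u"
      using ind_eigenvector[OF Kn, of v \<nu>] by blast
    then obtain r' :: nat where
      r': "\<forall>x\<in>vanish lam n. \<nu> x - of_nat r * taylor lam s (vir_bracket x ?y) = mu x + of_nat r' * weight x"
      using t(5)[THEN spec, THEN spec, THEN mp, THEN mp, OF u(1),
          of "\<lambda>x. \<nu> x - of_nat r * taylor lam s (vir_bracket x ?y)"] u(2) by blast
    show "\<exists>r::nat. \<forall>x\<in>vanish lam n. \<nu> x = mu x + of_nat r * weight x"
    proof (rule exI[of _ "if s = 0 then r + r' else r'"], intro ballI)
      fix x assume x: "x \<in> vanish lam n"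
      show "\<nu> x = mu x + of_nat (if s = 0 then r + r' else r') * weight x"
        using r'[rule_format, OF x] w[OF x] by (auto simp: algebra_simps split: if_splits)
    qed
  next
    fix \<Phi> v assume "cyc_hom M (vanish lam s) w ind \<Phi>" "\<Phi> w = level 0 \<omega>" "v \<in> cyc M (vanish lam s) w" "\<Phi> v = 0"
    then show "v = \<zero>\<^bsub>M\<^esub>" using cyc_hom_injective[OF assms(1,2)] t(6) by blast
  qed
  then show ?thesis by blast
qed

lemma tower_exists:
  assumes "vir_mod M" "w \<in> carrier M" "\<And>x. x \<in> vanish lam n \<Longrightarrow> act M x w = mu x \<odot>\<^bsub>M\<^esub> w"
  shows "\<exists>\<rho> \<omega>. tower M w 0 \<rho> \<omega>"
proof -
  have "\<exists>\<rho> \<omega>. tower M w s \<rho> \<omega>" if "s \<le> n" for s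
    using that
  proof (induction rule: inc_induct)
    case base
    show ?case using tower_base[OF assms] by blast
  next
    case (step s)
    then show ?case using tower_step[OF assms(1,2)] by blast
  qed
  then show ?thesis by blast
qed

end

section \<open>Enveloping algebras\<close>

locale lie_sub =
  fixes L :: "vir set"
  assumes L_sub: "cspace.subspace L" and L_br: "x \<in> L \<Longrightarrow> y \<in> L \<Longrightarrow> vir_bracket x y \<in> L"
begin

lemma L_add: "x \<in> L \<Longrightarrow> y \<in> L \<Longrightarrow> x + y \<in> L" and L_scale: "x \<in> L \<Longrightarrow> cscale c x \<in> L"
  using L_sub cspace.subspace_add cspace.subspace_scale by blast+

abbreviation "W \<equiv> {w. set (letters w) \<subseteq> L}"
abbreviation "F \<equiv> {p. Poly_Mapping.keys p \<subseteq> W} :: falg set"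
abbreviation "I \<equiv> uea_ideal L"

lemma fa_sel [simp]:
  "carrier (free_alg L) = F" "p \<otimes>\<^bsub>free_alg L\<^esub> q = p * q" "p \<oplus>\<^bsub>free_alg L\<^esub> q = p + q"
  "\<zero>\<^bsub>free_alg L\<^esub> = 0" "\<one>\<^bsub>free_alg L\<^esub> = 1"
  by (auto simp: free_alg_def)

lemma F_add: "p \<in> F \<Longrightarrow> q \<in> F \<Longrightarrow> p + q \<in> F"
  by (auto dest!: keys_add[THEN subsetD])

lemma F_mult: "p \<in> F \<Longrightarrow> q \<in> F \<Longrightarrow> p * q \<in> F"
  by (fastforce dest!: keys_mult[THEN subsetD] simp: plus_fword_def)

lemma F_scale: "p \<in> F \<Longrightarrow> cscale c p \<in> F"
  by (auto dest!: keys_cscale[THEN subsetD])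

lemma F_diff: "p \<in> F \<Longrightarrow> q \<in> F \<Longrightarrow> p - q \<in> F"
  using F_add[of p "- q"] by simp

lemma F_single0: "Poly_Mapping.single 0 c \<in> F"
  by (simp add: zero_fword_def)

lemma F_one: "1 \<in> F"
  by (simp add: zero_fword_def)

lemma F_gen: "x \<in> L \<Longrightarrow> fgen x \<in> F"
  by simp

lemma fa_abelian: "abelian_group (free_alg L)"
proof (rule abelian_groupI)
  fix x assume "x \<in> carrier (free_alg L)"
  then show "\<exists>y\<in>carrier (free_alg L). y \<oplus>\<^bsub>free_alg L\<^esub> x = \<zero>\<^bsub>free_alg L\<^esub>"
    by (intro bexI[of _ "- x"]) auto
qed (simp_all add: add_ac F_add[simplified])

lemma fa_ring: "ring (free_alg L)"
  by (rule ringI[OF fa_abelian]; (rule monoidI)?)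
    (use F_mult F_one in \<open>simp_all add: mult.assoc distrib_left distrib_right\<close>)

sublocale fa: ring "free_alg L" by (rule fa_ring)

lemma fa_uminus: "q \<in> F \<Longrightarrow> \<ominus>\<^bsub>free_alg L\<^esub> q = - q"
  by (rule fa.minus_equality) simp_all

lemma fa_minus: "q \<in> F \<Longrightarrow> p \<ominus>\<^bsub>free_alg L\<^esub> q = p - q"
  by (simp only: a_minus_def fa_uminus fa_sel) simp

definition gens :: "falg set" where
  "gens = {fgen (x + y) - fgen x - fgen y | x y. x \<in> L \<and> y \<in> L} \<union>
      {fgen (cscale c x) - cscale c (fgen x) | c x. x \<in> L} \<union>
      {fgen x * fgen y - fgen y * fgen x - fgen (vir_bracket x y) | x y. x \<in> L \<and> y \<in> L}"

lemma gens_F: "gens \<subseteq> F"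
proof -
  have 1: "fgen (x + y) - fgen x - fgen y \<in> F" if "x \<in> L" "y \<in> L" for x y
    by (rule F_diff[OF F_diff[OF F_gen[OF L_add[OF that]] F_gen[OF that(1)]] F_gen[OF that(2)]])
  have 2: "fgen (cscale c x) - cscale c (fgen x) \<in> F" if "x \<in> L" for x c
    by (rule F_diff[OF F_gen[OF L_scale[OF that]] F_scale[OF F_gen[OF that]]])
  have 3: "fgen x * fgen y - fgen y * fgen x - fgen (vir_bracket x y) \<in> F" if "x \<in> L" "y \<in> L" for x y
    by (rule F_diff[OF F_diff[OF F_mult[OF F_gen[OF that(1)] F_gen[OF that(2)]]
            F_mult[OF F_gen[OF that(2)] F_gen[OF that(1)]]] F_gen[OF L_br[OF that]]])
  show ?thesis
  proof
    fix p assume "p \<in> gens"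
    then show "p \<in> F" unfolding gens_def using 1 2 3 by (elim UnE CollectE exE conjE) (simp_all only:)
  qed
qed

lemma I_eq: "I = genideal (free_alg L) gens"
  by (simp add: uea_ideal_def gens_def)

lemma ideal_I: "ideal I (free_alg L)"
  unfolding I_eq by (rule fa.genideal_ideal) (use gens_F in simp)

lemma I_subgroup: "abelian_subgroup I (free_alg L)"
proof -
  interpret idl: ideal I "free_alg L" by (rule ideal_I)
  show ?thesis by (rule idl.abelian_subgroup_axioms)
qed

lemma I_F: "p \<in> I \<Longrightarrow> p \<in> F"
  using additive_subgroup.a_subset[OF ideal.axioms(1)[OF ideal_I]] by auto

lemma gens_I: "p \<in> gens \<Longrightarrow> p \<in> I"
  unfolding I_eq using fa.genideal_self[of gens] gens_F by auto

lemma I_zero: "0 \<in> I" using additive_subgroup.zero_closed[OF ideal.axioms(1)[OF ideal_I]] by simp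

lemma I_add: "p \<in> I \<Longrightarrow> q \<in> I \<Longrightarrow> p + q \<in> I"
  using additive_subgroup.a_closed[OF ideal.axioms(1)[OF ideal_I], of p q] by simp

lemma I_left: "p \<in> I \<Longrightarrow> a \<in> F \<Longrightarrow> a * p \<in> I"
  using ideal.I_l_closed[OF ideal_I, of p a] by simp

lemma I_right: "p \<in> I \<Longrightarrow> a \<in> F \<Longrightarrow> p * a \<in> I"
  using ideal.I_r_closed[OF ideal_I, of p a] by simp

lemma cscale_eq_mult: "cscale c p = Poly_Mapping.single 0 c * p" for p :: falg
  by (induction p rule: pm_single_induct) (simp_all add: mult_single cspace.scale_right_distrib distrib_left)

lemma I_scale: "p \<in> I \<Longrightarrow> cscale c p \<in> I"
  using I_left[OF _ F_single0] by (simp add: cscale_eq_mult)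

lemma I_uminus: "p \<in> I \<Longrightarrow> - p \<in> I"
  using I_scale[of p "-1"] by simp

text \<open>Serves as the induction principle for the ideal, both to include one enveloping ideal in
  another and to show that an ideal acts as zero.\<close>

lemma I_minimal:
  assumes "J \<subseteq> F" "0 \<in> J" "\<And>p q. p \<in> J \<Longrightarrow> q \<in> J \<Longrightarrow> p + q \<in> J" "\<And>p. p \<in> J \<Longrightarrow> - p \<in> J"
    and "\<And>a p. a \<in> F \<Longrightarrow> p \<in> J \<Longrightarrow> a * p \<in> J" "\<And>a p. a \<in> F \<Longrightarrow> p \<in> J \<Longrightarrow> p * a \<in> J" "gens \<subseteq> J"
  shows "I \<subseteq> J"
  unfolding I_eq
proof (rule fa.genideal_minimal[OF _ assms(7)], rule idealI[OF fa_ring])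
  show "subgroup J (add_monoid (free_alg L))"
  proof
    fix x assume x: "x \<in> J"
    then have "inv\<^bsub>add_monoid (free_alg L)\<^esub> x = - x"
      using fa_uminus[of x] assms(1) by (auto simp: a_inv_def)
    then show "inv\<^bsub>add_monoid (free_alg L)\<^esub> x \<in> J" using assms(4) x by simp
  qed (use assms in auto)
qed (use assms in auto)

lemma uc_eq: "p \<in> F \<Longrightarrow> q \<in> F \<Longrightarrow> uea_class L p = uea_class L q \<longleftrightarrow> p - q \<in> I"
  unfolding uea_class_def
  using fa.quotient_eq_iff_same_a_r_cos[OF ideal_I, of p q] by (simp add: fa_minus)

lemma uc_self: "p \<in> F \<Longrightarrow> p \<in> uea_class L p"
  unfolding uea_class_def using abelian_subgroup.a_rcos_self[OF I_subgroup, of p] by simp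

lemma in_uc:
  assumes "q \<in> uea_class L p" "p \<in> F"
  shows "q \<in> F \<and> q - p \<in> I"
proof -
  obtain i where "i \<in> I" "q = i + p" using assms(1) unfolding uea_class_def a_r_coset_def' by auto
  then show ?thesis using F_add[OF I_F[of i] assms(2)] by simp
qed

lemma uea_sel:
  "carrier (uea L) = uea_class L ` F"
  "p \<in> F \<Longrightarrow> q \<in> F \<Longrightarrow> uea_class L p \<otimes>\<^bsub>uea L\<^esub> uea_class L q = uea_class L (p * q)"
  "p \<in> F \<Longrightarrow> q \<in> F \<Longrightarrow> uea_class L p \<oplus>\<^bsub>uea L\<^esub> uea_class L q = uea_class L (p + q)"
  "p \<in> F \<Longrightarrow> c \<odot>\<^bsub>uea L\<^esub> uea_class L p = uea_class L (cscale c p)"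
  "\<zero>\<^bsub>uea L\<^esub> = uea_class L 0"
proof -
  note d = uea_def ring.extend_def module.fields_def FactRing_def
  show "carrier (uea L) = uea_class L ` F"
    by (auto simp: d A_RCOSETS_def' uea_class_def)
  show "p \<in> F \<Longrightarrow> q \<in> F \<Longrightarrow> uea_class L p \<otimes>\<^bsub>uea L\<^esub> uea_class L q = uea_class L (p * q)"
    using ideal.rcoset_mult_add[OF ideal_I, of p q] by (simp add: d uea_class_def)
  show "p \<in> F \<Longrightarrow> q \<in> F \<Longrightarrow> uea_class L p \<oplus>\<^bsub>uea L\<^esub> uea_class L q = uea_class L (p + q)"
    using abelian_subgroup.a_rcos_sum[OF I_subgroup, of p q] by (simp add: d uea_class_def)
  show "\<zero>\<^bsub>uea L\<^esub> = uea_class L 0"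
    using abelian_subgroup.a_rcos_const[OF I_subgroup I_zero] by (simp add: d uea_class_def)
  show "c \<odot>\<^bsub>uea L\<^esub> uea_class L p = uea_class L (cscale c p)" if p: "p \<in> F"
  proof -
    have "uea_class L (cscale c q) = uea_class L (cscale c p)" if "q \<in> uea_class L p" for q
      using in_uc[OF that p] p I_scale[of "q - p" c] F_scale
      by (subst uc_eq) (auto simp: cspace.scale_right_diff_distrib dest!: keys_cscale[THEN subsetD])
    then have "(\<Union>q\<in>uea_class L p. uea_class L (cscale c q)) = uea_class L (cscale c p)"
      using uc_self[OF p] by blast
    then show ?thesis by (simp add: d)
  qed
qed

end

global_interpretation full: lie_sub UNIV
  by unfold_locales (auto simp: cspace.subspace_def)

abbreviation uc :: "falg \<Rightarrow> falg set" where "uc \<equiv> uea_class UNIV"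

lemma ucls_eq: "uc p = uc q \<longleftrightarrow> p - q \<in> uea_ideal UNIV"
  using full.uc_eq[of p q] by simp

lemma ucls_carrier: "carrier (uea UNIV) = range uc"
  using full.uea_sel(1) by simp

lemma ucls_sel:
  "uc p \<otimes>\<^bsub>uea UNIV\<^esub> uc q = uc (p * q)" "uc p \<oplus>\<^bsub>uea UNIV\<^esub> uc q = uc (p + q)"
  "c \<odot>\<^bsub>uea UNIV\<^esub> uc p = uc (cscale c p)" "\<zero>\<^bsub>uea UNIV\<^esub> = uc 0"
  using full.uea_sel(2)[of p q] full.uea_sel(3)[of p q] full.uea_sel(4)[of p c] full.uea_sel(5) by simp_all

lemmas ucls_all = ucls_carrier ucls_sel

lemma cmod_uea: "cmod (uea UNIV)"
proof (rule cmodI, rule moduleI)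
  let ?U = "uea UNIV"
  show "abelian_group ?U"
  proof (rule abelian_groupI)
    fix x assume "x \<in> carrier ?U"
    then obtain p where "x = uc p" by (auto simp: ucls_all)
    then show "\<exists>y\<in>carrier ?U. y \<oplus>\<^bsub>?U\<^esub> x = \<zero>\<^bsub>?U\<^esub>"
      by (intro bexI[of _ "uc (- p)"]) (simp_all add: ucls_all)
  qed (auto simp: ucls_all add_ac)
qed (auto simp: ucls_all cring_complex_ring cspace.scale_left_distrib cspace.scale_right_distrib)

text \<open>The defining relations over \<open>L\<close> are among those over the whole algebra, so
  the map \<open>uea_incl\<close> is independent of representatives.\<close>

lemma (in lie_sub) ideal_subset: "I \<subseteq> uea_ideal UNIV"
proof -
  have "gens \<subseteq> full.gens" unfolding full.gens_def gens_def by blast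
  then have g: "gens \<subseteq> uea_ideal UNIV" using full.gens_I by blast
  have l: "a * p \<in> uea_ideal UNIV" "p * a \<in> uea_ideal UNIV" if "p \<in> uea_ideal UNIV" for a p
    using full.I_left[OF that, of a] full.I_right[OF that, of a] by simp_all
  have "I \<subseteq> uea_ideal UNIV \<inter> F"
  proof (rule I_minimal)
    show "gens \<subseteq> uea_ideal UNIV \<inter> F" using g gens_F by blast
    show "0 \<in> uea_ideal UNIV \<inter> F" using full.I_zero by simp
    fix p assume p: "p \<in> uea_ideal UNIV \<inter> F"
    show "- p \<in> uea_ideal UNIV \<inter> F" using full.I_uminus p by simp
    show "p + q \<in> uea_ideal UNIV \<inter> F" if "q \<in> uea_ideal UNIV \<inter> F" for q
      using full.I_add F_add p that by blast
    show "a * p \<in> uea_ideal UNIV \<inter> F" if "a \<in> F" for a using l(1) F_mult[OF that] p by blast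
    show "p * a \<in> uea_ideal UNIV \<inter> F" if "a \<in> F" for a using l(2) F_mult[OF _ that] p by blast
  qed blast
  then show ?thesis by blast
qed

lemma (in lie_sub) uea_incl_class:
  assumes "p \<in> F"
  shows "uea_incl (uea_class L p) = uc p"
proof -
  have "uc q = uc p" if "q \<in> uea_class L p" for q
    using in_uc[OF that assms] ideal_subset by (auto simp: ucls_eq)
  then have "uc ` uea_class L p = {uc p}" using uc_self[OF assms] by blast
  then show ?thesis by (simp add: uea_incl_def)
qed

lemma mult_cscale_falg: "p * cscale c q = cscale c (p * q)" "cscale c p * q = cscale c (p * q)" for p q :: falg
proof -
  have comm: "p * Poly_Mapping.single 0 c = Poly_Mapping.single 0 c * p" for p :: falg
    by (induction p rule: pm_single_induct) (simp_all add: mult_single distrib_left distrib_right mult.commute)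
  show "cscale c p * q = cscale c (p * q)" by (simp add: full.cscale_eq_mult mult.assoc)
  have "p * cscale c q = (p * Poly_Mapping.single 0 c) * q" by (simp add: full.cscale_eq_mult mult.assoc)
  also have "\<dots> = cscale c (p * q)" unfolding comm by (simp add: full.cscale_eq_mult mult.assoc)
  finally show "p * cscale c q = cscale c (p * q)" .
qed

section \<open>Free algebra elements acting through a representation\<close>

definition falg_rep :: "(vir \<Rightarrow> ('x \<Rightarrow>\<^sub>0 complex) \<Rightarrow> ('x \<Rightarrow>\<^sub>0 complex)) \<Rightarrow> falg \<Rightarrow> ('x \<Rightarrow>\<^sub>0 complex) \<Rightarrow> ('x \<Rightarrow>\<^sub>0 complex)" where
  "falg_rep \<rho> p u = lin_ext (\<lambda>w. foldr \<rho> (letters w) u) p"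

lemma falg_rep_simps:
  "falg_rep \<rho> (p + q) u = falg_rep \<rho> p u + falg_rep \<rho> q u" "falg_rep \<rho> (cscale c p) u = cscale c (falg_rep \<rho> p u)"
  "falg_rep \<rho> (p - q) u = falg_rep \<rho> p u - falg_rep \<rho> q u" "falg_rep \<rho> 0 u = 0"
  "falg_rep \<rho> (fgen x) u = \<rho> x u" "falg_rep \<rho> 1 u = u"
proof -
  have "(1 :: falg) = basis_vec (FWord [])" unfolding zero_fword_def[symmetric] by simp
  moreover have "falg_rep \<rho> (basis_vec (FWord [])) u = u" by (simp add: falg_rep_def)
  ultimately show "falg_rep \<rho> 1 u = u" by (simp only:)
qed (simp_all add: falg_rep_def lin_ext_add lin_ext_cscale lin_ext_diff lin_ext_zero)

lemma falg_rep_clin: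
  assumes "\<And>x. clin (\<rho> x)"
  shows "clin (falg_rep \<rho> p)"
proof -
  have "clin (foldr \<rho> xs)" for xs
  proof (induction xs)
    case Nil
    show ?case using clin_id by (simp add: id_def)
  next
    case (Cons x xs)
    have "foldr \<rho> (x # xs) = (\<lambda>u. \<rho> x (foldr \<rho> xs u))" by (simp add: fun_eq_iff)
    then show ?case using clin_comp[OF assms Cons.IH] by simp
  qed
  then have "clin (\<lambda>u. lin_ext (\<lambda>w. foldr \<rho> (letters w) u) p)" by (intro clin_lin_ext_fun)
  moreover have "falg_rep \<rho> p = (\<lambda>u. lin_ext (\<lambda>w. foldr \<rho> (letters w) u) p)" by (simp add: fun_eq_iff falg_rep_def)
  ultimately show ?thesis by simp
qed

lemma falg_rep_mult:
  assumes "\<And>x. clin (\<rho> x)"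
  shows "falg_rep \<rho> (p * q) u = falg_rep \<rho> p (falg_rep \<rho> q u)"
proof (induction p rule: pm_induct)
  case (basis v)
  show ?case
  proof (induction q rule: pm_induct)
    case (basis w)
    show ?case by (simp add: mult_single falg_rep_def plus_fword_def)
  qed (simp_all add: distrib_left mult_cscale_falg falg_rep_simps
      clin_add[OF falg_rep_clin[OF assms]] clin_scale[OF falg_rep_clin[OF assms]])
qed (simp_all add: distrib_right mult_cscale_falg falg_rep_simps)

text \<open>The elements that act as zero form a two-sided ideal, and the conditions on
  \<open>\<rho>\<close> put the defining relations into it.\<close>

lemma (in lie_sub) falg_rep_ideal:
  assumes \<rho>: "\<And>x. clin (\<rho> x)"
    and add: "\<And>x y u. x \<in> L \<Longrightarrow> y \<in> L \<Longrightarrow> \<rho> (x + y) u = \<rho> x u + \<rho> y u"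
    and scale: "\<And>x c u. x \<in> L \<Longrightarrow> \<rho> (cscale c x) u = cscale c (\<rho> x u)"
    and br: "\<And>x y u. x \<in> L \<Longrightarrow> y \<in> L \<Longrightarrow> \<rho> (vir_bracket x y) u = \<rho> x (\<rho> y u) - \<rho> y (\<rho> x u)"
    and p: "p \<in> I"
  shows "falg_rep \<rho> p u = 0"
proof -
  note mult = falg_rep_mult[OF \<rho>]
  have "I \<subseteq> {p. (\<forall>u. falg_rep \<rho> p u = 0)} \<inter> F"
  proof (rule I_minimal)
    show "gens \<subseteq> {p. (\<forall>u. falg_rep \<rho> p u = 0)} \<inter> F"
    proof (intro Int_greatest gens_F subsetI CollectI allI)
      fix p u assume "p \<in> gens"
      then show "falg_rep \<rho> p u = 0"
        unfolding gens_def
        by (auto simp: falg_rep_simps mult add scale br simp del: cscale_single)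
    qed
    show "- p \<in> {p. (\<forall>u. falg_rep \<rho> p u = 0)} \<inter> F" if "p \<in> {p. (\<forall>u. falg_rep \<rho> p u = 0)} \<inter> F" for p
      using that falg_rep_simps(3)[of \<rho> 0 p] by (auto simp: falg_rep_simps(4))
    fix a p assume *: "a \<in> F" "p \<in> {p. (\<forall>u. falg_rep \<rho> p u = 0)} \<inter> F"
    show "a * p \<in> {p. (\<forall>u. falg_rep \<rho> p u = 0)} \<inter> F"
      using * F_mult[of a p] by (auto simp: mult clin_zero[OF falg_rep_clin[OF \<rho>]])
    show "p * a \<in> {p. (\<forall>u. falg_rep \<rho> p u = 0)} \<inter> F"
      using * F_mult[of p a] by (auto simp: mult)
  qed (use F_add in \<open>auto simp: falg_rep_simps\<close>)
  then show ?thesis using p by blast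
qed

text \<open>
  Complex numbers as the free space on one point, which makes the action of the free algebra
  on a one-dimensional module an instance of \<open>falg_rep\<close>.
\<close>

definition char_val :: "(vir \<Rightarrow> complex) \<Rightarrow> falg \<Rightarrow> complex" where
  "char_val \<mu> p = Poly_Mapping.lookup (falg_rep (\<lambda>x. cscale (\<mu> x)) p (basis_vec ())) ()"

lemma one_dim_foldr: "foldr (act (one_dim \<mu>)) xs c = prod_list (map \<mu> xs) * c"
  by (induction xs) simp_all

lemma cscale_foldr: "foldr (\<lambda>x. cscale (\<mu> x)) xs u = cscale (prod_list (map \<mu> xs)) u"
  by (induction xs) simp_all

lemma falg_rep_char: "falg_rep (\<lambda>x. cscale (\<mu> x)) p u = cscale (char_val \<mu> p) u"
  by (induction p rule: pm_induct)
    (simp_all add: char_val_def falg_rep_simps lookup_add lookup_cscale cspace.scale_left_distrib,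
     simp add: falg_rep_def cscale_foldr)

lemma free_alg_act_one_dim: "free_alg_act (one_dim \<mu>) p c = char_val \<mu> p * c"
proof -
  interpret N: cmod "one_dim \<mu>" by (rule cmod_one_dim)
  let ?f = "\<lambda>w. foldr (act (one_dim \<mu>)) (letters w) c"
  have f: "?f \<in> UNIV \<rightarrow> carrier (one_dim \<mu>)" by simp
  have "lcomb (one_dim \<mu>) ?f p = char_val \<mu> p * c"
  proof (induction p rule: pm_induct)
    case (basis w)
    have "char_val \<mu> (basis_vec w) = prod_list (map \<mu> (letters w))"
      by (simp add: char_val_def falg_rep_def cscale_foldr)
    have "lcomb (one_dim \<mu>) ?f (basis_vec w) = ?f w" by (rule N.lcomb_basis) simp
    also have "\<dots> = prod_list (map \<mu> (letters w)) * c" by (rule one_dim_foldr)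
    finally show ?case by (simp only: \<open>char_val \<mu> (basis_vec w) = prod_list (map \<mu> (letters w))\<close>)
  next
    case (add p q)
    then show ?case
      using N.lcomb_add[OF f, of p q] by (simp add: char_val_def falg_rep_simps lookup_add distrib_right del: one_dim_simps(5))
  next
    case (scale a p)
    then show ?case
      using N.lcomb_scale[OF f, of p a] by (simp add: char_val_def falg_rep_simps lookup_cscale del: one_dim_simps(5))
  qed
  then show ?thesis by (simp add: free_alg_act_def lcomb_def)
qed

lemma char_val_simps: "char_val \<mu> (fgen x) = \<mu> x" "char_val \<mu> (p - q) = char_val \<mu> p - char_val \<mu> q"
  by (simp_all add: char_val_def falg_rep_simps lookup_minus)

lemma lie_sub_vanish: "lie_sub (vanish lam n)"
proof
  show "cspace.subspace (vanish lam n)" by (rule subspace_vanish)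
  show "vir_bracket x y \<in> vanish lam n" if "x \<in> vanish lam n" "y \<in> vanish lam n" for x y
    using bracket_vanish[OF that, of n] by (cases n) (simp_all add: vanish_def)
qed

text \<open>Dresses a free space as a module record, so that \<open>lift\<close> can take values in
  it.\<close>

definition free_mod :: "(complex, 'x \<Rightarrow>\<^sub>0 complex) module" where
  "free_mod = \<lparr>carrier = UNIV, monoid.mult = undefined, one = undefined, ring.zero = 0, add = (+), module.smult = cscale\<rparr>"

lemma free_mod_sel [simp]: "carrier free_mod = UNIV" "\<zero>\<^bsub>free_mod\<^esub> = 0" "p \<oplus>\<^bsub>free_mod\<^esub> q = p + q" "c \<odot>\<^bsub>free_mod\<^esub> p = cscale c p"
  by (simp_all add: free_mod_def)

lemma cmod_free_mod: "cmod (free_mod :: (complex, 'x \<Rightarrow>\<^sub>0 complex) module)" (is "cmod ?M")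
proof (rule cmodI, rule moduleI)
  show "abelian_group ?M"
  proof (rule abelian_groupI)
    fix x assume "x \<in> carrier ?M"
    show "\<exists>y\<in>carrier ?M. y \<oplus>\<^bsub>?M\<^esub> x = \<zero>\<^bsub>?M\<^esub>" by (intro bexI[of _ "- x"]) auto
  qed (auto simp: add_ac)
qed (auto simp: cring_complex_ring cspace.scale_left_distrib cspace.scale_right_distrib)

context bilin
begin

lemma rel_add_left: "u \<in> carrier A \<Longrightarrow> u' \<in> carrier A \<Longrightarrow> v \<in> carrier B \<Longrightarrow>
    basis_vec (u \<oplus>\<^bsub>A\<^esub> u', v) - basis_vec (u, v) - basis_vec (u', v) \<in> bilinear_relations A B"
  and rel_add_right: "u \<in> carrier A \<Longrightarrow> v \<in> carrier B \<Longrightarrow> v' \<in> carrier B \<Longrightarrow>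
    basis_vec (u, v \<oplus>\<^bsub>B\<^esub> v') - basis_vec (u, v) - basis_vec (u, v') \<in> bilinear_relations A B"
  and rel_scale_left: "u \<in> carrier A \<Longrightarrow> v \<in> carrier B \<Longrightarrow>
    basis_vec (c \<odot>\<^bsub>A\<^esub> u, v) - cscale c (basis_vec (u, v)) \<in> bilinear_relations A B"
  and rel_scale_right: "u \<in> carrier A \<Longrightarrow> v \<in> carrier B \<Longrightarrow>
    basis_vec (u, c \<odot>\<^bsub>B\<^esub> v) - cscale c (basis_vec (u, v)) \<in> bilinear_relations A B"
  unfolding bilinear_relations_def by blast+

end

section \<open>The modules induced from characters\<close>

context character
begin

abbreviation "H \<equiv> vanish lam n"

sublocale H: lie_sub H
  by (rule lie_sub_vanish)

lemma char_val_ideal: "p \<in> uea_ideal H \<Longrightarrow> char_val mu p = 0"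
  unfolding char_val_def
  by (subst H.falg_rep_ideal)
    (auto simp: mu_add mu_scale mu_bracket clin_cscale cspace.scale_left_distrib mult.commute)

lemma uea_act_one_dim:
  assumes "p \<in> H.F"
  shows "uea_act (one_dim mu) (uea_class H p) c = char_val mu p * c"
proof -
  have "(\<lambda>p. free_alg_act (one_dim mu) p c) ` uea_class H p = {char_val mu p * c}"
  proof -
    have "char_val mu q = char_val mu p" if "q \<in> uea_class H p" for q
      using H.in_uc[OF that assms] char_val_ideal[of "q - p"] by (simp add: char_val_simps)
    then have "(\<lambda>p. free_alg_act (one_dim mu) p c) ` uea_class H p = (\<lambda>_. char_val mu p * c) ` uea_class H p"
      by (intro image_cong[OF refl]) (simp only: free_alg_act_one_dim)
    also have "\<dots> = {char_val mu p * c}" by (rule image_constant[OF H.uc_self[OF assms]])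
    finally show ?thesis .
  qed
  then show ?thesis by (simp add: uea_act_def)
qed

definition "f = [:- lam, 1:] ^ n"

abbreviation "Vm \<equiv> Vfmu f mu"

text \<open>The relations of \<open>induced\<close> in terms of free algebra representatives;
  \<open>Vm_eq\<close> justifies the translation.\<close>

definition rels :: "(falg set \<times> complex \<Rightarrow>\<^sub>0 complex) set" where
  "rels = bilinear_relations (uea UNIV) (one_dim mu) \<union>
    {basis_vec (uc (p * q), c) - basis_vec (uc p, char_val mu q * c) | p q c. q \<in> H.F}"

abbreviation "gen_act \<equiv> \<lambda>x (u, v). basis_vec (uc (fgen x) \<otimes>\<^bsub>uea UNIV\<^esub> u, v) :: (falg set \<times> complex) \<Rightarrow>\<^sub>0 complex"

abbreviation "G \<equiv> carrier (uea UNIV) \<times> (UNIV :: complex set)"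

lemma Vm_eq: "Vm = presented G rels gen_act"
proof -
  have "{basis_vec (u \<otimes>\<^bsub>uea UNIV\<^esub> uea_incl r, v) - basis_vec (u, uea_act (one_dim mu) r v) | u r v.
           u \<in> carrier (uea UNIV) \<and> r \<in> carrier (uea H) \<and> v \<in> carrier (one_dim mu)} =
     {basis_vec (uc (p * q), c) - basis_vec (uc p, char_val mu q * c) | p q c. q \<in> H.F}" (is "?A = ?B")
  proof (intro equalityI subsetI)
    fix a assume "a \<in> ?A"
    then obtain u r v where *: "a = basis_vec (u \<otimes>\<^bsub>uea UNIV\<^esub> uea_incl r, v) - basis_vec (u, uea_act (one_dim mu) r v)"
      "u \<in> carrier (uea UNIV)" "r \<in> carrier (uea H)" by blast
    obtain p where p: "u = uc p" using *(2) by (auto simp: ucls_all)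
    obtain q where q: "r = uea_class H q" "q \<in> H.F" using *(3) unfolding H.uea_sel by blast
    have "a = basis_vec (uc (p * q), v) - basis_vec (uc p, char_val mu q * v)"
      unfolding *(1) p q(1) H.uea_incl_class[OF q(2)] uea_act_one_dim[OF q(2)] ucls_all ..
    then show "a \<in> ?B" using q(2) by blast
  next
    fix a assume "a \<in> ?B"
    then obtain p q c where *: "a = basis_vec (uc (p * q), c) - basis_vec (uc p, char_val mu q * c)" "q \<in> H.F" by blast
    have "a = basis_vec (uc p \<otimes>\<^bsub>uea UNIV\<^esub> uea_incl (uea_class H q), c) - basis_vec (uc p, uea_act (one_dim mu) (uea_class H q) c)"
      unfolding *(1) H.uea_incl_class[OF *(2)] uea_act_one_dim[OF *(2)] ucls_all ..
    moreover have "uc p \<in> carrier (uea UNIV)" "uea_class H q \<in> carrier (uea H)" "c \<in> carrier (one_dim mu)"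
      using *(2) unfolding H.uea_sel ucls_all by auto
    ultimately show "a \<in> ?A" by blast
  qed
  then show ?thesis unfolding Vfmu_def induced_def rels_def f_def Virf_eq by simp
qed

sublocale bl: bilin "uea UNIV" "one_dim mu"
  using cmod_uea cmod_one_dim by (simp add: bilin_def)

lemma uc_carrier [simp]: "uc p \<in> carrier (uea UNIV)"
  by (simp add: ucls_all)

sublocale V: presentation G rels
proof
  fix r assume "r \<in> rels"
  then show "Poly_Mapping.keys r \<subseteq> G"
  proof (unfold rels_def, elim UnE)
    assume "r \<in> bilinear_relations (uea UNIV) (one_dim mu)"
    then show ?thesis using bl.rel_supp by simp
  next
    assume "r \<in> {basis_vec (uc (p * q), c) - basis_vec (uc p, char_val mu q * c) | p q c. q \<in> H.F}"
    then show ?thesis by (auto dest!: keys_diff[THEN subsetD])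
  qed
qed

lemma rels_bil: "r \<in> bilinear_relations (uea UNIV) (one_dim mu) \<Longrightarrow> r \<in> V.K"
  by (rule cspace.span_base) (simp add: rels_def)

text \<open>Multiplication from the left is linear and, by associativity, commutes with moving an
  element of the subalgebra across the tensor sign on the right.\<close>

lemma gen_act_rels:
  assumes "r \<in> rels"
  shows "lin_ext (gen_act x) r \<in> V.K"
proof (cases "r \<in> bilinear_relations (uea UNIV) (one_dim mu)")
  case True
  then show ?thesis
  proof (rule bl.rel_cases[where Q = "\<lambda>r. lin_ext (gen_act x) r \<in> V.K"])
    fix u u' :: "falg set" and v :: complex assume "u \<in> carrier (uea UNIV)" "u' \<in> carrier (uea UNIV)"
    then obtain p q where "u = uc p" "u' = uc q" by (auto simp: ucls_all)
    then have "lin_ext (gen_act x) (basis_vec (u \<oplus>\<^bsub>uea UNIV\<^esub> u', v) - basis_vec (u, v) - basis_vec (u', v)) =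
        basis_vec (uc (fgen x * p) \<oplus>\<^bsub>uea UNIV\<^esub> uc (fgen x * q), v) - basis_vec (uc (fgen x * p), v) - basis_vec (uc (fgen x * q), v)"
      by (simp add: lin_ext_diff ucls_all distrib_left)
    also have "\<dots> \<in> V.K" by (intro rels_bil bl.rel_add_left) simp_all
    finally show "lin_ext (gen_act x) (basis_vec (u \<oplus>\<^bsub>uea UNIV\<^esub> u', v) - basis_vec (u, v) - basis_vec (u', v)) \<in> V.K" .
  next
    fix u :: "falg set" and v v' :: complex assume "u \<in> carrier (uea UNIV)"
    then obtain p where "u = uc p" by (auto simp: ucls_all)
    then have "lin_ext (gen_act x) (basis_vec (u, v \<oplus>\<^bsub>one_dim mu\<^esub> v') - basis_vec (u, v) - basis_vec (u, v')) =
        basis_vec (uc (fgen x * p), v \<oplus>\<^bsub>one_dim mu\<^esub> v') - basis_vec (uc (fgen x * p), v) - basis_vec (uc (fgen x * p), v')"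
      by (simp add: lin_ext_diff ucls_all)
    also have "\<dots> \<in> V.K" by (intro rels_bil bl.rel_add_right) simp_all
    finally show "lin_ext (gen_act x) (basis_vec (u, v \<oplus>\<^bsub>one_dim mu\<^esub> v') - basis_vec (u, v) - basis_vec (u, v')) \<in> V.K" .
  next
    fix c v :: complex and u :: "falg set" assume "u \<in> carrier (uea UNIV)"
    then obtain p where p: "u = uc p" by (auto simp: ucls_all)
    have "lin_ext (gen_act x) (basis_vec (c \<odot>\<^bsub>uea UNIV\<^esub> u, v) - cscale c (basis_vec (u, v))) =
        basis_vec (c \<odot>\<^bsub>uea UNIV\<^esub> uc (fgen x * p), v) - cscale c (basis_vec (uc (fgen x * p), v))"
      by (simp add: p lin_ext_diff lin_ext_cscale ucls_all mult_cscale_falg del: cscale_single)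
    also have "\<dots> \<in> V.K" by (intro rels_bil bl.rel_scale_left) simp_all
    finally show "lin_ext (gen_act x) (basis_vec (c \<odot>\<^bsub>uea UNIV\<^esub> u, v) - cscale c (basis_vec (u, v))) \<in> V.K" .
    have "lin_ext (gen_act x) (basis_vec (u, c \<odot>\<^bsub>one_dim mu\<^esub> v) - cscale c (basis_vec (u, v))) =
        basis_vec (uc (fgen x * p), c \<odot>\<^bsub>one_dim mu\<^esub> v) - cscale c (basis_vec (uc (fgen x * p), v))"
      by (simp add: p lin_ext_diff lin_ext_cscale ucls_all del: cscale_single)
    also have "\<dots> \<in> V.K" by (intro rels_bil bl.rel_scale_right) simp_all
    finally show "lin_ext (gen_act x) (basis_vec (u, c \<odot>\<^bsub>one_dim mu\<^esub> v) - cscale c (basis_vec (u, v))) \<in> V.K" .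
  qed
next
  case False
  then have "r \<in> {basis_vec (uc (p * q), c) - basis_vec (uc p, char_val mu q * c) | p q c. q \<in> H.F}"
    using assms unfolding rels_def by blast
  then obtain p q c where *: "r = basis_vec (uc (p * q), c) - basis_vec (uc p, char_val mu q * c)" "q \<in> H.F" by blast
  have "lin_ext (gen_act x) r = basis_vec (uc ((fgen x * p) * q), c) - basis_vec (uc (fgen x * p), char_val mu q * c)"
    by (simp add: *(1) lin_ext_diff ucls_all mult.assoc)
  also have "\<dots> \<in> V.K" by (rule cspace.span_base) (use *(2) in \<open>unfold rels_def, blast\<close>)
  finally show ?thesis .
qed

lemma Vm_lin_act: "lin_act Vm"
  unfolding Vm_eq
proof (rule V.presented_lin_act)
  show "r \<in> rels \<Longrightarrow> lin_ext (gen_act x) r \<in> V.K" for x r by (rule gen_act_rels)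
  show "g \<in> G \<Longrightarrow> Poly_Mapping.keys (gen_act x g) \<subseteq> G" for x g by (auto simp: ucls_all simp del: uc_carrier)
qed

sublocale Vm: lin_act_mod Vm
  by (rule lin_act_mod[OF Vm_lin_act])

definition pt :: "falg \<Rightarrow> complex \<Rightarrow> (falg set \<times> complex \<Rightarrow>\<^sub>0 complex) set" where
  "pt p c = V.cls (basis_vec (uc p, c))"

definition w :: "(falg set \<times> complex \<Rightarrow>\<^sub>0 complex) set" where "w = pt 1 1"

lemma pt_closed [simp, intro]: "pt p c \<in> carrier Vm"
  unfolding Vm_eq pt_def by (rule V.cls_in_carrier) simp

lemma pt_add: "pt (p + q) c = pt p c \<oplus>\<^bsub>Vm\<^esub> pt q c"
proof -
  have "basis_vec (uc p \<oplus>\<^bsub>uea UNIV\<^esub> uc q, c) - basis_vec (uc p, c) - basis_vec (uc q, c) \<in> V.K"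
    by (intro rels_bil bl.rel_add_left) simp_all
  then show ?thesis by (simp add: pt_def Vm_eq V.presented_sel V.cls_eq_iff diff_diff_eq ucls_sel)
qed

lemma pt_scale: "pt (cscale a p) c = a \<odot>\<^bsub>Vm\<^esub> pt p c"
proof -
  have "basis_vec (a \<odot>\<^bsub>uea UNIV\<^esub> uc p, c) - cscale a (basis_vec (uc p, c)) \<in> V.K"
    by (intro rels_bil bl.rel_scale_left) simp_all
  then show ?thesis by (simp add: pt_def Vm_eq V.presented_sel V.cls_eq_iff ucls_sel del: cscale_single)
qed

lemma pt_scale_right: "pt p (a * c) = a \<odot>\<^bsub>Vm\<^esub> pt p c"
proof -
  have "basis_vec (uc p, a \<odot>\<^bsub>one_dim mu\<^esub> c) - cscale a (basis_vec (uc p, c)) \<in> V.K"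
    by (intro rels_bil bl.rel_scale_right) simp_all
  then show ?thesis by (simp add: pt_def Vm_eq V.presented_sel V.cls_eq_iff ucls_sel del: cscale_single)
qed

lemma pt_balanced: "q \<in> H.F \<Longrightarrow> pt (p * q) c = pt p (char_val mu q * c)"
  unfolding pt_def V.cls_eq_iff by (rule cspace.span_base) (unfold rels_def, blast)

lemma pt_cong: "p - q \<in> uea_ideal UNIV \<Longrightarrow> pt p c = pt q c"
  using ucls_eq[of p q] by (simp add: pt_def)

lemma act_pt: "act Vm x (pt p c) = pt (fgen x * p) c"
  unfolding Vm_eq pt_def by (simp add: V.act_cls[OF gen_act_rels] ucls_sel)

lemma pt_induct [consumes 1, case_names pt add scale]:
  assumes "v \<in> carrier Vm" and "\<And>p c. Q (pt p c)"
    and "\<And>x y. x \<in> carrier Vm \<Longrightarrow> y \<in> carrier Vm \<Longrightarrow> Q x \<Longrightarrow> Q y \<Longrightarrow> Q (x \<oplus>\<^bsub>Vm\<^esub> y)"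
    and "\<And>c x. x \<in> carrier Vm \<Longrightarrow> Q x \<Longrightarrow> Q (c \<odot>\<^bsub>Vm\<^esub> x)"
  shows "Q v"
  using assms(1) unfolding Vm_eq
proof (induction rule: V.presented_induct)
  case (gen g)
  then obtain p c where "g = (uc p, c)" by (auto simp: ucls_all simp del: uc_carrier)
  then show ?case using assms(2)[of p c] by (simp add: pt_def)
next
  case (add x y) then show ?case using assms(3) unfolding Vm_eq by blast
next
  case (scale c x) then show ?case using assms(4) unfolding Vm_eq by blast
next
  show "G \<noteq> {}" using uc_carrier by blast
qed

end

section \<open>The induced module as a cyclic, locally annihilated module\<close>

context character
begin

lemma w_closed [simp, intro]: "w \<in> carrier Vm"
  by (simp add: w_def)

lemma fgen_rels:
  "fgen (x + y) - fgen x - fgen y \<in> uea_ideal UNIV" "fgen (cscale c x) - cscale c (fgen x) \<in> uea_ideal UNIV"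
  "fgen x * fgen y - fgen y * fgen x - fgen (vir_bracket x y) \<in> uea_ideal UNIV"
  by (rule full.gens_I, unfold full.gens_def, blast)+

lemma ideal_right: "p \<in> uea_ideal UNIV \<Longrightarrow> p * a \<in> uea_ideal UNIV"
  using full.I_right[of p a] by simp

text \<open>On \<open>pt p c\<close> each module axiom is a defining relation of the enveloping
  algebra multiplied by \<open>p\<close> from the right.\<close>

lemma Vm_vir_mod: "vir_mod Vm"
proof
  fix v x y assume v: "v \<in> carrier Vm"
  show "act Vm (x + y) v = act Vm x v \<oplus>\<^bsub>Vm\<^esub> act Vm y v"
    using v
  proof (induction rule: pt_induct)
    case (pt p c)
    have "fgen (x + y) * p - (fgen x * p + fgen y * p) = (fgen (x + y) - fgen x - fgen y) * p" by (simp add: algebra_simps)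
    then have "fgen (x + y) * p - (fgen x * p + fgen y * p) \<in> uea_ideal UNIV" using ideal_right[OF fgen_rels(1)] by simp
    then show ?case by (simp add: act_pt pt_cong flip: pt_add)
  qed (simp_all add: Vm.act_add Vm.act_scale Vm.a_ac Vm.sm_add_right)
  show "act Vm (cscale c x) v = c \<odot>\<^bsub>Vm\<^esub> act Vm x v" for c
    using v
  proof (induction rule: pt_induct)
    case (pt p d)
    have "fgen (cscale c x) * p - cscale c (fgen x * p) = (fgen (cscale c x) - cscale c (fgen x)) * p"
      by (simp add: left_diff_distrib mult_cscale_falg del: cscale_single)
    then have "fgen (cscale c x) * p - cscale c (fgen x * p) \<in> uea_ideal UNIV" using ideal_right[OF fgen_rels(2)] by simp
    then show ?case by (simp add: act_pt pt_cong flip: pt_scale)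
  qed (simp_all add: Vm.act_add Vm.act_scale Vm.sm_add_right Vm.sm_sm mult.commute)
  show "act Vm (vir_bracket x y) v = act Vm x (act Vm y v) \<ominus>\<^bsub>Vm\<^esub> act Vm y (act Vm x v)"
  proof -
    have "act Vm x (act Vm y v) = act Vm (vir_bracket x y) v \<oplus>\<^bsub>Vm\<^esub> act Vm y (act Vm x v)"
      using v
    proof (induction rule: pt_induct)
      case (pt p d)
      have "fgen x * (fgen y * p) - (fgen (vir_bracket x y) * p + fgen y * (fgen x * p)) =
          (fgen x * fgen y - fgen y * fgen x - fgen (vir_bracket x y)) * p"
        by (simp add: algebra_simps)
      then have "fgen x * (fgen y * p) - (fgen (vir_bracket x y) * p + fgen y * (fgen x * p)) \<in> uea_ideal UNIV"
        using ideal_right[OF fgen_rels(3)] by simp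
      then show ?case by (simp add: act_pt pt_cong flip: pt_add)
    qed (simp_all add: Vm.act_add Vm.act_scale Vm.a_ac Vm.sm_add_right)
    then show ?thesis using v by (simp add: Vm.minus_eq Vm.a_assoc Vm.r_neg)
  qed
qed

sublocale Vm: vir_mod Vm
  by (rule Vm_vir_mod)

lemma act_w: "x \<in> H \<Longrightarrow> act Vm x w = mu x \<odot>\<^bsub>Vm\<^esub> w"
proof -
  assume x: "x \<in> H"
  have "act Vm x w = pt (1 * fgen x) 1" by (simp add: w_def act_pt)
  also have "\<dots> = pt 1 (char_val mu (fgen x) * 1)" by (rule pt_balanced) (use x in simp)
  also have "\<dots> = mu x \<odot>\<^bsub>Vm\<^esub> w" by (simp only: char_val_simps pt_scale_right w_def)
  finally show ?thesis .
qed

lemma Vm_cyclic: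
  assumes "v \<in> carrier Vm"
  shows "v \<in> cyc Vm UNIV w"
  using assms
proof (induction rule: pt_induct)
  case (pt p c)
  show ?case
  proof (induction p rule: pm_induct)
    case (basis v)
    obtain xs where v: "v = FWord xs" by (cases v)
    show ?case unfolding v
    proof (induction xs)
      case Nil
      have "basis_vec (FWord []) = (1 :: falg)" unfolding zero_fword_def[symmetric] by simp
      then have "pt (basis_vec (FWord [])) c = c \<odot>\<^bsub>Vm\<^esub> w" using pt_scale_right[of 1 c 1] by (simp add: w_def)
      then show ?case by (simp add: cyc_scale cyc_gen)
    next
      case (Cons x xs)
      have "basis_vec (FWord (x # xs)) = fgen x * basis_vec (FWord xs)" by (simp add: mult_single plus_fword_def)
      then show ?case using cyc_act[OF UNIV_I Cons.IH] by (simp add: act_pt)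
    qed
  qed (simp_all add: pt_add pt_scale cyc_add cyc_scale)
qed (simp_all add: cyc_add cyc_scale)

text \<open>Centrality carries \<open>mu vz = 0\<close> from the generator to the whole
  module.\<close>

lemma act_vz: "v \<in> carrier Vm \<Longrightarrow> act Vm vz v = \<zero>\<^bsub>Vm\<^esub>"
proof -
  assume "v \<in> carrier Vm"
  then have "v \<in> cyc Vm UNIV w" by (rule Vm_cyclic)
  then show ?thesis
  proof induction
    case cyc_gen
    then show ?case by (simp add: act_w vz_vanish mu_vz)
  next
    case (cyc_act x u)
    then show ?case using Vm.cyc_carrier[OF w_closed cyc_act(2)] by (simp add: Vm.act_act[of u vz x])
  next
    case (cyc_add u v)
    then show ?case using Vm.cyc_carrier[OF w_closed cyc_add(1)] Vm.cyc_carrier[OF w_closed cyc_add(2)] by (simp add: Vm.act_add)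
  next
    case (cyc_scale u c)
    then show ?case using Vm.cyc_carrier[OF w_closed cyc_scale(1)] by (simp add: Vm.act_scale)
  qed
qed

text \<open>The generator is killed from order \<open>2 * n\<close> on, where \<open>mu\<close>
  vanishes. Each further application of a Lie algebra element raises the bound by one, the order
  lost in a bracket.\<close>

lemma Vm_locally_killed: "locally_killed (order_filt lam) Vm"
  unfolding locally_killed_def
proof
  fix v assume "v \<in> carrier Vm"
  then have "v \<in> cyc Vm UNIV w" by (rule Vm_cyclic)
  then have "\<exists>N. \<forall>g. linfac lam ^ N dvd g \<longrightarrow> act Vm (e_of g) v = \<zero>\<^bsub>Vm\<^esub>"
  proof induction
    case cyc_gen
    have "act Vm (e_of g) w = \<zero>\<^bsub>Vm\<^esub>" if "linfac lam ^ (2 * n) dvd g" for g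
    proof -
      have "e_of g \<in> vanish lam (2 * n)" using that by (simp add: vanish_def)
      moreover have "vanish lam (2 * n) \<subseteq> H" by (rule vanish_mono) simp
      ultimately show ?thesis using mu_vanish by (auto simp: act_w)
    qed
    then show ?case by (intro exI[of _ "2 * n"]) simp
  next
    case (cyc_add u v)
    from cyc_add.IH obtain N N' where N: "\<forall>g. linfac lam ^ N dvd g \<longrightarrow> act Vm (e_of g) u = \<zero>\<^bsub>Vm\<^esub>"
      "\<forall>g. linfac lam ^ N' dvd g \<longrightarrow> act Vm (e_of g) v = \<zero>\<^bsub>Vm\<^esub>" by (elim exE) rule
    have uv: "u \<in> carrier Vm" "v \<in> carrier Vm" using Vm.cyc_carrier[OF w_closed cyc_add(1)] Vm.cyc_carrier[OF w_closed cyc_add(2)] by auto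
    have "linfac lam ^ N dvd g \<and> linfac lam ^ N' dvd g" if "linfac lam ^ max N N' dvd g" for g
      using dvd_trans[OF le_imp_power_dvd that] by simp
    then show ?case using N uv by (intro exI[of _ "max N N'"]) (simp add: Vm.act_add)
  next
    case (cyc_scale u c)
    from cyc_scale.IH obtain N where "\<forall>g. linfac lam ^ N dvd g \<longrightarrow> act Vm (e_of g) u = \<zero>\<^bsub>Vm\<^esub>" ..
    then show ?case using Vm.cyc_carrier[OF w_closed cyc_scale(1)] by (intro exI[of _ N]) (simp add: Vm.act_scale)
  next
    case (cyc_act x u)
    from cyc_act.IH obtain N where N': "\<forall>g. linfac lam ^ N dvd g \<longrightarrow> act Vm (e_of g) u = \<zero>\<^bsub>Vm\<^esub>" ..
    have N: "act Vm (e_of g) u = \<zero>\<^bsub>Vm\<^esub>" if "linfac lam ^ N dvd g" for g using N' that by simp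
    have u: "u \<in> carrier Vm" using Vm.cyc_carrier[OF w_closed cyc_act(2)] .
    have "act Vm (e_of g) (act Vm x u) = \<zero>\<^bsub>Vm\<^esub>" if g: "linfac lam ^ Suc N dvd g" for g
    proof -
      let ?b = "vir_bracket (e_of g) x"
      have g': "linfac lam ^ N dvd g" by (rule dvd_trans[OF le_imp_power_dvd g]) simp
      have "linfac lam ^ N dvd lau ?b"
        using g' dvd_D[OF g] by (simp add: lau_bracket)
      then have "act Vm (e_of (lau ?b)) u = \<zero>\<^bsub>Vm\<^esub>" by (rule N)
      \<comment> \<open>The bracket may have a central part, which acts as zero by
        \<open>act_vz\<close>.\<close>
      moreover have "act Vm ?b u = act Vm (cscale (Poly_Mapping.lookup ?b Z) vz + e_of (lau ?b)) u"
        using vir_decomp[of ?b] by simp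
      ultimately have "act Vm ?b u = \<zero>\<^bsub>Vm\<^esub>"
        using u by (simp add: Vm.act_plus Vm.act_cscale act_vz del: cscale_single)
      then show ?thesis using u N[OF g'] by (simp add: Vm.act_act[of u "e_of g" x])
    qed
    then show ?case by (intro exI[of _ "Suc N"]) simp
  qed
  then show "\<exists>N. \<forall>x\<in>order_filt lam N. act Vm x v = \<zero>\<^bsub>Vm\<^esub>"
    using lam by (auto simp: order_filt_def germs_def)
qed

section \<open>Universal property, embedding, and eigenvectors\<close>

text \<open>Frobenius reciprocity: the generator may be sent to any vector with character
  \<open>mu\<close>, by letting the enveloping algebra act on that vector.\<close>

lemma Vm_realization:
  assumes \<rho>: "vir_rep UNIV \<rho>" and \<omega>: "\<And>x. x \<in> H \<Longrightarrow> \<rho> x \<omega> = cscale (mu x) \<omega>"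
  obtains \<Phi> where "cyc_hom Vm UNIV w \<rho> \<Phi>" "\<Phi> w = \<omega>"
proof -
  have cl: "clin (\<rho> x)" for x using \<rho> by (simp add: vir_rep_def)
  have ideal: "falg_rep \<rho> p u = 0" if "p \<in> uea_ideal UNIV" for p u
    using full.falg_rep_ideal[OF cl _ _ _ that] \<rho> by (simp add: vir_rep_def)
  have balanced: "falg_rep \<rho> q \<omega> = cscale (char_val mu q) \<omega>" if "q \<in> H.F" for q
  proof -
    have "falg_rep \<rho> q \<omega> = falg_rep (\<lambda>x. cscale (mu x)) q \<omega>"
      unfolding falg_rep_def
    proof (rule lin_ext_cong)
      fix v assume "v \<in> Poly_Mapping.keys q"
      then have "set (letters v) \<subseteq> H" using that by auto
      moreover have "foldr \<rho> xs \<omega> = foldr (\<lambda>x. cscale (mu x)) xs \<omega>" if "set xs \<subseteq> H" for xs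
        using that by (induction xs) (simp_all add: cscale_foldr clin_scale[OF cl] \<omega> mult.commute)
      ultimately show "foldr \<rho> (letters v) \<omega> = foldr (\<lambda>x. cscale (mu x)) (letters v) \<omega>" by blast
    qed
    then show ?thesis by (simp add: falg_rep_char)
  qed
  \<comment> \<open>Any representative of the class may act on \<open>\<omega>\<close>, because the
    ideal acts as zero.\<close>
  define h where "h u = falg_rep \<rho> (SOME p. uc p = u) \<omega>" for u
  have h: "h (uc p) = falg_rep \<rho> p \<omega>" for p
  proof -
    have "uc (SOME q. uc q = uc p) = uc p" by (rule someI) (rule refl)
    then have "(SOME q. uc q = uc p) - p \<in> uea_ideal UNIV" by (simp add: ucls_eq)
    from ideal[OF this, of \<omega>] show ?thesis by (simp add: h_def falg_rep_simps)
  qed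
  define g where "g = (\<lambda>(u, c). cscale c (h u))"
  have gG: "g \<in> G \<rightarrow> carrier free_mod" by simp
  interpret N: cmod "free_mod :: (complex, uspace) module" by (rule cmod_free_mod)
  have rel: "lcomb free_mod g r = \<zero>\<^bsub>free_mod\<^esub>" if "r \<in> rels" for r
  proof (cases "r \<in> bilinear_relations (uea UNIV) (one_dim mu)")
    case True
    show ?thesis
      by (rule bl.rel_lcomb[OF cmod_free_mod _ _ _ _ _ True])
        (auto simp: g_def ucls_all h falg_rep_simps cspace.scale_right_distrib cspace.scale_left_distrib mult.commute
          simp del: uc_carrier)
  next
    case False
    then have "r \<in> {basis_vec (uc (p * q), c) - basis_vec (uc p, char_val mu q * c) | p q c. q \<in> H.F}"
      using that unfolding rels_def by blast
    then obtain p q c where r: "r = basis_vec (uc (p * q), c) - basis_vec (uc p, char_val mu q * c)" "q \<in> H.F" by blast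
    have "g (uc (p * q), c) = 1 \<odot>\<^bsub>free_mod\<^esub> g (uc p, char_val mu q * c)"
      by (simp add: g_def h falg_rep_mult[OF cl] balanced[OF r(2)] clin_scale[OF falg_rep_clin[OF cl]] mult.commute)
    from N.lcomb_rel_scale[OF gG _ _ this] show ?thesis by (simp add: r(1))
  qed
  define \<Phi> where "\<Phi> = V.lift free_mod g"
  have Phi_pt: "\<Phi> (pt p c) = cscale c (falg_rep \<rho> p \<omega>)" for p c
  proof -
    have "\<Phi> (V.cls (basis_vec (uc p, c))) = lcomb free_mod g (basis_vec (uc p, c))"
      unfolding \<Phi>_def by (rule V.lift_cls[OF cmod_free_mod gG rel]) simp_all
    also have "\<dots> = g (uc p, c)" by (rule N.lcomb_basis) simp
    finally show ?thesis by (simp add: pt_def g_def h)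
  qed
  have hom: "cmod_hom Vm free_mod \<Phi>"
    unfolding \<Phi>_def Vm_eq by (rule V.lift_hom[OF cmod_free_mod gG rel])
  have act: "\<Phi> (act Vm x v) = \<rho> x (\<Phi> v)" if "v \<in> carrier Vm" for x v
    using that
  proof (induction rule: pt_induct)
    case (pt p c)
    show ?case by (simp add: act_pt Phi_pt falg_rep_mult[OF cl] falg_rep_simps clin_scale[OF cl])
  next
    case (add x y)
    then show ?case using cmod_hom_add[OF hom] by (simp add: Vm.act_add clin_add[OF cl])
  next
    case (scale c x)
    then show ?case using cmod_hom_scale[OF hom] by (simp add: Vm.act_scale clin_scale[OF cl])
  qed
  have car: "u \<in> carrier Vm" if "u \<in> cyc Vm UNIV w" for u using Vm.cyc_carrier[OF w_closed that] .
  have "cyc_hom Vm UNIV w \<rho> \<Phi>"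
    unfolding cyc_hom_def using act car cmod_hom_add[OF hom] cmod_hom_scale[OF hom] by simp
  moreover have "\<Phi> w = \<omega>" by (simp add: w_def Phi_pt falg_rep_simps)
  ultimately show ?thesis by (rule that)
qed

text \<open>At \<open>s = 0\<close> the tower is a representation of the whole algebra, so the
  universal property maps into it and the last clause of \<open>tower\<close> makes this map
  injective. Eigenvectors of the induced module thus become eigenvectors in the tower.\<close>

lemma Vm_embedding:
  obtains \<rho> \<omega> \<Phi> where "tower Vm w 0 \<rho> \<omega>" "cmod_hom Vm free_mod \<Phi>" "\<Phi> w = \<omega>"
    "\<And>x v. v \<in> carrier Vm \<Longrightarrow> \<Phi> (act Vm x v) = \<rho> x (\<Phi> v)"
    "\<And>v. v \<in> carrier Vm \<Longrightarrow> \<Phi> v = 0 \<Longrightarrow> v = \<zero>\<^bsub>Vm\<^esub>"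
proof -
  obtain \<rho> \<omega> where t: "tower Vm w 0 \<rho> \<omega>" using tower_exists[OF Vm_vir_mod w_closed act_w] by blast
  have U: "vanish lam 0 = UNIV" by (simp add: vanish_def)
  note T2 = t[unfolded tower_def, THEN conjunct2]
  note T6 = T2[THEN conjunct2, THEN conjunct2, THEN conjunct2, THEN conjunct2]
  have rep: "vir_rep UNIV \<rho>" using t[unfolded tower_def, THEN conjunct1] by (simp add: U)
  have om: "\<rho> x \<omega> = cscale (mu x) \<omega>" if "x \<in> H" for x
    using T2[THEN conjunct2, THEN conjunct1] that by simp
  obtain \<Phi> where \<Phi>: "cyc_hom Vm UNIV w \<rho> \<Phi>" "\<Phi> w = \<omega>" using Vm_realization[OF rep om] .
  have h: "cmod_hom Vm free_mod \<Phi>" and a: "\<And>x v. v \<in> carrier Vm \<Longrightarrow> \<Phi> (act Vm x v) = \<rho> x (\<Phi> v)"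
    using \<Phi>(1) Vm_cyclic by (auto simp: cmod_hom_def cyc_hom_def)
  have i: "v = \<zero>\<^bsub>Vm\<^esub>" if "v \<in> carrier Vm" "\<Phi> v = 0" for v
    using T6[unfolded U, THEN spec, THEN mp, OF \<Phi>(1), THEN mp, OF \<Phi>(2)] Vm_cyclic[OF that(1)] that(2) by simp
  from t h \<Phi>(2) a i show ?thesis by (rule that)
qed

lemma w_nonzero: "w \<noteq> \<zero>\<^bsub>Vm\<^esub>"
proof -
  obtain \<rho> \<omega> \<Phi> where *: "tower Vm w 0 \<rho> \<omega>" "cmod_hom Vm free_mod \<Phi>" "\<Phi> w = \<omega>" using Vm_embedding by metis
  have "\<omega> \<noteq> 0" using *(1)[unfolded tower_def, THEN conjunct2, THEN conjunct1] .
  then show ?thesis using cmod_hom_zero[OF Vm.cmod cmod_free_mod *(2)] *(3) by auto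
qed

lemma Vm_no_eigenvector:
  assumes v: "v \<in> carrier Vm" "v \<noteq> \<zero>\<^bsub>Vm\<^esub>" and x: "x \<notin> H" and eig: "act Vm x v = c \<odot>\<^bsub>Vm\<^esub> v"
  shows False
proof -
  obtain \<rho> \<omega> \<Phi> where t: "tower Vm w 0 \<rho> \<omega>" and hom: "cmod_hom Vm free_mod \<Phi>"
    and act: "\<And>x v. v \<in> carrier Vm \<Longrightarrow> \<Phi> (act Vm x v) = \<rho> x (\<Phi> v)"
    and inj: "\<And>v. v \<in> carrier Vm \<Longrightarrow> \<Phi> v = 0 \<Longrightarrow> v = \<zero>\<^bsub>Vm\<^esub>"
    using Vm_embedding by metis
  note T4 = t[unfolded tower_def, THEN conjunct2, THEN conjunct2, THEN conjunct2, THEN conjunct1]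
  have "\<rho> x (\<Phi> v) = cscale c (\<Phi> v)" using act[OF v(1), of x] eig cmod_hom_scale[OF hom v(1)] by simp
  moreover have "x \<in> vanish lam 0 - H" using x by (simp add: vanish_def)
  ultimately have "\<Phi> v = 0" using T4 by blast
  then show False using inj v by blast
qed

lemma Vm_eigenvector:
  assumes v: "v \<in> carrier Vm" "v \<noteq> \<zero>\<^bsub>Vm\<^esub>" and eig: "\<And>x. x \<in> H \<Longrightarrow> act Vm x v = \<nu> x \<odot>\<^bsub>Vm\<^esub> v"
  shows "\<exists>r::nat. \<forall>x\<in>H. \<nu> x = mu x + of_nat r * weight x"
proof -
  obtain \<rho> \<omega> \<Phi> where t: "tower Vm w 0 \<rho> \<omega>" and hom: "cmod_hom Vm free_mod \<Phi>"
    and act: "\<And>x v. v \<in> carrier Vm \<Longrightarrow> \<Phi> (act Vm x v) = \<rho> x (\<Phi> v)"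
    and inj: "\<And>v. v \<in> carrier Vm \<Longrightarrow> \<Phi> v = 0 \<Longrightarrow> v = \<zero>\<^bsub>Vm\<^esub>"
    using Vm_embedding by metis
  note T5 = t[unfolded tower_def, THEN conjunct2, THEN conjunct2, THEN conjunct2, THEN conjunct2, THEN conjunct1]
  have "\<rho> x (\<Phi> v) = cscale (\<nu> x) (\<Phi> v)" if "x \<in> H" for x
    using act[OF v(1), of x] eig[OF that] cmod_hom_scale[OF hom v(1)] by simp
  moreover have "\<Phi> v \<noteq> 0" using inj v by blast
  ultimately show ?thesis using T5[THEN spec, THEN spec, THEN mp, THEN mp, of "\<Phi> v" \<nu>] by blast
qed

end

section \<open>Homomorphisms of simple modules\<close>

lemma cmod_hom_comp: "cmod_hom A B \<phi> \<Longrightarrow> cmod_hom B C \<psi> \<Longrightarrow> cmod_hom A C (\<lambda>v. \<psi> (\<phi> v))"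
  unfolding cmod_hom_def by (simp add: Pi_iff)

lemma (in vir_mod) vir_submoduleI:
  assumes "N \<subseteq> carrier M" "\<zero> \<in> N" "\<And>u v. u \<in> N \<Longrightarrow> v \<in> N \<Longrightarrow> u \<oplus> v \<in> N"
    "\<And>c v. v \<in> N \<Longrightarrow> c \<odot> v \<in> N" "\<And>x v. v \<in> N \<Longrightarrow> act M x v \<in> N"
  shows "vir_submodule N M"
  unfolding vir_submodule_def
proof (intro conjI allI ballI)
  show "submodule N complex_ring M"
  proof (rule submoduleI)
    show "\<ominus> a \<in> N" if "a \<in> N" for a using assms(1,4) that by (subst neg_eq_sm) auto
  qed (use assms in auto)
qed (use assms in auto)

lemma simple_hom_iso:
  assumes "simple_vir_module V" "simple_vir_module W" and hom: "cmod_hom V W \<xi>"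
    and act: "\<And>x v. v \<in> carrier V \<Longrightarrow> \<xi> (act V x v) = act W x (\<xi> v)"
    and v0: "v0 \<in> carrier V" "\<xi> v0 \<noteq> \<zero>\<^bsub>W\<^esub>"
  shows "V \<cong>\<^sub>V W"
proof -
  interpret V: vir_mod V using assms(1) vir_module_vir_mod by (auto simp: simple_vir_module_def)
  interpret W: vir_mod W using assms(2) vir_module_vir_mod by (auto simp: simple_vir_module_def)
  have z: "\<xi> \<zero>\<^bsub>V\<^esub> = \<zero>\<^bsub>W\<^esub>" by (rule cmod_hom_zero[OF V.cmod W.cmod hom])
  note h = cmod_hom_add[OF hom] cmod_hom_scale[OF hom] cmod_hom_closed[OF hom]
  let ?K = "{v \<in> carrier V. \<xi> v = \<zero>\<^bsub>W\<^esub>}"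
  have "vir_submodule ?K V"
    by (rule V.vir_submoduleI) (auto simp: h z act)
  then have K: "?K = {\<zero>\<^bsub>V\<^esub>}" using assms(1) v0 unfolding simple_vir_module_def by blast
  have "vir_submodule (\<xi> ` carrier V) W"
  proof (rule W.vir_submoduleI)
    show "\<xi> ` carrier V \<subseteq> carrier W" using h(3) by blast
    show "\<zero>\<^bsub>W\<^esub> \<in> \<xi> ` carrier V" by (rule image_eqI[where x = "\<zero>\<^bsub>V\<^esub>"]) (simp_all add: z)
    show "u \<oplus>\<^bsub>W\<^esub> v \<in> \<xi> ` carrier V" if uv: "u \<in> \<xi> ` carrier V" "v \<in> \<xi> ` carrier V" for u v
    proof -
      obtain a b where ab: "u = \<xi> a" "v = \<xi> b" "a \<in> carrier V" "b \<in> carrier V" using uv by auto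
      then show ?thesis by (intro image_eqI[of _ _ "a \<oplus>\<^bsub>V\<^esub> b"]) (simp_all add: h)
    qed
    show "c \<odot>\<^bsub>W\<^esub> v \<in> \<xi> ` carrier V" if uv: "v \<in> \<xi> ` carrier V" for c v
    proof -
      obtain b where "v = \<xi> b" "b \<in> carrier V" using uv by auto
      then show ?thesis by (intro image_eqI[of _ _ "c \<odot>\<^bsub>V\<^esub> b"]) (simp_all add: h)
    qed
    show "act W x v \<in> \<xi> ` carrier V" if uv: "v \<in> \<xi> ` carrier V" for x v
    proof -
      obtain b where "v = \<xi> b" "b \<in> carrier V" using uv by auto
      then show ?thesis by (intro image_eqI[of _ _ "act V x b"]) (simp_all add: act)
    qed
  qed
  then have img: "\<xi> ` carrier V = carrier W" using assms(2) v0 unfolding simple_vir_module_def by blast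
  have "inj_on \<xi> (carrier V)"
  proof (rule inj_onI)
    fix a b assume ab: "a \<in> carrier V" "b \<in> carrier V" "\<xi> a = \<xi> b"
    have "\<xi> (a \<ominus>\<^bsub>V\<^esub> b) = \<xi> a \<ominus>\<^bsub>W\<^esub> \<xi> b" using ab(1,2) by (simp add: V.minus_eq_sm W.minus_eq_sm h)
    then have "a \<ominus>\<^bsub>V\<^esub> b \<in> ?K" using ab h(3) by (simp add: W.diff_eq_zero_iff)
    then have "a \<ominus>\<^bsub>V\<^esub> b = \<zero>\<^bsub>V\<^esub>" using K by blast
    then show "a = b" using ab V.diff_eq_zero_iff by simp
  qed
  then show ?thesis
    unfolding vir_iso_def bij_betw_def using img h act by blast
qed

lemma (in tensor_pair) tensor_locally_killed:
  assumes "locally_killed J A" "locally_killed J' B" "decseq J" "decseq J'"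
  shows "locally_killed (\<lambda>N. J N \<inter> J' N) (A \<otimes>\<^sub>V B)"
  unfolding locally_killed_def
proof
  fix y assume "y \<in> carrier (A \<otimes>\<^sub>V B)"
  then show "\<exists>N. \<forall>x\<in>J N \<inter> J' N. act (A \<otimes>\<^sub>V B) x y = \<zero>\<^bsub>A \<otimes>\<^sub>V B\<^esub>"
  proof (induction rule: tens_induct)
    case (tens u v)
    obtain N where N: "\<forall>x\<in>J N. act A x u = \<zero>\<^bsub>A\<^esub>" using assms(1) tens(1) unfolding locally_killed_def by blast
    obtain N' where N': "\<forall>x\<in>J' N'. act B x v = \<zero>\<^bsub>B\<^esub>" using assms(2) tens(2) unfolding locally_killed_def by blast
    have "x \<in> J N \<and> x \<in> J' N'" if "x \<in> J (max N N') \<inter> J' (max N N')" for x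
      using that decseqD[OF assms(3), of N "max N N'"] decseqD[OF assms(4), of N' "max N N'"] by auto
    then show ?case using N N' tens by (intro exI[of _ "max N N'"]) (simp add: act_tens)
  next
    case (add y z)
    from add(3) obtain N where N: "\<forall>x\<in>J N \<inter> J' N. act (A \<otimes>\<^sub>V B) x y = \<zero>\<^bsub>A \<otimes>\<^sub>V B\<^esub>" ..
    from add(4) obtain N' where N': "\<forall>x\<in>J N' \<inter> J' N'. act (A \<otimes>\<^sub>V B) x z = \<zero>\<^bsub>A \<otimes>\<^sub>V B\<^esub>" ..
    have "x \<in> J N \<inter> J' N \<and> x \<in> J N' \<inter> J' N'" if "x \<in> J (max N N') \<inter> J' (max N N')" for x
      using that decseqD[OF assms(3), of N "max N N'"] decseqD[OF assms(4), of N' "max N N'"]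
        decseqD[OF assms(3), of N' "max N N'"] decseqD[OF assms(4), of N "max N N'"] by auto
    then show ?case using N N' add(1,2) by (intro exI[of _ "max N N'"]) (simp add: T.act_add)
  next
    case (scale c z)
    from scale(2) obtain N where N: "\<forall>x\<in>J N \<inter> J' N. act (A \<otimes>\<^sub>V B) x z = \<zero>\<^bsub>A \<otimes>\<^sub>V B\<^esub>" ..
    then show ?case using scale(1) by (intro exI[of _ N]) (simp add: T.act_scale)
  qed
qed

lemma locally_annihilated_killed:
  assumes "vir_mod V" "vir_locally_annihilated V"
  shows "locally_killed (order_filt 0) V"
  unfolding locally_killed_def
proof
  interpret V: vir_mod V by fact
  fix v assume v: "v \<in> carrier V"
  then obtain l :: nat where l: "\<forall>j\<ge>int l. act V (ve j) v = \<zero>\<^bsub>V\<^esub>"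
    using assms(2) by (auto simp: vir_locally_annihilated_def)
  have "act V (e_of g) v = \<zero>\<^bsub>V\<^esub>" if "Poly_Mapping.keys g \<subseteq> {int l..}" for g
    using that
  proof (induction rule: supported_induct)
    case (basis g)
    then show ?case using l by simp
  next
    case (add p q)
    then show ?case using v by (simp add: e_of_add V.act_plus)
  next
    case (scale c p)
    then show ?case using v by (simp add: e_of_scale V.act_cscale)
  qed (use v in \<open>simp add: e_of_zero\<close>)
  then show "\<exists>N. \<forall>x\<in>order_filt 0 N. act V x v = \<zero>\<^bsub>V\<^esub>"
    by (intro exI[of _ l]) (auto simp: order_filt_def germs_def)
qed

section \<open>The tensor product modules\<close>

locale side =
  fixes I :: "nat set" and lam :: "nat \<Rightarrow> complex" and n :: "nat \<Rightarrow> nat" and mu :: "nat \<Rightarrow> vir \<Rightarrow> complex"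
    and V :: "'v vmod"
  assumes finite_I: "finite I" and inj: "inj_on lam I"
    and chars: "i \<in> I \<Longrightarrow> character (lam i) (n i) (mu i)"
    and simple: "simple_vir_module V" and ann: "vir_locally_annihilated V"
begin

abbreviation "VV \<equiv> \<lambda>i. Vfmu ([:- lam i, 1:] ^ n i) (mu i)"
definition ww where "ww i = character.w (lam i) (n i) (mu i)"

lemma lam_nonzero: "i \<in> I \<Longrightarrow> lam i \<noteq> 0"
  using chars character.lam by blast

lemma VV_facts:
  assumes i: "i \<in> I"
  shows "vir_mod (VV i)" and "ww i \<in> carrier (VV i)" and "ww i \<noteq> \<zero>\<^bsub>VV i\<^esub>"
    and "x \<in> vanish (lam i) (n i) \<Longrightarrow> act (VV i) x (ww i) = mu i x \<odot>\<^bsub>VV i\<^esub> ww i"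
    and "locally_killed (order_filt (lam i)) (VV i)"
    and "v \<in> carrier (VV i) \<Longrightarrow> act (VV i) vz v = \<zero>\<^bsub>VV i\<^esub>"
    and "v \<in> carrier (VV i) \<Longrightarrow> v \<noteq> \<zero>\<^bsub>VV i\<^esub> \<Longrightarrow> act (VV i) x v = c \<odot>\<^bsub>VV i\<^esub> v \<Longrightarrow> x \<in> vanish (lam i) (n i)"
    and "v \<in> carrier (VV i) \<Longrightarrow> v \<noteq> \<zero>\<^bsub>VV i\<^esub> \<Longrightarrow>
      (\<And>x. x \<in> vanish (lam i) (n i) \<Longrightarrow> act (VV i) x v = \<nu> x \<odot>\<^bsub>VV i\<^esub> v) \<Longrightarrow>
      \<exists>r::nat. \<forall>x\<in>vanish (lam i) (n i). \<nu> x = mu i x + of_nat r * character.weight (lam i) x"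
proof -
  interpret C: character "lam i" "n i" "mu i" by (rule chars[OF i])
  note f = C.f_def[symmetric]
  show "vir_mod (VV i)" unfolding f by (rule C.Vm_vir_mod)
  show "ww i \<in> carrier (VV i)" unfolding f ww_def by (rule C.w_closed)
  show "ww i \<noteq> \<zero>\<^bsub>VV i\<^esub>" unfolding f ww_def by (rule C.w_nonzero)
  show "x \<in> vanish (lam i) (n i) \<Longrightarrow> act (VV i) x (ww i) = mu i x \<odot>\<^bsub>VV i\<^esub> ww i"
    unfolding f ww_def by (rule C.act_w)
  show "locally_killed (order_filt (lam i)) (VV i)" unfolding f by (rule C.Vm_locally_killed)
  show "v \<in> carrier (VV i) \<Longrightarrow> act (VV i) vz v = \<zero>\<^bsub>VV i\<^esub>" unfolding f by (rule C.act_vz)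
  show "v \<in> carrier (VV i) \<Longrightarrow> v \<noteq> \<zero>\<^bsub>VV i\<^esub> \<Longrightarrow> act (VV i) x v = c \<odot>\<^bsub>VV i\<^esub> v \<Longrightarrow> x \<in> vanish (lam i) (n i)"
    unfolding f using C.Vm_no_eigenvector by blast
  show "v \<in> carrier (VV i) \<Longrightarrow> v \<noteq> \<zero>\<^bsub>VV i\<^esub> \<Longrightarrow>
      (\<And>x. x \<in> vanish (lam i) (n i) \<Longrightarrow> act (VV i) x v = \<nu> x \<odot>\<^bsub>VV i\<^esub> v) \<Longrightarrow>
      \<exists>r::nat. \<forall>x\<in>vanish (lam i) (n i). \<nu> x = mu i x + of_nat r * C.weight x"
    unfolding f by (rule C.Vm_eigenvector)
qed

sublocale V: vir_mod V
  using simple vir_module_vir_mod by (auto simp: simple_vir_module_def)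

lemma V_killed: "locally_killed (order_filt 0) V"
  by (rule locally_annihilated_killed[OF V.vir_mod_axioms ann])

sublocale fam: tensor_fam I VV
proof (rule tensor_fam.intro)
  show "finite I" by (rule finite_I)
  show "lin_act_mod (VV i)" if "i \<in> I" for i by (rule vir_mod.axioms(1)[OF VV_facts(1)[OF that]])
qed

sublocale pair: tensor_pair fam.T V ..

abbreviation "M \<equiv> fam.T \<otimes>\<^sub>V V"

text \<open>The canonical generators of all factors. On the tensors \<open>vec v\<close> built from
  them the action of each factor is explicit, which makes them the test vectors of the
  comparison.\<close>

definition wm where "wm = (\<lambda>i\<in>I. ww i)"
definition vec where "vec v = pair.tens (fam.pure wm) v"

lemma wm_P: "wm \<in> fam.P"
  using VV_facts(2) by (auto simp: wm_def)

lemma T_killed: "locally_killed (\<lambda>N. \<Inter>i\<in>I. order_filt (lam i) N) fam.T"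
  by (rule fam.fam_locally_killed) (use VV_facts(5) decseq_order_filt in auto)

lemma T_decseq: "decseq (\<lambda>N. \<Inter>i\<in>I. order_filt (lam i) N)"
  by (rule decseq_INT) (rule decseq_order_filt)

lemma M_killed:
  assumes "y \<in> carrier M"
  shows "\<exists>N. \<forall>x. (\<forall>j\<in>I. x \<in> order_filt (lam j) N) \<longrightarrow> x \<in> order_filt 0 N \<longrightarrow> act M x y = \<zero>\<^bsub>M\<^esub>"
proof -
  have "locally_killed (\<lambda>N. (\<Inter>i\<in>I. order_filt (lam i) N) \<inter> order_filt 0 N) M"
    by (rule pair.tensor_locally_killed[OF T_killed V_killed T_decseq decseq_order_filt])
  then obtain N where "\<forall>x\<in>(\<Inter>i\<in>I. order_filt (lam i) N) \<inter> order_filt 0 N. act M x y = \<zero>\<^bsub>M\<^esub>"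
    using assms unfolding locally_killed_def by blast
  then show ?thesis by (intro exI[of _ N]) simp
qed

text \<open>Two contractions in succession, first of the locally annihilated factor and then of all
  induced factors but \<open>i\<close>.\<close>

lemma slice_factor:
  assumes y: "y \<in> carrier M" "y \<noteq> \<zero>\<^bsub>M\<^esub>" and i: "i \<in> I"
  shows "\<exists>\<Psi>. cmod_hom M (VV i) \<Psi> \<and> \<Psi> y \<noteq> \<zero>\<^bsub>VV i\<^esub> \<and>
    (\<forall>z\<in>carrier M. \<exists>N. \<forall>x. (\<forall>j\<in>I - {i}. x \<in> order_filt (lam j) N) \<longrightarrow> x \<in> order_filt 0 N \<longrightarrow>
      \<Psi> (act M x z) = act (VV i) x (\<Psi> z))"
proof -
  obtain \<Phi> where \<Phi>: "cmod_hom M fam.T \<Phi>" "\<Phi> y \<noteq> \<zero>\<^bsub>fam.T\<^esub>"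
    "\<forall>z\<in>carrier M. \<exists>N. \<forall>x\<in>order_filt 0 N. \<Phi> (act M x z) = act fam.T x (\<Phi> z)"
    using pair.contract_right[OF y V_killed decseq_order_filt] by (elim exE conjE) rule
  have lk: "locally_killed (order_filt (lam j)) (VV j)" if "j \<in> I" "j \<noteq> i" for j by (rule VV_facts(5)[OF that(1)])
  have "\<exists>\<Theta>. cmod_hom fam.T (VV i) \<Theta> \<and> \<Theta> (\<Phi> y) \<noteq> \<zero>\<^bsub>VV i\<^esub> \<and>
    (\<forall>z\<in>carrier fam.T. \<exists>N. \<forall>x\<in>\<Inter>j\<in>I - {i}. order_filt (lam j) N. \<Theta> (act fam.T x z) = act (VV i) x (\<Theta> z))"
    by (rule fam.contract[OF cmod_hom_closed[OF \<Phi>(1) y(1)] \<Phi>(2) i lk decseq_order_filt])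
  then obtain \<Theta> where \<Theta>: "cmod_hom fam.T (VV i) \<Theta>" "\<Theta> (\<Phi> y) \<noteq> \<zero>\<^bsub>VV i\<^esub>"
    "\<forall>z\<in>carrier fam.T. \<exists>N. \<forall>x\<in>\<Inter>j\<in>I - {i}. order_filt (lam j) N. \<Theta> (act fam.T x z) = act (VV i) x (\<Theta> z)"
    by (elim exE conjE) rule
  show ?thesis
  proof (intro exI[of _ "\<lambda>z. \<Theta> (\<Phi> z)"] conjI ballI)
    show "cmod_hom M (VV i) (\<lambda>z. \<Theta> (\<Phi> z))"
      by (rule cmod_hom_comp[OF \<Phi>(1) \<Theta>(1)])
    show "\<Theta> (\<Phi> y) \<noteq> \<zero>\<^bsub>VV i\<^esub>" by (rule \<Theta>(2))
    fix z assume z: "z \<in> carrier M"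
    obtain N where N: "\<forall>x\<in>order_filt 0 N. \<Phi> (act M x z) = act fam.T x (\<Phi> z)" using bspec[OF \<Phi>(3) z] ..
    obtain N' where N': "\<forall>x\<in>\<Inter>j\<in>I - {i}. order_filt (lam j) N'. \<Theta> (act fam.T x (\<Phi> z)) = act (VV i) x (\<Theta> (\<Phi> z))"
      using bspec[OF \<Theta>(3) cmod_hom_closed[OF \<Phi>(1) z]] ..
    show "\<exists>N. \<forall>x. (\<forall>j\<in>I - {i}. x \<in> order_filt (lam j) N) \<longrightarrow> x \<in> order_filt 0 N \<longrightarrow>
      \<Theta> (\<Phi> (act M x z)) = act (VV i) x (\<Theta> (\<Phi> z))"
    proof (intro exI[of _ "max N N'"] allI impI)
      fix x assume x: "\<forall>j\<in>I - {i}. x \<in> order_filt (lam j) (max N N')" "x \<in> order_filt 0 (max N N')"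
      have "x \<in> order_filt 0 N" using x(2) decseqD[OF decseq_order_filt, of N "max N N'" 0] by auto
      moreover have "x \<in> (\<Inter>j\<in>I - {i}. order_filt (lam j) N')"
        using x(1) decseqD[OF decseq_order_filt, of N' "max N N'"] by fastforce
      ultimately show "\<Theta> (\<Phi> (act M x z)) = act (VV i) x (\<Theta> (\<Phi> z))" using N N' by simp
    qed
  qed
qed

text \<open>Puts the central element under the exact clause of \<open>contract_left\<close>, so that
  its action on the last factor survives contraction.\<close>

lemma act_T_vz: "u \<in> carrier fam.T \<Longrightarrow> act fam.T vz u = \<zero>\<^bsub>fam.T\<^esub>"
proof (induction rule: fam.pure_induct)
  case (pure m)
  show ?case by (rule fam.act_pure_zero[OF pure]) (use VV_facts(6) fam.in_P[OF pure] in auto)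
qed (simp_all add: fam.T.act_add fam.T.act_scale)

lemma slice_last:
  assumes y: "y \<in> carrier M" "y \<noteq> \<zero>\<^bsub>M\<^esub>"
  shows "\<exists>\<Psi>. cmod_hom M V \<Psi> \<and> \<Psi> y \<noteq> \<zero>\<^bsub>V\<^esub> \<and>
    (\<forall>z\<in>carrier M. \<exists>N. \<forall>x. (\<forall>j\<in>I. x \<in> order_filt (lam j) N) \<longrightarrow> \<Psi> (act M x z) = act V x (\<Psi> z)) \<and>
    (\<forall>z\<in>carrier M. \<Psi> (act M vz z) = act V vz (\<Psi> z))"
proof -
  obtain \<Phi> where \<Phi>: "cmod_hom M V \<Phi>" "\<Phi> y \<noteq> \<zero>\<^bsub>V\<^esub>"
    "\<forall>z\<in>carrier M. \<exists>N. \<forall>x\<in>\<Inter>j\<in>I. order_filt (lam j) N. \<Phi> (act M x z) = act V x (\<Phi> z)"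
    "\<forall>x. (\<forall>u\<in>carrier fam.T. act fam.T x u = \<zero>\<^bsub>fam.T\<^esub>) \<longrightarrow> (\<forall>z\<in>carrier M. \<Phi> (act M x z) = act V x (\<Phi> z))"
    using pair.contract_left[OF y T_killed T_decseq] by (elim exE conjE) rule
  have 3: "\<exists>N. \<forall>x. (\<forall>j\<in>I. x \<in> order_filt (lam j) N) \<longrightarrow> \<Phi> (act M x z) = act V x (\<Phi> z)" if z: "z \<in> carrier M" for z
  proof -
    obtain N where "\<forall>x\<in>\<Inter>j\<in>I. order_filt (lam j) N. \<Phi> (act M x z) = act V x (\<Phi> z)" using bspec[OF \<Phi>(3) z] ..
    then show ?thesis by (intro exI[of _ N]) simp
  qed
  have 4: "\<Phi> (act M vz z) = act V vz (\<Phi> z)" if z: "z \<in> carrier M" for z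
    using \<Phi>(4)[THEN spec, THEN mp, of vz] act_T_vz z by blast
  show ?thesis by (intro exI[of _ \<Phi>] conjI \<Phi>(1,2) ballI[OF 3] ballI[OF 4])
qed

lemma vec_closed: "v \<in> carrier V \<Longrightarrow> vec v \<in> carrier M"
  unfolding vec_def by (intro pair.tens_closed fam.pure_closed wm_P)

lemma vec_hom: "cmod_hom V M vec"
  unfolding vec_def[abs_def] by (rule pair.tens_hom_right) (rule fam.pure_closed[OF wm_P])

lemma vec_nonzero: "v \<in> carrier V \<Longrightarrow> v \<noteq> \<zero>\<^bsub>V\<^esub> \<Longrightarrow> vec v \<noteq> \<zero>\<^bsub>M\<^esub>"
  unfolding vec_def
  by (rule pair.tens_nonzero[OF fam.pure_closed[OF wm_P] fam.pure_nonzero[OF wm_P]])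
    (use VV_facts(3) in \<open>auto simp: wm_def\<close>)

lemma act_vec: "v \<in> carrier V \<Longrightarrow> act M x (vec v) = pair.tens (act fam.T x (fam.pure wm)) v \<oplus>\<^bsub>M\<^esub> vec (act V x v)"
  unfolding vec_def by (rule pair.act_tens)

lemma wm_killed: "\<exists>N. \<forall>j\<in>I. \<forall>x\<in>order_filt (lam j) N. act (VV j) x (wm j) = \<zero>\<^bsub>VV j\<^esub>"
  by (rule fam.common_bound[OF order_refl _ _ wm_P]) (use VV_facts(5) decseq_order_filt in auto)

text \<open>The stage depends on the generators alone and therefore serves all \<open>v\<close> at
  once.\<close>

lemma act_vec_last:
  shows "\<exists>N. \<forall>x. (\<forall>j\<in>I. x \<in> order_filt (lam j) N) \<longrightarrow> (\<forall>v\<in>carrier V. act M x (vec v) = vec (act V x v))"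
proof -
  obtain N where N: "\<forall>j\<in>I. \<forall>x\<in>order_filt (lam j) N. act (VV j) x (wm j) = \<zero>\<^bsub>VV j\<^esub>" using wm_killed ..
  show ?thesis
  proof (intro exI[of _ N] allI impI ballI)
    fix x v assume x: "\<forall>j\<in>I. x \<in> order_filt (lam j) N" and v: "v \<in> carrier V"
    have "act fam.T x (fam.pure wm) = \<zero>\<^bsub>fam.T\<^esub>"
      by (rule fam.act_pure_zero[OF wm_P]) (use N x in auto)
    then show "act M x (vec v) = vec (act V x v)"
      using v vec_closed[of "act V x v"] by (simp add: act_vec)
  qed
qed

lemma act_vec_vz: "v \<in> carrier V \<Longrightarrow> act M vz (vec v) = vec (act V vz v)"
  using act_T_vz[OF fam.pure_closed[OF wm_P]] vec_closed[of "act V vz v"] by (simp add: act_vec)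

definition vec_at where "vec_at i u v = pair.tens (fam.pure (wm(i := u))) v"

lemma act_vec_factor:
  assumes v: "v \<in> carrier V" and i: "i \<in> I"
  shows "\<exists>N. \<forall>x. (\<forall>j\<in>I - {i}. x \<in> order_filt (lam j) N) \<longrightarrow> x \<in> order_filt 0 N \<longrightarrow>
    act M x (vec v) = vec_at i (act (VV i) x (ww i)) v"
proof -
  obtain N where N: "\<forall>j\<in>I. \<forall>x\<in>order_filt (lam j) N. act (VV j) x (wm j) = \<zero>\<^bsub>VV j\<^esub>" using wm_killed ..
  obtain N' where N': "\<forall>x\<in>order_filt 0 N'. act V x v = \<zero>\<^bsub>V\<^esub>"
    using V_killed v unfolding locally_killed_def by blast
  interpret Vi: vir_mod "VV i" by (rule VV_facts(1)[OF i])
  show ?thesis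
  proof (intro exI[of _ "max N N'"] allI impI)
    fix x assume x: "\<forall>j\<in>I - {i}. x \<in> order_filt (lam j) (max N N')" "x \<in> order_filt 0 (max N N')"
    have x': "x \<in> order_filt 0 N'" using x(2) decseqD[OF decseq_order_filt, of N' "max N N'" 0] by auto
    have "act fam.T x (fam.pure wm) = fam.pure (wm(i := act (VV i) x (wm i)))"
    proof (rule fam.act_pure_single[OF wm_P i])
      fix j assume j: "j \<in> I" "j \<noteq> i"
      have "x \<in> order_filt (lam j) N" using x(1) j decseqD[OF decseq_order_filt, of N "max N N'" "lam j"] by auto
      then show "act (VV j) x (wm j) = \<zero>\<^bsub>VV j\<^esub>" using N j by blast
    qed
    moreover have "wm i = ww i" using i by (simp add: wm_def)
    moreover have "vec \<zero>\<^bsub>V\<^esub> = \<zero>\<^bsub>M\<^esub>" by (rule cmod_hom_zero[OF V.cmod pair.T.cmod vec_hom])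
    moreover have "vec_at i (act (VV i) x (ww i)) v \<in> carrier M"
      unfolding vec_at_def using fam.upd_P[OF wm_P i, of "act (VV i) x (ww i)"] VV_facts(2)[OF i] v
      by (intro pair.tens_closed fam.pure_closed) auto
    ultimately show "act M x (vec v) = vec_at i (act (VV i) x (ww i)) v"
      using N' x' v by (simp add: act_vec vec_at_def)
  qed
qed

lemma vec_at_nonzero:
  assumes "i \<in> I" "u \<in> carrier (VV i)" "u \<noteq> \<zero>\<^bsub>VV i\<^esub>" "v \<in> carrier V" "v \<noteq> \<zero>\<^bsub>V\<^esub>"
  shows "vec_at i u v \<noteq> \<zero>\<^bsub>M\<^esub>"
  unfolding vec_at_def
proof (rule pair.tens_nonzero[OF fam.pure_closed fam.pure_nonzero])
  show "wm(i := u) \<in> fam.P" "wm(i := u) \<in> fam.P" by (rule fam.upd_P[OF wm_P assms(1,2)])+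
  show "(wm(i := u)) j \<noteq> \<zero>\<^bsub>VV j\<^esub>" if "j \<in> I" for j
    using assms(3) VV_facts(3)[OF that] that by (auto simp: wm_def)
qed (use assms in auto)

lemma vec_at_scale:
  assumes "i \<in> I" "v \<in> carrier V"
  shows "vec_at i (c \<odot>\<^bsub>VV i\<^esub> ww i) v = c \<odot>\<^bsub>M\<^esub> vec v"
proof -
  have "wm(i := ww i) = wm" using assms(1) by (auto simp: wm_def fun_eq_iff)
  then have "fam.pure (wm(i := c \<odot>\<^bsub>VV i\<^esub> ww i)) = c \<odot>\<^bsub>fam.T\<^esub> fam.pure wm"
    using fam.pure_scale[OF wm_P assms(1) VV_facts(2)[OF assms(1)], of c] by simp
  then show ?thesis
    unfolding vec_at_def vec_def using pair.tens_scale_left[OF fam.pure_closed[OF wm_P] assms(2)] by simp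
qed

end

lemma germs_order_filt: "g \<in> germs \<nu> N \<Longrightarrow> e_of g \<in> order_filt \<nu> N"
  by (simp add: order_filt_def)

text \<open>For nonzero \<open>lam\<close> evaluation shows that \<open>linfac lam\<close> is no
  unit; at \<open>lam = 0\<close> it would be the unit \<open>t\<close>.\<close>

lemma linfac_power_dvd: "lam \<noteq> 0 \<Longrightarrow> linfac lam ^ a dvd linfac lam ^ b \<Longrightarrow> a \<le> b"
proof (rule ccontr)
  assume *: "lam \<noteq> 0" "linfac lam ^ a dvd linfac lam ^ b" "\<not> a \<le> b"
  have "linfac lam ^ Suc b dvd linfac lam ^ a" by (rule le_imp_power_dvd) (use *(3) in simp)
  then have "linfac lam ^ Suc b dvd linfac lam ^ b" using *(2) by (rule dvd_trans)
  then have "linfac lam ^ b * linfac lam dvd linfac lam ^ b * 1" by (simp add: mult.commute)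
  then have "linfac lam dvd 1" by (subst (asm) dvd_mult_cancel_left) simp
  then show False using *(1) by (simp add: lin_dvd_iff)
qed

lemma (in vir_mod) act_eq_of_killed:
  assumes "v \<in> carrier M" "act M (e_of (g - h)) v = \<zero>"
  shows "act M (e_of g) v = act M (e_of h) v"
proof -
  have "e_of g = e_of (g - h) + e_of h" by (simp add: e_of_diff)
  then have "act M (e_of g) v = act M (e_of (g - h)) v \<oplus> act M (e_of h) v" using assms(1) act_plus by metis
  then show ?thesis using assms by simp
qed

section \<open>Comparing two tensor products along an injective homomorphism\<close>

locale two_sides = L: side I lam n mu V + R: side I' gam m theta W
  for I :: "nat set" and lam n mu and V :: "'v vmod" and I' :: "nat set" and gam m theta and W :: "'w vmod" +
  fixes \<phi>
  assumes \<phi>_hom: "cmod_hom L.M R.M \<phi>" and \<phi>_inj: "y \<in> carrier L.M \<Longrightarrow> y \<noteq> \<zero>\<^bsub>L.M\<^esub> \<Longrightarrow> \<phi> y \<noteq> \<zero>\<^bsub>R.M\<^esub>"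
    and \<phi>_act: "y \<in> carrier L.M \<Longrightarrow> \<phi> (act L.M x y) = act R.M x (\<phi> y)"
begin

text \<open>The points of both sides together with \<open>0\<close> for the last factors, so that a
  single \<open>g\<close> has prescribed behaviour on both tensor products.\<close>

definition \<Lambda> where "\<Lambda> = insert 0 (lam ` I \<union> gam ` I')"

lemma approx: "\<exists>g. g - h \<in> germs x N \<and> (\<forall>\<nu>\<in>\<Lambda>. \<nu> \<noteq> x \<longrightarrow> g \<in> germs \<nu> N)"
proof -
  have "finite \<Lambda>" using L.finite_I R.finite_I by (simp add: \<Lambda>_def)
  then obtain g where "g - h \<in> germs x N" "\<And>\<nu>. \<nu> \<in> \<Lambda> \<Longrightarrow> \<nu> \<noteq> x \<Longrightarrow> g \<in> germs \<nu> N"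
    using approximation by metis
  then show ?thesis by blast
qed

lemma obtain_v0: obtains v0 where "v0 \<in> carrier V" "v0 \<noteq> \<zero>\<^bsub>V\<^esub>"
proof -
  have "carrier V \<noteq> {\<zero>\<^bsub>V\<^esub>}" using L.simple by (simp add: simple_vir_module_def)
  then show ?thesis using that L.V.zero_closed by blast
qed

text \<open>If \<open>g\<close> imitates \<open>h\<close> at \<open>lam i\<close> and vanishes at
  all other points, it acts on \<open>vec v\<close> as \<open>h\<close> acts on the
  \<open>i\<close>-th generator. The bound depends neither on \<open>g\<close> nor on
  \<open>h\<close>, so it can be enlarged to suit the other side before \<open>g\<close> is
  chosen.\<close>

lemma factor_action:
  assumes i: "i \<in> I" and v: "v \<in> carrier V"
  shows "\<exists>N0. \<forall>N\<ge>N0. \<forall>g h. g - h \<in> germs (lam i) N \<longrightarrow> (\<forall>\<nu>\<in>\<Lambda>. \<nu> \<noteq> lam i \<longrightarrow> g \<in> germs \<nu> N) \<longrightarrow>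
    act L.M (e_of g) (L.vec v) = L.vec_at i (act (L.VV i) (e_of h) (L.ww i)) v"
proof -
  interpret Vi: vir_mod "L.VV i" by (rule L.VV_facts(1)[OF i])
  obtain N1 where N1: "\<forall>x. (\<forall>j\<in>I - {i}. x \<in> order_filt (lam j) N1) \<longrightarrow> x \<in> order_filt 0 N1 \<longrightarrow>
    act L.M x (L.vec v) = L.vec_at i (act (L.VV i) x (L.ww i)) v"
    using L.act_vec_factor[OF v i] ..
  obtain N2 where N2: "\<forall>x\<in>order_filt (lam i) N2. act (L.VV i) x (L.ww i) = \<zero>\<^bsub>L.VV i\<^esub>"
    using L.VV_facts(5)[OF i] L.VV_facts(2)[OF i] unfolding locally_killed_def by blast
  show ?thesis
  proof (intro exI[of _ "max N1 N2"] allI impI)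
    fix N g h assume N: "max N1 N2 \<le> N" and gh: "g - h \<in> germs (lam i) N" and g: "\<forall>\<nu>\<in>\<Lambda>. \<nu> \<noteq> lam i \<longrightarrow> g \<in> germs \<nu> N"
    have d: "g \<in> germs \<nu> N1" if "\<nu> \<in> \<Lambda>" "\<nu> \<noteq> lam i" for \<nu>
      using g that germs_antimono[of N1 N \<nu>] N by auto
    have "e_of g \<in> order_filt (lam j) N1" if "j \<in> I - {i}" for j
      using d[of "lam j"] that i inj_onD[OF L.inj, of j i] by (intro germs_order_filt) (auto simp: \<Lambda>_def)
    moreover have "e_of g \<in> order_filt 0 N1"
      using d[of 0] L.lam_nonzero[OF i] by (intro germs_order_filt) (auto simp: \<Lambda>_def)
    ultimately have 1: "act L.M (e_of g) (L.vec v) = L.vec_at i (act (L.VV i) (e_of g) (L.ww i)) v" using N1 by blast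
    have "e_of (g - h) \<in> order_filt (lam i) N2"
      using gh germs_antimono[of N2 N "lam i"] N by (intro germs_order_filt) auto
    then have "act (L.VV i) (e_of (g - h)) (L.ww i) = \<zero>\<^bsub>L.VV i\<^esub>" using N2 by blast
    then show "act L.M (e_of g) (L.vec v) = L.vec_at i (act (L.VV i) (e_of h) (L.ww i)) v"
      using 1 Vi.act_eq_of_killed[OF L.VV_facts(2)[OF i]] by simp
  qed
qed

text \<open>Otherwise a \<open>g\<close> that imitates \<open>1\<close> at \<open>lam i\<close> and
  vanishes at all other points kills the image on the right. On the left it acts as
  \<open>e_of 1\<close> on the generator; a zero result would make the generator an eigenvector of
  an element outside Vir^f.\<close>

lemma point_match:
  assumes i: "i \<in> I"
  shows "lam i \<in> gam ` I'"
proof (rule ccontr)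
  assume no: "lam i \<notin> gam ` I'"
  interpret Vi: vir_mod "L.VV i" by (rule L.VV_facts(1)[OF i])
  interpret C: character "lam i" "n i" "mu i" by (rule L.chars[OF i])
  obtain v0 where v0: "v0 \<in> carrier V" "v0 \<noteq> \<zero>\<^bsub>V\<^esub>" using obtain_v0 .
  let ?y = "\<phi> (L.vec v0)"
  have yc: "?y \<in> carrier R.M" by (rule cmod_hom_closed[OF \<phi>_hom L.vec_closed[OF v0(1)]])
  obtain N1 where N1: "\<forall>N\<ge>N1. \<forall>g h. g - h \<in> germs (lam i) N \<longrightarrow> (\<forall>\<nu>\<in>\<Lambda>. \<nu> \<noteq> lam i \<longrightarrow> g \<in> germs \<nu> N) \<longrightarrow>
    act L.M (e_of g) (L.vec v0) = L.vec_at i (act (L.VV i) (e_of h) (L.ww i)) v0"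
    using factor_action[OF i v0(1)] ..
  obtain N2 where N2: "\<forall>x. (\<forall>j\<in>I'. x \<in> order_filt (gam j) N2) \<longrightarrow> x \<in> order_filt 0 N2 \<longrightarrow> act R.M x ?y = \<zero>\<^bsub>R.M\<^esub>"
    using R.M_killed[OF yc] ..
  let ?N = "max N1 N2"
  obtain g where g: "g - 1 \<in> germs (lam i) ?N" "\<forall>\<nu>\<in>\<Lambda>. \<nu> \<noteq> lam i \<longrightarrow> g \<in> germs \<nu> ?N"
    using approx by blast
  have 1: "act L.M (e_of g) (L.vec v0) = L.vec_at i (act (L.VV i) (e_of 1) (L.ww i)) v0"
    using N1[rule_format, OF _ g(1)] g(2) by simp
  have d: "g \<in> germs \<nu> N2" if "\<nu> \<in> \<Lambda>" "\<nu> \<noteq> lam i" for \<nu>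
    using g(2) that germs_antimono[of N2 ?N \<nu>] by auto
  have "e_of g \<in> order_filt (gam j) N2" if "j \<in> I'" for j
  proof -
    have "gam j \<noteq> lam i" using that no by (metis imageI)
    then show ?thesis using d[of "gam j"] that by (intro germs_order_filt) (auto simp: \<Lambda>_def)
  qed
  moreover have "e_of g \<in> order_filt 0 N2"
    using d[of 0] L.lam_nonzero[OF i] by (intro germs_order_filt) (auto simp: \<Lambda>_def)
  ultimately have "act R.M (e_of g) ?y = \<zero>\<^bsub>R.M\<^esub>" using N2 by blast
  then have "\<phi> (act L.M (e_of g) (L.vec v0)) = \<zero>\<^bsub>R.M\<^esub>" using \<phi>_act[OF L.vec_closed[OF v0(1)]] by simp
  then have 0: "act L.M (e_of g) (L.vec v0) = \<zero>\<^bsub>L.M\<^esub>"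
    using \<phi>_inj[OF L.pair.T.act_closed[OF L.vec_closed[OF v0(1)]]] by blast
  have "act (L.VV i) (e_of 1) (L.ww i) \<noteq> \<zero>\<^bsub>L.VV i\<^esub>"
  proof
    assume "act (L.VV i) (e_of 1) (L.ww i) = \<zero>\<^bsub>L.VV i\<^esub>"
    then have "act (L.VV i) (e_of 1) (L.ww i) = 0 \<odot>\<^bsub>L.VV i\<^esub> L.ww i" using L.VV_facts(2)[OF i] by simp
    then have "e_of 1 \<in> vanish (lam i) (n i)" using L.VV_facts(7)[OF i L.VV_facts(2,3)[OF i]] by blast
    then have "linfac (lam i) ^ n i dvd linfac (lam i) ^ 0" by (simp add: vanish_def)
    then show False using linfac_power_dvd[OF C.lam] C.n by fastforce
  qed
  then show False
    using L.vec_at_nonzero[OF i Vi.act_closed[OF L.VV_facts(2)[OF i]] _ v0, of "e_of 1"] 1 0 by simp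
qed

lemma factor_match:
  assumes i: "i \<in> I" and j: "j \<in> I'" and ij: "lam i = gam j"
  shows "m j \<le> n i" and "m j = n i \<Longrightarrow> \<exists>r::nat. \<forall>x\<in>vanish (lam i) (n i). mu i x = theta j x + of_nat r * character.weight (lam i) x"
proof -
  interpret Vi: vir_mod "L.VV i" by (rule L.VV_facts(1)[OF i])
  interpret Wj: vir_mod "R.VV j" by (rule R.VV_facts(1)[OF j])
  interpret C: character "lam i" "n i" "mu i" by (rule L.chars[OF i])
  obtain v0 where v0: "v0 \<in> carrier V" "v0 \<noteq> \<zero>\<^bsub>V\<^esub>" using obtain_v0 .
  let ?u = "L.vec v0"
  let ?y = "\<phi> ?u"
  have uc: "?u \<in> carrier L.M" by (rule L.vec_closed[OF v0(1)])
  have yc: "?y \<in> carrier R.M" by (rule cmod_hom_closed[OF \<phi>_hom uc])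
  have ynz: "?y \<noteq> \<zero>\<^bsub>R.M\<^esub>" by (rule \<phi>_inj[OF uc L.vec_nonzero[OF v0]])
  obtain \<Psi> where \<Psi>: "cmod_hom R.M (R.VV j) \<Psi>" "\<Psi> ?y \<noteq> \<zero>\<^bsub>R.VV j\<^esub>"
    "\<forall>z\<in>carrier R.M. \<exists>N. \<forall>x. (\<forall>l\<in>I' - {j}. x \<in> order_filt (gam l) N) \<longrightarrow> x \<in> order_filt 0 N \<longrightarrow>
      \<Psi> (act R.M x z) = act (R.VV j) x (\<Psi> z)"
    using R.slice_factor[OF yc ynz j] by (elim exE conjE) rule
  let ?v = "\<Psi> ?y"
  have vc: "?v \<in> carrier (R.VV j)" by (rule cmod_hom_closed[OF \<Psi>(1) yc])
  obtain N1 where N1: "\<forall>N\<ge>N1. \<forall>g h. g - h \<in> germs (lam i) N \<longrightarrow> (\<forall>\<nu>\<in>\<Lambda>. \<nu> \<noteq> lam i \<longrightarrow> g \<in> germs \<nu> N) \<longrightarrow>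
    act L.M (e_of g) ?u = L.vec_at i (act (L.VV i) (e_of h) (L.ww i)) v0"
    using factor_action[OF i v0(1)] ..
  obtain N2 where N2: "\<forall>x. (\<forall>l\<in>I' - {j}. x \<in> order_filt (gam l) N2) \<longrightarrow> x \<in> order_filt 0 N2 \<longrightarrow>
      \<Psi> (act R.M x ?y) = act (R.VV j) x ?v"
    using bspec[OF \<Psi>(3) yc] ..
  obtain N3 where N3: "\<forall>x\<in>order_filt (gam j) N3. act (R.VV j) x ?v = \<zero>\<^bsub>R.VV j\<^esub>"
    using R.VV_facts(5)[OF j] vc unfolding locally_killed_def by blast
  let ?N = "max N1 (max N2 N3)"
  \<comment> \<open>One \<open>g\<close> is read in two ways: on the left it scales the test vector
    by \<open>mu i (e_of h)\<close>, on the right it acts on the contracted image as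
    \<open>h\<close> does.\<close>
  have eig_e: "act (R.VV j) (e_of h) ?v = mu i (e_of h) \<odot>\<^bsub>R.VV j\<^esub> ?v" if h: "e_of h \<in> vanish (lam i) (n i)" for h
  proof -
    obtain g where g: "g - h \<in> germs (lam i) ?N" "\<forall>\<nu>\<in>\<Lambda>. \<nu> \<noteq> lam i \<longrightarrow> g \<in> germs \<nu> ?N"
      using approx by blast
    have "act L.M (e_of g) ?u = L.vec_at i (act (L.VV i) (e_of h) (L.ww i)) v0"
      using N1[rule_format, OF _ g(1)] g(2) by simp
    also have "\<dots> = mu i (e_of h) \<odot>\<^bsub>L.M\<^esub> ?u"
      by (simp only: L.VV_facts(4)[OF i h] L.vec_at_scale[OF i v0(1)])
    finally have "act R.M (e_of g) ?y = mu i (e_of h) \<odot>\<^bsub>R.M\<^esub> ?y"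
      using \<phi>_act[OF uc, of "e_of g"] cmod_hom_scale[OF \<phi>_hom uc] by simp
    then have 1: "\<Psi> (act R.M (e_of g) ?y) = mu i (e_of h) \<odot>\<^bsub>R.VV j\<^esub> ?v"
      using cmod_hom_scale[OF \<Psi>(1) yc] by simp
    have d: "g \<in> germs \<nu> N2" if "\<nu> \<in> \<Lambda>" "\<nu> \<noteq> lam i" for \<nu>
      by (rule germs_antimono[THEN subsetD, of N2 ?N]) (use g(2) that in auto)
    have "e_of g \<in> order_filt (gam l) N2" if "l \<in> I' - {j}" for l
      using d[of "gam l"] that j ij inj_onD[OF R.inj, of l j] by (intro germs_order_filt) (auto simp: \<Lambda>_def)
    moreover have "e_of g \<in> order_filt 0 N2"
      using d[of 0] L.lam_nonzero[OF i] by (intro germs_order_filt) (auto simp: \<Lambda>_def)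
    ultimately have 2: "\<Psi> (act R.M (e_of g) ?y) = act (R.VV j) (e_of g) ?v" using N2 by blast
    have "g - h \<in> germs (lam i) N3" by (rule germs_antimono[THEN subsetD, OF _ g(1)]) simp
    then have "e_of (g - h) \<in> order_filt (gam j) N3" unfolding ij by (rule germs_order_filt)
    then have "act (R.VV j) (e_of g) ?v = act (R.VV j) (e_of h) ?v"
      using N3 by (intro Wj.act_eq_of_killed[OF vc]) blast
    then show ?thesis using 1 2 by simp
  qed
  \<comment> \<open>The central part of \<open>x\<close> contributes nothing to either side:
    \<open>vz\<close> kills the factor on the right, and \<open>mu i\<close> is zero on it.\<close>
  have eig: "act (R.VV j) x ?v = mu i x \<odot>\<^bsub>R.VV j\<^esub> ?v" if x: "x \<in> vanish (lam i) (n i)" for x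
  proof -
    let ?c = "Poly_Mapping.lookup x Z"
    have e: "e_of (lau x) \<in> vanish (lam i) (n i)" using x by (simp add: vanish_def)
    have dec: "x = cscale ?c vz + e_of (lau x)" by (rule vir_decomp)
    have "mu i (cscale ?c vz + e_of (lau x)) = mu i (e_of (lau x))"
      by (simp add: C.mu_add C.mu_scale C.vanish_scale C.vz_vanish e C.mu_vz del: cscale_single)
    then have mu: "mu i x = mu i (e_of (lau x))" using dec by simp
    have "act (R.VV j) (cscale ?c vz + e_of (lau x)) ?v = act (R.VV j) (e_of (lau x)) ?v"
      using vc by (simp add: Wj.act_plus Wj.act_cscale R.VV_facts(6)[OF j] del: cscale_single)
    then have "act (R.VV j) x ?v = act (R.VV j) (e_of (lau x)) ?v" using dec by simp
    then show ?thesis using eig_e[OF e] mu by simp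
  qed
  have sub: "x \<in> vanish (gam j) (m j)" if "x \<in> vanish (lam i) (n i)" for x
    using R.VV_facts(7)[OF j vc \<Psi>(2)] eig[OF that] by blast
  \<comment> \<open>An element of order exactly \<open>n i\<close> turns the inclusion of
    subalgebras into an inequality of exponents.\<close>
  have "e_of (linfac (lam i) ^ n i) \<in> vanish (gam j) (m j)" by (rule sub) (simp add: vanish_def)
  then have "linfac (lam i) ^ m j dvd linfac (lam i) ^ n i" by (simp add: vanish_def ij)
  then show "m j \<le> n i" using linfac_power_dvd[OF C.lam] by blast
  show "\<exists>r::nat. \<forall>x\<in>vanish (lam i) (n i). mu i x = theta j x + of_nat r * character.weight (lam i) x" if "m j = n i"
    using R.VV_facts(8)[OF j vc \<Psi>(2), of "mu i"] eig unfolding that ij by blast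
qed

lemma last_match: "V \<cong>\<^sub>V W"
proof -
  obtain v0 where v0: "v0 \<in> carrier V" "v0 \<noteq> \<zero>\<^bsub>V\<^esub>" using obtain_v0 .
  have phi_c: "\<phi> (L.vec v) \<in> carrier R.M" if "v \<in> carrier V" for v
    by (rule cmod_hom_closed[OF \<phi>_hom L.vec_closed[OF that]])
  have ynz: "\<phi> (L.vec v0) \<noteq> \<zero>\<^bsub>R.M\<^esub>" by (rule \<phi>_inj[OF L.vec_closed[OF v0(1)] L.vec_nonzero[OF v0]])
  obtain \<Psi> where \<Psi>: "cmod_hom R.M W \<Psi>" "\<Psi> (\<phi> (L.vec v0)) \<noteq> \<zero>\<^bsub>W\<^esub>"
    "\<forall>z\<in>carrier R.M. \<exists>N. \<forall>x. (\<forall>j\<in>I'. x \<in> order_filt (gam j) N) \<longrightarrow> \<Psi> (act R.M x z) = act W x (\<Psi> z)"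
    "\<forall>z\<in>carrier R.M. \<Psi> (act R.M vz z) = act W vz (\<Psi> z)"
    using R.slice_last[OF phi_c[OF v0(1)] ynz] by (elim exE conjE) rule
  define \<xi> where "\<xi> v = \<Psi> (\<phi> (L.vec v))" for v
  have hom: "cmod_hom V W \<xi>"
    unfolding \<xi>_def[abs_def] by (rule cmod_hom_comp[OF cmod_hom_comp[OF L.vec_hom \<phi>_hom] \<Psi>(1)])
  have \<xi>c: "\<xi> v \<in> carrier W" if "v \<in> carrier V" for v using cmod_hom_closed[OF hom that] .
  obtain N1 where N1: "\<forall>x. (\<forall>j\<in>I. x \<in> order_filt (lam j) N1) \<longrightarrow> (\<forall>v\<in>carrier V. act L.M x (L.vec v) = L.vec (act V x v))"
    using L.act_vec_last ..
  \<comment> \<open>The point imitated now is \<open>0\<close>: \<open>g\<close> agrees with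
    \<open>h\<close> there to high order and vanishes at all nonzero points of
    \<open>\<Lambda>\<close>, so it acts on the last factors alone.\<close>
  have act_e: "\<xi> (act V (e_of h) v) = act W (e_of h) (\<xi> v)" if v: "v \<in> carrier V" for h v
  proof -
    obtain N2 where N2: "\<forall>x. (\<forall>j\<in>I'. x \<in> order_filt (gam j) N2) \<longrightarrow> \<Psi> (act R.M x (\<phi> (L.vec v))) = act W x (\<xi> v)"
      using bspec[OF \<Psi>(3) phi_c[OF v]] unfolding \<xi>_def ..
    obtain N3 where N3: "\<forall>x\<in>order_filt 0 N3. act V x v = \<zero>\<^bsub>V\<^esub>"
      using L.V_killed v unfolding locally_killed_def by blast
    obtain N4 where N4: "\<forall>x\<in>order_filt 0 N4. act W x (\<xi> v) = \<zero>\<^bsub>W\<^esub>"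
      using R.V_killed \<xi>c[OF v] unfolding locally_killed_def by blast
    let ?N = "max (max N1 N2) (max N3 N4)"
    obtain g where g: "g - h \<in> germs 0 ?N" "\<forall>\<nu>\<in>\<Lambda>. \<nu> \<noteq> 0 \<longrightarrow> g \<in> germs \<nu> ?N"
      using approx by blast
    have "e_of g \<in> order_filt (lam j) N1" if "j \<in> I" for j
      by (rule germs_order_filt, rule germs_antimono[THEN subsetD, of N1 ?N])
        (use g(2) that L.lam_nonzero[OF that] in \<open>auto simp: \<Lambda>_def\<close>)
    then have 1: "act L.M (e_of g) (L.vec v) = L.vec (act V (e_of g) v)" using N1 v by blast
    have "e_of g \<in> order_filt (gam j) N2" if "j \<in> I'" for j
      by (rule germs_order_filt, rule germs_antimono[THEN subsetD, of N2 ?N])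
        (use g(2) that R.lam_nonzero[OF that] in \<open>auto simp: \<Lambda>_def\<close>)
    then have 2: "\<Psi> (act R.M (e_of g) (\<phi> (L.vec v))) = act W (e_of g) (\<xi> v)" using N2 by blast
    have "e_of (g - h) \<in> order_filt 0 N3" "e_of (g - h) \<in> order_filt 0 N4"
      by (rule germs_order_filt, rule germs_antimono[THEN subsetD, OF _ g(1)], simp)+
    then have 3: "act V (e_of g) v = act V (e_of h) v" "act W (e_of g) (\<xi> v) = act W (e_of h) (\<xi> v)"
      using N3 N4 by (intro L.V.act_eq_of_killed[OF v] R.V.act_eq_of_killed[OF \<xi>c[OF v]]; blast)+
    have "\<xi> (act V (e_of h) v) = \<Psi> (\<phi> (act L.M (e_of g) (L.vec v)))" by (simp add: \<xi>_def 1 3(1))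
    also have "\<dots> = act W (e_of h) (\<xi> v)" by (simp add: \<phi>_act L.vec_closed[OF v] 2 3(2))
    finally show ?thesis .
  qed
  \<comment> \<open>The central element is out of reach of approximation, but each of the three maps
    composed in \<open>\<xi>\<close> commutes with it exactly.\<close>
  have act_z: "\<xi> (act V vz v) = act W vz (\<xi> v)" if v: "v \<in> carrier V" for v
    using bspec[OF \<Psi>(4) phi_c[OF v]] by (simp add: \<xi>_def flip: L.act_vec_vz[OF v] \<phi>_act[OF L.vec_closed[OF v]])
  have act: "\<xi> (act V x v) = act W x (\<xi> v)" if v: "v \<in> carrier V" for x v
  proof -
    let ?c = "Poly_Mapping.lookup x Z"
    have "\<xi> (act V (cscale ?c vz + e_of (lau x)) v) = act W (cscale ?c vz + e_of (lau x)) (\<xi> v)"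
      using v \<xi>c[OF v]
      by (simp add: L.V.act_plus L.V.act_cscale R.V.act_plus R.V.act_cscale cmod_hom_add[OF hom] cmod_hom_scale[OF hom]
          act_e act_z del: cscale_single)
    then show ?thesis using vir_decomp[of x] by simp
  qed
  show ?thesis
    by (rule simple_hom_iso[OF L.simple R.simple hom act v0(1)]) (use \<Psi>(2) in \<open>simp_all add: \<xi>_def\<close>)
qed

end

section \<open>Isomorphic factors\<close>

text \<open>A character enters the presentation only through words in the subalgebra. The two
  records are therefore equal, so that factors can be rewritten inside a tensor product.\<close>

lemma Vfmu_cong:
  assumes "\<And>x. x \<in> Virf ([:- lam, 1:] ^ n) \<Longrightarrow> mu x = theta x"
  shows "Vfmu ([:- lam, 1:] ^ n) mu = Vfmu ([:- lam, 1:] ^ n) theta"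
proof -
  interpret H: lie_sub "vanish lam n" by (rule lie_sub_vanish)
  have ch: "char_val mu p = char_val theta p" if "p \<in> H.F" for p
  proof -
    have "falg_rep (\<lambda>x. cscale (mu x)) p u = falg_rep (\<lambda>x. cscale (theta x)) p u" for u :: "unit \<Rightarrow>\<^sub>0 complex"
      unfolding falg_rep_def
    proof (rule lin_ext_cong)
      fix v assume "v \<in> Poly_Mapping.keys p"
      then have "map mu (letters v) = map theta (letters v)" using that assms unfolding Virf_eq by auto
      then show "foldr (\<lambda>x. cscale (mu x)) (letters v) u = foldr (\<lambda>x. cscale (theta x)) (letters v) u"
        by (simp only: cscale_foldr)
    qed
    then show ?thesis by (simp add: char_val_def)
  qed
  have "uea_act (one_dim mu) r v = uea_act (one_dim theta) r v" if r: "r \<in> carrier (uea (vanish lam n))" for r v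
  proof -
    obtain p where p: "r = uea_class (vanish lam n) p" "p \<in> H.F" using r unfolding H.uea_sel by blast
    have "(\<lambda>p. free_alg_act (one_dim mu) p v) ` r = (\<lambda>p. free_alg_act (one_dim theta) p v) ` r"
      by (rule image_cong[OF refl]) (use H.in_uc p ch in \<open>simp add: free_alg_act_one_dim\<close>)
    then show ?thesis by (simp only: uea_act_def)
  qed
  then have "{basis_vec (u \<otimes>\<^bsub>uea UNIV\<^esub> uea_incl r, v) - basis_vec (u, uea_act (one_dim mu) r v) | u r v.
           u \<in> carrier (uea UNIV) \<and> r \<in> carrier (uea (vanish lam n)) \<and> v \<in> (UNIV :: complex set)} =
        {basis_vec (u \<otimes>\<^bsub>uea UNIV\<^esub> uea_incl r, v) - basis_vec (u, uea_act (one_dim theta) r v) | u r v.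
           u \<in> carrier (uea UNIV) \<and> r \<in> carrier (uea (vanish lam n)) \<and> v \<in> (UNIV :: complex set)}"
    by (intro Collect_cong) metis
  moreover have "bilinear_relations (uea UNIV) (one_dim mu) = bilinear_relations (uea UNIV) (one_dim theta)"
    by (simp add: bilinear_relations_def)
  ultimately show ?thesis
    unfolding Vfmu_def induced_def Virf_eq one_dim_simps(1) by simp
qed

definition vir_hom :: "'v vmod \<Rightarrow> 'w vmod \<Rightarrow> ('v \<Rightarrow> 'w) \<Rightarrow> bool" where
  "vir_hom A B \<phi> \<longleftrightarrow> cmod_hom A B \<phi> \<and> (\<forall>x. \<forall>v\<in>carrier A. \<phi> (act A x v) = act B x (\<phi> v))"

lemma vir_isoI:
  assumes "vir_hom A B \<phi>" "vir_hom B A \<psi>" "\<And>v. v \<in> carrier A \<Longrightarrow> \<psi> (\<phi> v) = v" "\<And>w. w \<in> carrier B \<Longrightarrow> \<phi> (\<psi> w) = w"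
  shows "A \<cong>\<^sub>V B"
proof -
  have "bij_betw \<phi> (carrier A) (carrier B)"
    by (rule bij_betw_byWitness[of _ \<psi>]) (use assms in \<open>auto simp: vir_hom_def cmod_hom_def\<close>)
  then show ?thesis using assms(1) unfolding vir_iso_def vir_hom_def cmod_hom_def by blast
qed

lemma vir_isoE:
  assumes "A \<cong>\<^sub>V B" "lin_act_mod A" "lin_act_mod B"
  shows "\<exists>\<phi> \<psi>. vir_hom A B \<phi> \<and> vir_hom B A \<psi> \<and> (\<forall>v\<in>carrier A. \<psi> (\<phi> v) = v) \<and> (\<forall>w\<in>carrier B. \<phi> (\<psi> w) = w)"
proof -
  interpret A: lin_act_mod A by fact
  obtain \<phi> where b: "bij_betw \<phi> (carrier A) (carrier B)"
    and add: "\<forall>v\<in>carrier A. \<forall>w\<in>carrier A. \<phi> (v \<oplus>\<^bsub>A\<^esub> w) = \<phi> v \<oplus>\<^bsub>B\<^esub> \<phi> w"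
    and sc: "\<forall>c. \<forall>v\<in>carrier A. \<phi> (c \<odot>\<^bsub>A\<^esub> v) = c \<odot>\<^bsub>B\<^esub> \<phi> v"
    and ac: "\<forall>x. \<forall>v\<in>carrier A. \<phi> (act A x v) = act B x (\<phi> v)"
    using assms(1) unfolding vir_iso_def by (elim exE conjE) rule
  let ?\<psi> = "inv_into (carrier A) \<phi>"
  have c: "\<phi> v \<in> carrier B" if "v \<in> carrier A" for v using bij_betwE[OF b] that by blast
  have l: "?\<psi> (\<phi> v) = v" if "v \<in> carrier A" for v using bij_betw_inv_into_left[OF b that] .
  have r: "\<phi> (?\<psi> w) = w" "?\<psi> w \<in> carrier A" if "w \<in> carrier B" for w
    using bij_betw_inv_into_right[OF b that] bij_betwE[OF bij_betw_inv_into[OF b]] that by blast+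
  have f: "vir_hom A B \<phi>" using c add sc ac by (simp add: vir_hom_def cmod_hom_def)
  have g: "vir_hom B A ?\<psi>"
    unfolding vir_hom_def cmod_hom_def
  proof (intro conjI funcsetI ballI allI)
    show "?\<psi> w \<in> carrier A" if "w \<in> carrier B" for w using r(2)[OF that] .
    show "?\<psi> (v \<oplus>\<^bsub>B\<^esub> w) = ?\<psi> v \<oplus>\<^bsub>A\<^esub> ?\<psi> w" if "v \<in> carrier B" "w \<in> carrier B" for v w
      using l[of "?\<psi> v \<oplus>\<^bsub>A\<^esub> ?\<psi> w"] add r that by simp
    show "?\<psi> (c \<odot>\<^bsub>B\<^esub> w) = c \<odot>\<^bsub>A\<^esub> ?\<psi> w" if "w \<in> carrier B" for c w
      using l[of "c \<odot>\<^bsub>A\<^esub> ?\<psi> w"] sc r that by simp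
    show "?\<psi> (act B x w) = act A x (?\<psi> w)" if "w \<in> carrier B" for x w
      using l[of "act A x (?\<psi> w)"] ac r that by simp
  qed
  show ?thesis using f g l r by (intro exI[of _ \<phi>] exI[of _ ?\<psi>]) simp
qed

lemma vir_hom_act: "vir_hom A B \<phi> \<Longrightarrow> v \<in> carrier A \<Longrightarrow> \<phi> (act A x v) = act B x (\<phi> v)"
  and vir_hom_cmod: "vir_hom A B \<phi> \<Longrightarrow> cmod_hom A B \<phi>"
  by (simp_all add: vir_hom_def)

lemma tensor_vir_hom:
  assumes AB: "tensor_pair A B" and AB': "tensor_pair A' B'" and \<alpha>: "vir_hom A A' \<alpha>" and \<beta>: "vir_hom B B' \<beta>"
  shows "\<exists>\<Phi>. vir_hom (A \<otimes>\<^sub>V B) (A' \<otimes>\<^sub>V B') \<Phi> \<and>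
    (\<forall>u\<in>carrier A. \<forall>v\<in>carrier B. \<Phi> (tensor_pair.tens A B u v) = tensor_pair.tens A' B' (\<alpha> u) (\<beta> v))"
proof -
  interpret P: tensor_pair A B by fact
  interpret Q: tensor_pair A' B' by fact
  note a = vir_hom_cmod[OF \<alpha>] and b = vir_hom_cmod[OF \<beta>]
  note h = cmod_hom_closed[OF a] cmod_hom_closed[OF b] cmod_hom_add[OF a] cmod_hom_add[OF b] cmod_hom_scale[OF a] cmod_hom_scale[OF b]
  obtain \<Phi> where \<Phi>: "cmod_hom (A \<otimes>\<^sub>V B) (A' \<otimes>\<^sub>V B') \<Phi>"
    "\<And>u v. u \<in> carrier A \<Longrightarrow> v \<in> carrier B \<Longrightarrow> \<Phi> (P.tens u v) = Q.tens (\<alpha> u) (\<beta> v)"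
  proof (rule P.tens_lift[OF Q.T.cmod, of "\<lambda>u v. Q.tens (\<alpha> u) (\<beta> v)"])
  qed (auto simp: h Q.tens_add_left Q.tens_add_right Q.tens_scale_left Q.tens_scale_right)
  have "\<Phi> (act (A \<otimes>\<^sub>V B) x y) = act (A' \<otimes>\<^sub>V B') x (\<Phi> y)" if "y \<in> carrier (A \<otimes>\<^sub>V B)" for x y
    using that
  proof (induction rule: P.tens_induct)
    case (tens u v)
    then show ?case
      by (simp add: P.act_tens Q.act_tens cmod_hom_add[OF \<Phi>(1)] \<Phi>(2) vir_hom_act[OF \<alpha>] vir_hom_act[OF \<beta>])
  next
    case (add y z)
    then show ?case by (simp add: P.T.act_add Q.T.act_add cmod_hom_add[OF \<Phi>(1)] cmod_hom_closed[OF \<Phi>(1)])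
  next
    case (scale c y)
    then show ?case by (simp add: P.T.act_scale Q.T.act_scale cmod_hom_scale[OF \<Phi>(1)] cmod_hom_closed[OF \<Phi>(1)])
  qed
  then show ?thesis using \<Phi> by (intro exI[of _ \<Phi>]) (simp add: vir_hom_def)
qed

lemma tensor_iso:
  assumes AB: "tensor_pair A B" and AB': "tensor_pair A' B'" and "A \<cong>\<^sub>V A'" "B \<cong>\<^sub>V B'"
  shows "A \<otimes>\<^sub>V B \<cong>\<^sub>V A' \<otimes>\<^sub>V B'"
proof -
  interpret P: tensor_pair A B by fact
  interpret Q: tensor_pair A' B' by fact
  obtain \<alpha> \<alpha>' where \<alpha>: "vir_hom A A' \<alpha>" "vir_hom A' A \<alpha>'" "\<forall>v\<in>carrier A. \<alpha>' (\<alpha> v) = v" "\<forall>w\<in>carrier A'. \<alpha> (\<alpha>' w) = w"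
    using vir_isoE[OF assms(3) P.A.lin_act_mod_axioms Q.A.lin_act_mod_axioms] by (elim exE conjE) rule
  obtain \<beta> \<beta>' where \<beta>: "vir_hom B B' \<beta>" "vir_hom B' B \<beta>'" "\<forall>v\<in>carrier B. \<beta>' (\<beta> v) = v" "\<forall>w\<in>carrier B'. \<beta> (\<beta>' w) = w"
    using vir_isoE[OF assms(4) P.B.lin_act_mod_axioms Q.B.lin_act_mod_axioms] by (elim exE conjE) rule
  obtain \<Phi> where \<Phi>: "vir_hom (A \<otimes>\<^sub>V B) (A' \<otimes>\<^sub>V B') \<Phi>"
    "\<forall>u\<in>carrier A. \<forall>v\<in>carrier B. \<Phi> (P.tens u v) = Q.tens (\<alpha> u) (\<beta> v)"
    using tensor_vir_hom[OF AB AB' \<alpha>(1) \<beta>(1)] by (elim exE conjE) rule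
  obtain \<Psi> where \<Psi>: "vir_hom (A' \<otimes>\<^sub>V B') (A \<otimes>\<^sub>V B) \<Psi>"
    "\<forall>u\<in>carrier A'. \<forall>v\<in>carrier B'. \<Psi> (Q.tens u v) = P.tens (\<alpha>' u) (\<beta>' v)"
    using tensor_vir_hom[OF AB' AB \<alpha>(2) \<beta>(2)] by (elim exE conjE) rule
  note f = vir_hom_cmod[OF \<Phi>(1)] and g = vir_hom_cmod[OF \<Psi>(1)]
  note h = cmod_hom_closed[OF f] cmod_hom_closed[OF g] cmod_hom_add[OF f] cmod_hom_add[OF g] cmod_hom_scale[OF f] cmod_hom_scale[OF g]
  note c = cmod_hom_closed[OF vir_hom_cmod[OF \<alpha>(1)]] cmod_hom_closed[OF vir_hom_cmod[OF \<alpha>(2)]]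
    cmod_hom_closed[OF vir_hom_cmod[OF \<beta>(1)]] cmod_hom_closed[OF vir_hom_cmod[OF \<beta>(2)]]
  show ?thesis
  proof (rule vir_isoI[OF \<Phi>(1) \<Psi>(1)])
    show "\<Psi> (\<Phi> y) = y" if "y \<in> carrier (A \<otimes>\<^sub>V B)" for y
      using that by (induction rule: P.tens_induct) (simp_all add: \<Phi>(2) \<Psi>(2) c h \<alpha>(3) \<beta>(3))
    show "\<Phi> (\<Psi> y) = y" if "y \<in> carrier (A' \<otimes>\<^sub>V B')" for y
      using that by (induction rule: Q.tens_induct) (simp_all add: \<Phi>(2) \<Psi>(2) c h \<alpha>(4) \<beta>(4))
  qed
qed

lemma cmod_hom_finsum:
  assumes "cmod A" "cmod B" "cmod_hom A B \<phi>" "finite J" "\<And>j. j \<in> J \<Longrightarrow> f j \<in> carrier A"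
  shows "\<phi> (\<Oplus>\<^bsub>A\<^esub>j\<in>J. f j) = (\<Oplus>\<^bsub>B\<^esub>j\<in>J. \<phi> (f j))"
proof -
  interpret A: cmod A by fact
  interpret B: cmod B by fact
  from assms(4,5) show ?thesis
  proof (induction J rule: finite_induct)
    case empty
    then show ?case using cmod_hom_zero[OF assms(1-3)] by simp
  next
    case (insert x J)
    then have 1: "f \<in> J \<rightarrow> carrier A" "f x \<in> carrier A" by auto
    then have 2: "(\<lambda>j. \<phi> (f j)) \<in> J \<rightarrow> carrier B" "\<phi> (f x) \<in> carrier B" using cmod_hom_closed[OF assms(3)] by auto
    show ?case
      using insert 1 2 by (simp add: A.finsum_insert B.finsum_insert cmod_hom_add[OF assms(3)])
  qed
qed

text \<open>The Leibniz rule as a sum in the module itself, where linear maps and changes of the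
  index set can be applied to it.\<close>

lemma (in tensor_fam) act_pure:
  assumes m: "m \<in> P"
  shows "act T x (pure m) = (\<Oplus>\<^bsub>T\<^esub>i\<in>I. pure (m(i := act (M i) x (m i))))"
proof -
  have c: "m(i := act (M i) x (m i)) \<in> P" if "i \<in> I" for i
  proof -
    interpret Mi: lin_act_mod "M i" by (rule lin_acts[OF that])
    show ?thesis using upd_P[OF m that] in_P[OF m that] by simp
  qed
  have "cls (\<Sum>i\<in>J. basis_vec (m(i := act (M i) x (m i)))) = (\<Oplus>\<^bsub>T\<^esub>i\<in>J. pure (m(i := act (M i) x (m i))))"
    if "J \<subseteq> I" "finite J" for J
    using that(2,1)
  proof (induction J rule: finite_induct)
    case empty
    have "\<zero>\<^bsub>T\<^esub> = cls 0" by (simp add: fam_eq presented_sel)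
    then show ?case by (simp only: sum.empty T.finsum_empty)
  next
    case (insert j J)
    have 1: "(\<lambda>i. pure (m(i := act (M i) x (m i)))) \<in> J \<rightarrow> carrier T" "pure (m(j := act (M j) x (m j))) \<in> carrier T"
      using c insert.prems by auto
    have "cls (\<Sum>i\<in>insert j J. basis_vec (m(i := act (M i) x (m i)))) =
        pure (m(j := act (M j) x (m j))) \<oplus>\<^bsub>T\<^esub> cls (\<Sum>i\<in>J. basis_vec (m(i := act (M i) x (m i))))"
      using insert.hyps by (simp add: fam_eq presented_sel pure_def del: fun_upd_apply)
    then show ?case using insert 1 by (simp add: T.finsum_insert del: fun_upd_apply)
  qed
  from this[OF order_refl fin] show ?thesis by (simp add: act_pure_sum del: fun_upd_apply)
qed

text \<open>The inverse \<open>\<tau>\<close> is a parameter, so that the roles of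
  \<open>\<sigma>\<close> and \<open>\<tau>\<close> can be exchanged to obtain the inverse
  homomorphism. Restriction to \<open>I'\<close> keeps the reindexed family extensional.\<close>

lemma reindex_vir_hom:
  assumes TF: "tensor_fam I M" and TF': "tensor_fam I' M'" and \<sigma>: "bij_betw \<sigma> I I'" and \<tau>: "\<And>j. j \<in> I' \<Longrightarrow> \<tau> j \<in> I \<and> \<sigma> (\<tau> j) = j"
    and MM: "\<And>i. i \<in> I \<Longrightarrow> M i = M' (\<sigma> i)"
  shows "\<exists>\<Phi>. vir_hom (tensor_family I M) (tensor_family I' M') \<Phi> \<and>
    (\<forall>m\<in>\<Pi>\<^sub>E i\<in>I. carrier (M i). \<Phi> (tensor_fam.pure I M m) = tensor_fam.pure I' M' (\<lambda>j\<in>I'. m (\<tau> j)))"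
proof -
  interpret F: tensor_fam I M by fact
  interpret F': tensor_fam I' M' by fact
  let ?r = "\<lambda>m. \<lambda>j\<in>I'. m (\<tau> j)"
  have \<sigma>I: "\<sigma> i \<in> I'" if "i \<in> I" for i using bij_betwE[OF \<sigma>] that by blast
  have \<tau>\<sigma>: "\<tau> (\<sigma> i) = i" if "i \<in> I" for i
    using \<tau>[OF \<sigma>I[OF that]] bij_betw_imp_inj_on[OF \<sigma>] that by (auto dest: inj_onD)
  have rP: "?r m \<in> F'.P" if m: "m \<in> F.P" for m
  proof (rule PiE_I)
    fix j assume j: "j \<in> I'"
    then show "?r m j \<in> carrier (M' j)" using F.in_P[OF m, of "\<tau> j"] \<tau>[OF j] MM[of "\<tau> j"] by simp
  qed simp
  have r_upd: "?r (m(i := u)) = (?r m)(\<sigma> i := u)" if "i \<in> I" for m i u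
    using that \<tau> \<tau>\<sigma> \<sigma>I by (auto simp: fun_eq_iff)
  obtain \<Phi> where \<Phi>: "cmod_hom F.T F'.T \<Phi>" "\<And>m. m \<in> F.P \<Longrightarrow> \<Phi> (F.pure m) = F'.pure (?r m)"
  proof (rule F.pure_lift[OF F'.T.cmod, of "\<lambda>m. F'.pure (?r m)"])
    show "F'.pure (?r m) \<in> carrier F'.T" if "m \<in> F.P" for m using rP[OF that] by (rule F'.pure_closed)
    fix m i u assume *: "m \<in> F.P" "i \<in> I" "u \<in> carrier (M i)"
    have u: "u \<in> carrier (M' (\<sigma> i))" using * MM by simp
    show "F'.pure (?r (m(i := c \<odot>\<^bsub>M i\<^esub> u))) = c \<odot>\<^bsub>F'.T\<^esub> F'.pure (?r (m(i := u)))" for c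
      unfolding r_upd[OF *(2)] MM[OF *(2)] by (rule F'.pure_scale[OF rP[OF *(1)] \<sigma>I[OF *(2)] u])
    fix v assume "v \<in> carrier (M i)"
    then have v: "v \<in> carrier (M' (\<sigma> i))" using *(2) MM by simp
    show "F'.pure (?r (m(i := u \<oplus>\<^bsub>M i\<^esub> v))) = F'.pure (?r (m(i := u))) \<oplus>\<^bsub>F'.T\<^esub> F'.pure (?r (m(i := v)))"
      unfolding r_upd[OF *(2)] MM[OF *(2)] by (rule F'.pure_add[OF rP[OF *(1)] \<sigma>I[OF *(2)] u v])
  qed auto
  have "\<Phi> (act F.T x y) = act F'.T x (\<Phi> y)" if "y \<in> carrier F.T" for x y
    using that
  proof (induction rule: F.pure_induct)
    case (pure m)
    have c: "m(i := act (M i) x (m i)) \<in> F.P" if "i \<in> I" for i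
    proof -
      interpret Mi: lin_act_mod "M i" by (rule F.lin_acts[OF that])
      show ?thesis using F.upd_P[OF pure that] F.in_P[OF pure that] by simp
    qed
    have c': "(?r m)(j := act (M' j) x (?r m j)) \<in> F'.P" if "j \<in> I'" for j
    proof -
      interpret Mj: lin_act_mod "M' j" by (rule F'.lin_acts[OF that])
      show ?thesis using F'.upd_P[OF rP[OF pure] that] F'.in_P[OF rP[OF pure] that] by simp
    qed
    have "\<Phi> (act F.T x (F.pure m)) = (\<Oplus>\<^bsub>F'.T\<^esub>i\<in>I. \<Phi> (F.pure (m(i := act (M i) x (m i)))))"
      unfolding F.act_pure[OF pure] by (rule cmod_hom_finsum[OF F.T.cmod F'.T.cmod \<Phi>(1) F.fin]) (use c in auto)
    also have "\<dots> = (\<Oplus>\<^bsub>F'.T\<^esub>i\<in>I. F'.pure ((?r m)(\<sigma> i := act (M' (\<sigma> i)) x (?r m (\<sigma> i)))))"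
    proof (rule F'.T.add.finprod_cong')
      fix i assume i: "i \<in> I"
      show "\<Phi> (F.pure (m(i := act (M i) x (m i)))) = F'.pure ((?r m)(\<sigma> i := act (M' (\<sigma> i)) x (?r m (\<sigma> i))))"
        unfolding \<Phi>(2)[OF c[OF i]] r_upd[OF i] using \<sigma>I[OF i] \<tau>\<sigma>[OF i] MM[OF i] by simp
    qed (use c' \<sigma>I in auto)
    also have "\<dots> = (\<Oplus>\<^bsub>F'.T\<^esub>j\<in>\<sigma> ` I. F'.pure ((?r m)(j := act (M' j) x (?r m j))))"
      by (rule F'.T.finsum_reindex[symmetric]) (use c' \<sigma>I bij_betw_imp_inj_on[OF \<sigma>] in auto)
    also have "\<dots> = act F'.T x (F'.pure (?r m))"
      unfolding F'.act_pure[OF rP[OF pure]] bij_betw_imp_surj_on[OF \<sigma>] ..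
    finally show ?case by (simp only: \<Phi>(2)[OF pure])
  next
    case (add y z)
    then show ?case by (simp add: F.T.act_add F'.T.act_add cmod_hom_add[OF \<Phi>(1)] cmod_hom_closed[OF \<Phi>(1)])
  next
    case (scale c y)
    then show ?case by (simp add: F.T.act_scale F'.T.act_scale cmod_hom_scale[OF \<Phi>(1)] cmod_hom_closed[OF \<Phi>(1)])
  qed
  then show ?thesis using \<Phi> by (intro exI[of _ \<Phi>]) (simp add: vir_hom_def)
qed

lemma reindex_iso:
  assumes TF: "tensor_fam I M" and TF': "tensor_fam I' M'" and \<sigma>: "bij_betw \<sigma> I I'"
    and MM: "\<And>i. i \<in> I \<Longrightarrow> M i = M' (\<sigma> i)"
  shows "tensor_family I M \<cong>\<^sub>V tensor_family I' M'"
proof -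
  interpret F: tensor_fam I M by fact
  interpret F': tensor_fam I' M' by fact
  define \<tau> where "\<tau> = inv_into I \<sigma>"
  have \<tau>: "\<tau> j \<in> I \<and> \<sigma> (\<tau> j) = j" if "j \<in> I'" for j
    unfolding \<tau>_def using bij_betw_inv_into_right[OF \<sigma> that] bij_betwE[OF bij_betw_inv_into[OF \<sigma>]] that by blast
  have \<sigma>': "\<sigma> i \<in> I' \<and> \<tau> (\<sigma> i) = i" if "i \<in> I" for i
    unfolding \<tau>_def using bij_betw_inv_into_left[OF \<sigma> that] bij_betwE[OF \<sigma>] that by blast
  have \<tau>b: "bij_betw \<tau> I' I" unfolding \<tau>_def by (rule bij_betw_inv_into[OF \<sigma>])
  have MM': "M' j = M (\<tau> j)" if "j \<in> I'" for j using MM[of "\<tau> j"] \<tau>[OF that] by simp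
  have "\<exists>\<Phi>. vir_hom F.T F'.T \<Phi> \<and> (\<forall>m\<in>F.P. \<Phi> (F.pure m) = F'.pure (\<lambda>j\<in>I'. m (\<tau> j)))"
    by (rule reindex_vir_hom[OF TF TF' \<sigma> \<tau> MM])
  then obtain \<Phi> where \<Phi>: "vir_hom F.T F'.T \<Phi>" "\<forall>m\<in>F.P. \<Phi> (F.pure m) = F'.pure (\<lambda>j\<in>I'. m (\<tau> j))"
    by (elim exE conjE) rule
  have "\<exists>\<Psi>. vir_hom F'.T F.T \<Psi> \<and> (\<forall>m\<in>F'.P. \<Psi> (F'.pure m) = F.pure (\<lambda>i\<in>I. m (\<sigma> i)))"
    by (rule reindex_vir_hom[OF TF' TF \<tau>b \<sigma>' MM'])
  then obtain \<Psi> where \<Psi>: "vir_hom F'.T F.T \<Psi>" "\<forall>m\<in>F'.P. \<Psi> (F'.pure m) = F.pure (\<lambda>i\<in>I. m (\<sigma> i))"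
    by (elim exE conjE) rule
  note f = vir_hom_cmod[OF \<Phi>(1)] and g = vir_hom_cmod[OF \<Psi>(1)]
  note h = cmod_hom_closed[OF f] cmod_hom_closed[OF g] cmod_hom_add[OF f] cmod_hom_add[OF g] cmod_hom_scale[OF f] cmod_hom_scale[OF g]
  show ?thesis
  proof (rule vir_isoI[OF \<Phi>(1) \<Psi>(1)])
    show "\<Psi> (\<Phi> y) = y" if "y \<in> carrier F.T" for y
      using that
    proof (induction rule: F.pure_induct)
      case (pure m)
      have "(\<lambda>j\<in>I'. m (\<tau> j)) \<in> F'.P"
        using F.in_P[OF pure] \<tau> MM' by (intro PiE_I) auto
      then have "\<Psi> (\<Phi> (F.pure m)) = F.pure (\<lambda>i\<in>I. (\<lambda>j\<in>I'. m (\<tau> j)) (\<sigma> i))" using \<Phi>(2) \<Psi>(2) pure by simp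
      also have "(\<lambda>i\<in>I. (\<lambda>j\<in>I'. m (\<tau> j)) (\<sigma> i)) = m"
        by (rule extensionalityI[of _ I]) (use pure \<sigma>' in \<open>auto simp: PiE_iff\<close>)
      finally show ?case .
    qed (simp_all add: h)
    show "\<Phi> (\<Psi> y) = y" if "y \<in> carrier F'.T" for y
      using that
    proof (induction rule: F'.pure_induct)
      case (pure m)
      have "(\<lambda>i\<in>I. m (\<sigma> i)) \<in> F.P"
        using F'.in_P[OF pure] \<sigma>' MM by (intro PiE_I) auto
      then have "\<Phi> (\<Psi> (F'.pure m)) = F'.pure (\<lambda>j\<in>I'. (\<lambda>i\<in>I. m (\<sigma> i)) (\<tau> j))" using \<Phi>(2) \<Psi>(2) pure by simp
      also have "(\<lambda>j\<in>I'. (\<lambda>i\<in>I. m (\<sigma> i)) (\<tau> j)) = m"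
        by (rule extensionalityI[of _ I']) (use pure \<tau> in \<open>auto simp: PiE_iff\<close>)
      finally show ?case .
    qed (simp_all add: h)
  qed
qed

lemma two_sidesI:
  assumes "side I lam n mu V" "side I' gam m theta W"
    and "vir_hom (side.M I lam n mu V) (side.M I' gam m theta W) \<phi>"
    and "vir_hom (side.M I' gam m theta W) (side.M I lam n mu V) \<psi>"
    and "\<And>v. v \<in> carrier (side.M I lam n mu V) \<Longrightarrow> \<psi> (\<phi> v) = v"
  shows "two_sides I lam n mu V I' gam m theta W \<phi>"
proof -
  interpret L: side I lam n mu V by fact
  interpret R: side I' gam m theta W by fact
  show ?thesis
  proof
    show "cmod_hom L.M R.M \<phi>" by (rule vir_hom_cmod[OF assms(3)])
    show "\<phi> (act L.M x y) = act R.M x (\<phi> y)" if "y \<in> carrier L.M" for x y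
      by (rule vir_hom_act[OF assms(3) that])
    show "\<phi> y \<noteq> \<zero>\<^bsub>R.M\<^esub>" if "y \<in> carrier L.M" "y \<noteq> \<zero>\<^bsub>L.M\<^esub>" for y
      using assms(5)[OF that(1)] that(2) cmod_hom_zero[OF R.pair.T.cmod L.pair.T.cmod vir_hom_cmod[OF assms(4)]] by auto
  qed
qed

section \<open>The classification of isomorphic tensor products\<close>

theorem proposition5p12:
  fixes k l :: nat
    and lam gam :: "nat \<Rightarrow> complex"
    and n m :: "nat \<Rightarrow> nat"
    and mu theta :: "nat \<Rightarrow> vir \<Rightarrow> complex"
    and V :: "'v vmod" and W :: "'w vmod"
  assumes "k \<ge> 1" and "l \<ge> 1"
    and "inj_on lam {1..k}" and "\<forall>i\<in>{1..k}. lam i \<noteq> 0"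
    and "\<forall>i\<in>{1..k}. n i \<ge> 1"
    and "\<forall>i\<in>{1..k}. lie_character (Virf ([:- lam i, 1:] ^ n i)) (mu i)"
    and "inj_on gam {1..l}" and "\<forall>i\<in>{1..l}. gam i \<noteq> 0"
    and "\<forall>i\<in>{1..l}. m i \<ge> 1"
    and "\<forall>i\<in>{1..l}. lie_character (Virf ([:- gam i, 1:] ^ m i)) (theta i)"
    and "simple_vir_module V" and "vir_locally_annihilated V"
    and "simple_vir_module W" and "vir_locally_annihilated W"
  shows "tensor_family {1..k} (\<lambda>i. Vfmu ([:- lam i, 1:] ^ n i) (mu i)) \<otimes>\<^sub>V V \<cong>\<^sub>V
         tensor_family {1..l} (\<lambda>i. Vfmu ([:- gam i, 1:] ^ m i) (theta i)) \<otimes>\<^sub>V W \<longleftrightarrow>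
         V \<cong>\<^sub>V W \<and> k = l \<and>
         (\<exists>\<sigma>. bij_betw \<sigma> {1..k} {1..l} \<and>
            (\<forall>i\<in>{1..k}. lam i = gam (\<sigma> i) \<and> n i = m (\<sigma> i) \<and>
               (\<forall>x\<in>Virf ([:- lam i, 1:] ^ n i). mu i x = theta (\<sigma> i) x)))"
proof -
  define I where "I = {1..k}"
  define I' where "I' = {1..l}"
  have S: "side I lam n mu V"
  proof (rule side.intro)
    show "character (lam i) (n i) (mu i)" if "i \<in> I" for i
      by (rule character.intro) (use assms(4-6) that in \<open>unfold I_def, blast+\<close>)
  qed (use assms(3,11,12) in \<open>simp_all only: I_def finite_atLeastAtMost\<close>)
  have S': "side I' gam m theta W"
  proof (rule side.intro)
    show "character (gam i) (m i) (theta i)" if "i \<in> I'" for i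
      by (rule character.intro) (use assms(8-10) that in \<open>unfold I'_def, blast+\<close>)
  qed (use assms(7,13,14) in \<open>simp_all only: I'_def finite_atLeastAtMost\<close>)
  interpret L: side I lam n mu V by (rule S)
  interpret R: side I' gam m theta W by (rule S')
  have "L.M \<cong>\<^sub>V R.M \<longleftrightarrow> V \<cong>\<^sub>V W \<and> k = l \<and>
         (\<exists>\<sigma>. bij_betw \<sigma> I I' \<and>
            (\<forall>i\<in>I. lam i = gam (\<sigma> i) \<and> n i = m (\<sigma> i) \<and>
               (\<forall>x\<in>Virf ([:- lam i, 1:] ^ n i). mu i x = theta (\<sigma> i) x)))" (is "_ \<longleftrightarrow> ?rhs")
  proof
    assume iso: "L.M \<cong>\<^sub>V R.M"
    obtain \<phi> \<psi> where \<phi>: "vir_hom L.M R.M \<phi>" "vir_hom R.M L.M \<psi>"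
      "\<forall>v\<in>carrier L.M. \<psi> (\<phi> v) = v" "\<forall>w\<in>carrier R.M. \<phi> (\<psi> w) = w"
      using vir_isoE[OF iso L.pair.T.lin_act_mod_axioms R.pair.T.lin_act_mod_axioms] by (elim exE conjE) rule
    interpret A: two_sides I lam n mu V I' gam m theta W \<phi>
      by (rule two_sidesI[OF S S' \<phi>(1,2)]) (use \<phi>(3) in blast)
    \<comment> \<open>The inverse isomorphism supplies surjectivity of the matching and the reverse
      inequalities of exponents.\<close>
    interpret B: two_sides I' gam m theta W I lam n mu V \<psi>
      by (rule two_sidesI[OF S' S \<phi>(2,1)]) (use \<phi>(4) in blast)
    \<comment> \<open>The index on the right with the same point, unique because \<open>gam\<close>
      is injective.\<close>
    define \<sigma> where "\<sigma> i = inv_into I' gam (lam i)" for i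
    have \<sigma>: "\<sigma> i \<in> I'" "lam i = gam (\<sigma> i)" if "i \<in> I" for i
      using inv_into_into[OF A.point_match[OF that]] f_inv_into_f[OF A.point_match[OF that]] by (simp_all add: \<sigma>_def)
    have bij: "bij_betw \<sigma> I I'"
    proof (rule bij_betwI')
      show "\<sigma> i = \<sigma> j \<longleftrightarrow> i = j" if "i \<in> I" "j \<in> I" for i j
        using \<sigma>(2)[OF that(1)] \<sigma>(2)[OF that(2)] inj_onD[OF L.inj _ that] by auto
      show "\<sigma> i \<in> I'" if "i \<in> I" for i by (rule \<sigma>(1)[OF that])
      show "\<exists>i\<in>I. j = \<sigma> i" if j: "j \<in> I'" for j
      proof -
        obtain i where i: "i \<in> I" "gam j = lam i" using B.point_match[OF j] by auto
        then show ?thesis using \<sigma>[OF i(1)] inj_onD[OF R.inj _ j \<sigma>(1)[OF i(1)]] by auto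
      qed
    qed
    have "lam i = gam (\<sigma> i) \<and> n i = m (\<sigma> i) \<and> (\<forall>x\<in>Virf ([:- lam i, 1:] ^ n i). mu i x = theta (\<sigma> i) x)" if i: "i \<in> I" for i
    proof (intro conjI ballI)
      show lg: "lam i = gam (\<sigma> i)" by (rule \<sigma>(2)[OF i])
      show nm: "n i = m (\<sigma> i)"
        using A.factor_match(1)[OF i \<sigma>(1)[OF i] lg] B.factor_match(1)[OF \<sigma>(1)[OF i] i lg[symmetric]] by simp
      obtain r :: nat where r: "\<forall>x\<in>vanish (lam i) (n i). mu i x = theta (\<sigma> i) x + of_nat r * character.weight (lam i) x"
        using A.factor_match(2)[OF i \<sigma>(1)[OF i] lg nm[symmetric]] ..
      obtain r' :: nat where
        r': "\<forall>x\<in>vanish (gam (\<sigma> i)) (m (\<sigma> i)). theta (\<sigma> i) x = mu i x + of_nat r' * character.weight (gam (\<sigma> i)) x"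
        using B.factor_match(2)[OF \<sigma>(1)[OF i] i lg[symmetric] nm] ..
      fix x assume "x \<in> Virf ([:- lam i, 1:] ^ n i)"
      then have x: "x \<in> vanish (lam i) (n i)" by (simp only: Virf_eq)
      let ?w = "character.weight (lam i) x"
      have 1: "mu i x = theta (\<sigma> i) x + of_nat r * ?w" using r x by blast
      have 2: "theta (\<sigma> i) x = mu i x + of_nat r' * ?w" using r' x unfolding lg[symmetric] nm[symmetric] by blast
      \<comment> \<open>Both shifts are natural multiples of the same weight, so adding the
        relations leaves no room for cancellation: either there is no shift or the weight of
        \<open>x\<close> is zero.\<close>
      have "(of_nat (r + r') :: complex) * ?w = 0" using 1 2 by (simp add: algebra_simps)
      then have "(of_nat (r + r') :: complex) = 0 \<or> ?w = 0" by (simp only: mult_eq_0_iff)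
      then have "r + r' = 0 \<or> ?w = 0" by (simp only: of_nat_eq_0_iff)
      then show "mu i x = theta (\<sigma> i) x" using 1 by auto
    qed
    moreover have "k = l" using bij_betw_same_card[OF bij] by (simp add: I_def I'_def)
    ultimately show ?rhs using A.last_match bij by blast
  next
    assume rhs: ?rhs
    then obtain \<sigma> where \<sigma>: "bij_betw \<sigma> I I'"
      "\<forall>i\<in>I. lam i = gam (\<sigma> i) \<and> n i = m (\<sigma> i) \<and> (\<forall>x\<in>Virf ([:- lam i, 1:] ^ n i). mu i x = theta (\<sigma> i) x)"
      by blast
    have "L.VV i = R.VV (\<sigma> i)" if "i \<in> I" for i
    proof -
      have *: "lam i = gam (\<sigma> i)" "n i = m (\<sigma> i)" using \<sigma>(2) that by auto
      have "Vfmu ([:- lam i, 1:] ^ n i) (mu i) = Vfmu ([:- lam i, 1:] ^ n i) (theta (\<sigma> i))"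
        by (rule Vfmu_cong) (use \<sigma>(2) that in blast)
      then show ?thesis unfolding * .
    qed
    then have "L.fam.T \<cong>\<^sub>V R.fam.T"
      by (rule reindex_iso[OF L.fam.tensor_fam_axioms R.fam.tensor_fam_axioms \<sigma>(1)])
    then show "L.M \<cong>\<^sub>V R.M"
      using tensor_iso[OF L.pair.tensor_pair_axioms R.pair.tensor_pair_axioms] rhs by blast
  qed
  then show ?thesis unfolding I_def I'_def .
qed

end
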